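(* Let $X$ be a geometrically doubling metric space, let $\lambda$ be a positive function on $X\times(0,\infty)$, increasing and doubling in the second variable, let $\mu$ be a doubling measure on $X$ with $\mu(B(x,r))\le C\lambda(x,r)$ for all $x\in X$, $r>0$, and let $T$ be a Calder\'on--Zygmund operator with a Calder\'on--Zygmund kernel $K$ associated to $\lambda$. Then there is a constant $C(T)$, independent of $w$, such that for every weight $w\in A_{2,\mu}$ $$\|T\|_{L^2(w\,d\mu)\to L^2(w\,d\mu)}\le C(T)\,[w]_{2,\mu}.$$
   Context: Notation: $|xy|$ is the distance between $x$ and $y$, and $B(x,r)=\{y\in X: |yx|<r\}$. A metric space $X$ is geometrically doubling with constant $A$ if for any $x\in X$ and $r>0$ at most $A$ disjoint balls of radius $r/2$ fit in the ball $B(x,r)$. $\lambda$ is increasing in $r$ and doubling in $r$: $\lambda(x,2r)\le C\lambda(x,r)$ with $C$ independent of $x$ and $r$. $K: X\times X\to\mathbb{R}$ is a Calder\'on--Zygmund kernel associated to $\lambda$ if for some constants $C$ and $\varepsilon>0$ (and $x\neq y$): $$|K(x,y)|\le C\min\left(\frac1{\lambda(x,|xy|)},\frac1{\lambda(y,|xy|)}\right),$$ $$|K(x,y)-K(x',y)|\le C\frac{|xx'|^{\varepsilon}}{|xy|^{\varepsilon}\lambda(x,|xy|)}\quad\text{if } |xy|\ge C|xx'|,$$ $$|K(x,y)-K(x,y')|\le C\frac{|yy'|^{\varepsilon}}{|xy|^{\varepsilon}\lambda(y,|xy|)}\quad\text{if } |xy|\ge C|yy'|.$$ $\mu$ is a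 Borel measure on $X$, with balls of positive finite measure, such that $\mu(B(x,r))\le C\lambda(x,r)$ with $C$ independent of $x,r$. It is doubling: $\mu(B(x,2r))\le C\mu(B(x,r))$ with $C$ independent of $x,r$. $T$ is a Calder\'on--Zygmund operator with kernel $K$ if $T$ is a bounded linear operator $L^2(\mu)\to L^2(\mu)$ and $Tf(x)=\int K(x,y)f(y)\,d\mu(y)$ for ($\mu$-almost) every $x\notin\operatorname{supp} f$ and every Lipschitz function $f$ with bounded support. For $w>0$ $\mu$-a.e., $w\in A_{2,\mu}$ means $$[w]_{2,\mu}=\sup_{x,r}\ \frac1{\mu(B(x,r))}\int_{B(x,r)}w\,d\mu\cdot\frac1{\mu(B(x,r))}\int_{B(x,r)}w^{-1}\,d\mu<\infty .$$ The norm $\|T\|_{L^2(w\,d\mu)\to L^2(w\,d\mu)}$ is the norm of the operator defined by $T$ on $L^2(\mu)\cap L^2(w\,d\mu)$, extended to $L^2(w\,d\mu)$. *)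

theory Defs
  imports "HOL-Analysis.Analysis"
begin

text \<open>The metric space is the whole type. The disjoint balls are counted as sets.\<close>

definition geometrically_doubling :: "'a::metric_space itself \<Rightarrow> bool" where
  "geometrically_doubling TYPE('a::metric_space) \<longleftrightarrow>
    (\<exists>A::nat. \<forall>(x::'a) r \<B>. 0 < r \<longrightarrow>
      (\<forall>B\<in>\<B>. (\<exists>y. B = ball y (r / 2)) \<and> B \<subseteq> ball x r) \<longrightarrow> disjoint \<B> \<longrightarrow>
      finite \<B> \<and> card \<B> \<le> A)"

definition dominating_function :: "('a::metric_space \<Rightarrow> real \<Rightarrow> real) \<Rightarrow> bool" where
  "dominating_function \<Lambda> \<longleftrightarrow>
    (\<forall>x r. 0 < r \<longrightarrow> 0 < \<Lambda> x r) \<and>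
    (\<forall>x r s. 0 < r \<longrightarrow> r \<le> s \<longrightarrow> \<Lambda> x r \<le> \<Lambda> x s) \<and>
    (\<exists>C. \<forall>x r. 0 < r \<longrightarrow> \<Lambda> x (2 * r) \<le> C * \<Lambda> x r)"

definition doubling_measure :: "'a::metric_space measure \<Rightarrow> bool" where
  "doubling_measure \<mu> \<longleftrightarrow>
    sets \<mu> = sets borel \<and>
    (\<forall>x r. 0 < r \<longrightarrow> 0 < emeasure \<mu> (ball x r) \<and> emeasure \<mu> (ball x r) < \<infinity>) \<and>
    (\<exists>C. \<forall>x r. 0 < r \<longrightarrow> measure \<mu> (ball x (2 * r)) \<le> C * measure \<mu> (ball x r))"

text \<open>
  The values of the kernel on the diagonal play no role: the constant \<open>C\<close> below may always be
  enlarged, and for \<open>C > 1\<close> the side conditions exclude \<open>x' = y\<close> and \<open>y' = x\<close>.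
\<close>

definition CZ_kernel ::
  "('a::metric_space \<Rightarrow> real \<Rightarrow> real) \<Rightarrow> ('a \<Rightarrow> 'a \<Rightarrow> real) \<Rightarrow> bool" where
  "CZ_kernel \<Lambda> K \<longleftrightarrow>
    (\<exists>C \<epsilon>. 0 < \<epsilon> \<and>
      (\<forall>x y. x \<noteq> y \<longrightarrow>
        \<bar>K x y\<bar> \<le> C * min (1 / \<Lambda> x (dist x y)) (1 / \<Lambda> y (dist x y))) \<and>
      (\<forall>x x' y. x \<noteq> y \<longrightarrow> C * dist x x' \<le> dist x y \<longrightarrow>
        \<bar>K x y - K x' y\<bar>
          \<le> C * (dist x x' powr \<epsilon> / (dist x y powr \<epsilon> * \<Lambda> x (dist x y)))) \<and>
      (\<forall>x y y'. x \<noteq> y \<longrightarrow> C * dist y y' \<le> dist x y \<longrightarrow>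
        \<bar>K x y - K x y'\<bar>
          \<le> C * (dist y y' powr \<epsilon> / (dist x y powr \<epsilon> * \<Lambda> y (dist x y)))))"

text \<open>
  Elements of \<open>L\<^sup>2\<close> are represented by functions, and operators on \<open>L\<^sup>2\<close> by maps on functions
  whose linearity is required almost everywhere. That such a map respects almost everywhere
  equality follows from linearity and boundedness.
\<close>

definition L2 :: "'a measure \<Rightarrow> ('a \<Rightarrow> real) set" where
  "L2 M = {f \<in> borel_measurable M. integrable M (\<lambda>x. (f x)\<^sup>2)}"

definition L2_norm :: "'a measure \<Rightarrow> ('a \<Rightarrow> real) \<Rightarrow> real" where
  "L2_norm M f = sqrt (\<integral>x. (f x)\<^sup>2 \<partial>M)"

definition bounded_L2_operator ::
  "'a measure \<Rightarrow> (('a \<Rightarrow> real) \<Rightarrow> ('a \<Rightarrow> real)) \<Rightarrow> bool" where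
  "bounded_L2_operator M T \<longleftrightarrow>
    (\<forall>f\<in>L2 M. T f \<in> L2 M) \<and>
    (\<forall>f\<in>L2 M. \<forall>g\<in>L2 M. AE x in M. T (\<lambda>y. f y + g y) x = T f x + T g x) \<and>
    (\<forall>c. \<forall>f\<in>L2 M. AE x in M. T (\<lambda>y. c * f y) x = c * T f x) \<and>
    (\<exists>C. \<forall>f\<in>L2 M. L2_norm M (T f) \<le> C * L2_norm M f)"

text \<open>As in \<^const>\<open>onorm\<close>, functions of norm \<open>0\<close> contribute \<open>0\<close> to the supremum.\<close>

definition L2_onorm :: "'a measure \<Rightarrow> (('a \<Rightarrow> real) \<Rightarrow> ('a \<Rightarrow> real)) \<Rightarrow> real" where
  "L2_onorm M T = (SUP f\<in>L2 M. L2_norm M (T f) / L2_norm M f)"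

definition CZ_operator ::
  "'a::metric_space measure \<Rightarrow> ('a \<Rightarrow> 'a \<Rightarrow> real) \<Rightarrow> (('a \<Rightarrow> real) \<Rightarrow> ('a \<Rightarrow> real)) \<Rightarrow> bool" where
  "CZ_operator \<mu> K T \<longleftrightarrow>
    bounded_L2_operator \<mu> T \<and>
    (\<forall>f. (\<exists>L. L-lipschitz_on UNIV f) \<longrightarrow> bounded (closure {x. f x \<noteq> 0}) \<longrightarrow>
      (AE x in \<mu>. x \<notin> closure {x. f x \<noteq> 0} \<longrightarrow> T f x = (\<integral>y. K x y * f y \<partial>\<mu>)))"

definition A2_const :: "'a::metric_space measure \<Rightarrow> ('a \<Rightarrow> real) \<Rightarrow> ennreal" where
  "A2_const \<mu> w =
    (SUP x. SUP r\<in>{0<..}.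
      ((\<integral>\<^sup>+y\<in>ball x r. ennreal (w y) \<partial>\<mu>) / emeasure \<mu> (ball x r)) *
      ((\<integral>\<^sup>+y\<in>ball x r. ennreal (inverse (w y)) \<partial>\<mu>) / emeasure \<mu> (ball x r)))"

definition A2_weight :: "'a::metric_space measure \<Rightarrow> ('a \<Rightarrow> real) \<Rightarrow> bool" where
  "A2_weight \<mu> w \<longleftrightarrow>
    w \<in> borel_measurable \<mu> \<and> (AE x in \<mu>. 0 < w x) \<and> A2_const \<mu> w < \<infinity>"

definition weighted :: "'a measure \<Rightarrow> ('a \<Rightarrow> real) \<Rightarrow> 'a measure" where
  "weighted \<mu> w = density \<mu> (\<lambda>x. ennreal (w x))"

text \<open>
  \<open>S\<close> is the bounded operator on \<open>L\<^sup>2(w d\<mu>)\<close> that extends the operator defined by \<open>T\<close> on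
  \<open>L\<^sup>2(\<mu>) \<inter> L\<^sup>2(w d\<mu>)\<close>. As this intersection is dense in \<open>L\<^sup>2(w d\<mu>)\<close>, there is at most one
  such \<open>S\<close> up to almost everywhere equality.
\<close>

definition weighted_extension ::
  "'a measure \<Rightarrow> ('a \<Rightarrow> real) \<Rightarrow> (('a \<Rightarrow> real) \<Rightarrow> ('a \<Rightarrow> real)) \<Rightarrow>
    (('a \<Rightarrow> real) \<Rightarrow> ('a \<Rightarrow> real)) \<Rightarrow> bool" where
  "weighted_extension \<mu> w T S \<longleftrightarrow>
    bounded_L2_operator (weighted \<mu> w) S \<and>
    (\<forall>f \<in> L2 \<mu> \<inter> L2 (weighted \<mu> w). AE x in \<mu>. S f x = T f x)"

end

theory Submission
  imports Defs
begin

text \<open>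
  A weight and its inverse are dual, so it is enough to bound the form \<open>\<integral> |T f| |g| d\<mu>\<close> by a
  constant times \<open>[w]\<close> times the norm of \<open>f\<close> in \<open>L\<^sup>2(w d\<mu>)\<close> times the norm of \<open>g\<close> in
  \<open>L\<^sup>2(w\<^sup>-\<^sup>1 d\<mu>)\<close>. The product of the two norms is written throughout as
  \<open>\<theta> \<integral> f\<^sup>2 w + \<theta>\<^sup>-\<^sup>1 \<integral> g\<^sup>2 w\<^sup>-\<^sup>1\<close> with a free \<open>\<theta> > 0\<close>. Since \<open>\<mu>(B(x,r)) \<le> C \<Lambda>(x,r)\<close>, the kernel
  satisfies the standard estimates with \<open>\<mu>(B(x,|xy|))\<close> instead of \<open>\<Lambda>(x,|xy|)\<close>
  (\<open>cz_operator_exists\<close>), and everything takes place on a doubling measure space.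

  The form is dominated by a sparse form (\<open>sparse_domination\<close>). Given a cube \<open>Q\<close>, stop at the
  maximal subcubes \<open>P\<close> that have a fixed proportion of points with \<open>|T f|\<close> large, or whose centre
  is the centre of a larger ball over which \<open>|f|\<close> has a large average, where large means large in
  comparison with the average of \<open>|f|\<close> over a dilate of \<open>Q\<close>. By the weak type (1,1) of \<open>T\<close> (\<open>weak_type\<close>) and of
  the maximal function (\<open>maximal_inequality\<close>) these cubes fill at most half of \<open>Q\<close>. On a stopping
  cube \<open>P\<close>, the part of \<open>f\<close> far away from \<open>P\<close> contributes to \<open>T f\<close> a function that is almost
  constant (\<open>T_oscillation\<close>), and the constant is small because \<open>P\<close> contains points at which both
  \<open>T f\<close> and the contribution of the rest of \<open>f\<close> are small (\<open>localization\<close>). So on \<open>P\<close> one loses only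
  a multiple of the average of \<open>|f|\<close> on passing from \<open>f\<close> to its restriction to a dilate of \<open>P\<close>, and
  the argument is repeated in \<open>P\<close>.

  The grids have a finest scale \<open>s\<close>, which makes all families of cubes finite and spares
  Lebesgue's differentiation theorem and maximal truncations of \<open>T\<close>. The recursion ends in the
  cubes of scale \<open>s\<close>. There, for Lipschitz functions, the \<open>L\<^sup>2\<close> bound of \<open>T\<close> alone gives
  \<open>C \<integral> |f| |g| d\<mu>\<close> plus an error that vanishes as \<open>s\<close> tends to \<open>0\<close> (\<open>leaf_bound\<close>), and
  \<open>\<integral> |f| |g| d\<mu>\<close> is harmless for every weight.

  The linear dependence on \<open>[w]\<close> is visible in the sparse form (\<open>sparse_weighted\<close>): if the averages
  of \<open>|f|\<close> and \<open>|g|\<close> are rewritten as averages of \<open>|f| w\<close> with respect to \<open>w\<^sup>-\<^sup>1 d\<mu>\<close> and of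
  \<open>|g| w\<^sup>-\<^sup>1\<close> with respect to \<open>w d\<mu>\<close>, each term acquires the factor
  \<open>w(Q) w\<^sup>-\<^sup>1(Q) / \<mu>(Q)\<^sup>2 \<le> C [w]\<close> once, and sparseness leaves two maximal functions, which have to be
  bounded on \<open>L\<^sup>2\<close> independently of the weight. This is true for nested families of sets and
  any measure (\<open>carleson_embedding\<close>). The dilated cubes are not nested, but finitely many
  subfamilies of them have slightly larger nested neighbourhoods (\<open>adj_nested\<close>).

  Choosing \<open>g = |T f| w\<close> on large sets gives the bound for Lipschitz \<open>f\<close>
  (\<open>weighted_bound_Lipschitz\<close>), density gives it on \<open>L\<^sup>2(\<mu>) \<inter> L\<^sup>2(w d\<mu>)\<close> (\<open>weighted_bound\<close>), and
  completeness of \<open>L\<^sup>2(w d\<mu>)\<close> provides the extension.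
\<close>

section \<open>Lipschitz approximation of Borel functions\<close>

definition lip :: "('a::metric_space \<Rightarrow> real) \<Rightarrow> bool" where
  "lip f \<longleftrightarrow> (\<exists>L. L-lipschitz_on UNIV f)"

lemma lipI:
  fixes f :: "'a::metric_space \<Rightarrow> real"
  assumes "\<And>x y. \<bar>f x - f y\<bar> \<le> L * dist x y" shows "lip f"
  unfolding lip_def lipschitz_on_def dist_real_def
proof (intro exI[of _ "max L 0"] conjI ballI)
  fix x y :: 'a
  have "L * dist x y \<le> max L 0 * dist x y" by (intro mult_right_mono) auto
  with assms[of x y] show "\<bar>f x - f y\<bar> \<le> max L 0 * dist x y" by linarith
qed simp

lemma lipE:
  assumes "lip f" obtains L where "L \<ge> 0" "\<And>x y. \<bar>f x - f y\<bar> \<le> L * dist x y"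
  using assms unfolding lip_def lipschitz_on_def dist_real_def by blast

lemma lip_measurable: "lip f \<Longrightarrow> f \<in> borel_measurable borel"
  unfolding lip_def by (elim exE) (rule borel_measurable_continuous_onI, rule lipschitz_on_continuous_on)

lemma lip_const: "lip (\<lambda>x. c)" by (rule lipI[of _ 0]) auto

lemma lip_add:
  assumes "lip f" "lip g" shows "lip (\<lambda>x. f x + g x)"
proof -
  obtain L where L: "\<And>x y. \<bar>f x - f y\<bar> \<le> L * dist x y" using lipE[OF assms(1)] by metis
  obtain L' where L': "\<And>x y. \<bar>g x - g y\<bar> \<le> L' * dist x y" using lipE[OF assms(2)] by metis
  show ?thesis
  proof (rule lipI[of _ "L + L'"])
    fix x y
    show "\<bar>f x + g x - (f y + g y)\<bar> \<le> (L + L') * dist x y"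
      using L[of x y] L'[of x y] unfolding distrib_right by linarith
  qed
qed

lemma lip_cmult:
  assumes "lip f" shows "lip (\<lambda>x. c * f x)"
proof -
  obtain L where L: "L \<ge> 0" "\<And>x y. \<bar>f x - f y\<bar> \<le> L * dist x y" using lipE[OF assms(1)] by metis
  show ?thesis
  proof (rule lipI[of _ "\<bar>c\<bar> * L"])
    fix x y
    have "\<bar>c * f x - c * f y\<bar> = \<bar>c\<bar> * \<bar>f x - f y\<bar>"
      by (simp add: abs_mult[symmetric] right_diff_distrib)
    also have "\<dots> \<le> \<bar>c\<bar> * (L * dist x y)" by (intro mult_left_mono L) auto
    finally show "\<bar>c * f x - c * f y\<bar> \<le> \<bar>c\<bar> * L * dist x y" by (simp add: mult.assoc)
  qed
qed

lemma lip_clamp: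
  assumes "lip f" shows "lip (\<lambda>x. max a (min b (f x)))"
proof -
  obtain L where L: "L \<ge> 0" "\<And>x y. \<bar>f x - f y\<bar> \<le> L * dist x y" using lipE[OF assms(1)] by metis
  show ?thesis
  proof (rule lipI[of _ L])
    fix x y
    show "\<bar>max a (min b (f x)) - max a (min b (f y))\<bar> \<le> L * dist x y"
      using L(2)[of x y] by (auto simp: max_def min_def)
  qed
qed

lemma lip_mult:
  assumes "lip f" "lip g" "\<And>x. \<bar>f x\<bar> \<le> a" "\<And>x. \<bar>g x\<bar> \<le> b"
  shows "lip (\<lambda>x. f x * g x)"
proof -
  obtain L where L: "L \<ge> 0" "\<And>x y. \<bar>f x - f y\<bar> \<le> L * dist x y" using lipE[OF assms(1)] by metis
  obtain L' where L': "L' \<ge> 0" "\<And>x y. \<bar>g x - g y\<bar> \<le> L' * dist x y" using lipE[OF assms(2)] by metis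
  show ?thesis
  proof (rule lipI[of _ "a * L' + b * L"])
    fix x y
    have "f x * g x - f y * g y = f x * (g x - g y) + g y * (f x - f y)" by algebra
    then have "\<bar>f x * g x - f y * g y\<bar> \<le> \<bar>f x\<bar> * \<bar>g x - g y\<bar> + \<bar>g y\<bar> * \<bar>f x - f y\<bar>"
      by (metis abs_mult abs_triangle_ineq)
    also have "\<dots> \<le> a * (L' * dist x y) + b * (L * dist x y)"
      by (intro add_mono mult_mono assms L L') (use assms(3)[of x] assms(4)[of x] in auto)
    finally show "\<bar>f x * g x - f y * g y\<bar> \<le> (a * L' + b * L) * dist x y" by (simp add: algebra_simps)
  qed
qed

lemma lip_dist: "lip (\<lambda>x. dist x0 x)"
  by (rule lipI[of _ 1]) (metis abs_dist_diff_le dist_commute mult_1)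

lemma lip_infdist: "lip (\<lambda>x. infdist x F)"
  by (rule lipI[of _ 1]) (metis infdist_triangle_abs mult_1)

lemma lip_sum: "(\<And>i. i \<in> I \<Longrightarrow> lip (f i)) \<Longrightarrow> lip (\<lambda>x. \<Sum>i\<in>I. f i x)"
  by (induction I rule: infinite_finite_induct) (auto intro: lip_add lip_const)

text \<open>
  The sets that can be approximated form a Dynkin system. It contains the closed sets, for which
  \<open>max 0 (1 - n * infdist x F)\<close> decreases to the indicator, and closed sets are stable under
  intersection.
\<close>

lemma lip_indicator_dense:
  fixes M :: "'a::metric_space measure"
  assumes M: "sets M = sets borel" "finite_measure M" and "A \<in> sets borel" "e > 0"
  shows "\<exists>\<phi>. lip \<phi> \<and> (\<forall>x. 0 \<le> \<phi> x \<and> \<phi> x \<le> 1) \<and> (\<integral>x. \<bar>indicator A x - \<phi> x\<bar> \<partial>M) < e"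
proof -
  interpret finite_measure M by fact
  note [measurable_cong] = M(1)
  have int: "integrable M (\<lambda>x. \<bar>indicator A x - \<phi> x\<bar>)"
    if "A \<in> sets borel" "\<phi> \<in> borel_measurable borel" "\<And>x. 0 \<le> \<phi> x \<and> \<phi> x \<le> 1" for A and \<phi> :: "'a \<Rightarrow> real"
  proof -
    have [measurable]: "A \<in> sets M" "\<phi> \<in> borel_measurable M" using that M by auto
    have "\<bar>indicator A x - \<phi> x\<bar> \<le> 1" for x
      using that(3)[of x] by (cases "x \<in> A") auto
    then show ?thesis
      by (intro integrable_const_bound[of _ 1]) auto
  qed
  have A: "A \<in> sigma_sets UNIV {F. closed F}"
    using assms by (metis borel_eq_closed sets_measure_of Pow_UNIV subset_UNIV)
  have st: "Int_stable {F::'a set. closed F}" by (auto simp: Int_stable_def)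
  have sub: "{F::'a set. closed F} \<subseteq> Pow UNIV" by simp
  define P where "P A \<longleftrightarrow> (\<forall>e>0. \<exists>\<phi>. lip \<phi> \<and> (\<forall>x. 0 \<le> \<phi> x \<and> \<phi> x \<le> 1) \<and> (\<integral>x. \<bar>indicator A x - \<phi> x\<bar> \<partial>M) < e)" for A
  note P_I = P_def[THEN iffD2, rule_format] and P_D = P_def[THEN iffD1, rule_format]
  from st sub A have "P A"
  proof (induction rule: sigma_sets_induct_disjoint)
    case (basic F)
    then have "closed F" by simp
    show ?case
    proof (rule P_I)
      fix e :: real assume "e > 0"
      show "\<exists>\<phi>. lip \<phi> \<and> (\<forall>x. 0 \<le> \<phi> x \<and> \<phi> x \<le> 1) \<and> (\<integral>x. \<bar>indicator F x - \<phi> x\<bar> \<partial>M) < e"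
      proof (cases "F = {}")
      case True then show ?thesis using \<open>e > 0\<close> lip_const[of 0] by (intro exI[of _ "\<lambda>x. 0"]) auto
    next
      case False
      define \<phi> where "\<phi> n x = max 0 (min 1 (1 + (- real n) * infdist x F))" for n x
      have lip: "lip (\<phi> n)" for n
        unfolding \<phi>_def by (intro lip_clamp lip_add lip_const lip_cmult lip_infdist)
      have [measurable]: "\<phi> n \<in> borel_measurable M" for n
        using lip_measurable[OF lip] by auto
      have [measurable]: "F \<in> sets M" using \<open>closed F\<close> M by auto
      have lim: "(\<lambda>n. \<phi> n x) \<longlonglongrightarrow> indicator F x" for x
      proof (cases "x \<in> F")
        case True then show ?thesis by (simp add: \<phi>_def)
      next
        case False
        then have pos: "infdist x F > 0"
          using \<open>closed F\<close> \<open>F \<noteq> {}\<close> by (metis in_closed_iff_infdist_zero infdist_nonneg less_eq_real_def)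
        obtain N where N: "real N > 1 / infdist x F" using reals_Archimedean2 by blast
        have "\<phi> n x = 0" if "n \<ge> N" for n
        proof -
          have "real n > 1 / infdist x F" using N that by linarith
          then have "real n * infdist x F > 1" using pos by (simp add: field_simps)
          then show ?thesis by (simp add: \<phi>_def)
        qed
        then have "eventually (\<lambda>n. \<phi> n x = indicator F x) sequentially"
          using False by (auto simp: eventually_sequentially)
        then show ?thesis by (rule tendsto_eventually)
      qed
      have "\<bar>indicator F x - \<phi> n x\<bar> \<le> 1" for n x by (cases "x \<in> F") (auto simp: \<phi>_def)
      moreover have "(\<lambda>n. \<bar>indicator F x - \<phi> n x\<bar>) \<longlonglongrightarrow> \<bar>indicator F x - indicator F x\<bar>" for x
        by (intro tendsto_intros lim)
      ultimately have "(\<lambda>n. \<integral>x. \<bar>indicator F x - \<phi> n x\<bar> \<partial>M) \<longlonglongrightarrow> (\<integral>x. \<bar>indicator F x - indicator F x\<bar> \<partial>M)"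
        by (intro integral_dominated_convergence[where w = "\<lambda>_. 1"])
          auto
      then have "eventually (\<lambda>n. (\<integral>x. \<bar>indicator F x - \<phi> n x\<bar> \<partial>M) < e) sequentially"
        by (intro order_tendstoD(2)) (use \<open>e > 0\<close> in auto)
      then obtain n where "(\<integral>x. \<bar>indicator F x - \<phi> n x\<bar> \<partial>M) < e"
        by (auto simp: eventually_sequentially)
      then show ?thesis using lip by (intro exI[of _ "\<phi> n"]) (auto simp: \<phi>_def)
      qed
    qed
  next
    case empty then show ?case using lip_const[of 0] by (intro P_I exI[of _ "\<lambda>x. 0"]) auto
  next
    case (compl A)
    show ?case
    proof (rule P_I)
    fix e :: real assume "e > 0"
    then obtain \<phi> where p: "lip \<phi>" "\<forall>x. 0 \<le> \<phi> x \<and> \<phi> x \<le> 1" "(\<integral>x. \<bar>indicator A x - \<phi> x\<bar> \<partial>M) < e" using P_D[OF compl(2)] by blast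
    have "\<bar>indicator (UNIV - A) x - (1 + (- 1) * \<phi> x)\<bar> = \<bar>indicator A x - \<phi> x\<bar>" for x
      by (auto simp: indicator_def)
    with p show "\<exists>\<phi>. lip \<phi> \<and> (\<forall>x. 0 \<le> \<phi> x \<and> \<phi> x \<le> 1) \<and> (\<integral>x. \<bar>indicator (UNIV - A) x - \<phi> x\<bar> \<partial>M) < e"
      using lip_add[OF lip_const[of 1] lip_cmult[OF p(1), of "-1"]]
      by (intro exI[of _ "\<lambda>x. 1 + (- 1) * \<phi> x"]) (simp del: mult_minus1)
    qed
  next
    case (union A)
    show ?case
    proof (rule P_I)
    fix e :: real assume e: "e > 0"
    have Aset [measurable]: "A i \<in> sets borel" for i
      using union(2) by (simp add: borel_eq_closed image_subset_iff)
    have [measurable]: "A i \<in> sets M" "(\<Union>i. A i) \<in> sets M" for i using Aset M by auto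
    have lim: "(\<lambda>n. indicator (\<Union>i<n. A i) x :: real) \<longlonglongrightarrow> indicator (\<Union>i. A i) x" for x
      by (rule LIMSEQ_indicator_UN)
    have lim0: "(\<lambda>n. \<bar>indicator (\<Union>i. A i) x - indicator (\<Union>i<n. A i) x :: real\<bar>)
        \<longlonglongrightarrow> \<bar>indicator (\<Union>i. A i) x - indicator (\<Union>i. A i) x\<bar>" for x
      by (intro tendsto_intros lim)
    have "\<bar>indicator (\<Union>i. A i) x - indicator (\<Union>i<n. A i) x :: real\<bar> \<le> 1" for n x
      by (simp add: indicator_def)
    with lim0 have "(\<lambda>n. \<integral>x. \<bar>indicator (\<Union>i. A i) x - indicator (\<Union>i<n. A i) x :: real\<bar> \<partial>M)
        \<longlonglongrightarrow> (\<integral>x. \<bar>indicator (\<Union>i. A i) x - indicator (\<Union>i. A i) x :: real\<bar> \<partial>M)"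
      by (intro integral_dominated_convergence[where w = "\<lambda>_. 1"]) auto
    then have "eventually (\<lambda>n. (\<integral>x. \<bar>indicator (\<Union>i. A i) x - indicator (\<Union>i<n. A i) x :: real\<bar> \<partial>M) < e / 2) sequentially"
      by (intro order_tendstoD(2)) (use e in auto)
    then obtain n where n: "(\<integral>x. \<bar>indicator (\<Union>i. A i) x - indicator (\<Union>i<n. A i) x :: real\<bar> \<partial>M) < e / 2"
      by (auto simp: eventually_sequentially)
    have "\<exists>\<phi>. lip \<phi> \<and> (\<forall>x. 0 \<le> \<phi> x \<and> \<phi> x \<le> 1) \<and> (\<integral>x. \<bar>indicator (A i) x - \<phi> x\<bar> \<partial>M) < e / (2 * (real n + 1))" for i
      using P_D[OF union(3)[of i], of "e / (2 * (real n + 1))"] e by auto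
    then obtain \<phi> where p: "\<And>i. lip (\<phi> i)" "\<And>i x. 0 \<le> \<phi> i x \<and> \<phi> i x \<le> 1"
      "\<And>i. (\<integral>x. \<bar>indicator (A i) x - \<phi> i x\<bar> \<partial>M) < e / (2 * (real n + 1))" by metis
    define \<psi> where "\<psi> x = max 0 (min 1 (\<Sum>i<n. \<phi> i x))" for x
    have lip: "lip \<psi>" unfolding \<psi>_def by (intro lip_clamp lip_sum p)
    have i1: "integrable M (\<lambda>x. \<bar>indicator (A i) x - \<phi> i x\<bar>)" for i
      using int[OF Aset lip_measurable[OF p(1)] p(2)] .
    have i2: "integrable M (\<lambda>x. \<bar>indicator (\<Union>i. A i) x - \<psi> x\<bar>)"
      by (rule int[OF _ lip_measurable[OF lip]]) (auto simp: \<psi>_def)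
    have i3: "integrable M (\<lambda>x. \<bar>indicator (\<Union>i. A i) x - indicator (\<Union>i<n. A i) x :: real\<bar>)"
      by (rule int) auto
    have sumi: "indicator (\<Union>i<n. A i) x = (\<Sum>i<n. indicator (A i) x :: real)" for x
      by (rule indicator_UN_disjoint) (use union(1) in \<open>auto simp: disjoint_family_on_def\<close>)
    have "\<bar>indicator (\<Union>i. A i) x - \<psi> x\<bar> \<le> \<bar>indicator (\<Union>i. A i) x - indicator (\<Union>i<n. A i) x\<bar>
        + (\<Sum>i<n. \<bar>indicator (A i) x - \<phi> i x\<bar>)" for x
    proof -
      have "\<bar>indicator (\<Union>i<n. A i) x - \<psi> x\<bar> \<le> \<bar>indicator (\<Union>i<n. A i) x - (\<Sum>i<n. \<phi> i x)\<bar>"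
        unfolding \<psi>_def by (auto simp: indicator_def)
      also have "\<dots> \<le> (\<Sum>i<n. \<bar>indicator (A i) x - \<phi> i x\<bar>)"
        unfolding sumi sum_subtractf[symmetric] by (rule sum_abs)
      finally show ?thesis by linarith
    qed
    then have "(\<integral>x. \<bar>indicator (\<Union>i. A i) x - \<psi> x\<bar> \<partial>M) \<le> (\<integral>x. \<bar>indicator (\<Union>i. A i) x - indicator (\<Union>i<n. A i) x\<bar>
        + (\<Sum>i<n. \<bar>indicator (A i) x - \<phi> i x\<bar>) \<partial>M)"
      by (intro integral_mono i2 Bochner_Integration.integrable_add i3 Bochner_Integration.integrable_sum i1)
    also have "\<dots> = (\<integral>x. \<bar>indicator (\<Union>i. A i) x - indicator (\<Union>i<n. A i) x :: real\<bar> \<partial>M)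
        + (\<Sum>i<n. \<integral>x. \<bar>indicator (A i) x - \<phi> i x\<bar> \<partial>M)"
      using i1 i3 by simp
    also have "(\<Sum>i<n. \<integral>x. \<bar>indicator (A i) x - \<phi> i x\<bar> \<partial>M) \<le> (\<Sum>i<n. e / (2 * (real n + 1)))"
      by (intro sum_mono less_imp_le p)
    also have "\<dots> \<le> e / 2" using e by (simp add: field_simps)
    finally have "(\<integral>x. \<bar>indicator (\<Union>i. A i) x - \<psi> x\<bar> \<partial>M) < e" using n by simp
    then show "\<exists>\<phi>. lip \<phi> \<and> (\<forall>x. 0 \<le> \<phi> x \<and> \<phi> x \<le> 1) \<and> (\<integral>x. \<bar>indicator (\<Union>i. A i) x - \<phi> x\<bar> \<partial>M) < e"
      using lip by (intro exI[of _ \<psi>]) (auto simp: \<psi>_def)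
    qed
  qed
  then show ?thesis using \<open>e > 0\<close> by (rule P_D)
qed

lemma lip_L1_dense:
  fixes M :: "'a::metric_space measure" and f :: "'a \<Rightarrow> real"
  assumes M: "sets M = sets borel" "finite_measure M" and f: "integrable M f" and "e > 0"
  shows "\<exists>\<phi>. lip \<phi> \<and> integrable M \<phi> \<and> (\<integral>x. \<bar>f x - \<phi> x\<bar> \<partial>M) < e"
  using f \<open>e > 0\<close>
proof (induction arbitrary: e rule: integrable_induct)
  case (base A c)
  interpret finite_measure M by fact
  obtain \<phi> where p: "lip \<phi>" "\<forall>x. 0 \<le> \<phi> x \<and> \<phi> x \<le> 1" "(\<integral>x. \<bar>indicator A x - \<phi> x\<bar> \<partial>M) < e / (\<bar>c\<bar> + 1)"
    using lip_indicator_dense[OF M, of A "e / (\<bar>c\<bar> + 1)"] base M by auto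
  have "integrable M \<phi>"
    by (rule integrable_const_bound[of _ 1]) (use p lip_measurable[OF p(1)] M in \<open>auto cong: measurable_cong_sets\<close>)
  moreover have "(\<integral>x. \<bar>indicator A x *\<^sub>R c - c * \<phi> x\<bar> \<partial>M) < e"
  proof -
    have "\<bar>indicator A x *\<^sub>R c - c * \<phi> x\<bar> = \<bar>c\<bar> * \<bar>indicator A x - \<phi> x\<bar>" for x
      by (simp add: abs_mult[symmetric] right_diff_distrib mult.commute)
    then have "(\<integral>x. \<bar>indicator A x *\<^sub>R c - c * \<phi> x\<bar> \<partial>M) = \<bar>c\<bar> * (\<integral>x. \<bar>indicator A x - \<phi> x\<bar> \<partial>M)" by simp
    also have "\<dots> \<le> \<bar>c\<bar> * (e / (\<bar>c\<bar> + 1))" using p by (intro mult_left_mono) auto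
    also have "\<dots> < e" using base by (simp add: field_simps)
    finally show ?thesis .
  qed
  ultimately show ?case using p by (intro exI[of _ "\<lambda>x. c * \<phi> x"]) (auto intro: lip_cmult)
next
  case (add f g)
  obtain \<phi> where p: "lip \<phi>" "integrable M \<phi>" "(\<integral>x. \<bar>f x - \<phi> x\<bar> \<partial>M) < e / 2" using add.IH(1)[of "e/2"] add.prems by auto
  obtain \<psi> where q: "lip \<psi>" "integrable M \<psi>" "(\<integral>x. \<bar>g x - \<psi> x\<bar> \<partial>M) < e / 2" using add.IH(2)[of "e/2"] add.prems by auto
  have "(\<integral>x. \<bar>f x + g x - (\<phi> x + \<psi> x)\<bar> \<partial>M) \<le> (\<integral>x. \<bar>f x - \<phi> x\<bar> + \<bar>g x - \<psi> x\<bar> \<partial>M)"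
    by (intro integral_mono) (use add p q in auto)
  also have "\<dots> = (\<integral>x. \<bar>f x - \<phi> x\<bar> \<partial>M) + (\<integral>x. \<bar>g x - \<psi> x\<bar> \<partial>M)"
    using add p q by simp
  finally show ?case using p q by (intro exI[of _ "\<lambda>x. \<phi> x + \<psi> x"]) (auto intro: lip_add)
next
  case (lim f s)
  have "(\<lambda>i. \<integral>x. \<bar>f x - s i x\<bar> \<partial>M) \<longlonglongrightarrow> (\<integral>x. \<bar>f x - f x\<bar> \<partial>M)"
  proof (rule integral_dominated_convergence[where w = "\<lambda>x. 3 * \<bar>f x\<bar>"])
    show "AE x in M. norm \<bar>f x - s i x\<bar> \<le> 3 * \<bar>f x\<bar>" for i
    proof (rule AE_I2)
      fix x assume "x \<in> space M"
      then have "norm (s i x) \<le> 2 * norm (f x)" using lim by blast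
      then show "norm \<bar>f x - s i x\<bar> \<le> 3 * \<bar>f x\<bar>" by simp
    qed
    show "AE x in M. (\<lambda>i. \<bar>f x - s i x\<bar>) \<longlonglongrightarrow> \<bar>f x - f x\<bar>"
      using lim by (intro AE_I2 tendsto_intros) blast+
  qed (use lim in auto)
  then have "eventually (\<lambda>i. (\<integral>x. \<bar>f x - s i x\<bar> \<partial>M) < e / 2) sequentially"
    by (intro order_tendstoD(2)) (use lim in auto)
  then obtain i where i: "(\<integral>x. \<bar>f x - s i x\<bar> \<partial>M) < e / 2" by (auto simp: eventually_sequentially)
  obtain \<phi> where p: "lip \<phi>" "integrable M \<phi>" "(\<integral>x. \<bar>s i x - \<phi> x\<bar> \<partial>M) < e / 2" using lim.IH[of "e / 2" i] lim.prems by auto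
  have "(\<integral>x. \<bar>f x - \<phi> x\<bar> \<partial>M) \<le> (\<integral>x. \<bar>f x - s i x\<bar> + \<bar>s i x - \<phi> x\<bar> \<partial>M)"
    by (intro integral_mono) (use lim p in auto)
  also have "\<dots> = (\<integral>x. \<bar>f x - s i x\<bar> \<partial>M) + (\<integral>x. \<bar>s i x - \<phi> x\<bar> \<partial>M)"
    using lim p by simp
  finally show ?case using p i by (intro exI[of _ "\<phi>"]) auto
qed

text \<open>
  The class of functions on which the operator is analysed. It is stable under truncation to
  Borel sets, which Lipschitz functions are not, and it lies in \<open>L\<^sup>2\<close> of every measure that is
  finite on balls, in particular of \<open>\<mu>\<close>, \<open>w d\<mu>\<close> and \<open>w\<^sup>-\<^sup>1 d\<mu>\<close> at the same time.
\<close>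

definition BB :: "('a::metric_space \<Rightarrow> real) set" where
  "BB = {f \<in> borel_measurable borel. (\<exists>c. \<forall>x. \<bar>f x\<bar> \<le> c) \<and> bounded {x. f x \<noteq> 0}}"

lemma BB_measurable [measurable_dest]: "f \<in> BB \<Longrightarrow> f \<in> borel_measurable borel" by (simp add: BB_def)

lemma BB_E:
  assumes "f \<in> BB"
  obtains c r where "c > 0" "r > 0" "\<And>x. \<bar>f x\<bar> \<le> c" "\<And>x. f x \<noteq> 0 \<Longrightarrow> x \<in> ball x0 r"
proof -
  obtain c where c: "\<And>x. \<bar>f x\<bar> \<le> c" using assms by (auto simp: BB_def)
  have "bounded {x. f x \<noteq> 0}" using assms by (auto simp: BB_def)
  then obtain r where r: "\<And>x. f x \<noteq> 0 \<Longrightarrow> dist x0 x \<le> r" by (auto simp: bounded_any_center[where a=x0])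
  show ?thesis
  proof (rule that[of "max c 1" "max r 0 + 1"])
    show "\<bar>f x\<bar> \<le> max c 1" for x using c[of x] by linarith
    show "x \<in> ball x0 (max r 0 + 1)" if "f x \<noteq> 0" for x using r[OF that] by simp
  qed auto
qed

lemma BB_I:
  assumes "f \<in> borel_measurable borel" "\<And>x. \<bar>f x\<bar> \<le> c" "\<And>x. f x \<noteq> 0 \<Longrightarrow> x \<in> ball x0 r"
  shows "f \<in> BB"
proof -
  have "bounded {x. f x \<noteq> 0}" by (rule bounded_subset[OF bounded_ball[of x0 r]]) (use assms(3) in blast)
  with assms(1,2) show ?thesis by (auto simp: BB_def)
qed

lemma BB_mult_bounded:
  assumes "f \<in> BB" "g \<in> borel_measurable borel" "\<And>x. \<bar>g x\<bar> \<le> c"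
  shows "(\<lambda>x. f x * g x) \<in> BB" "(\<lambda>x. g x * f x) \<in> BB"
proof -
  note [measurable] = assms(2) BB_measurable[OF assms(1)]
  obtain b r where b: "b > 0" "r > 0" "\<And>x. \<bar>f x\<bar> \<le> b" "\<And>x. f x \<noteq> 0 \<Longrightarrow> x \<in> ball undefined r"
    using BB_E[OF assms(1)] by metis
  have "\<bar>f x * g x\<bar> \<le> b * c" for x
    unfolding abs_mult using b(1) b(3)[of x] assms(3)[of x] by (intro mult_mono) auto
  then show "(\<lambda>x. f x * g x) \<in> BB" by (intro BB_I[of _ "b * c" undefined r]) (use b in auto)
  then show "(\<lambda>x. g x * f x) \<in> BB" by (simp add: mult.commute)
qed

lemma BB_mult: "f \<in> BB \<Longrightarrow> g \<in> BB \<Longrightarrow> (\<lambda>x. f x * g x) \<in> BB"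
  by (metis BB_E BB_measurable BB_mult_bounded(1))

lemma BB_indicator: "f \<in> BB \<Longrightarrow> A \<in> sets borel \<Longrightarrow> (\<lambda>x. f x * indicator A x) \<in> BB"
  by (rule BB_mult_bounded[where c = 1]) (auto simp: indicator_def)

lemma BB_cmult: "f \<in> BB \<Longrightarrow> (\<lambda>x. c * f x) \<in> BB"
  by (rule BB_mult_bounded[where c = "\<bar>c\<bar>"]) auto

lemma BB_abs: "f \<in> BB \<Longrightarrow> (\<lambda>x. \<bar>f x\<bar>) \<in> BB"
  by (auto simp: BB_def)

lemma BB_add: assumes "f \<in> BB" "g \<in> BB" shows "(\<lambda>x. f x + g x) \<in> BB"
proof -
  note [measurable] = BB_measurable[OF assms(2)] BB_measurable[OF assms(1)]
  obtain c r where b: "\<And>x. \<bar>f x\<bar> \<le> c" "\<And>x. f x \<noteq> 0 \<Longrightarrow> x \<in> ball undefined r"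
    using BB_E[OF assms(1)] by metis
  obtain c' r' where b': "\<And>x. \<bar>g x\<bar> \<le> c'" "\<And>x. g x \<noteq> 0 \<Longrightarrow> x \<in> ball undefined r'"
    using BB_E[OF assms(2)] by metis
  show ?thesis
  proof (rule BB_I[of _ "c + c'" undefined "max r r'"])
    show "\<bar>f x + g x\<bar> \<le> c + c'" for x using b(1)[of x] b'(1)[of x] by linarith
    show "x \<in> ball undefined (max r r')" if "f x + g x \<noteq> 0" for x
      using b(2)[of x] b'(2)[of x] that by (cases "f x = 0") (auto simp: less_max_iff_disj)
  qed measurable
qed

lemma BB_diff: "f \<in> BB \<Longrightarrow> g \<in> BB \<Longrightarrow> (\<lambda>x. f x - g x) \<in> BB"
  using BB_add[OF _ BB_cmult[of g "-1"], of f] by simp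

lemma BB_zero: "(\<lambda>x. 0) \<in> BB" by (auto simp: BB_def)

lemma BB_sum: "(\<And>i. i \<in> I \<Longrightarrow> f i \<in> BB) \<Longrightarrow> (\<lambda>x. \<Sum>i\<in>I. f i x) \<in> BB"
  by (induction I rule: infinite_finite_induct) (auto intro: BB_add BB_zero)

lemma BB_of_indicator: "A \<in> sets borel \<Longrightarrow> bounded A \<Longrightarrow> (indicator A :: _ \<Rightarrow> real) \<in> BB"
  by (auto simp: BB_def indicator_def intro!: exI[of _ 1] bounded_subset[of A])

lemmas BB_intros = BB_cmult BB_indicator BB_abs BB_add BB_diff BB_zero BB_sum BB_of_indicator

locale borel_ball_finite =
  fixes M :: "'a::metric_space measure"
  assumes sets_M [measurable_cong]: "sets M = sets borel"
    and ball_finite: "emeasure M (ball x r) < \<infinity>"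
begin

lemma space_M [simp]: "space M = UNIV"
  using sets_M sets_eq_imp_space_eq by force

lemma bounded_finite: "bounded A \<Longrightarrow> A \<in> sets borel \<Longrightarrow> emeasure M A < \<infinity>"
proof -
  assume A: "bounded A" "A \<in> sets borel"
  then obtain r where "\<And>x. x \<in> A \<Longrightarrow> dist undefined x \<le> r" by (auto simp: bounded_any_center[where a = undefined])
  then have "A \<subseteq> ball undefined (r + 1)" by force
  then have "emeasure M A \<le> emeasure M (ball undefined (r + 1))" by (intro emeasure_mono) auto
  then show ?thesis using ball_finite le_less_trans by blast
qed

lemma BB_integrable: assumes "f \<in> BB" shows "integrable M f"
proof -
  note [measurable] = BB_measurable[OF assms(1)]
  obtain c r where b: "c > 0" "\<And>x. \<bar>f x\<bar> \<le> c" "\<And>x. f x \<noteq> 0 \<Longrightarrow> x \<in> ball undefined r"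
    using BB_E[OF assms(1)] by metis
  have "integrable M (\<lambda>x. c * indicator (ball undefined r) x :: real)"
    using ball_finite[of undefined r] by (auto intro!: integrable_mult_right integrable_real_indicator)
  then show ?thesis
    by (rule Bochner_Integration.integrable_bound) (use b in \<open>auto intro!: AE_I2 simp: indicator_def\<close>)
qed

lemma BB_L2: "f \<in> BB \<Longrightarrow> f \<in> L2 M"
  using BB_integrable[OF BB_mult[of f f]] by (auto simp: L2_def power2_eq_square)

text \<open>
  Truncating an \<open>L\<^sup>1\<close>-approximation at height \<open>c\<close> and cutting it off outside the ball does not increase the
  error. As both functions are bounded by \<open>c\<close>, the square of the difference is at most
  \<open>2 * c\<close> times the difference.
\<close>

lemma BB_Lipschitz_approx:
  assumes "f \<in> BB" "\<And>x. \<bar>f x\<bar> \<le> c" "\<And>x. f x \<noteq> 0 \<Longrightarrow> x \<in> ball x0 r" "r > 0" and "e > 0"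
  shows "\<exists>\<phi>. lip \<phi> \<and> \<phi> \<in> BB \<and> (\<forall>x. \<bar>\<phi> x\<bar> \<le> c) \<and> (\<forall>x. \<phi> x \<noteq> 0 \<longrightarrow> x \<in> ball x0 (r + 1)) \<and> (\<integral>x. (f x - \<phi> x)\<^sup>2 \<partial>M) < e"
proof -
  note [measurable] = BB_measurable[OF assms(1)]
  have "c \<ge> 0" using assms(2)[of x0] by linarith
  define B where "B = ball x0 (r + 1)"
  have [measurable]: "B \<in> sets borel" unfolding B_def by auto
  define N where "N = density M (\<lambda>x. ennreal (indicator B x))"
  have "emeasure N (space N) = emeasure M B"
    unfolding N_def by (subst emeasure_density) (auto simp: ennreal_indicator)
  then have N: "sets N = sets borel" "finite_measure N"
    using ball_finite[of x0 "r + 1"] by (auto simp: N_def sets_M B_def intro!: finite_measureI)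
  have "integrable N f"
    using BB_integrable[OF BB_indicator[OF assms(1), of B]]
    unfolding N_def by (subst integrable_density) (auto simp: mult.commute)
  then obtain \<phi> where p: "lip \<phi>" "integrable N \<phi>" "(\<integral>x. \<bar>f x - \<phi> x\<bar> \<partial>N) < e / (2 * c + 1)"
    using lip_L1_dense[OF N, of f "e / (2 * c + 1)"] \<open>e > 0\<close> \<open>c \<ge> 0\<close> by auto
  note [measurable] = lip_measurable[OF p(1)]
  define \<eta> where "\<eta> x = max 0 (min 1 ((r + 1) + (-1) * dist x0 x))" for x
  define \<psi> where "\<psi> x = max (- c) (min c (\<phi> x))" for x
  have l: "lip \<eta>" "lip \<psi>" unfolding \<eta>_def \<psi>_def
    by (intro lip_clamp lip_add lip_const lip_cmult lip_dist p)+
  note [measurable] = lip_measurable[OF l(1)] lip_measurable[OF l(2)]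
  have bd: "\<bar>\<eta> x\<bar> \<le> 1" "\<bar>\<psi> x\<bar> \<le> c" for x using \<open>c \<ge> 0\<close> by (auto simp: \<eta>_def \<psi>_def)
  have lip: "lip (\<lambda>x. \<eta> x * \<psi> x)" using lip_mult[OF l] bd by blast
  have bd2: "\<bar>\<eta> x * \<psi> x\<bar> \<le> c" for x
    using mult_mono[OF bd(1)[of x] bd(2)[of x]] by (auto simp: abs_mult)
  have supp: "\<eta> x * \<psi> x \<noteq> 0 \<Longrightarrow> x \<in> B" for x by (auto simp: \<eta>_def B_def)
  have inBB: "(\<lambda>x. \<eta> x * \<psi> x) \<in> BB"
    by (rule BB_I[of _ c x0 "r + 1"]) (use bd2 supp B_def in auto)
  have le: "(f x - \<eta> x * \<psi> x)\<^sup>2 \<le> (2 * c) * (indicator B x * \<bar>f x - \<phi> x\<bar>)" for x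
  proof (cases "x \<in> B")
    case True
    have 1: "\<bar>f x - \<eta> x * \<psi> x\<bar> \<le> \<bar>f x - \<phi> x\<bar>"
    proof (cases "f x = 0")
      case True
      have "\<bar>\<eta> x * \<psi> x\<bar> \<le> 1 * \<bar>\<psi> x\<bar>" unfolding abs_mult by (intro mult_right_mono bd) auto
      also have "\<dots> \<le> \<bar>\<phi> x\<bar>" using \<open>c \<ge> 0\<close> by (auto simp: \<psi>_def)
      finally show ?thesis using True by simp
    next
      case False
      then have "\<eta> x = 1" using assms(3)[OF False] by (auto simp: \<eta>_def)
      then show ?thesis using assms(2)[of x] by (auto simp: \<psi>_def)
    qed
    have 2: "\<bar>f x - \<eta> x * \<psi> x\<bar> \<le> 2 * c" using assms(2)[of x] bd2[of x] by linarith
    have "(f x - \<eta> x * \<psi> x)\<^sup>2 = \<bar>f x - \<eta> x * \<psi> x\<bar> * \<bar>f x - \<eta> x * \<psi> x\<bar>"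
      by (simp add: power2_eq_square)
    also have "\<dots> \<le> (2 * c) * \<bar>f x - \<phi> x\<bar>" by (intro mult_mono 1 2) (use \<open>c \<ge> 0\<close> in auto)
    finally show ?thesis using True by simp
  next
    case False
    then have "f x = 0" using assms(3)[of x] by (auto simp: B_def)
    moreover have "\<eta> x * \<psi> x = 0" using False supp by blast
    ultimately show ?thesis using False by simp
  qed
  have i1: "integrable N (\<lambda>x. \<bar>f x - \<phi> x\<bar>)" using \<open>integrable N f\<close> p by auto
  then have i2: "integrable M (\<lambda>x. indicator B x * \<bar>f x - \<phi> x\<bar>)"
    unfolding N_def by (subst (asm) integrable_density) auto
  have "(\<integral>x. (f x - \<eta> x * \<psi> x)\<^sup>2 \<partial>M) \<le> (\<integral>x. (2 * c) * (indicator B x * \<bar>f x - \<phi> x\<bar>) \<partial>M)"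
    by (rule integral_mono) (use le i2 BB_L2[OF BB_diff[OF assms(1) inBB]] in \<open>auto simp: L2_def\<close>)
  also have "\<dots> = (2 * c) * (\<integral>x. \<bar>f x - \<phi> x\<bar> \<partial>N)"
    unfolding N_def by (subst integral_density) auto
  also have "\<dots> \<le> (2 * c) * (e / (2 * c + 1))" using p \<open>c \<ge> 0\<close> by (intro mult_left_mono) auto
  also have "\<dots> < e" using \<open>e > 0\<close> \<open>c \<ge> 0\<close> by (simp add: field_simps)
  finally show ?thesis using lip inBB bd2 supp unfolding B_def by blast
qed

end

section \<open>Doubling measures\<close>

text \<open>
  The greedy selection of a ball of largest radius that is disjoint from the balls selected so
  far: a ball that is discarded meets a selected ball of at least the same radius.
\<close>

lemma finite_Vitali_covering:
  fixes c :: "'i \<Rightarrow> 'a::metric_space"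
  assumes "finite I" "\<And>i. i \<in> I \<Longrightarrow> r i > 0"
  shows "\<exists>J\<subseteq>I. disjoint_family_on (\<lambda>i. ball (c i) (r i)) J \<and>
    (\<Union>i\<in>I. ball (c i) (r i)) \<subseteq> (\<Union>i\<in>J. ball (c i) (3 * r i))"
  using assms
proof (induction rule: finite_psubset_induct)
  case (psubset I)
  show ?case
  proof (cases "I = {}")
    case False
    obtain m where m: "m \<in> I" "\<And>i. i \<in> I \<Longrightarrow> r i \<le> r m"
      using arg_min_if_finite[OF psubset(1) False, of "\<lambda>i. - r i"] by (metis neg_less_iff_less not_le)
    define I' where "I' = {i \<in> I. ball (c i) (r i) \<inter> ball (c m) (r m) = {}}"
    have "m \<notin> I'" using psubset(3)[OF m(1)] by (auto simp: I'_def)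
    moreover have "I' \<subseteq> I" by (auto simp: I'_def)
    ultimately have "I' \<subset> I" using m(1) by blast
    then obtain J where J: "J \<subseteq> I'" "disjoint_family_on (\<lambda>i. ball (c i) (r i)) J"
      "(\<Union>i\<in>I'. ball (c i) (r i)) \<subseteq> (\<Union>i\<in>J. ball (c i) (3 * r i))"
      using psubset(2)[of I'] psubset(3) by blast
    have dj: "ball (c m) (r m) \<inter> ball (c i) (r i) = {}" if "i \<in> J" for i
      using J(1) that by (auto simp: I'_def)
    have "disjoint_family_on (\<lambda>i. ball (c i) (r i)) (insert m J)"
      using J(2) dj unfolding disjoint_family_on_def by blast
    moreover have "(\<Union>i\<in>I. ball (c i) (r i)) \<subseteq> (\<Union>i\<in>insert m J. ball (c i) (3 * r i))"
    proof
      fix x assume "x \<in> (\<Union>i\<in>I. ball (c i) (r i))"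
      then obtain i where i: "i \<in> I" "x \<in> ball (c i) (r i)" by blast
      show "x \<in> (\<Union>i\<in>insert m J. ball (c i) (3 * r i))"
      proof (cases "i \<in> I'")
        case True then show ?thesis using J(3) i by blast
      next
        case False
        then obtain z where z: "z \<in> ball (c i) (r i)" "z \<in> ball (c m) (r m)"
          using i by (auto simp: I'_def)
        have "dist (c m) x < 3 * r m"
          using z i(2) m(2)[OF i(1)] dist_triangle[of "c m" x z] dist_triangle[of z x "c i"]
          by (simp add: dist_commute)
        then show ?thesis by auto
      qed
    qed
    moreover have "insert m J \<subseteq> I" using J m by (auto simp: I'_def)
    ultimately show ?thesis by blast
  qed (auto simp: disjoint_family_on_def)
qed

definition separated :: "real \<Rightarrow> 'a::metric_space set \<Rightarrow> bool" where
  "separated r N \<longleftrightarrow> (\<forall>x\<in>N. \<forall>y\<in>N. x \<noteq> y \<longrightarrow> r \<le> dist x y)"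

definition is_net :: "real \<Rightarrow> 'a::metric_space set \<Rightarrow> bool" where
  "is_net r N \<longleftrightarrow> separated r N \<and> (\<forall>x. \<exists>z\<in>N. dist x z < r)"

lemma net_exists:
  assumes "0 < r" shows "\<exists>N. x0 \<in> N \<and> is_net r N"
proof -
  define \<A> where "\<A> = {N. x0 \<in> N \<and> separated r N}"
  have "{x0} \<in> \<A>" by (auto simp: \<A>_def separated_def)
  moreover have "\<Union>\<C> \<in> \<A>" if "\<C> \<noteq> {}" "subset.chain \<A> \<C>" for \<C>
  proof -
    have sub: "\<C> \<subseteq> \<A>" and ch: "\<And>A B. A \<in> \<C> \<Longrightarrow> B \<in> \<C> \<Longrightarrow> A \<subseteq> B \<or> B \<subseteq> A"
      using that(2) by (auto simp: subset_chain_def)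
    have "separated r (\<Union>\<C>)"
      unfolding separated_def
    proof (intro ballI impI)
      fix x y assume "x \<in> \<Union>\<C>" "y \<in> \<Union>\<C>" "x \<noteq> y"
      then obtain A where "A \<in> \<C>" "x \<in> A" "y \<in> A" using ch by blast
      then show "r \<le> dist x y" using sub \<open>x \<noteq> y\<close> by (auto simp: \<A>_def separated_def)
    qed
    then show ?thesis using sub that(1) by (auto simp: \<A>_def)
  qed
  ultimately obtain N where N: "N \<in> \<A>" "\<And>X. X \<in> \<A> \<Longrightarrow> N \<subseteq> X \<Longrightarrow> X = N"
    using subset_Zorn_nonempty[of \<A>] by blast
  have "\<exists>z\<in>N. dist x z < r" for x
  proof (rule ccontr)
    assume "\<not> (\<exists>z\<in>N. dist x z < r)"
    then have *: "\<And>z. z \<in> N \<Longrightarrow> r \<le> dist x z" by force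
    then have "insert x N \<in> \<A>" using N(1) by (auto simp: \<A>_def separated_def dist_commute)
    then have "x \<in> N" using N(2) by blast
    then show False using *[of x] \<open>0 < r\<close> by simp
  qed
  then show ?thesis using N by (auto simp: \<A>_def is_net_def)
qed

text \<open>
  Balls are enlarged by powers of \<open>2\<close> only. A comparison of the measures of two balls then costs a
  power of \<open>D\<close>, which is read off from \<open>V_comp\<close>.
\<close>

locale doubling_space = borel_ball_finite \<mu> for \<mu> :: "'a::metric_space measure" +
  fixes D :: real
  assumes ball_pos: "0 < r \<Longrightarrow> 0 < measure \<mu> (ball x r)"
    and doubling: "0 < r \<Longrightarrow> measure \<mu> (ball x (2 * r)) \<le> D * measure \<mu> (ball x r)"
begin

abbreviation V :: "'a \<Rightarrow> real \<Rightarrow> real" where "V x r \<equiv> measure \<mu> (ball x r)"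

lemma measure_mono_bounded:
  "A \<subseteq> B \<Longrightarrow> A \<in> sets borel \<Longrightarrow> B \<in> sets borel \<Longrightarrow> bounded B \<Longrightarrow> measure \<mu> A \<le> measure \<mu> B"
  by (rule measure_mono_fmeasurable) (use bounded_finite[of B] in \<open>auto simp: sets_M fmeasurable_def\<close>)

lemma V_subset: "ball x r \<subseteq> ball y R \<Longrightarrow> V x r \<le> V y R"
  by (rule measure_mono_bounded) auto

lemma V_mono: "r \<le> R \<Longrightarrow> V x r \<le> V x R"
  by (rule V_subset) auto

lemma D_ge1: "1 \<le> D"
proof -
  have "V undefined 1 \<le> V undefined (2 * 1)" by (rule V_mono) auto
  also have "\<dots> \<le> D * V undefined 1" by (rule doubling) auto
  finally show ?thesis using ball_pos[of 1 undefined] by simp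
qed

lemma D_pow_ge1: "1 \<le> D ^ n" using D_ge1 by (rule one_le_power)

lemma V_pow: "0 < r \<Longrightarrow> V x (2 ^ n * r) \<le> D ^ n * V x r"
proof (induction n)
  case (Suc n)
  have "V x (2 ^ Suc n * r) \<le> D * V x (2 ^ n * r)"
    using doubling[of "2 ^ n * r" x] Suc.prems by (simp add: mult.assoc)
  also have "\<dots> \<le> D * (D ^ n * V x r)" using Suc D_ge1 by (intro mult_left_mono) auto
  finally show ?case by (simp add: mult.assoc)
qed simp

lemma ball_subI: "dist x y + r \<le> R \<Longrightarrow> ball x r \<subseteq> ball y R"
proof
  fix z assume "dist x y + r \<le> R" "z \<in> ball x r"
  then show "z \<in> ball y R" using dist_triangle[of y z x] by (simp add: dist_commute)
qed

lemma V_comp: "0 < r \<Longrightarrow> dist x y + R \<le> 2 ^ n * r \<Longrightarrow> V x R \<le> D ^ n * V y r"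
  by (rule order_trans[OF V_subset[OF ball_subI] V_pow])

text \<open>
  The balls of radius \<open>r / 2\<close> around the points of \<open>S\<close> are disjoint, lie in one ball of radius
  comparable to \<open>2 ^ n * r\<close>, and each of them has a fixed proportion of its measure.
\<close>

lemma packing:
  fixes S :: "'a set"
  assumes "0 < r" "separated r S" "S \<subseteq> ball x (2 ^ n * r)"
  shows "finite S \<and> card S \<le> nat \<lfloor>D ^ (n + 3)\<rfloor>"
proof (rule finite_if_finite_subsets_card_bdd)
  fix G assume G: "G \<subseteq> S" "finite G"
  have dj: "disjoint_family_on (\<lambda>z. ball z (r / 2)) G"
    unfolding disjoint_family_on_def
  proof (intro ballI impI)
    fix y z assume "y \<in> G" "z \<in> G" "y \<noteq> z"
    then have "r \<le> dist y z" using assms G by (auto simp: separated_def)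
    then show "ball y (r / 2) \<inter> ball z (r / 2) = {}" by (intro disjoint_ballI) simp
  qed
  have sub: "ball z (r / 2) \<subseteq> ball x (2 ^ (n + 1) * r)" if "z \<in> G" for z
  proof (rule ball_subI)
    have "dist z x < 2 ^ n * r" using that G assms(3) by (auto simp: dist_commute)
    moreover have "r \<le> 2 ^ n * r" using mult_right_mono[of 1 "2 ^ n" r] assms(1) by simp
    moreover have "2 ^ (n + 1) * r = 2 * (2 ^ n * r)" by simp
    ultimately show "dist z x + r / 2 \<le> 2 ^ (n + 1) * r" using assms(1) by linarith
  qed
  let ?W = "V x (2 ^ (n + 1) * r)"
  have le: "?W \<le> D ^ (n + 3) * V z (r / 2)" if "z \<in> G" for z
  proof (rule V_comp)
    have "dist x z < 2 ^ n * r" using that G assms(3) by auto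
    moreover have "0 < 2 ^ n * r" using assms(1) by simp
    moreover have "2 ^ (n + 3) * (r / 2) = 4 * (2 ^ n * r)" "2 ^ (n + 1) * r = 2 * (2 ^ n * r)"
      by (simp_all add: power_add)
    ultimately show "dist x z + 2 ^ (n + 1) * r \<le> 2 ^ (n + 3) * (r / 2)" by linarith
  qed (use assms in auto)
  have "real (card G) * ?W \<le> (\<Sum>z\<in>G. D ^ (n + 3) * V z (r / 2))"
    using sum_mono[of G "\<lambda>_. ?W", OF le] by simp
  also have "\<dots> = D ^ (n + 3) * measure \<mu> (\<Union>z\<in>G. ball z (r / 2))"
    unfolding sum_distrib_left[symmetric]
    by (subst measure_finite_Union[OF G(2) _ dj]) (use ball_finite in \<open>auto simp: sets_M less_top[symmetric]\<close>)
  also have "\<dots> \<le> D ^ (n + 3) * ?W"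
    using sub D_ge1 G by (intro mult_left_mono measure_mono_bounded) auto
  finally have "real (card G) \<le> D ^ (n + 3)" using ball_pos[of "2 ^ (n + 1) * r" x] assms(1) by simp
  then show "card G \<le> nat \<lfloor>D ^ (n + 3)\<rfloor>" by (simp add: le_nat_iff le_floor_iff)
qed

lemma separated_locally_finite:
  fixes S :: "'a set"
  assumes "0 < r" "separated r S" shows "finite (S \<inter> ball x R)"
proof -
  obtain n where "R / r < 2 ^ n" using real_arch_pow[of 2 "R / r"] by auto
  then have "R \<le> 2 ^ n * r" using assms(1) by (simp add: field_simps)
  then have "S \<inter> ball x R \<subseteq> ball x (2 ^ n * r)" by auto
  moreover have "separated r (S \<inter> ball x R)" using assms(2) by (auto simp: separated_def)
  ultimately show ?thesis using packing[OF assms(1)] by blast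
qed

lemma separated_countable:
  fixes S :: "'a set"
  assumes "0 < r" "separated r S" shows "countable S"
proof -
  have "S = (\<Union>n. S \<inter> ball undefined (real n))"
    using reals_Archimedean2[of "dist undefined _"] by auto
  moreover have "countable (\<Union>n. S \<inter> ball undefined (real n))"
    using separated_locally_finite[OF assms] by (intro countable_UN countableI_type countable_finite) auto
  ultimately show ?thesis by simp
qed

text \<open>
  The weak type (1,1) of the maximal function, for finitely many balls.
\<close>

lemma maximal_inequality:
  fixes c :: "'i \<Rightarrow> 'a"
  assumes "finite I" "\<And>i. i \<in> I \<Longrightarrow> 0 < r i" "integrable \<mu> F" "\<And>x. 0 \<le> F x"
    and "0 \<le> t" and avg: "\<And>i. i \<in> I \<Longrightarrow> t * V (c i) (r i) \<le> (\<integral>x. F x * indicator (ball (c i) (r i)) x \<partial>\<mu>)"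
  shows "t * measure \<mu> (\<Union>i\<in>I. ball (c i) (r i)) \<le> D ^ 2 * (\<integral>x. F x \<partial>\<mu>)"
proof -
  have "\<exists>J\<subseteq>I. disjoint_family_on (\<lambda>i. ball (c i) (r i)) J \<and>
    (\<Union>i\<in>I. ball (c i) (r i)) \<subseteq> (\<Union>i\<in>J. ball (c i) (3 * r i))"
    by (rule finite_Vitali_covering[OF assms(1)]) (rule assms(2))
  then obtain J where J: "J \<subseteq> I" "disjoint_family_on (\<lambda>i. ball (c i) (r i)) J"
    "(\<Union>i\<in>I. ball (c i) (r i)) \<subseteq> (\<Union>i\<in>J. ball (c i) (3 * r i))"
    by (elim exE conjE) (rule that)
  have intF: "integrable \<mu> (\<lambda>x. F x * indicator (ball (c i) (r i)) x)" for i
    by (rule integrable_real_mult_indicator[OF _ assms(3)]) (simp add: sets_M)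
  have finJ: "finite J" using J assms(1) finite_subset by blast
  have "measure \<mu> (\<Union>i\<in>I. ball (c i) (r i)) \<le> measure \<mu> (\<Union>i\<in>J. ball (c i) (3 * r i))"
    by (rule measure_mono_bounded[OF J(3)]) (auto intro!: bounded_UN finJ borel_open open_UN)
  also have "\<dots> \<le> (\<Sum>i\<in>J. V (c i) (3 * r i))"
    by (rule measure_UNION_le[OF finJ]) (auto simp: sets_M)
  also have "\<dots> \<le> (\<Sum>i\<in>J. D ^ 2 * V (c i) (r i))"
  proof (rule sum_mono)
    fix i assume "i \<in> J"
    then have "r i > 0" using J(1) assms(2) by blast
    then show "V (c i) (3 * r i) \<le> D\<^sup>2 * V (c i) (r i)" by (intro V_comp) auto
  qed
  finally have "t * measure \<mu> (\<Union>i\<in>I. ball (c i) (r i)) \<le> t * (\<Sum>i\<in>J. D ^ 2 * V (c i) (r i))"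
    using assms(5) by (rule mult_left_mono)
  also have "\<dots> = D ^ 2 * (\<Sum>i\<in>J. t * V (c i) (r i))" by (simp add: sum_distrib_left mult_ac)
  also have "\<dots> \<le> D ^ 2 * (\<Sum>i\<in>J. \<integral>x. F x * indicator (ball (c i) (r i)) x \<partial>\<mu>)"
    using J(1) D_ge1 by (intro mult_left_mono sum_mono avg) auto
  also have "(\<Sum>i\<in>J. \<integral>x. F x * indicator (ball (c i) (r i)) x \<partial>\<mu>) = (\<integral>x. (\<Sum>i\<in>J. F x * indicator (ball (c i) (r i)) x) \<partial>\<mu>)"
    by (rule Bochner_Integration.integral_sum[symmetric]) (rule intF)
  also have "\<dots> \<le> (\<integral>x. F x \<partial>\<mu>)"
  proof (rule integral_mono)
    show "integrable \<mu> (\<lambda>x. \<Sum>i\<in>J. F x * indicator (ball (c i) (r i)) x)"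
      by (intro Bochner_Integration.integrable_sum intF)
    show "(\<Sum>i\<in>J. F x * indicator (ball (c i) (r i)) x) \<le> F x" for x
    proof -
      have "(\<Sum>i\<in>J. F x * indicator (ball (c i) (r i)) x) = F x * indicator (\<Union>i\<in>J. ball (c i) (r i)) x"
        by (subst indicator_UN_disjoint[OF finJ J(2)]) (simp add: sum_distrib_left)
      also have "\<dots> \<le> F x" using assms(4)[of x] by (auto simp: indicator_def)
      finally show ?thesis .
    qed
  qed fact
  finally show ?thesis using D_ge1 by simp
qed

end

text \<open>
  Ties between nearest points are broken by an enumeration of the net, so that the map is
  measurable.
\<close>

definition nearest :: "'a::metric_space set \<Rightarrow> 'a \<Rightarrow> 'a" where
  "nearest N x = from_nat_into N
     (LEAST i. \<forall>j. dist x (from_nat_into N i) \<le> dist x (from_nat_into N j))"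

context doubling_space begin

lemma nearest:
  fixes N :: "'a set"
  assumes "0 < r" "is_net r N"
  shows "nearest N x \<in> N" "z \<in> N \<Longrightarrow> dist x (nearest N x) \<le> dist x z"
proof -
  have sep: "separated r N" and ex: "\<exists>z\<in>N. dist x z < r" using assms(2) by (auto simp: is_net_def)
  have cN: "countable N" and ne: "N \<noteq> {}" using separated_countable[OF assms(1) sep] ex by auto
  have "finite (N \<inter> ball x r)" "N \<inter> ball x r \<noteq> {}"
    using separated_locally_finite[OF assms(1) sep] ex by auto
  then obtain m where m: "m \<in> N \<inter> ball x r" "\<And>z. z \<in> N \<inter> ball x r \<Longrightarrow> dist x m \<le> dist x z"
    using arg_min_if_finite[of "N \<inter> ball x r" "dist x"] by (metis not_le)
  have m': "dist x m \<le> dist x z" if "z \<in> N" for z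
    using m that by (cases "z \<in> ball x r") auto
  obtain i where i: "from_nat_into N i = m"
    using from_nat_into_surj[OF cN, of m] m by auto
  have "\<forall>j. dist x (from_nat_into N i) \<le> dist x (from_nat_into N j)"
    using m' i from_nat_into[OF ne] by auto
  then have L: "\<forall>j. dist x (nearest N x) \<le> dist x (from_nat_into N j)"
    unfolding nearest_def by (rule LeastI)
  show "nearest N x \<in> N" unfolding nearest_def by (rule from_nat_into[OF ne])
  show "dist x (nearest N x) \<le> dist x z" if "z \<in> N" using L from_nat_into_surj[OF cN that] by auto
qed

lemma nearest_close: "0 < r \<Longrightarrow> is_net r (N :: 'a set) \<Longrightarrow> dist x (nearest N x) < r"
  using nearest(2) unfolding is_net_def by (meson le_less_trans is_net_def)

lemma nearest_eq:
  fixes N :: "'a set"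
  assumes "0 < r" "is_net r N" "z \<in> N" "dist x z < r / 2"
  shows "nearest N x = z"
proof (rule ccontr)
  assume "nearest N x \<noteq> z"
  then have "r \<le> dist (nearest N x) z"
    using assms nearest(1)[OF assms(1,2)] by (auto simp: is_net_def separated_def)
  also have "\<dots> \<le> dist x (nearest N x) + dist x z" by (metis dist_commute dist_triangle)
  also have "\<dots> < r" using nearest(2)[OF assms(1-3), of x] assms(4) by simp
  finally show False by simp
qed

lemma nearest_measurable: "{x. nearest N x = (z :: 'a)} \<in> sets borel"
proof -
  have [measurable]: "Measurable.pred borel (\<lambda>x. \<forall>j. dist x (from_nat_into N i) \<le> dist x (from_nat_into N j))" for i :: nat
  proof -
    have [measurable]: "(\<lambda>x. dist x c) \<in> borel_measurable borel" for c :: 'a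
      using lip_measurable[OF lip_dist[of c]] by (simp add: dist_commute)
    show ?thesis
      by (intro pred_intros_countable, unfold pred_def, intro borel_measurable_le) measurable
  qed
  have "(\<lambda>x. LEAST i. \<forall>j. dist x (from_nat_into N i) \<le> dist x (from_nat_into N j)) \<in> measurable borel (count_space UNIV)"
    by measurable
  from measurable_sets[OF this, of "{i. from_nat_into N i = z}"]
  show ?thesis by (simp add: vimage_def nearest_def)
qed

end

section \<open>Grids of cubes with a finest scale\<close>

text \<open>
  The cubes of level \<open>0\<close> are the cells of points with the same nearest point in a net of mesh \<open>s\<close>,
  and a cube of level \<open>j + 1\<close> is the union of the cubes of level \<open>j\<close> whose centres have the same
  nearest point in the next net. Every net contains \<open>x0\<close>, so that the cubes around \<open>x0\<close> exhaust the
  space. Starting from a finest scale, measurability and nestedness are immediate. Since the mesh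
  grows by the factor \<open>16\<close>, the distances from a point to its successive centres add up
  to less than \<open>2 * rad j\<close>, and a cube of level \<open>j\<close> contains the ball of radius \<open>rad j / 4\<close> around its
  centre.
\<close>

locale grid = doubling_space \<mu> D for \<mu> :: "'a::metric_space measure" and D +
  fixes s :: real and x0 :: 'a
  assumes s_pos: "0 < s"
begin

definition rad :: "nat \<Rightarrow> real" where "rad j = s * 16 ^ j"

definition net :: "nat \<Rightarrow> 'a set" where "net j = (SOME N. x0 \<in> N \<and> is_net (rad j) N)"

definition parent :: "nat \<Rightarrow> 'a \<Rightarrow> 'a" where "parent j y = nearest (net (Suc j)) y"

primrec anc :: "nat \<Rightarrow> 'a \<Rightarrow> 'a" where
  "anc 0 x = nearest (net 0) x"
| "anc (Suc j) x = parent j (anc j x)"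

definition cube :: "nat \<Rightarrow> 'a \<Rightarrow> 'a set" where "cube j z = {x. anc j x = z}"

lemma rad_pos: "0 < rad j" using s_pos by (simp add: rad_def)

lemma rad_Suc: "rad (Suc j) = 16 * rad j" by (simp add: rad_def)

lemma rad_mono: "i \<le> j \<Longrightarrow> rad i \<le> rad j"
  unfolding rad_def using s_pos by (intro mult_left_mono power_increasing) auto

lemma rad_less: "i < j \<Longrightarrow> 16 * rad i \<le> rad j"
  using rad_mono[of "Suc i" j] by (simp add: rad_Suc)

lemma net: "x0 \<in> net j" "is_net (rad j) (net j)"
  using someI_ex[OF net_exists[OF rad_pos, of x0 j]] by (auto simp: net_def)

lemma net_separated: "separated (rad j) (net j)" using net by (auto simp: is_net_def)

lemma parent_net: "parent j y \<in> net (Suc j)"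
  unfolding parent_def by (rule nearest[OF rad_pos net(2)])

lemma parent_dist: "dist y (parent j y) < rad (Suc j)"
  unfolding parent_def by (rule nearest_close[OF rad_pos net(2)])

lemma anc_net: "anc j x \<in> net j"
  by (cases j) (auto simp: nearest(1)[OF rad_pos net(2)] parent_net)

lemma anc_dist: "dist x (anc j x) < 2 * rad j"
proof (induction j)
  case 0
  have "dist x (nearest (net 0) x) < rad 0" by (rule nearest_close[OF rad_pos net(2)])
  then show ?case using rad_pos[of 0] by simp
next
  case (Suc j)
  have "dist x (anc (Suc j) x) \<le> dist x (anc j x) + dist (anc j x) (parent j (anc j x))"
    by (simp add: dist_triangle)
  also have "\<dots> < 2 * rad (Suc j)" using Suc parent_dist[of "anc j x" j] rad_pos[of j] by (simp add: rad_Suc)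
  finally show ?case .
qed

lemma cube_ball: "cube j z \<subseteq> ball z (2 * rad j)"
  unfolding cube_def using anc_dist by (auto simp: dist_commute)

text \<open>
  The centre of level \<open>j - 1\<close> of a point of the ball has distance less than
  \<open>rad j / 4 + 2 * rad (j - 1) < rad j / 2\<close> from \<open>z\<close>, so \<open>z\<close> is the nearest point of \<open>net j\<close>.
\<close>

lemma ball_cube: assumes "z \<in> net j" shows "ball z (rad j / 4) \<subseteq> cube j z"
proof
  fix x assume x: "x \<in> ball z (rad j / 4)"
  show "x \<in> cube j z"
  proof (cases j)
    case 0
    have "nearest (net 0) x = z"
      using x assms rad_pos[of 0] unfolding 0 by (intro nearest_eq[OF rad_pos net(2)]) (auto simp: dist_commute)
    then show ?thesis by (simp add: cube_def 0)
  next
    case (Suc i)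
    have "dist (anc i x) z \<le> dist x (anc i x) + dist x z" by (metis dist_commute dist_triangle)
    also have "\<dots> < rad (Suc i) / 2" using anc_dist[of x i] x Suc rad_pos[of i] by (simp add: rad_Suc dist_commute)
    finally have "nearest (net (Suc i)) (anc i x) = z"
      using assms Suc by (intro nearest_eq[OF rad_pos net(2)]) auto
    then show ?thesis by (simp add: cube_def Suc parent_def)
  qed
qed

lemma center_in_cube: "z \<in> net j \<Longrightarrow> z \<in> cube j z"
  using ball_cube rad_pos[of j] by force

lemma cube_Suc: "cube (Suc j) z = (\<Union>y\<in>{y \<in> net j. parent j y = z}. cube j y)"
  by (auto simp: cube_def anc_net)

lemma cube_measurable [measurable]: "cube j z \<in> sets borel"
proof (induction j arbitrary: z)
  case 0 show ?case unfolding cube_def anc.simps by (rule nearest_measurable)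
next
  case (Suc j)
  have "countable {y \<in> net j. parent j y = z}"
    by (rule countable_subset[OF _ separated_countable[OF rad_pos net_separated[of j]]]) auto
  then show ?case unfolding cube_Suc using Suc by (intro sets.countable_UN') auto
qed

lemma cube_bounded: "bounded (cube j z)" by (rule bounded_subset[OF bounded_ball cube_ball])

lemma children_finite: "finite {y \<in> net j. parent j y = z}"
proof -
  have "{y \<in> net j. parent j y = z} \<subseteq> net j \<inter> ball z (rad (Suc j))"
    using parent_dist by (auto simp: dist_commute)
  then show ?thesis using separated_locally_finite[OF rad_pos net_separated] finite_subset by blast
qed

lemma cube_disjoint: "y \<noteq> z \<Longrightarrow> cube j y \<inter> cube j z = {}" by (auto simp: cube_def)

lemma V_cube: assumes "y \<in> net j" shows "V y (2 ^ n * rad j) \<le> D ^ (n + 2) * measure \<mu> (cube j y)"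
proof -
  have "V y (2 ^ n * rad j) \<le> D ^ (n + 2) * V y (rad j / 4)"
    using rad_pos[of j] by (intro V_comp) (auto simp: power_add)
  also have "\<dots> \<le> D ^ (n + 2) * measure \<mu> (cube j y)"
    using D_ge1 by (intro mult_left_mono measure_mono_bounded ball_cube assms cube_bounded) auto
  finally show ?thesis .
qed

lemma cube_pos: "y \<in> net j \<Longrightarrow> 0 < measure \<mu> (cube j y)"
  using measure_mono_bounded[OF ball_cube _ _ cube_bounded, of y j] ball_pos[of "rad j / 4" y] rad_pos[of j] by auto

lemma parent_ball: "dist y z < rad (Suc i) \<Longrightarrow> ball z (2 * rad (Suc i)) \<subseteq> ball y (2 ^ 6 * rad i)"
  by (rule ball_subI) (use rad_pos[of i] in \<open>simp add: dist_commute rad_Suc\<close>)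

lemma measure_parent:
  assumes "y \<in> net i" shows "measure \<mu> (cube (Suc i) (parent i y)) \<le> D ^ 8 * measure \<mu> (cube i y)"
proof -
  have "measure \<mu> (cube (Suc i) (parent i y)) \<le> V y (2 ^ 6 * rad i)"
    by (intro measure_mono_bounded order_trans[OF cube_ball parent_ball[OF parent_dist]]) auto
  also have "\<dots> \<le> D ^ 8 * measure \<mu> (cube i y)" using V_cube[OF assms, of 6] by simp
  finally show ?thesis .
qed

lemma child_subset: "y \<in> net i \<Longrightarrow> cube i y \<subseteq> cube (Suc i) (parent i y)"
  by (auto simp: cube_Suc)

text \<open>
  A stopping time argument: descend from a cube that is not bad and stop at a bad cube, whose
  parent is then not bad, or at level \<open>0\<close>. As there is a lowest level, the selected cubes cover
  all of the original cube.
\<close>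

lemma stopping_cubes:
  assumes "z \<in> net J" "\<not> bad J z"
  shows "\<exists>P. finite P \<and> disjoint_family_on (\<lambda>(i, y). cube i y) P \<and> (\<Union>(i, y)\<in>P. cube i y) = cube J z \<and>
    (\<forall>(i, y)\<in>P. i \<le> J \<and> y \<in> net i \<and>
      (i < J \<and> bad i y \<and> \<not> bad (Suc i) (parent i y) \<or> i = 0 \<and> \<not> bad 0 y))"
  using assms
proof (induction J arbitrary: z)
  case 0 then show ?case by (intro exI[of _ "{(0, z)}"]) (auto simp: disjoint_family_on_def)
next
  case (Suc J)
  define Ch where "Ch = {y \<in> net J. parent J y = z}"
  define good where "good y P \<longleftrightarrow> finite P \<and> disjoint_family_on (\<lambda>(i, y). cube i y) P \<and> (\<Union>(i, y)\<in>P. cube i y) = cube J y \<and>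
    (\<forall>(i, y)\<in>P. i \<le> Suc J \<and> y \<in> net i \<and>
      (i < Suc J \<and> bad i y \<and> \<not> bad (Suc i) (parent i y) \<or> i = 0 \<and> \<not> bad 0 y))" for y P
  have "\<exists>P. good y P" if y: "y \<in> Ch" for y
  proof (cases "bad J y")
    case True
    then show ?thesis using y Suc.prems
      by (intro exI[of _ "{(J, y)}"]) (auto simp: good_def Ch_def disjoint_family_on_def)
  next
    case False
    then obtain P where P: "finite P" "disjoint_family_on (\<lambda>(i, y). cube i y) P" "(\<Union>(i, y)\<in>P. cube i y) = cube J y"
      "\<forall>(i, y)\<in>P. i \<le> J \<and> y \<in> net i \<and>
      (i < J \<and> bad i y \<and> \<not> bad (Suc i) (parent i y) \<or> i = 0 \<and> \<not> bad 0 y)"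
      using Suc.IH[of y] y by (auto simp: Ch_def)
    then have "good y P" unfolding good_def by (auto; force)
    then show ?thesis ..
  qed
  then obtain \<P> where \<P>: "\<And>y. y \<in> Ch \<Longrightarrow> good y (\<P> y)" by metis
  have sub: "cube (fst p) (snd p) \<subseteq> cube J y" if "y \<in> Ch" "p \<in> \<P> y" for y p
    using \<P>[OF that(1)] that(2) unfolding good_def by (auto split: prod.splits)
  have "disjoint_family_on (\<lambda>(i, y). cube i y) (\<Union>y\<in>Ch. \<P> y)"
    unfolding disjoint_family_on_def
  proof (intro ballI impI)
    fix p q assume "p \<in> (\<Union>y\<in>Ch. \<P> y)" "q \<in> (\<Union>y\<in>Ch. \<P> y)" and pq: "p \<noteq> q"
    then obtain y y' where y: "y \<in> Ch" "p \<in> \<P> y" "y' \<in> Ch" "q \<in> \<P> y'" by blast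
    show "(case p of (i, y) \<Rightarrow> cube i y) \<inter> (case q of (i, y) \<Rightarrow> cube i y) = {}"
    proof (cases "y = y'")
      case True
      then show ?thesis using \<P>[OF y(1)] y pq by (auto simp: good_def disjoint_family_on_def)
    next
      case False
      have "cube (fst p) (snd p) \<inter> cube (fst q) (snd q) = {}"
        using sub[OF y(1,2)] sub[OF y(3,4)] cube_disjoint[OF False, of J] by blast
      then show ?thesis by (simp add: case_prod_unfold)
    qed
  qed
  moreover have "(\<Union>(i, y)\<in>(\<Union>y\<in>Ch. \<P> y). cube i y) = (\<Union>y\<in>Ch. cube J y)"
    using \<P> by (simp add: good_def)
  moreover have "finite (\<Union>y\<in>Ch. \<P> y)" using \<P> children_finite by (auto simp: Ch_def good_def)
  moreover have "\<forall>(i, y)\<in>(\<Union>y\<in>Ch. \<P> y). i \<le> Suc J \<and> y \<in> net i \<and>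
      (i < Suc J \<and> bad i y \<and> \<not> bad (Suc i) (parent i y) \<or> i = 0 \<and> \<not> bad 0 y)"
    using \<P> unfolding good_def by blast
  ultimately show ?case unfolding cube_Suc Ch_def[symmetric] by blast
qed

end

section \<open>Kernel estimates\<close>

lemma ex_dyadic_scale:
  fixes \<rho> d :: real
  assumes "0 < \<rho>" "\<rho> \<le> d" shows "\<exists>m::nat. 2 ^ m * \<rho> \<le> d \<and> d < 2 ^ (m + 1) * \<rho>"
proof -
  obtain n where "d / \<rho> < 2 ^ n" using real_arch_pow[of 2 "d / \<rho>"] by auto
  then have n: "d < 2 ^ n * \<rho>" using assms by (simp add: field_simps)
  define m where "m = (LEAST n. d < 2 ^ n * \<rho>)"
  have m: "d < 2 ^ m * \<rho>" unfolding m_def by (rule LeastI, rule n)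
  then have "m \<noteq> 0" using assms by (cases m) auto
  then obtain k where k: "m = Suc k" using not0_implies_Suc by blast
  have "\<not> d < 2 ^ k * \<rho>" using not_less_Least[of k "\<lambda>n. d < 2 ^ n * \<rho>"] k by (simp add: m_def)
  then show ?thesis using m k by (intro exI[of _ k]) auto
qed

lemma tendsto_of_square_zero:
  fixes f :: "nat \<Rightarrow> real"
  assumes "(\<lambda>n. (l - f n)\<^sup>2) \<longlonglongrightarrow> 0" shows "f \<longlonglongrightarrow> l"
proof -
  have "(\<lambda>n. sqrt ((l - f n)\<^sup>2)) \<longlonglongrightarrow> sqrt 0" by (intro tendsto_intros assms)
  then have "(\<lambda>n. l - f n) \<longlonglongrightarrow> 0" by (simp add: tendsto_rabs_zero_iff)
  then have "(\<lambda>n. l - (l - f n)) \<longlonglongrightarrow> l - 0" by (intro tendsto_intros)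
  then show ?thesis by simp
qed

lemma ball_pred [measurable]: "Measurable.pred borel (\<lambda>x. x \<in> ball (z :: 'a::metric_space) r)"
  unfolding pred_def using borel_open[OF open_ball[of z r]] by (simp add: ball_def)

text \<open>
  One exponent \<open>\<kappa>\<close> serves as the constant of the kernel bounds and as the separation that the
  smoothness estimates require. As \<open>2 ^ \<kappa>\<close> is a power of \<open>2\<close>, it can be absorbed into a power of
  \<open>D\<close>.
\<close>

locale cz_operator = doubling_space \<mu> D for \<mu> :: "'a::metric_space measure" and D +
  fixes K :: "'a \<Rightarrow> 'a \<Rightarrow> real" and T :: "('a \<Rightarrow> real) \<Rightarrow> ('a \<Rightarrow> real)" and \<kappa> :: nat and \<epsilon> B :: real
  assumes K_size: "x \<noteq> y \<Longrightarrow> \<bar>K x y\<bar> \<le> 2 ^ \<kappa> / V x (dist x y)"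
    and K_reg1: "x \<noteq> y \<Longrightarrow> 2 ^ \<kappa> * dist x x' \<le> dist x y \<Longrightarrow>
      \<bar>K x y - K x' y\<bar> \<le> 2 ^ \<kappa> * ((dist x x' / dist x y) powr \<epsilon> / V x (dist x y))"
    and K_reg2: "x \<noteq> y \<Longrightarrow> 2 ^ \<kappa> * dist y y' \<le> dist x y \<Longrightarrow>
      \<bar>K x y - K x y'\<bar> \<le> 2 ^ \<kappa> * ((dist y y' / dist x y) powr \<epsilon> / V y (dist x y))"
    and \<epsilon>_pos: "0 < \<epsilon>" and \<kappa>_pos: "1 \<le> \<kappa>" and B_nonneg: "0 \<le> B"
    and T_CZ: "CZ_operator \<mu> K T"
    and T_bound: "f \<in> L2 \<mu> \<Longrightarrow> (\<integral>x. (T f x)\<^sup>2 \<partial>\<mu>) \<le> B * (\<integral>x. (f x)\<^sup>2 \<partial>\<mu>)"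
begin

lemma T_L2: "f \<in> L2 \<mu> \<Longrightarrow> T f \<in> L2 \<mu>"
  using T_CZ by (auto simp: CZ_operator_def bounded_L2_operator_def)

lemma T_measurable [measurable]: "f \<in> BB \<Longrightarrow> T f \<in> borel_measurable borel"
  using T_L2[OF BB_L2, of f] measurable_cong_sets[OF sets_M refl, of "borel :: real measure"] by (simp add: L2_def)

lemma T_integrable: "f \<in> BB \<Longrightarrow> integrable \<mu> (\<lambda>x. (T f x)\<^sup>2)"
  using T_L2[OF BB_L2, of f] by (simp add: L2_def)

lemma T_add: "f \<in> BB \<Longrightarrow> g \<in> BB \<Longrightarrow> AE x in \<mu>. T (\<lambda>y. f y + g y) x = T f x + T g x"
  using T_CZ BB_L2 by (auto simp: CZ_operator_def bounded_L2_operator_def)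

lemma T_cmult: "f \<in> BB \<Longrightarrow> AE x in \<mu>. T (\<lambda>y. c * f y) x = c * T f x"
  using T_CZ BB_L2 by (auto simp: CZ_operator_def bounded_L2_operator_def)

lemma T_diff: assumes "f \<in> BB" "g \<in> BB" shows "AE x in \<mu>. T (\<lambda>y. f y - g y) x = T f x - T g x"
  using T_add[OF assms(1) BB_cmult[OF assms(2), of "-1"]] T_cmult[OF assms(2), of "-1"] by eventually_elim auto

lemma T_Lip: "lip f \<Longrightarrow> f \<in> BB \<Longrightarrow> AE x in \<mu>. x \<notin> closure {x. f x \<noteq> 0} \<longrightarrow> T f x = (\<integral>y. K x y * f y \<partial>\<mu>)"
  using T_CZ unfolding CZ_operator_def lip_def BB_def by (blast intro: bounded_closure)

lemma T_zero: "AE x in \<mu>. T (\<lambda>y. 0) x = 0"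
  using T_Lip[OF lip_const BB_zero] by simp

lemma T_sum: "finite I \<Longrightarrow> (\<And>i. i \<in> I \<Longrightarrow> f i \<in> BB) \<Longrightarrow> AE x in \<mu>. T (\<lambda>y. \<Sum>i\<in>I. f i y) x = (\<Sum>i\<in>I. T (f i) x)"
proof (induction I rule: finite_induct)
  case (insert i I)
  have "AE x in \<mu>. T (\<lambda>y. f i y + (\<Sum>i\<in>I. f i y)) x = T (f i) x + T (\<lambda>y. \<Sum>i\<in>I. f i y) x"
    by (intro T_add BB_sum) (use insert in auto)
  with insert show ?case by auto
qed (use T_zero in simp)

lemma T_null: assumes "f \<in> BB" "(\<integral>x. \<bar>f x\<bar> \<partial>\<mu>) = 0" shows "AE x in \<mu>. T f x = 0"
proof -
  have "AE x in \<mu>. \<bar>f x\<bar> = 0"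
    using assms(2) by (subst (asm) integral_nonneg_eq_0_iff_AE) (auto intro: BB_integrable BB_abs assms)
  then have "(\<integral>x. (f x)\<^sup>2 \<partial>\<mu>) = (\<integral>x. 0 \<partial>\<mu>)"
    by (intro integral_cong_AE) (use assms in \<open>auto intro!: borel_measurable_power simp: BB_measurable\<close>)
  then have "(\<integral>x. (T f x)\<^sup>2 \<partial>\<mu>) \<le> 0" using T_bound[OF BB_L2[OF assms(1)]] by simp
  then have "(\<integral>x. (T f x)\<^sup>2 \<partial>\<mu>) = 0" by (simp add: antisym)
  then show ?thesis
    by (subst (asm) integral_nonneg_eq_0_iff_AE) (auto intro: T_integrable assms)
qed

lemma level_set:
  assumes "f \<in> BB" "0 < t"
  shows "{x. t < \<bar>T f x\<bar>} \<in> fmeasurable \<mu>"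
    and "t\<^sup>2 * measure \<mu> {x. t < \<bar>T f x\<bar>} \<le> B * (\<integral>x. (f x)\<^sup>2 \<partial>\<mu>)"
proof -
  note [measurable] = T_measurable[OF assms(1)]
  have sub: "{x. t < \<bar>T f x\<bar>} \<subseteq> {x. t\<^sup>2 \<le> (T f x)\<^sup>2}"
    using assms(2) by (auto simp: abs_le_square_iff[symmetric])
  have "emeasure \<mu> {x \<in> space \<mu>. t\<^sup>2 \<le> (T f x)\<^sup>2} \<le> ennreal (1 / t\<^sup>2 * (\<integral>x. (T f x)\<^sup>2 \<partial>\<mu>))"
    by (rule integral_Markov_inequality[OF T_integrable[OF assms(1)]]) (use assms(2) in simp_all)
  moreover have "emeasure \<mu> {x. t < \<bar>T f x\<bar>} \<le> emeasure \<mu> {x \<in> space \<mu>. t\<^sup>2 \<le> (T f x)\<^sup>2}"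
    by (rule emeasure_mono) (use sub in simp, measurable)
  ultimately have le: "emeasure \<mu> {x. t < \<bar>T f x\<bar>} \<le> ennreal (1 / t\<^sup>2 * (\<integral>x. (T f x)\<^sup>2 \<partial>\<mu>))"
    by simp
  show "{x. t < \<bar>T f x\<bar>} \<in> fmeasurable \<mu>"
  proof (rule fmeasurableI)
    show "{x. t < \<bar>T f x\<bar>} \<in> sets \<mu>" unfolding sets_M by measurable
    show "emeasure \<mu> {x. t < \<bar>T f x\<bar>} < \<infinity>" using le by (simp add: le_less_trans)
  qed
  have "measure \<mu> {x. t < \<bar>T f x\<bar>} \<le> 1 / t\<^sup>2 * (\<integral>x. (T f x)\<^sup>2 \<partial>\<mu>)"
    using le unfolding measure_def by (intro enn2real_leI) auto
  then have "t\<^sup>2 * measure \<mu> {x. t < \<bar>T f x\<bar>} \<le> (\<integral>x. (T f x)\<^sup>2 \<partial>\<mu>)"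
    using assms(2) by (simp add: field_simps)
  also have "\<dots> \<le> B * (\<integral>x. (f x)\<^sup>2 \<partial>\<mu>)" by (rule T_bound[OF BB_L2[OF assms(1)]])
  finally show "t\<^sup>2 * measure \<mu> {x. t < \<bar>T f x\<bar>} \<le> B * (\<integral>x. (f x)\<^sup>2 \<partial>\<mu>)" .
qed

lemma K_continuous: "continuous_on (- {x}) (K x)"
proof (intro continuous_at_imp_continuous_on ballI)
  fix y assume "y \<in> - {x}"
  then have ne: "x \<noteq> y" by auto
  define d where "d = dist x y"
  have d: "d > 0" using ne by (simp add: d_def)
  show "isCont (K x) y"
    unfolding isCont_def
  proof (rule tendsto_dist_iff[THEN iffD2], rule tendsto_sandwich[OF _ _ tendsto_const])
    show "\<forall>\<^sub>F y' in at y. 0 \<le> dist (K x y') (K x y)" by simp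
    have "\<forall>\<^sub>F y' in at y. dist y' y < d / 2 ^ \<kappa>"
      using d by (auto simp: eventually_at intro!: exI[of _ "d / 2 ^ \<kappa>"])
    then show "\<forall>\<^sub>F y' in at y. dist (K x y') (K x y) \<le> 2 ^ \<kappa> * ((dist y y' / d) powr \<epsilon> / V y d)"
    proof eventually_elim
      fix y' assume "dist y' y < d / 2 ^ \<kappa>"
      then have "2 ^ \<kappa> * dist y y' \<le> dist x y" by (simp add: field_simps d_def dist_commute)
      from K_reg2[OF ne this] show "dist (K x y') (K x y) \<le> 2 ^ \<kappa> * ((dist y y' / d) powr \<epsilon> / V y d)"
        by (simp add: dist_real_def d_def abs_minus_commute)
    qed
    have "((\<lambda>y'. dist y y' / d) \<longlongrightarrow> dist y y / d) (at y)"
      using d by (intro tendsto_intros) auto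
    then have "((\<lambda>y'. (dist y y' / d) powr \<epsilon>) \<longlongrightarrow> 0) (at y)"
      using d \<epsilon>_pos by (intro tendsto_zero_powrI[OF _ tendsto_const]) auto
    then show "((\<lambda>y'. 2 ^ \<kappa> * ((dist y y' / d) powr \<epsilon> / V y d)) \<longlongrightarrow> 0) (at y)"
      by (intro tendsto_mult_right_zero tendsto_divide_zero)
  qed
qed

lemma K_mult_BB:
  assumes "f \<in> BB" "0 < r" "\<And>y. y \<in> ball x r \<Longrightarrow> f y = 0"
  shows "(\<lambda>y. K x y * f y) \<in> BB" "\<bar>K x y * f y\<bar> \<le> 2 ^ \<kappa> / V x r * \<bar>f y\<bar>"
proof -
  have [measurable]: "(\<lambda>y. indicator (- {x}) y *\<^sub>R K x y) \<in> borel_measurable borel"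
    by (rule borel_measurable_continuous_on_indicator[OF _ K_continuous]) auto
  note [measurable] = BB_measurable[OF assms(1)]
  have eq: "K x y * f y = (indicator (- {x}) y *\<^sub>R K x y) * f y" for y
    using assms(2) assms(3)[of x] by (cases "y = x") auto
  have le: "\<bar>K x y * f y\<bar> \<le> 2 ^ \<kappa> / V x r * \<bar>f y\<bar>" for y
  proof (cases "f y = 0")
    case False
    then have r: "r \<le> dist x y" using assms(3)[of y] by force
    then have "\<bar>K x y\<bar> \<le> 2 ^ \<kappa> / V x (dist x y)" using K_size[of x y] assms(2) by force
    also have "\<dots> \<le> 2 ^ \<kappa> / V x r"
      using V_mono[OF r, of x] ball_pos[OF assms(2), of x] by (intro divide_left_mono mult_pos_pos) auto
    finally show ?thesis unfolding abs_mult by (rule mult_right_mono) auto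
  qed simp
  show "\<bar>K x y * f y\<bar> \<le> 2 ^ \<kappa> / V x r * \<bar>f y\<bar>" by (rule le)
  obtain c R where c: "c > 0" "\<And>y. \<bar>f y\<bar> \<le> c" "\<And>y. f y \<noteq> 0 \<Longrightarrow> y \<in> ball x R" using BB_E[OF assms(1)] by metis
  show "(\<lambda>y. K x y * f y) \<in> BB"
  proof (rule BB_I)
    show "(\<lambda>y. K x y * f y) \<in> borel_measurable borel" unfolding eq by measurable
    show "\<bar>K x y * f y\<bar> \<le> 2 ^ \<kappa> / V x r * c" for y
      using order_trans[OF le mult_left_mono[OF c(2)[of y]]] by simp
    show "y \<in> ball x R" if "K x y * f y \<noteq> 0" for y using c(3)[of y] that by auto
  qed
qed

text \<open>
  The integral representation is given for Lipschitz functions off their support, and here it is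
  carried over to \<open>h\<close>. The approximating functions are multiplied by a cutoff that is \<open>1\<close> where
  \<open>h\<close> lives and vanishes at distance \<open>r / 2\<close> from there; near \<open>x\<close> they vanish like \<open>h\<close>, so that
  dominated convergence applies to the integrals, while \<open>T\<close> of them converges almost everywhere
  along a subsequence.
\<close>

lemma T_representation:
  assumes h: "h \<in> BB" and r: "0 < r"
  shows "AE x in \<mu>. (\<forall>y\<in>ball x r. h y = 0) \<longrightarrow> T h x = (\<integral>y. K x y * h y \<partial>\<mu>)"
proof (cases "\<forall>x. h x = 0")
  case True
  then have "h = (\<lambda>_. 0)" by auto
  then show ?thesis using T_zero by simp
next
  case False
  define S where "S = {x. h x \<noteq> 0}"
  have S: "S \<noteq> {}" using False by (auto simp: S_def)
  obtain z :: 'a where True by blast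
  obtain c R where c: "c > 0" "R > 0" "\<And>y. \<bar>h y\<bar> \<le> c" "\<And>y. h y \<noteq> 0 \<Longrightarrow> y \<in> ball z R" using BB_E[OF h] by metis
  have "\<exists>\<phi>. lip \<phi> \<and> \<phi> \<in> BB \<and> (\<forall>x. \<bar>\<phi> x\<bar> \<le> c) \<and> (\<forall>x. \<phi> x \<noteq> 0 \<longrightarrow> x \<in> ball z (R + 1)) \<and>
    (\<integral>x. (h x - \<phi> x)\<^sup>2 \<partial>\<mu>) < 1 / (real n + 1)" for n
    by (rule BB_Lipschitz_approx[OF h c(3,4,2)]) auto
  then obtain \<phi> where \<phi>: "\<And>n. lip (\<phi> n)" "\<And>n. \<phi> n \<in> BB" "\<And>n x. \<bar>\<phi> n x\<bar> \<le> c"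
    "\<And>n x. \<phi> n x \<noteq> 0 \<Longrightarrow> x \<in> ball z (R + 1)" "\<And>n. (\<integral>x. (h x - \<phi> n x)\<^sup>2 \<partial>\<mu>) < 1 / (real n + 1)" by metis
  define \<eta> where "\<eta> x = max 0 (min 1 (1 + (- 2 / r) * infdist x S))" for x
  have \<eta>: "lip \<eta>" "\<And>x. \<bar>\<eta> x\<bar> \<le> 1" unfolding \<eta>_def
    by (intro lip_clamp lip_add lip_const lip_cmult lip_infdist) auto
  have \<eta>S: "\<eta> x = 1" if "x \<in> S" for x using that by (simp add: \<eta>_def)
  have \<eta>0: "infdist x S < r / 2" if "\<eta> x \<noteq> 0" for x
  proof (rule ccontr)
    assume "\<not> infdist x S < r / 2"
    then have "1 + (- 2 / r) * infdist x S \<le> 0" using r by (simp add: field_simps)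
    then show False using that by (simp add: \<eta>_def)
  qed
  define \<psi> where "\<psi> n x = \<phi> n x * \<eta> x" for n x
  have \<psi>: "lip (\<psi> n)" "\<psi> n \<in> BB" for n unfolding \<psi>_def
    using lip_mult[OF \<phi>(1) \<eta>(1)] \<phi>(3) \<eta>(2) BB_mult_bounded(1)[OF \<phi>(2) lip_measurable[OF \<eta>(1)]] by blast+
  have \<psi>le: "\<bar>\<psi> n x\<bar> \<le> \<bar>\<phi> n x\<bar>" for n x
    using mult_left_mono[OF \<eta>(2)[of x], of "\<bar>\<phi> n x\<bar>"] by (simp add: \<psi>_def abs_mult)
  have h\<psi>: "\<bar>h x - \<psi> n x\<bar> \<le> \<bar>h x - \<phi> n x\<bar>" for n x
  proof (cases "x \<in> S")
    case True then show ?thesis by (simp add: \<psi>_def \<eta>S)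
  next
    case False then show ?thesis using \<psi>le[of n x] by (simp add: S_def)
  qed
  \<comment> \<open>one integrable sequence, so that a single subsequence serves \<open>h\<close> and \<open>T h\<close>\<close>
  define u where "u n x = (h x - \<psi> n x)\<^sup>2 + (T (\<lambda>y. h y - \<psi> n y) x)\<^sup>2" for n x
  have dBB: "(\<lambda>y. h y - \<psi> n y) \<in> BB" for n by (intro BB_diff h \<psi>)
  have i1: "integrable \<mu> (\<lambda>x. (h x - \<psi> n x)\<^sup>2)" for n using BB_L2[OF dBB] by (simp add: L2_def)
  have i2: "integrable \<mu> (\<lambda>x. (h x - \<phi> n x)\<^sup>2)" for n using BB_L2[OF BB_diff[OF h \<phi>(2)]] by (simp add: L2_def)
  have iu: "integrable \<mu> (u n)" for n unfolding u_def using i1 T_integrable[OF dBB] by simp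
  have u0: "0 \<le> u n x" for n x by (simp add: u_def)
  have "(\<integral>x. norm (u n x) \<partial>\<mu>) \<le> (1 + B) * (1 / (real n + 1))" for n
  proof -
    have "(\<integral>x. norm (u n x) \<partial>\<mu>) = (\<integral>x. u n x \<partial>\<mu>)" using u0 by simp
    also have "\<dots> = (\<integral>x. (h x - \<psi> n x)\<^sup>2 \<partial>\<mu>) + (\<integral>x. (T (\<lambda>y. h y - \<psi> n y) x)\<^sup>2 \<partial>\<mu>)"
      unfolding u_def by (intro Bochner_Integration.integral_add i1 T_integrable dBB)
    also have "\<dots> \<le> (1 + B) * (\<integral>x. (h x - \<psi> n x)\<^sup>2 \<partial>\<mu>)"
      using T_bound[OF BB_L2[OF dBB[of n]]] by (simp add: algebra_simps)
    also have "\<dots> \<le> (1 + B) * (\<integral>x. (h x - \<phi> n x)\<^sup>2 \<partial>\<mu>)"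
      using B_nonneg by (intro mult_left_mono integral_mono i1 i2) (use h\<psi> in \<open>auto simp: abs_le_square_iff\<close>)
    also have "\<dots> \<le> (1 + B) * (1 / (real n + 1))" using B_nonneg \<phi>(5)[of n] by (intro mult_left_mono) auto
    finally show ?thesis .
  qed
  then have ule: "norm (\<integral>x. norm (u n x) \<partial>\<mu>) \<le> (1 + B) * inverse (real (Suc n))" for n
    by (simp add: inverse_eq_divide add.commute)
  have "(\<lambda>n. (1 + B) * inverse (real (Suc n))) \<longlonglongrightarrow> 0"
    by (rule tendsto_mult_right_zero[OF LIMSEQ_inverse_real_of_nat])
  then have "(\<lambda>n. \<integral>x. norm (u n x) \<partial>\<mu>) \<longlonglongrightarrow> 0"
    by (rule Lim_null_comparison[rotated]) (rule always_eventually, rule allI, rule ule)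
  from tendsto_L1_AE_subseq[OF iu this]
  obtain q where q: "strict_mono q" "AE x in \<mu>. (\<lambda>n. u (q n) x) \<longlonglongrightarrow> 0" by blast
  have "AE x in \<mu>. \<forall>n. T (\<lambda>y. h y - \<psi> n y) x = T h x - T (\<psi> n) x"
    by (simp add: AE_all_countable) (intro allI T_diff h \<psi>)
  moreover have "AE x in \<mu>. \<forall>n. x \<notin> closure {x. \<psi> n x \<noteq> 0} \<longrightarrow> T (\<psi> n) x = (\<integral>y. K x y * \<psi> n y \<partial>\<mu>)"
    by (simp only: AE_all_countable) (intro allI T_Lip \<psi>)
  moreover note q(2)
  ultimately show ?thesis
  proof eventually_elim
    case (elim x)
    show ?case
    proof
      assume x: "\<forall>y\<in>ball x r. h y = 0"
      have inf_x: "infdist x S \<ge> r"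
      proof -
        have "r \<le> dist x y" if "y \<in> S" for y using x that unfolding S_def by force
        then show ?thesis using S by (auto simp: infdist_def intro: cINF_greatest)
      qed
      have far: "r / 2 \<le> dist x y" if "infdist y S \<le> r / 2" for y
        using infdist_triangle[of x S y] inf_x that by linarith
      have \<psi>0: "\<psi> n y = 0" if "y \<in> ball x (r / 2)" for n y
        using far[of y] \<eta>0[of y] that by (force simp: \<psi>_def)
      have cl: "closure {x. \<psi> n x \<noteq> 0} \<subseteq> {x. infdist x S \<le> r / 2}" for n
      proof (rule closure_minimal)
        show "{x. \<psi> n x \<noteq> 0} \<subseteq> {x. infdist x S \<le> r / 2}" using \<eta>0 by (force simp: \<psi>_def)
        show "closed {x. infdist x S \<le> r / 2}" by (intro closed_Collect_le continuous_intros)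
      qed
      have "x \<notin> closure {x. \<psi> n x \<noteq> 0}" for n
      proof
        assume "x \<in> closure {x. \<psi> n x \<noteq> 0}"
        then have "infdist x S \<le> r / 2" using cl by blast
        then show False using inf_x r by linarith
      qed
      with elim(2) have rep: "T (\<psi> n) x = (\<integral>y. K x y * \<psi> n y \<partial>\<mu>)" for n by blast
      have "(\<lambda>n. (T h x - T (\<psi> (q n)) x)\<^sup>2) \<longlonglongrightarrow> 0"
      proof (rule tendsto_sandwich[OF _ _ tendsto_const elim(3)])
        show "\<forall>\<^sub>F n in sequentially. (T h x - T (\<psi> (q n)) x)\<^sup>2 \<le> u (q n) x"
          using elim(1) by (simp add: u_def)
      qed simp
      then have lim1: "(\<lambda>n. \<integral>y. K x y * \<psi> (q n) y \<partial>\<mu>) \<longlonglongrightarrow> T h x"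
        unfolding rep[symmetric] by (rule tendsto_of_square_zero)
      have hx: "\<And>y. y \<in> ball x r \<Longrightarrow> h y = 0" using x by blast
      have r2: "0 < r / 2" using r by simp
      have lim2: "(\<lambda>n. \<integral>y. K x y * \<psi> (q n) y \<partial>\<mu>) \<longlonglongrightarrow> (\<integral>y. K x y * h y \<partial>\<mu>)"
      proof (rule integral_dominated_convergence[where w = "\<lambda>y. 2 ^ \<kappa> / V x (r / 2) * (c * indicator (ball z (R + 1)) y)"])
        show "(\<lambda>y. K x y * h y) \<in> borel_measurable \<mu>"
          using BB_measurable[OF K_mult_BB(1)[OF h r hx]] by simp
        show "(\<lambda>y. K x y * \<psi> (q n) y) \<in> borel_measurable \<mu>" for n
          using BB_measurable[OF K_mult_BB(1)[OF \<psi>(2) r2 \<psi>0]] by simp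
        show "integrable \<mu> (\<lambda>y. 2 ^ \<kappa> / V x (r / 2) * (c * indicator (ball z (R + 1)) y))"
          by (intro BB_integrable BB_intros) auto
        show "AE y in \<mu>. norm (K x y * \<psi> (q n) y) \<le> 2 ^ \<kappa> / V x (r / 2) * (c * indicator (ball z (R + 1)) y)" for n
        proof (rule AE_I2)
          fix y
          have "\<bar>\<psi> (q n) y\<bar> \<le> c * indicator (ball z (R + 1)) y"
            using \<psi>le[of "q n" y] \<phi>(3,4)[of "q n" y] by (cases "y \<in> ball z (R + 1)") fastforce+
          from mult_left_mono[OF this, of "2 ^ \<kappa> / V x (r / 2)"] K_mult_BB(2)[where x = x and y = y, OF \<psi>(2)[of "q n"] r2 \<psi>0]
          show "norm (K x y * \<psi> (q n) y) \<le> 2 ^ \<kappa> / V x (r / 2) * (c * indicator (ball z (R + 1)) y)" by simp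
        qed
        show "AE y in \<mu>. (\<lambda>n. K x y * \<psi> (q n) y) \<longlonglongrightarrow> K x y * h y"
          using q(2)
        proof eventually_elim
          fix y assume u_lim: "(\<lambda>n. u (q n) y) \<longlonglongrightarrow> 0"
          have "(\<lambda>n. (h y - \<psi> (q n) y)\<^sup>2) \<longlonglongrightarrow> 0"
            by (rule tendsto_sandwich[OF _ _ tendsto_const u_lim]) (simp_all add: u_def)
          then have "(\<lambda>n. \<psi> (q n) y) \<longlonglongrightarrow> h y" by (rule tendsto_of_square_zero)
          then show "(\<lambda>n. K x y * \<psi> (q n) y) \<longlonglongrightarrow> K x y * h y"
            by (rule tendsto_mult[OF tendsto_const])
        qed
      qed
      show "T h x = (\<integral>y. K x y * h y \<partial>\<mu>)" by (rule LIMSEQ_unique[OF lim1 lim2])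
    qed
  qed
qed

text \<open>
  The sum over the dyadic annuli of the geometric decay \<open>2 powr (- \<epsilon> * m)\<close>.
\<close>

definition C\<epsilon> :: real where "C\<epsilon> = D / (1 - 2 powr (- \<epsilon>))"

lemma q_less1: "2 powr (- \<epsilon>) < 1"
  using powr_less_mono[of "- \<epsilon>" 0 2] \<epsilon>_pos by simp

lemma C\<epsilon>_pos: "0 < C\<epsilon>" unfolding C\<epsilon>_def using q_less1 D_ge1 by simp

lemma majorant_measurable [measurable]:
  "(\<lambda>x. (\<rho> / dist z x) powr \<epsilon> / V z (dist z x)) \<in> borel_measurable borel"
proof -
  have [measurable]: "V z \<in> borel_measurable borel" by (intro borel_measurable_mono monoI V_mono)
  have [measurable]: "dist z \<in> borel_measurable borel" by (rule lip_measurable[OF lip_dist])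
  show ?thesis by measurable
qed

text \<open>
  On the annulus with radii \<open>2 ^ m * \<rho>\<close> and \<open>2 ^ (m + 1) * \<rho>\<close> the weight function is at most
  \<open>2 powr (- \<epsilon> * m)\<close> divided by the measure of the ball, so that the integral is dominated by a geometric
  series of averages of \<open>F\<close>.
\<close>

lemma annuli_integral:
  assumes [measurable]: "F \<in> borel_measurable borel" and "0 < \<rho>" "0 \<le> a"
    and avg: "\<And>m. (\<integral>\<^sup>+x. F x * indicator (ball z (2 ^ m * \<rho>)) x \<partial>\<mu>) \<le> ennreal (a * V z (2 ^ m * \<rho>))"
  shows "(\<integral>\<^sup>+x. ennreal ((\<rho> / dist z x) powr \<epsilon> / V z (dist z x)) * F x * indicator (- ball z \<rho>) x \<partial>\<mu>) \<le> ennreal (C\<epsilon> * a)"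
proof -
  define q where "q = 2 powr (- \<epsilon>)"
  have q: "0 < q" "q < 1" using q_less1 by (auto simp: q_def)
  let ?k = "\<lambda>m x. ennreal (q ^ m / V z (2 ^ m * \<rho>)) * (F x * indicator (ball z (2 ^ (m + 1) * \<rho>)) x)"
  have "ennreal ((\<rho> / dist z x) powr \<epsilon> / V z (dist z x)) * F x * indicator (- ball z \<rho>) x \<le> (\<Sum>m. ?k m x)" for x
  proof (cases "x \<in> ball z \<rho>")
    case False
    then have "\<rho> \<le> dist z x" by simp
    from ex_dyadic_scale[OF \<open>0 < \<rho>\<close> this] obtain m
      where m: "2 ^ m * \<rho> \<le> dist z x" "dist z x < 2 ^ (m + 1) * \<rho>" by blast
    have pos: "0 < 2 ^ m * \<rho>" using \<open>0 < \<rho>\<close> by simp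
    have d: "0 < dist z x" using pos m by linarith
    have "(\<rho> / dist z x) powr \<epsilon> \<le> (1 / 2 ^ m) powr \<epsilon>"
      using m d \<open>0 < \<rho>\<close> \<epsilon>_pos by (intro powr_mono2) (auto simp: field_simps)
    also have "\<dots> = q ^ m"
      by (simp add: q_def powr_divide powr_minus_divide power_divide powr_power mult.commute powr_realpow[symmetric] powr_powr)
    finally have "(\<rho> / dist z x) powr \<epsilon> / V z (dist z x) \<le> q ^ m / V z (2 ^ m * \<rho>)"
      using V_mono[OF m(1), of z] ball_pos[OF pos, of z] q by (intro frac_le) auto
    then have "ennreal ((\<rho> / dist z x) powr \<epsilon> / V z (dist z x)) * F x * indicator (- ball z \<rho>) x \<le> ?k m x"
      using m False by (auto intro!: mult_right_mono ennreal_leI)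
    also have "\<dots> \<le> (\<Sum>m. ?k m x)"
      using sum_le_suminf[of "\<lambda>m. ?k m x" "{m}"] by simp
    finally show ?thesis .
  qed simp
  then have "(\<integral>\<^sup>+x. ennreal ((\<rho> / dist z x) powr \<epsilon> / V z (dist z x)) * F x * indicator (- ball z \<rho>) x \<partial>\<mu>)
    \<le> (\<integral>\<^sup>+x. (\<Sum>m. ?k m x) \<partial>\<mu>)" by (intro nn_integral_mono)
  also have "\<dots> = (\<Sum>m. \<integral>\<^sup>+x. ?k m x \<partial>\<mu>)" by (rule nn_integral_suminf) measurable
  also have "\<dots> = (\<Sum>m. ennreal (q ^ m / V z (2 ^ m * \<rho>)) * (\<integral>\<^sup>+x. F x * indicator (ball z (2 ^ (m + 1) * \<rho>)) x \<partial>\<mu>))"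
    by (subst nn_integral_cmult) auto
  also have "\<dots> \<le> (\<Sum>m. ennreal (D * a * q ^ m))"
  proof (intro suminf_le summableI)
    fix m
    have pos: "0 < 2 ^ m * \<rho>" using \<open>0 < \<rho>\<close> by simp
    note Vp = ball_pos[OF pos, of z]
    have "ennreal (q ^ m / V z (2 ^ m * \<rho>)) * (\<integral>\<^sup>+x. F x * indicator (ball z (2 ^ (m + 1) * \<rho>)) x \<partial>\<mu>)
      \<le> ennreal (q ^ m / V z (2 ^ m * \<rho>)) * ennreal (a * V z (2 ^ (m + 1) * \<rho>))"
      by (intro mult_left_mono avg) auto
    also have "\<dots> = ennreal (q ^ m / V z (2 ^ m * \<rho>) * (a * V z (2 ^ (m + 1) * \<rho>)))"
      using q Vp by (intro ennreal_mult[symmetric]) (auto simp: \<open>0 \<le> a\<close>)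
    also have "\<dots> \<le> ennreal (q ^ m / V z (2 ^ m * \<rho>) * (a * (D * V z (2 ^ m * \<rho>))))"
      using q Vp doubling[OF pos, of z] by (intro ennreal_leI mult_left_mono) (auto simp: mult.assoc \<open>0 \<le> a\<close>)
    also have "q ^ m / V z (2 ^ m * \<rho>) * (a * (D * V z (2 ^ m * \<rho>))) = D * a * q ^ m"
      using Vp by (simp add: field_simps)
    finally show "ennreal (q ^ m / V z (2 ^ m * \<rho>)) * (\<integral>\<^sup>+x. F x * indicator (ball z (2 ^ (m + 1) * \<rho>)) x \<partial>\<mu>) \<le> ennreal (D * a * q ^ m)" .
  qed
  also have "\<dots> = ennreal (\<Sum>m. D * a * q ^ m)"
    by (rule suminf_ennreal2) (use q D_ge1 \<open>0 \<le> a\<close> in \<open>auto intro!: summable_mult summable_geometric\<close>)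
  also have "(\<Sum>m. D * a * q ^ m) = C\<epsilon> * a"
    using q by (subst suminf_mult) (auto simp: suminf_geometric C\<epsilon>_def q_def intro!: summable_geometric)
  finally show ?thesis .
qed

text \<open>
  For \<open>x\<close> in the small ball, \<open>T f x\<close> is given by the kernel. The smoothness of the kernel in the first
  variable bounds the difference to the value at the centre \<open>z\<close> by a sum of averages of \<open>|f|\<close>. The
  value at \<open>z\<close> is the kernel integral and not \<open>T f z\<close>, since \<open>T f\<close> is defined only almost everywhere.
\<close>

lemma T_oscillation:
  fixes z :: 'a
  assumes f: "f \<in> BB" and "0 < \<rho>" "0 \<le> a" and vanish: "\<And>y. y \<in> ball z (2 ^ \<kappa> * \<rho>) \<Longrightarrow> f y = 0"
    and avg: "\<And>m. (\<integral>x. \<bar>f x\<bar> * indicator (ball z (2 ^ m * \<rho>)) x \<partial>\<mu>) \<le> a * V z (2 ^ m * \<rho>)"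
  shows "AE x in \<mu>. x \<in> ball z \<rho> \<longrightarrow> \<bar>T f x - (\<integral>y. K z y * f y \<partial>\<mu>)\<bar> \<le> 2 ^ \<kappa> * C\<epsilon> * a"
  using T_representation[OF f \<open>0 < \<rho>\<close>]
proof eventually_elim
  case (elim x)
  note [measurable] = BB_measurable[OF f]
  have two: "2 \<le> (2::real) ^ \<kappa>" using power_increasing[OF \<kappa>_pos, of "2::real"] by simp
  then have two\<rho>: "2 * \<rho> \<le> 2 ^ \<kappa> * \<rho>" using \<open>0 < \<rho>\<close> by (intro mult_right_mono) auto
  show ?case
  proof
    assume x: "x \<in> ball z \<rho>"
    have 0: "f y = 0" if "y \<in> ball x \<rho>" for y
    proof (rule vanish)
      show "y \<in> ball z (2 ^ \<kappa> * \<rho>)" using that x two\<rho> dist_triangle[of z y x] by simp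
    qed
    have zz: "f y = 0" if "y \<in> ball z \<rho>" for y
      using vanish[of y] that two\<rho> \<open>0 < \<rho>\<close> unfolding mem_ball by linarith
    have rep: "T f x = (\<integral>y. K x y * f y \<partial>\<mu>)" using elim 0 by blast
    have ix: "integrable \<mu> (\<lambda>y. K x y * f y)" by (rule BB_integrable[OF K_mult_BB(1)[OF f \<open>0 < \<rho>\<close> 0]])
    have iz: "integrable \<mu> (\<lambda>y. K z y * f y)" by (rule BB_integrable[OF K_mult_BB(1)[OF f \<open>0 < \<rho>\<close> zz]])
    have "ennreal \<bar>T f x - (\<integral>y. K z y * f y \<partial>\<mu>)\<bar> = ennreal (norm (\<integral>y. K x y * f y - K z y * f y \<partial>\<mu>))"
      by (simp add: rep Bochner_Integration.integral_diff[OF ix iz])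
    also have "\<dots> \<le> (\<integral>\<^sup>+y. ennreal (norm (K x y * f y - K z y * f y)) \<partial>\<mu>)"
      by (rule integral_norm_bound_ennreal) (use ix iz in simp)
    also have "\<dots> \<le> (\<integral>\<^sup>+y. ennreal (2 ^ \<kappa>) * (ennreal ((\<rho> / dist z y) powr \<epsilon> / V z (dist z y)) * ennreal \<bar>f y\<bar> * indicator (- ball z \<rho>) y) \<partial>\<mu>)"
    proof (rule nn_integral_mono)
      fix y
      show "ennreal (norm (K x y * f y - K z y * f y)) \<le> ennreal (2 ^ \<kappa>) * (ennreal ((\<rho> / dist z y) powr \<epsilon> / V z (dist z y)) * ennreal \<bar>f y\<bar> * indicator (- ball z \<rho>) y)"
      proof (cases "f y = 0")
        case False
        then have far: "2 ^ \<kappa> * \<rho> \<le> dist z y" using vanish[of y] by force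
        then have "2 ^ \<kappa> * dist z x \<le> dist z y" using x by (smt (verit) mem_ball mult_left_mono zero_le_power)
        moreover have yz: "z \<noteq> y" "y \<notin> ball z \<rho>" using False zz \<open>0 < \<rho>\<close> by auto
        ultimately have "\<bar>K z y - K x y\<bar> \<le> 2 ^ \<kappa> * ((dist z x / dist z y) powr \<epsilon> / V z (dist z y))" by (intro K_reg1)
        also have "\<dots> \<le> 2 ^ \<kappa> * ((\<rho> / dist z y) powr \<epsilon> / V z (dist z y))"
          using x \<epsilon>_pos by (intro mult_left_mono divide_right_mono powr_mono2) auto
        finally have "\<bar>K z y - K x y\<bar> * \<bar>f y\<bar> \<le> 2 ^ \<kappa> * ((\<rho> / dist z y) powr \<epsilon> / V z (dist z y)) * \<bar>f y\<bar>"
          by (rule mult_right_mono) simp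
        moreover have "norm (K x y * f y - K z y * f y) = \<bar>K z y - K x y\<bar> * \<bar>f y\<bar>"
          by (simp add: abs_mult[symmetric] left_diff_distrib abs_minus_commute)
        ultimately have "ennreal (norm (K x y * f y - K z y * f y)) \<le> ennreal (2 ^ \<kappa> * ((\<rho> / dist z y) powr \<epsilon> / V z (dist z y)) * \<bar>f y\<bar>)"
          by (intro ennreal_leI) simp
        also have "\<dots> = ennreal (2 ^ \<kappa>) * (ennreal ((\<rho> / dist z y) powr \<epsilon> / V z (dist z y)) * ennreal \<bar>f y\<bar> * indicator (- ball z \<rho>) y)"
          using yz by (simp add: ennreal_mult[symmetric] mult.assoc)
        finally show ?thesis .
      qed simp
    qed
    also have "\<dots> = ennreal (2 ^ \<kappa>) * (\<integral>\<^sup>+y. ennreal ((\<rho> / dist z y) powr \<epsilon> / V z (dist z y)) * ennreal \<bar>f y\<bar> * indicator (- ball z \<rho>) y \<partial>\<mu>)"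
      by (rule nn_integral_cmult) measurable
    also have "\<dots> \<le> ennreal (2 ^ \<kappa>) * ennreal (C\<epsilon> * a)"
    proof (intro mult_left_mono annuli_integral)
      fix m
      have "(\<integral>\<^sup>+x. ennreal \<bar>f x\<bar> * indicator (ball z (2 ^ m * \<rho>)) x \<partial>\<mu>) = (\<integral>\<^sup>+x. ennreal (\<bar>f x\<bar> * indicator (ball z (2 ^ m * \<rho>)) x) \<partial>\<mu>)"
        by (intro nn_integral_cong) (simp add: ennreal_mult ennreal_indicator)
      also have "\<dots> = ennreal (\<integral>x. \<bar>f x\<bar> * indicator (ball z (2 ^ m * \<rho>)) x \<partial>\<mu>)"
        by (intro nn_integral_eq_integral BB_integrable BB_intros f) auto
      finally show "(\<integral>\<^sup>+x. ennreal \<bar>f x\<bar> * indicator (ball z (2 ^ m * \<rho>)) x \<partial>\<mu>) \<le> ennreal (a * V z (2 ^ m * \<rho>))"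
        using avg[of m] by (simp add: ennreal_leI)
    qed (use \<open>0 < \<rho>\<close> \<open>0 \<le> a\<close> in auto)
    also have "\<dots> = ennreal (2 ^ \<kappa> * C\<epsilon> * a)"
      using C\<epsilon>_pos \<open>0 \<le> a\<close> by (simp add: ennreal_mult mult.assoc)
    finally show "\<bar>T f x - (\<integral>y. K z y * f y \<partial>\<mu>)\<bar> \<le> 2 ^ \<kappa> * C\<epsilon> * a"
      using C\<epsilon>_pos \<open>0 \<le> a\<close> by (subst (asm) ennreal_le_iff) auto
  qed
qed

text \<open>
  As \<open>b\<close> has mean value \<open>0\<close>, the kernel may be replaced by its difference to the value at the centre, and
  the smoothness in the second variable gives integrable decay away from the support.
\<close>

lemma cancellation_tail:
  assumes b: "b \<in> BB" and "0 < \<rho>" and supp: "\<And>y. b y \<noteq> 0 \<Longrightarrow> y \<in> ball z \<rho>" and mean: "(\<integral>y. b y \<partial>\<mu>) = 0"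
  shows "(\<integral>\<^sup>+x. ennreal \<bar>T b x\<bar> * indicator (- ball z (2 ^ \<kappa> * \<rho>)) x \<partial>\<mu>) \<le> ennreal (2 ^ \<kappa> * C\<epsilon> * (\<integral>y. \<bar>b y\<bar> \<partial>\<mu>))"
proof -
  define I where "I = (\<integral>y. \<bar>b y\<bar> \<partial>\<mu>)"
  have I: "0 \<le> I" by (simp add: I_def)
  have two: "2 \<le> (2::real) ^ \<kappa>" using power_increasing[OF \<kappa>_pos, of "2::real"] by simp
  then have two\<rho>: "2 * \<rho> \<le> 2 ^ \<kappa> * \<rho>" using \<open>0 < \<rho>\<close> by (intro mult_right_mono) auto
  have "AE x in \<mu>. ennreal \<bar>T b x\<bar> * indicator (- ball z (2 ^ \<kappa> * \<rho>)) x \<le>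
    ennreal (2 ^ \<kappa> * I) * (ennreal ((\<rho> / dist z x) powr \<epsilon> / V z (dist z x)) * 1 * indicator (- ball z \<rho>) x)"
    using T_representation[OF b \<open>0 < \<rho>\<close>]
  proof eventually_elim
    case (elim x)
    show ?case
    proof (cases "x \<in> ball z (2 ^ \<kappa> * \<rho>)")
      case False
      then have far: "2 ^ \<kappa> * \<rho> \<le> dist z x" by simp
      have notin: "x \<notin> ball z \<rho>" using far two\<rho> \<open>0 < \<rho>\<close> unfolding mem_ball by linarith
      have "0 < dist z x" using far two\<rho> \<open>0 < \<rho>\<close> by linarith
      then have xz: "x \<noteq> z" by auto
      have 0: "b y = 0" if "y \<in> ball x \<rho>" for y
      proof (rule ccontr)
        assume "b y \<noteq> 0"
        then have "dist z y < \<rho>" using supp by simp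
        then show False using that far two\<rho> dist_triangle[of z x y] by (simp add: dist_commute)
      qed
      have rep: "T b x = (\<integral>y. K x y * b y \<partial>\<mu>)" using elim 0 by blast
      have ix: "integrable \<mu> (\<lambda>y. K x y * b y)" by (rule BB_integrable[OF K_mult_BB(1)[OF b \<open>0 < \<rho>\<close> 0]])
      have ib: "integrable \<mu> b" by (rule BB_integrable[OF b])
      define k where "k = 2 ^ \<kappa> * ((\<rho> / dist z x) powr \<epsilon> / V z (dist z x))"
      have "T b x = (\<integral>y. K x y * b y - K x z * b y \<partial>\<mu>)"
        using ix ib mean by (simp add: rep)
      also have "norm (\<integral>y. K x y * b y - K x z * b y \<partial>\<mu>) \<le> (\<integral>y. k * \<bar>b y\<bar> \<partial>\<mu>)"
      proof (intro order_trans[OF integral_norm_bound] integral_mono)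
        fix y
        show "norm (K x y * b y - K x z * b y) \<le> k * \<bar>b y\<bar>"
        proof (cases "b y = 0")
          case False
          then have y: "dist z y < \<rho>" using supp[of y] by simp
          have "2 ^ \<kappa> * dist z y \<le> dist x z"
            using far mult_left_mono[OF less_imp_le[OF y] zero_le_power[of "2::real" \<kappa>]] unfolding dist_commute[of x z] by linarith
          then have "\<bar>K x z - K x y\<bar> \<le> 2 ^ \<kappa> * ((dist z y / dist x z) powr \<epsilon> / V z (dist x z))"
            by (rule K_reg2[OF xz])
          also have "\<dots> \<le> k" unfolding k_def dist_commute[of x z]
            using y \<epsilon>_pos by (intro mult_left_mono divide_right_mono powr_mono2) auto
          finally have "\<bar>K x z - K x y\<bar> * \<bar>b y\<bar> \<le> k * \<bar>b y\<bar>" by (rule mult_right_mono) simp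
          then show ?thesis by (simp add: abs_mult[symmetric] left_diff_distrib abs_minus_commute)
        qed simp
      qed (use ix ib in auto)
      also have "\<dots> = k * I" by (simp add: I_def)
      finally have "\<bar>T b x\<bar> \<le> k * I" by simp
      then have "ennreal \<bar>T b x\<bar> \<le> ennreal (k * I)" by (rule ennreal_leI)
      also have "\<dots> = ennreal (2 ^ \<kappa> * I * ((\<rho> / dist z x) powr \<epsilon> / V z (dist z x)))" by (simp add: k_def mult_ac)
      also have "\<dots> = ennreal (2 ^ \<kappa> * I) * ennreal ((\<rho> / dist z x) powr \<epsilon> / V z (dist z x))"
        using I by (intro ennreal_mult) auto
      finally show ?thesis using False notin by simp
    qed simp
  qed
  then have "(\<integral>\<^sup>+x. ennreal \<bar>T b x\<bar> * indicator (- ball z (2 ^ \<kappa> * \<rho>)) x \<partial>\<mu>) \<le>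
    (\<integral>\<^sup>+x. ennreal (2 ^ \<kappa> * I) * (ennreal ((\<rho> / dist z x) powr \<epsilon> / V z (dist z x)) * 1 * indicator (- ball z \<rho>) x) \<partial>\<mu>)"
    by (rule nn_integral_mono_AE)
  also have "\<dots> = ennreal (2 ^ \<kappa> * I) * (\<integral>\<^sup>+x. ennreal ((\<rho> / dist z x) powr \<epsilon> / V z (dist z x)) * 1 * indicator (- ball z \<rho>) x \<partial>\<mu>)"
    by (rule nn_integral_cmult) measurable
  also have "\<dots> \<le> ennreal (2 ^ \<kappa> * I) * ennreal (C\<epsilon> * 1)"
  proof (intro mult_left_mono annuli_integral)
    show "(\<integral>\<^sup>+x. 1 * indicator (ball z (2 ^ m * \<rho>)) x \<partial>\<mu>) \<le> ennreal (1 * V z (2 ^ m * \<rho>))" for m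
      using ball_finite[of z "2 ^ m * \<rho>"] by (simp add: sets_M emeasure_eq_ennreal_measure less_top)
  qed (use \<open>0 < \<rho>\<close> in auto)
  also have "\<dots> = ennreal (2 ^ \<kappa> * C\<epsilon> * I)"
    using C\<epsilon>_pos I by (simp add: ennreal_mult[symmetric] mult_ac)
  finally show ?thesis by (simp add: I_def)
qed

end

section \<open>Weak type (1,1) of the operator\<close>

context borel_ball_finite begin

lemma measure_le_AE:
  assumes "AE x in M. x \<in> A \<longrightarrow> x \<in> B" "A \<in> sets borel" "B \<in> fmeasurable M"
  shows "measure M A \<le> measure M B"
proof -
  have "emeasure M A \<le> emeasure M B"
    using assms by (intro emeasure_mono_AE) (auto simp: fmeasurable_def)
  moreover have "emeasure M B < \<infinity>" using assms(3) by (simp add: fmeasurable_def)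
  ultimately show ?thesis unfolding measure_def by (intro enn2real_mono) auto
qed

lemma integral_indicator_mono:
  assumes "f \<in> BB" "A \<subseteq> C" "A \<in> sets borel" "C \<in> sets borel"
  shows "(\<integral>x. \<bar>f x\<bar> * indicator A x \<partial>M) \<le> (\<integral>x. \<bar>f x\<bar> * indicator C x \<partial>M)"
  by (intro integral_mono BB_integrable BB_intros assms) (use assms in \<open>auto simp: indicator_def\<close>)

lemma integral_indicator_le:
  assumes "f \<in> BB" "A \<in> sets borel"
  shows "(\<integral>x. \<bar>f x\<bar> * indicator A x \<partial>M) \<le> (\<integral>x. \<bar>f x\<bar> \<partial>M)"
  by (intro integral_mono BB_integrable BB_intros assms) (auto simp: indicator_def)

lemma integral_indicator_nonneg: "0 \<le> (\<integral>x. \<bar>f x :: real\<bar> * indicator A x \<partial>M)"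
  by (intro Bochner_Integration.integral_nonneg) (auto simp: indicator_def)

lemma bounded_fmeasurable: "A \<in> sets borel \<Longrightarrow> bounded A \<Longrightarrow> A \<in> fmeasurable M"
  using bounded_finite by (auto simp: fmeasurable_def sets_M)

lemma sum_integrals_disjoint:
  assumes f: "f \<in> BB" and P: "finite P" "disjoint_family_on Q P" "\<And>p. p \<in> P \<Longrightarrow> Q p \<in> sets borel"
  shows "(\<Sum>p\<in>P. \<integral>x. \<bar>f x\<bar> * indicator (Q p) x \<partial>M) = (\<integral>x. \<bar>f x\<bar> * indicator (\<Union>p\<in>P. Q p) x \<partial>M)"
proof -
  have "(\<Sum>p\<in>P. \<integral>x. \<bar>f x\<bar> * indicator (Q p) x \<partial>M) = (\<integral>x. (\<Sum>p\<in>P. \<bar>f x\<bar> * indicator (Q p) x) \<partial>M)"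
    by (intro Bochner_Integration.integral_sum[symmetric] BB_integrable BB_intros f P)
  also have "\<dots> = (\<integral>x. \<bar>f x\<bar> * indicator (\<Union>p\<in>P. Q p) x \<partial>M)"
    by (subst indicator_UN_disjoint[OF P(1,2)]) (simp add: sum_distrib_left)
  finally show ?thesis .
qed

end

lemma sum_indicator_disjoint:
  assumes "finite A" "disjoint_family_on Q A" "p \<in> A" "x \<in> Q p"
  shows "(\<Sum>q\<in>A. F q * indicator (Q q) x) = (F p :: real)"
proof -
  have "x \<notin> Q q" if "q \<in> A - {p}" for q
    using that assms unfolding disjoint_family_on_def by blast
  then show ?thesis using assms by (subst sum.remove[of A p]) auto
qed

context cz_operator begin

text \<open>
  The three summands come from the good part, the exceptional set and the bad part of the
  Calderon-Zygmund decomposition.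
\<close>

definition weak_const :: real where "weak_const = 9 * B * D ^ 8 + D ^ (\<kappa> + 3) + 6 * 2 ^ \<kappa> * C\<epsilon>"

lemma weak_const_ge1: "1 \<le> weak_const"
  unfolding weak_const_def using D_pow_ge1[of "\<kappa> + 3"] B_nonneg D_ge1 C\<epsilon>_pos by (simp add: add_increasing add_increasing2)

end

locale cz_grid = cz_operator \<mu> D K T \<kappa> \<epsilon> B + grid \<mu> D s x0
  for \<mu> :: "'a::metric_space measure" and D K T \<kappa> \<epsilon> B s x0
begin

text \<open>
  The Calderon-Zygmund decomposition of \<open>h\<close> at height \<open>t\<close> on the grid. The cubes of level \<open>0\<close> at
  which the stopping time ends without success need not have small oscillation in general, but
  \<open>h\<close> is Lipschitz, so that on them \<open>h\<close> differs from its average by at most \<open>4 * L * s\<close>. This produces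
  the second summand on the right, which disappears as \<open>s\<close> tends to \<open>0\<close>.
\<close>

lemma weak_type_on_grid:
  assumes h: "h \<in> BB" and "0 \<le> L" and hL: "\<And>x y. \<bar>h x - h y\<bar> \<le> L * dist x y" and t: "0 < t"
    and supp: "\<And>x. h x \<noteq> 0 \<Longrightarrow> x \<in> cube J x0"
    and small: "(\<integral>x. \<bar>h x\<bar> \<partial>\<mu>) \<le> t * measure \<mu> (cube J x0)"
  shows "t * measure \<mu> {x. t < \<bar>T h x\<bar>} \<le> weak_const * (\<integral>x. \<bar>h x\<bar> \<partial>\<mu>) + 144 * B * (L * s)\<^sup>2 / t * measure \<mu> (cube J x0)"
proof -
  define bad where "bad i y \<longleftrightarrow> t * measure \<mu> (cube i y) < (\<integral>x. \<bar>h x\<bar> * indicator (cube i y) x \<partial>\<mu>)" for i y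
  have root: "\<not> bad J x0"
    unfolding bad_def using integral_indicator_le[OF h cube_measurable, of J x0] small by linarith
  obtain P where finP: "finite P" and P0: "disjoint_family_on (\<lambda>(i, y). cube i y) P"
    "(\<Union>(i, y)\<in>P. cube i y) = cube J x0"
    "\<forall>(i, y)\<in>P. i \<le> J \<and> y \<in> net i \<and> (i < J \<and> bad i y \<and> \<not> bad (Suc i) (parent i y) \<or> i = 0 \<and> \<not> bad 0 y)"
    using stopping_cubes[where bad = bad, OF net(1) root] by (elim exE conjE) (rule that)
  define Q where "Q p = cube (fst p) (snd p)" for p
  have dj: "disjoint_family_on Q P" and un: "(\<Union>p\<in>P. Q p) = cube J x0"
    using P0(1,2) by (auto simp: Q_def[abs_def] case_prod_unfold)
  have Pnet: "snd p \<in> net (fst p)" if "p \<in> P" for p using P0(3) that by (auto simp: case_prod_unfold)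
  have Pcases: "bad (fst p) (snd p) \<and> \<not> bad (Suc (fst p)) (parent (fst p) (snd p)) \<or> fst p = 0 \<and> \<not> bad (fst p) (snd p)"
    if "p \<in> P" for p using P0(3) that by (auto simp: case_prod_unfold)
  have Qs [measurable]: "Q p \<in> sets borel" for p unfolding Q_def by measurable
  have Qb: "bounded (Q p)" for p unfolding Q_def by (rule cube_bounded)
  have Qpos: "0 < measure \<mu> (Q p)" if "p \<in> P" for p unfolding Q_def by (rule cube_pos[OF Pnet[OF that]])
  define I where "I p = (\<integral>x. \<bar>h x\<bar> * indicator (Q p) x \<partial>\<mu>)" for p
  define m where "m p = (\<integral>x. h x * indicator (Q p) x \<partial>\<mu>) / measure \<mu> (Q p)" for p
  define t' where "t' = D ^ 8 * t"
  have t': "t \<le> t'" "0 < t'"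
    using D_pow_ge1[of 8] t less_le_trans[OF zero_less_one D_pow_ge1[of 8]] by (auto simp: t'_def)
  have m_eq: "m p * measure \<mu> (Q p) = (\<integral>x. h x * indicator (Q p) x \<partial>\<mu>)" if "p \<in> P" for p
    using Qpos[OF that] by (simp add: m_def)
  have mI: "\<bar>m p\<bar> * measure \<mu> (Q p) \<le> I p" if "p \<in> P" for p
  proof -
    have "\<bar>m p\<bar> * measure \<mu> (Q p) = \<bar>\<integral>x. h x * indicator (Q p) x \<partial>\<mu>\<bar>"
      using m_eq[OF that] Qpos[OF that] by (simp add: abs_mult flip: m_eq[OF that])
    also have "\<dots> \<le> (\<integral>x. \<bar>h x * indicator (Q p) x\<bar> \<partial>\<mu>)" by (rule integral_abs_bound)
    also have "\<dots> = I p" by (simp add: I_def abs_mult)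
    finally show ?thesis .
  qed
  have It: "I p \<le> t' * measure \<mu> (Q p)" if p: "p \<in> P" for p
    using Pcases[OF p]
  proof
    assume "bad (fst p) (snd p) \<and> \<not> bad (Suc (fst p)) (parent (fst p) (snd p))"
    then have nb: "\<not> bad (Suc (fst p)) (parent (fst p) (snd p))" by simp
    have "I p \<le> (\<integral>x. \<bar>h x\<bar> * indicator (cube (Suc (fst p)) (parent (fst p) (snd p))) x \<partial>\<mu>)"
      unfolding I_def Q_def by (intro integral_indicator_mono h child_subset Pnet p cube_measurable)
    also have "\<dots> \<le> t * measure \<mu> (cube (Suc (fst p)) (parent (fst p) (snd p)))"
      using nb unfolding bad_def not_less .
    also have "\<dots> \<le> t * (D ^ 8 * measure \<mu> (Q p))"
      unfolding Q_def using t by (intro mult_left_mono measure_parent Pnet p) auto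
    finally show ?thesis by (simp add: t'_def mult_ac)
  next
    assume "fst p = 0 \<and> \<not> bad (fst p) (snd p)"
    then have "\<not> bad (fst p) (snd p)" by (rule conjunct2)
    then have "I p \<le> t * measure \<mu> (Q p)" unfolding bad_def I_def Q_def not_less .
    also have "\<dots> \<le> t' * measure \<mu> (Q p)" using t' by (intro mult_right_mono) auto
    finally show ?thesis .
  qed
  have mt: "\<bar>m p\<bar> \<le> t'" if "p \<in> P" for p
    using order_trans[OF mI[OF that] It[OF that]] Qpos[OF that] by simp
  define S where "S = (\<integral>x. \<bar>h x\<bar> \<partial>\<mu>)"
  have sum_I: "(\<Sum>p\<in>A. I p) \<le> S" if "A \<subseteq> P" for A
  proof -
    have "(\<Sum>p\<in>A. I p) \<le> (\<Sum>p\<in>P. I p)"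
      by (intro sum_mono2 finP that) (auto simp: I_def intro: integral_indicator_nonneg)
    also have "\<dots> = (\<integral>x. \<bar>h x\<bar> * indicator (\<Union>p\<in>P. Q p) x \<partial>\<mu>)"
      unfolding I_def by (rule sum_integrals_disjoint[OF h finP dj Qs])
    also have "\<dots> \<le> S" unfolding S_def un by (rule integral_indicator_le[OF h cube_measurable])
    finally show ?thesis .
  qed
  have S0: "0 \<le> S" by (simp add: S_def)
  define b where "b p x = (h x - m p) * indicator (Q p) x" for p x
  define Pb where "Pb = {p \<in> P. bad (fst p) (snd p)}"
  have PbP: "Pb \<subseteq> P" "finite Pb" using finP by (auto simp: Pb_def)
  define g where "g x = (\<Sum>p\<in>P. m p * indicator (Q p) x)" for x
  define b1 where "b1 x = (\<Sum>p\<in>Pb. b p x)" for x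
  define b0 where "b0 x = (\<Sum>p\<in>P - Pb. b p x)" for x
  have bBB: "b p \<in> BB" for p
  proof -
    have "(\<lambda>x. h x * indicator (Q p) x - m p * indicator (Q p) x) \<in> BB" by (intro BB_intros h Qs Qb)
    then show ?thesis by (simp add: b_def[abs_def] left_diff_distrib)
  qed
  have gBB: "g \<in> BB" unfolding g_def[abs_def] by (intro BB_intros Qs Qb)
  have b1BB: "b1 \<in> BB" unfolding b1_def[abs_def] by (intro BB_sum bBB)
  have b0BB: "b0 \<in> BB" unfolding b0_def[abs_def] by (intro BB_sum bBB)
  have dec: "h x = g x + (b1 x + b0 x)" for x
  proof -
    have "b1 x + b0 x = (\<Sum>p\<in>P. b p x)"
      unfolding b1_def b0_def using sum.subset_diff[OF PbP(1) finP, of "\<lambda>p. b p x"] by simp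
    then have "g x + (b1 x + b0 x) = (\<Sum>p\<in>P. h x * indicator (Q p) x)"
      unfolding g_def b_def by (simp add: sum.distrib[symmetric] distrib_right[symmetric])
    also have "\<dots> = h x * indicator (\<Union>p\<in>P. Q p) x"
      by (subst indicator_UN_disjoint[OF finP dj]) (simp add: sum_distrib_left)
    also have "\<dots> = h x" unfolding un using supp[of x] by (cases "h x = 0") auto
    finally show ?thesis by simp
  qed
  have Qex: "\<exists>p\<in>P. x \<in> Q p" if "x \<in> cube J x0" for x using un that by blast
  have Qout: "indicator (Q p) x = (0::real)" if "p \<in> P" "x \<notin> cube J x0" for p x using un that by auto
  \<comment> \<open>the averages \<open>m p\<close> are bounded by \<open>t'\<close>, so the \<open>L\<^sup>2\<close> bound of \<open>T\<close> handles \<open>g\<close>\<close>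
  have g2: "(g x)\<^sup>2 \<le> t' * (\<Sum>p\<in>P. \<bar>m p\<bar> * indicator (Q p) x)" for x
  proof (cases "x \<in> cube J x0")
    case True
    then obtain p where p: "p \<in> P" "x \<in> Q p" using Qex by blast
    have "(m p)\<^sup>2 = \<bar>m p\<bar> * \<bar>m p\<bar>" by (simp add: power2_eq_square)
    also have "\<dots> \<le> t' * \<bar>m p\<bar>" by (intro mult_right_mono mt p) auto
    finally show ?thesis unfolding g_def using sum_indicator_disjoint[OF finP dj p] by simp
  next
    case False then show ?thesis using Qout by (simp add: g_def)
  qed
  have intg: "(\<integral>x. (g x)\<^sup>2 \<partial>\<mu>) \<le> t' * S"
  proof -
    have "(\<integral>x. (g x)\<^sup>2 \<partial>\<mu>) \<le> (\<integral>x. t' * (\<Sum>p\<in>P. \<bar>m p\<bar> * indicator (Q p) x) \<partial>\<mu>)"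
    proof (intro integral_mono g2)
      show "integrable \<mu> (\<lambda>x. (g x)\<^sup>2)" using BB_L2[OF gBB] by (simp add: L2_def)
    qed (intro BB_integrable BB_intros Qs Qb)
    also have "\<dots> = t' * (\<Sum>p\<in>P. \<bar>m p\<bar> * measure \<mu> (Q p))"
      by (simp, subst Bochner_Integration.integral_sum) (auto intro!: BB_integrable BB_intros Qs Qb)
    also have "\<dots> \<le> t' * (\<Sum>p\<in>P. I p)" using t' by (intro mult_left_mono sum_mono mI) auto
    also have "\<dots> \<le> t' * S" using t' sum_I[of P] by simp
    finally show ?thesis .
  qed
  define Ag where "Ag = {x. t / 3 < \<bar>T g x\<bar>}"
  have t3: "0 < t / 3" using t by simp
  have Ag: "Ag \<in> fmeasurable \<mu>" "t * measure \<mu> Ag \<le> 9 * B * D ^ 8 * S"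
  proof -
    show "Ag \<in> fmeasurable \<mu>" unfolding Ag_def by (rule level_set[OF gBB t3])
    have "(t / 3)\<^sup>2 * measure \<mu> Ag \<le> B * (t' * S)"
      unfolding Ag_def using level_set(2)[OF gBB t3] mult_left_mono[OF intg B_nonneg] by linarith
    then have "t * (t * measure \<mu> Ag) \<le> t * (9 * B * D ^ 8 * S)"
      by (simp add: t'_def power2_eq_square field_simps)
    then show "t * measure \<mu> Ag \<le> 9 * B * D ^ 8 * S" using t by simp
  qed
  \<comment> \<open>on the cubes of level \<open>0\<close> the Lipschitz condition makes \<open>b0\<close> uniformly small\<close>
  have b0le: "\<bar>b0 x\<bar> \<le> 4 * (L * s) * indicator (cube J x0) x" for x
  proof (cases "\<exists>p\<in>P - Pb. x \<in> Q p")
    case True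
    then obtain p where p: "p \<in> P - Pb" "x \<in> Q p" by blast
    then have p0: "fst p = 0" using Pcases[of p] by (auto simp: Pb_def)
    have pP: "p \<in> P" using p by auto
    have "b0 x = h x - m p"
      unfolding b0_def b_def
    proof (rule sum_indicator_disjoint[where F = "\<lambda>q. h x - m q" and Q = Q])
      show "disjoint_family_on Q (P - Pb)" by (rule disjoint_family_on_mono[OF _ dj]) auto
    qed (use finP p in auto)
    moreover have "\<bar>h x - m p\<bar> * measure \<mu> (Q p) \<le> (4 * (L * s)) * measure \<mu> (Q p)"
    proof -
      have "\<bar>h x - m p\<bar> * measure \<mu> (Q p) = \<bar>(h x - m p) * measure \<mu> (Q p)\<bar>" by (simp add: abs_mult)
      also have "(h x - m p) * measure \<mu> (Q p) = (\<integral>y. h x * indicator (Q p) y - h y * indicator (Q p) y \<partial>\<mu>)"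
        by (subst Bochner_Integration.integral_diff)
          (auto intro!: BB_integrable BB_intros Qs Qb h simp: left_diff_distrib m_eq[OF pP])
      also have "\<bar>\<dots>\<bar> \<le> (\<integral>y. \<bar>h x * indicator (Q p) y - h y * indicator (Q p) y\<bar> \<partial>\<mu>)"
        by (rule integral_abs_bound)
      also have "\<dots> \<le> (\<integral>y. 4 * (L * s) * indicator (Q p) y \<partial>\<mu>)"
      proof (intro integral_mono BB_integrable BB_intros Qs Qb h)
        fix y
        show "\<bar>h x * indicator (Q p) y - h y * indicator (Q p) y\<bar> \<le> 4 * (L * s) * indicator (Q p) y"
        proof (cases "y \<in> Q p")
          case True
          have "Q p \<subseteq> ball (snd p) (2 * s)" using cube_ball[of 0 "snd p"] by (simp add: Q_def p0 rad_def)
          then have "dist (snd p) x < 2 * s" "dist (snd p) y < 2 * s" using p(2) True by auto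
          then have "dist x y \<le> 4 * s" using dist_triangle3[of x y "snd p"] by linarith
          then have "\<bar>h x - h y\<bar> \<le> L * (4 * s)" using hL[of x y] \<open>0 \<le> L\<close> by (meson mult_left_mono order_trans)
          then show ?thesis using True by simp
        qed simp
      qed
      also have "\<dots> = (4 * (L * s)) * measure \<mu> (Q p)" by simp
      finally show ?thesis .
    qed
    ultimately have "\<bar>b0 x\<bar> \<le> 4 * (L * s)" using Qpos[OF pP] by simp
    moreover have "x \<in> cube J x0" using p un by blast
    ultimately show ?thesis by simp
  next
    case False
    then have "b0 x = 0" unfolding b0_def b_def by (intro sum.neutral) auto
    then show ?thesis using \<open>0 \<le> L\<close> s_pos by (simp add: indicator_def)
  qed
  define A0 where "A0 = {x. t / 3 < \<bar>T b0 x\<bar>}"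
  define M where "M = measure \<mu> (cube J x0)"
  have A0: "A0 \<in> fmeasurable \<mu>" "t * measure \<mu> A0 \<le> 144 * B * (L * s)\<^sup>2 / t * M"
  proof -
    show "A0 \<in> fmeasurable \<mu>" unfolding A0_def by (rule level_set[OF b0BB t3])
    have "(\<integral>x. (b0 x)\<^sup>2 \<partial>\<mu>) \<le> (\<integral>x. (4 * (L * s))\<^sup>2 * indicator (cube J x0) x \<partial>\<mu>)"
    proof (rule integral_mono)
      show "integrable \<mu> (\<lambda>x. (b0 x)\<^sup>2)" using BB_L2[OF b0BB] by (simp add: L2_def)
      show "integrable \<mu> (\<lambda>x. (4 * (L * s))\<^sup>2 * indicator (cube J x0) x)"
        by (intro BB_integrable BB_intros cube_measurable cube_bounded)
      show "(b0 x)\<^sup>2 \<le> (4 * (L * s))\<^sup>2 * indicator (cube J x0) x" for x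
        using power_mono[OF b0le[of x], of 2] by (cases "x \<in> cube J x0") auto
    qed
    also have "\<dots> = 16 * (L * s)\<^sup>2 * M" by (simp add: M_def power2_eq_square)
    finally have "(t / 3)\<^sup>2 * measure \<mu> A0 \<le> B * (16 * (L * s)\<^sup>2 * M)"
      unfolding A0_def using level_set(2)[OF b0BB t3] mult_left_mono[OF _ B_nonneg] by (meson order_trans)
    then have "t * (t * measure \<mu> A0) \<le> t * (144 * B * (L * s)\<^sup>2 / t * M)"
      using t by (simp add: power2_eq_square field_simps)
    then show "t * measure \<mu> A0 \<le> 144 * B * (L * s)\<^sup>2 / t * M" by (simp only: mult_le_cancel_left_pos[OF t])
  qed
  \<comment> \<open>the dilates of the bad cubes, outside of which the cancellation of \<open>b p\<close> is effective\<close>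
  define bl where "bl p = ball (snd p) (2 ^ \<kappa> * (2 * rad (fst p)))" for p :: "nat \<times> 'a"
  define U where "U = (\<Union>p\<in>Pb. bl p)"
  have [measurable]: "bl p \<in> sets borel" for p unfolding bl_def by auto
  have U: "U \<in> fmeasurable \<mu>"
    unfolding U_def bl_def using PbP by (intro bounded_fmeasurable) (auto intro!: bounded_UN borel_open open_UN)
  have mU: "t * measure \<mu> U \<le> D ^ (\<kappa> + 3) * S"
  proof -
    have "measure \<mu> U \<le> (\<Sum>p\<in>Pb. measure \<mu> (bl p))"
      unfolding U_def by (rule measure_UNION_le[OF PbP(2)]) (simp add: sets_M)
    also have "\<dots> \<le> (\<Sum>p\<in>Pb. D ^ (\<kappa> + 3) * measure \<mu> (Q p))"
    proof (rule sum_mono)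
      fix p assume "p \<in> Pb"
      then have "snd p \<in> net (fst p)" using Pnet PbP by blast
      from V_cube[OF this, of "\<kappa> + 1"] show "measure \<mu> (bl p) \<le> D ^ (\<kappa> + 3) * measure \<mu> (Q p)"
        by (simp add: bl_def Q_def mult_ac numeral_eq_Suc)
    qed
    finally have "t * measure \<mu> U \<le> t * (\<Sum>p\<in>Pb. D ^ (\<kappa> + 3) * measure \<mu> (Q p))" using t by simp
    also have "\<dots> = D ^ (\<kappa> + 3) * (\<Sum>p\<in>Pb. t * measure \<mu> (Q p))" by (simp add: sum_distrib_left mult_ac)
    also have "\<dots> \<le> D ^ (\<kappa> + 3) * (\<Sum>p\<in>Pb. I p)"
      using D_ge1 by (intro mult_left_mono sum_mono) (auto simp: Pb_def bad_def I_def Q_def)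
    also have "\<dots> \<le> D ^ (\<kappa> + 3) * S" using sum_I[OF PbP(1)] D_ge1 by (intro mult_left_mono) auto
    finally show ?thesis .
  qed
  define A1 where "A1 = {x. t / 3 < \<bar>T b1 x\<bar>} - U"
  have A1f: "A1 \<in> fmeasurable \<mu>"
    unfolding A1_def by (intro fmeasurable.Diff U level_set(1)[OF b1BB t3])
  have b1abs: "(\<integral>x. \<bar>b p x\<bar> \<partial>\<mu>) \<le> 2 * I p" if p: "p \<in> P" for p
  proof -
    have "(\<integral>x. \<bar>b p x\<bar> \<partial>\<mu>) \<le> (\<integral>x. \<bar>h x\<bar> * indicator (Q p) x + \<bar>m p\<bar> * indicator (Q p) x \<partial>\<mu>)"
      by (intro integral_mono BB_integrable BB_intros Qs Qb h bBB) (auto simp: b_def indicator_def)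
    also have "\<dots> = I p + \<bar>m p\<bar> * measure \<mu> (Q p)"
      by (subst Bochner_Integration.integral_add) (auto intro!: BB_integrable BB_intros Qs Qb h simp: I_def)
    also have "\<dots> \<le> 2 * I p" using mI[OF p] by simp
    finally show ?thesis .
  qed
  have mean0: "(\<integral>x. b p x \<partial>\<mu>) = 0" if p: "p \<in> P" for p
  proof -
    have "(\<integral>x. b p x \<partial>\<mu>) = (\<integral>x. h x * indicator (Q p) x - m p * indicator (Q p) x \<partial>\<mu>)"
      by (simp add: b_def left_diff_distrib)
    also have "\<dots> = 0"
      by (subst Bochner_Integration.integral_diff) (auto intro!: BB_integrable BB_intros Qs Qb h simp: m_eq[OF p, symmetric])
    finally show ?thesis .
  qed
  have mA1: "t * measure \<mu> A1 \<le> 6 * 2 ^ \<kappa> * C\<epsilon> * S"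
  proof -
    have AEb1: "AE x in \<mu>. T b1 x = (\<Sum>p\<in>Pb. T (b p) x)"
      unfolding b1_def[abs_def] by (rule T_sum[OF PbP(2) bBB])
    have [measurable]: "A1 \<in> sets \<mu>" using A1f by auto
    have "ennreal (t / 3) * emeasure \<mu> A1 = (\<integral>\<^sup>+x. ennreal (t / 3) * indicator A1 x \<partial>\<mu>)"
      by (simp add: nn_integral_cmult_indicator)
    also have "\<dots> \<le> (\<integral>\<^sup>+x. (\<Sum>p\<in>Pb. ennreal \<bar>T (b p) x\<bar> * indicator (- bl p) x) \<partial>\<mu>)"
    proof (rule nn_integral_mono_AE)
      show "AE x in \<mu>. ennreal (t / 3) * indicator A1 x \<le> (\<Sum>p\<in>Pb. ennreal \<bar>T (b p) x\<bar> * indicator (- bl p) x)"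
        using AEb1
      proof eventually_elim
        case (elim x)
        show ?case
        proof (cases "x \<in> A1")
          case True
          then have x: "t / 3 < \<bar>T b1 x\<bar>" "\<And>p. p \<in> Pb \<Longrightarrow> x \<notin> bl p" by (auto simp: A1_def U_def)
          have "t / 3 \<le> (\<Sum>p\<in>Pb. \<bar>T (b p) x\<bar>)"
            using x(1) sum_abs[of "\<lambda>p. T (b p) x" Pb] unfolding elim by linarith
          then have "ennreal (t / 3) \<le> ennreal (\<Sum>p\<in>Pb. \<bar>T (b p) x\<bar>)" by (rule ennreal_leI)
          also have "\<dots> = (\<Sum>p\<in>Pb. ennreal \<bar>T (b p) x\<bar>)" by (simp add: sum_ennreal)
          also have "\<dots> = (\<Sum>p\<in>Pb. ennreal \<bar>T (b p) x\<bar> * indicator (- bl p) x)" using x(2) by (intro sum.cong) auto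
          finally show ?thesis using True by simp
        qed simp
      qed
    qed
    also have "\<dots> = (\<Sum>p\<in>Pb. \<integral>\<^sup>+x. ennreal \<bar>T (b p) x\<bar> * indicator (- bl p) x \<partial>\<mu>)"
    proof (rule nn_integral_sum)
      fix p
      have [measurable]: "T (b p) \<in> borel_measurable borel" by (rule T_measurable[OF bBB])
      show "(\<lambda>x. ennreal \<bar>T (b p) x\<bar> * indicator (- bl p) x) \<in> borel_measurable \<mu>" by measurable
    qed
    also have "\<dots> \<le> (\<Sum>p\<in>Pb. ennreal (2 ^ \<kappa> * C\<epsilon> * (2 * I p)))"
    proof (rule sum_mono)
      fix p assume "p \<in> Pb"
      then have p: "p \<in> P" using PbP by blast
      have "(\<integral>\<^sup>+x. ennreal \<bar>T (b p) x\<bar> * indicator (- bl p) x \<partial>\<mu>) \<le> ennreal (2 ^ \<kappa> * C\<epsilon> * (\<integral>y. \<bar>b p y\<bar> \<partial>\<mu>))"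
        unfolding bl_def
      proof (rule cancellation_tail[OF bBB _ _ mean0[OF p]])
        show "0 < 2 * rad (fst p)" using rad_pos by simp
        show "y \<in> ball (snd p) (2 * rad (fst p))" if "b p y \<noteq> 0" for y
          using that cube_ball[of "fst p" "snd p"] unfolding b_def Q_def by (cases "y \<in> cube (fst p) (snd p)") auto
      qed
      also have "\<dots> \<le> ennreal (2 ^ \<kappa> * C\<epsilon> * (2 * I p))"
        using b1abs[OF p] C\<epsilon>_pos by (intro ennreal_leI mult_left_mono) auto
      finally show "(\<integral>\<^sup>+x. ennreal \<bar>T (b p) x\<bar> * indicator (- bl p) x \<partial>\<mu>) \<le> ennreal (2 ^ \<kappa> * C\<epsilon> * (2 * I p))" .
    qed
    also have "\<dots> = ennreal (\<Sum>p\<in>Pb. 2 ^ \<kappa> * C\<epsilon> * (2 * I p))"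
      using C\<epsilon>_pos by (intro sum_ennreal) (auto simp: I_def intro!: mult_nonneg_nonneg integral_indicator_nonneg)
    also have "(\<Sum>p\<in>Pb. 2 ^ \<kappa> * C\<epsilon> * (2 * I p)) = 2 ^ \<kappa> * C\<epsilon> * (2 * (\<Sum>p\<in>Pb. I p))"
      by (simp add: sum_distrib_left)
    also have "ennreal \<dots> \<le> ennreal (2 ^ \<kappa> * C\<epsilon> * (2 * S))"
      using sum_I[OF PbP(1)] C\<epsilon>_pos by (intro ennreal_leI mult_left_mono) auto
    finally have "ennreal (t / 3) * emeasure \<mu> A1 \<le> ennreal (2 ^ \<kappa> * C\<epsilon> * (2 * S))" .
    moreover have "emeasure \<mu> A1 = ennreal (measure \<mu> A1)"
      using A1f by (simp add: emeasure_eq_measure2)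
    ultimately have "ennreal (t / 3 * measure \<mu> A1) \<le> ennreal (2 ^ \<kappa> * C\<epsilon> * (2 * S))"
      using t by (subst ennreal_mult) auto
    then have "t / 3 * measure \<mu> A1 \<le> 2 ^ \<kappa> * C\<epsilon> * (2 * S)"
      using C\<epsilon>_pos S0 by (subst (asm) ennreal_le_iff) auto
    then show ?thesis by simp
  qed
  have "AE x in \<mu>. T h x = T g x + (T b1 x + T b0 x)"
  proof -
    have "AE x in \<mu>. T (\<lambda>y. g y + (b1 y + b0 y)) x = T g x + T (\<lambda>y. b1 y + b0 y) x"
      by (intro T_add gBB BB_add b1BB b0BB)
    moreover have "AE x in \<mu>. T (\<lambda>y. b1 y + b0 y) x = T b1 x + T b0 x" by (intro T_add b1BB b0BB)
    moreover have "h = (\<lambda>y. g y + (b1 y + b0 y))" using dec by auto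
    ultimately show ?thesis by auto
  qed
  then have AEsub: "AE x in \<mu>. x \<in> {x. t < \<bar>T h x\<bar>} \<longrightarrow> x \<in> (Ag \<union> A0) \<union> (U \<union> A1)"
    by eventually_elim (auto simp: Ag_def A0_def A1_def)
  have [measurable]: "T h \<in> borel_measurable borel" by (rule T_measurable[OF h])
  have "measure \<mu> {x. t < \<bar>T h x\<bar>} \<le> measure \<mu> ((Ag \<union> A0) \<union> (U \<union> A1))"
    by (rule measure_le_AE[OF AEsub]) (measurable, intro fmeasurable.Un Ag A0 U A1f)
  also have "\<dots> \<le> measure \<mu> (Ag \<union> A0) + measure \<mu> (U \<union> A1)"
    using Ag A0 U A1f by (intro measure_Un_le) auto
  also have "\<dots> \<le> (measure \<mu> Ag + measure \<mu> A0) + (measure \<mu> U + measure \<mu> A1)"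
    using Ag A0 U A1f by (intro add_mono measure_Un_le) auto
  finally have "t * measure \<mu> {x. t < \<bar>T h x\<bar>} \<le> t * ((measure \<mu> Ag + measure \<mu> A0) + (measure \<mu> U + measure \<mu> A1))"
    using t by simp
  also have "\<dots> = t * measure \<mu> Ag + t * measure \<mu> A0 + (t * measure \<mu> U + t * measure \<mu> A1)"
    by (simp add: distrib_left)
  also have "\<dots> \<le> 9 * B * D ^ 8 * S + 144 * B * (L * s)\<^sup>2 / t * M + (D ^ (\<kappa> + 3) * S + 6 * 2 ^ \<kappa> * C\<epsilon> * S)"
    by (intro add_mono Ag A0 mU mA1)
  also have "\<dots> = weak_const * S + 144 * B * (L * s)\<^sup>2 / t * M" by (simp add: weak_const_def distrib_right)
  finally show ?thesis by (simp add: S_def M_def)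
qed

end

context cz_operator begin

text \<open>
  If some cube around the support is so large that the average of \<open>|h|\<close> over it is at most \<open>t\<close>, the grids
  with finest scale \<open>R / 16 ^ n\<close> and top scale \<open>R\<close> are used and \<open>n\<close> tends to infinity. Otherwise
  \<open>t\<close> times the measure of every large ball is at most the \<open>L\<^sup>1\<close> norm of \<open>h\<close>; then the whole space
  has finite measure and the claim is trivial.
\<close>

lemma weak_type_Lipschitz:
  assumes h: "h \<in> BB" "lip h" and t: "0 < t"
  shows "t * measure \<mu> {x. t < \<bar>T h x\<bar>} \<le> weak_const * (\<integral>x. \<bar>h x\<bar> \<partial>\<mu>)"
proof -
  obtain L where L: "0 \<le> L" "\<And>x y. \<bar>h x - h y\<bar> \<le> L * dist x y" using lipE[OF h(2)] by metis
  obtain x0 :: 'a where True by blast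
  obtain c r where r: "c > 0" "0 < r" "\<And>x. \<bar>h x\<bar> \<le> c" "\<And>x. h x \<noteq> 0 \<Longrightarrow> x \<in> ball x0 r"
    using BB_E[OF h(1), of x0] by metis
  define S where "S = (\<integral>x. \<bar>h x\<bar> \<partial>\<mu>)"
  have S0: "0 \<le> S" by (simp add: S_def)
  define A where "A = {x. t < \<bar>T h x\<bar>}"
  have A: "A \<in> fmeasurable \<mu>" unfolding A_def by (rule level_set[OF h(1) t])
  have "t * measure \<mu> A \<le> weak_const * S"
  proof (cases "\<exists>R>0. r \<le> R / 4 \<and> S \<le> t * V x0 (R / 4)")
    case True
    then obtain R where R: "0 < R" "r \<le> R / 4" "S \<le> t * V x0 (R / 4)" by blast
    define k where "k = 144 * B / t * L\<^sup>2 * R\<^sup>2 * V x0 (2 * R)"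
    have le: "t * measure \<mu> A \<le> weak_const * S + k * inverse (256 ^ n)" for n
    proof -
      interpret cz_grid \<mu> D K T \<kappa> \<epsilon> B "R / 16 ^ n" x0
        by unfold_locales (use R in simp)
      have rad: "rad n = R" by (simp add: rad_def)
      have sub: "ball x0 (R / 4) \<subseteq> cube n x0" "cube n x0 \<subseteq> ball x0 (2 * R)"
        using ball_cube[OF net(1), of n] cube_ball[of n x0] by (simp_all add: rad)
      have "V x0 (R / 4) \<le> measure \<mu> (cube n x0)"
        by (rule measure_mono_bounded[OF sub(1)]) (auto intro: cube_bounded)
      then have "t * V x0 (R / 4) \<le> t * measure \<mu> (cube n x0)" using t by (intro mult_left_mono) auto
      with R(3) have small: "(\<integral>x. \<bar>h x\<bar> \<partial>\<mu>) \<le> t * measure \<mu> (cube n x0)" unfolding S_def by linarith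
      have supp: "x \<in> cube n x0" if "h x \<noteq> 0" for x
      proof -
        have "dist x0 x < r" using r(4)[OF that] by simp
        with R(2) have "x \<in> ball x0 (R / 4)" unfolding mem_ball by linarith
        then show ?thesis using sub(1) by blast
      qed
      have M: "measure \<mu> (cube n x0) \<le> V x0 (2 * R)"
        by (rule measure_mono_bounded[OF sub(2)]) auto
      have "t * measure \<mu> A \<le> weak_const * S + 144 * B * (L * (R / 16 ^ n))\<^sup>2 / t * measure \<mu> (cube n x0)"
        unfolding A_def S_def by (rule weak_type_on_grid[OF h(1) L t supp small])
      also have "\<dots> \<le> weak_const * S + 144 * B * (L * (R / 16 ^ n))\<^sup>2 / t * V x0 (2 * R)"
        using M B_nonneg t by (intro add_left_mono mult_left_mono) auto
      also have "144 * B * (L * (R / 16 ^ n))\<^sup>2 / t * V x0 (2 * R) = k * inverse (256 ^ n)"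
      proof -
        have "((16::real) ^ n)\<^sup>2 = 256 ^ n" by (simp add: power2_eq_square power_mult_distrib[symmetric])
        then have "(L * (R / 16 ^ n))\<^sup>2 = L\<^sup>2 * R\<^sup>2 * inverse (256 ^ n)"
          by (simp add: power_mult_distrib power_divide divide_inverse power_inverse)
        then show ?thesis by (simp add: k_def)
      qed
      finally show ?thesis .
    qed
    have "(\<lambda>n. weak_const * S + k * inverse (256 ^ n)) \<longlonglongrightarrow> weak_const * S + k * 0"
      by (intro tendsto_intros LIMSEQ_inverse_realpow_zero) simp
    then show ?thesis using LIMSEQ_le_const[of _ "weak_const * S"] le by fastforce
  next
    case False
    have V: "t * V x0 \<rho> \<le> S" if "r \<le> \<rho>" for \<rho>
    proof (rule ccontr)
      assume "\<not> t * V x0 \<rho> \<le> S"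
      moreover have "4 * \<rho> > 0" "r \<le> (4 * \<rho>) / 4" "V x0 ((4 * \<rho>) / 4) = V x0 \<rho>" using r(2) that by simp_all
      ultimately show False using False by (metis less_imp_le not_le)
    qed
    have meas: "A \<inter> ball x0 (real n) \<in> sets \<mu>" for n using A by (auto simp: sets_M)
    have un: "(\<Union>n. A \<inter> ball x0 (real n)) = A" using reals_Archimedean2 by auto
    have "(\<lambda>n. measure \<mu> (A \<inter> ball x0 (real n))) \<longlonglongrightarrow> measure \<mu> (\<Union>n. A \<inter> ball x0 (real n))"
    proof (rule Lim_measure_incseq)
      show "range (\<lambda>n. A \<inter> ball x0 (real n)) \<subseteq> sets \<mu>" using meas by auto
      show "incseq (\<lambda>n. A \<inter> ball x0 (real n))" by (auto simp: incseq_def)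
      show "emeasure \<mu> (\<Union>n. A \<inter> ball x0 (real n)) \<noteq> \<infinity>" unfolding un using A by (auto simp: fmeasurable_def)
    qed
    moreover have "measure \<mu> (A \<inter> ball x0 (real n)) \<le> S / t" for n
    proof -
      have "measure \<mu> (A \<inter> ball x0 (real n)) \<le> V x0 (max r n)"
        using meas by (intro measure_mono_bounded) (auto simp: sets_M)
      also have "\<dots> \<le> S / t" using V[of "max r n"] t by (simp add: field_simps)
      finally show ?thesis .
    qed
    ultimately have "measure \<mu> A \<le> S / t" unfolding un by (intro LIMSEQ_le_const2) auto
    then have "t * measure \<mu> A \<le> S" using t by (simp add: field_simps)
    also have "\<dots> \<le> weak_const * S" using mult_right_mono[OF weak_const_ge1 S0] by simp
    finally show ?thesis .
  qed
  then show ?thesis by (simp add: A_def S_def)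
qed

text \<open>
  Passage to functions that are not Lipschitz: if \<open>\<phi>\<close> approximates \<open>h\<close> in \<open>L\<^sup>2\<close> on a fixed ball, it does so in \<open>L\<^sup>1\<close>, and
  the level set of \<open>T (h - \<phi>)\<close> is small by the \<open>L\<^sup>2\<close> bound.
\<close>

lemma weak_type:
  assumes h: "h \<in> BB" and t: "0 < t"
  shows "t * measure \<mu> {x. t < \<bar>T h x\<bar>} \<le> 2 * weak_const * (\<integral>x. \<bar>h x\<bar> \<partial>\<mu>)"
proof -
  obtain x0 :: 'a where True by blast
  obtain c r where r: "c > 0" "0 < r" "\<And>x. \<bar>h x\<bar> \<le> c" "\<And>x. h x \<noteq> 0 \<Longrightarrow> x \<in> ball x0 r"
    using BB_E[OF h, of x0] by metis
  define S where "S = (\<integral>x. \<bar>h x\<bar> \<partial>\<mu>)"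
  define W where "W = V x0 (r + 1)"
  define m where "m = measure \<mu> {x. t < \<bar>T h x\<bar>}"
  have [measurable]: "T h \<in> borel_measurable borel" by (rule T_measurable[OF h])
  have t2: "0 < t / 2" using t by simp
  have main: "t * m \<le> 2 * weak_const * (S + \<delta> * (W + 1)) + 4 * B / t * \<delta>\<^sup>2" if \<delta>: "0 < \<delta>" for \<delta>
  proof -
    have "0 < \<delta>\<^sup>2" using \<delta> by simp
    from BB_Lipschitz_approx[OF h r(3,4,2) this] obtain \<phi> where \<phi>: "lip \<phi>" "\<phi> \<in> BB"
      "\<And>x. \<phi> x \<noteq> 0 \<Longrightarrow> x \<in> ball x0 (r + 1)" "(\<integral>x. (h x - \<phi> x)\<^sup>2 \<partial>\<mu>) < \<delta>\<^sup>2" by metis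
    have dBB: "(\<lambda>x. h x - \<phi> x) \<in> BB" by (intro BB_diff h \<phi>)
    have isq: "integrable \<mu> (\<lambda>x. (h x - \<phi> x)\<^sup>2)" using BB_L2[OF dBB] by (simp add: L2_def)
    have am: "\<bar>h x - \<phi> x\<bar> \<le> \<delta> * indicator (ball x0 (r + 1)) x + (h x - \<phi> x)\<^sup>2 / \<delta>" for x
    proof (cases "x \<in> ball x0 (r + 1)")
      case True
      have "\<bar>a\<bar> \<le> \<delta> + a\<^sup>2 / \<delta>" for a :: real
      proof (cases "\<bar>a\<bar> \<le> \<delta>")
        case False
        then have "\<bar>a\<bar> * \<delta> \<le> \<bar>a\<bar> * \<bar>a\<bar>" by (intro mult_left_mono) auto
        then have "\<bar>a\<bar> \<le> a\<^sup>2 / \<delta>" using \<delta> by (simp add: field_simps power2_eq_square)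
        then show ?thesis using \<delta> by simp
      next
        case True
        have "0 \<le> a\<^sup>2 / \<delta>" using \<delta> by simp
        with True show ?thesis by linarith
      qed
      then show ?thesis using True by simp
    next
      case False
      then have "x \<notin> ball x0 r" by auto
      then show ?thesis using False r(4)[of x] \<phi>(3)[of x] by (cases "h x = 0"; cases "\<phi> x = 0") auto
    qed
    have "(\<integral>x. \<bar>h x - \<phi> x\<bar> \<partial>\<mu>) \<le> (\<integral>x. \<delta> * indicator (ball x0 (r + 1)) x + (h x - \<phi> x)\<^sup>2 / \<delta> \<partial>\<mu>)"
    proof (rule integral_mono)
      show "integrable \<mu> (\<lambda>x. \<bar>h x - \<phi> x\<bar>)" by (intro BB_integrable BB_abs dBB)
      show "integrable \<mu> (\<lambda>x. \<delta> * indicator (ball x0 (r + 1)) x + (h x - \<phi> x)\<^sup>2 / \<delta>)"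
      proof (intro Bochner_Integration.integrable_add)
        show "integrable \<mu> (\<lambda>x. \<delta> * indicator (ball x0 (r + 1)) x)" by (intro BB_integrable BB_intros) auto
        show "integrable \<mu> (\<lambda>x. (h x - \<phi> x)\<^sup>2 / \<delta>)" using isq by simp
      qed
    qed (rule am)
    also have "\<dots> = \<delta> * W + (\<integral>x. (h x - \<phi> x)\<^sup>2 \<partial>\<mu>) / \<delta>"
    proof -
      have "integrable \<mu> (\<lambda>x. \<delta> * indicator (ball x0 (r + 1)) x)" by (intro BB_integrable BB_intros) auto
      then show ?thesis using isq by (simp add: W_def)
    qed
    also have "(\<integral>x. (h x - \<phi> x)\<^sup>2 \<partial>\<mu>) / \<delta> \<le> \<delta>\<^sup>2 / \<delta>" using \<phi>(4) \<delta> by (intro divide_right_mono) auto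
    also have "\<delta>\<^sup>2 / \<delta> = \<delta>" using \<delta> by (simp add: power2_eq_square)
    finally have d: "(\<integral>x. \<bar>h x - \<phi> x\<bar> \<partial>\<mu>) \<le> \<delta> * (W + 1)" by (simp add: distrib_left)
    have "(\<integral>x. \<bar>\<phi> x\<bar> \<partial>\<mu>) \<le> (\<integral>x. \<bar>h x\<bar> + \<bar>h x - \<phi> x\<bar> \<partial>\<mu>)"
      by (intro integral_mono BB_integrable BB_intros h \<phi>) auto
    also have "\<dots> = S + (\<integral>x. \<bar>h x - \<phi> x\<bar> \<partial>\<mu>)"
      unfolding S_def by (intro Bochner_Integration.integral_add BB_integrable BB_intros h \<phi>)
    finally have \<phi>S: "(\<integral>x. \<bar>\<phi> x\<bar> \<partial>\<mu>) \<le> S + \<delta> * (W + 1)" using d by linarith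
    define m1 m2 where "m1 = measure \<mu> {x. t / 2 < \<bar>T \<phi> x\<bar>}"
      and "m2 = measure \<mu> {x. t / 2 < \<bar>T (\<lambda>y. h y - \<phi> y) x\<bar>}"
    have f1: "{x. t / 2 < \<bar>T \<phi> x\<bar>} \<in> fmeasurable \<mu>" by (rule level_set(1)[OF \<phi>(2) t2])
    have f2: "{x. t / 2 < \<bar>T (\<lambda>y. h y - \<phi> y) x\<bar>} \<in> fmeasurable \<mu>" by (rule level_set(1)[OF dBB t2])
    have "m \<le> measure \<mu> ({x. t / 2 < \<bar>T \<phi> x\<bar>} \<union> {x. t / 2 < \<bar>T (\<lambda>y. h y - \<phi> y) x\<bar>})"
      unfolding m_def
    proof (rule measure_le_AE)
      show "AE x in \<mu>. x \<in> {x. t < \<bar>T h x\<bar>} \<longrightarrow> x \<in> {x. t / 2 < \<bar>T \<phi> x\<bar>} \<union> {x. t / 2 < \<bar>T (\<lambda>y. h y - \<phi> y) x\<bar>}"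
        using T_diff[OF h \<phi>(2)]
      proof eventually_elim
        case (elim x)
        show ?case unfolding mem_Collect_eq Un_iff elim by linarith
      qed
      show "{x. t / 2 < \<bar>T \<phi> x\<bar>} \<union> {x. t / 2 < \<bar>T (\<lambda>y. h y - \<phi> y) x\<bar>} \<in> fmeasurable \<mu>"
        by (intro fmeasurable.Un f1 f2)
    qed measurable
    also have "\<dots> \<le> m1 + m2" unfolding m1_def m2_def using f1 f2 by (intro measure_Un_le) auto
    finally have "t * m \<le> t * m1 + t * m2" using t by (simp add: distrib_left[symmetric])
    moreover have "t * m1 \<le> 2 * weak_const * (S + \<delta> * (W + 1))"
    proof -
      have "t / 2 * m1 \<le> weak_const * (\<integral>x. \<bar>\<phi> x\<bar> \<partial>\<mu>)" unfolding m1_def by (rule weak_type_Lipschitz[OF \<phi>(2,1) t2])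
      also have "\<dots> \<le> weak_const * (S + \<delta> * (W + 1))" using weak_const_ge1 by (intro mult_left_mono \<phi>S) auto
      finally show ?thesis by simp
    qed
    moreover have "t * m2 \<le> 4 * B / t * \<delta>\<^sup>2"
    proof -
      have "(t / 2)\<^sup>2 * m2 \<le> B * (\<integral>x. (h x - \<phi> x)\<^sup>2 \<partial>\<mu>)" unfolding m2_def by (rule level_set(2)[OF dBB t2])
      also have "\<dots> \<le> B * \<delta>\<^sup>2" using \<phi>(4) B_nonneg by (intro mult_left_mono) auto
      finally have "t * (t * m2) \<le> 4 * B * \<delta>\<^sup>2" by (simp add: power2_eq_square)
      then show ?thesis using t by (simp add: field_simps)
    qed
    ultimately show ?thesis by linarith
  qed
  have "(\<lambda>n. 2 * weak_const * (S + inverse (real (Suc n)) * (W + 1)) + 4 * B / t * (inverse (real (Suc n)))\<^sup>2)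
    \<longlonglongrightarrow> 2 * weak_const * (S + 0 * (W + 1)) + 4 * B / t * 0\<^sup>2"
    by (intro tendsto_intros LIMSEQ_inverse_real_of_nat)
  moreover have "t * m \<le> 2 * weak_const * (S + inverse (real (Suc n)) * (W + 1)) + 4 * B / t * (inverse (real (Suc n)))\<^sup>2" for n
    by (rule main) simp
  ultimately have "t * m \<le> 2 * weak_const * (S + 0 * (W + 1)) + 4 * B / t * 0\<^sup>2"
    by (intro LIMSEQ_le_const) auto
  then show ?thesis by (simp add: m_def S_def)
qed

end

section \<open>Sparse domination\<close>

context cz_operator begin

text \<open>
  The stopping thresholds in multiples of the average: for the averages of \<open>|f|\<close> over balls and for
  \<open>|T f|\<close>. They are chosen such that each of the two stopping conditions holds on at most a
  quarter of the cube.
\<close>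

definition level_avg :: real where "level_avg = 4 * D ^ (\<kappa> + 5)"
definition level_T :: real where "level_T = 32 * weak_const * D ^ (\<kappa> + 11)"
definition sparse_const :: real where "sparse_const = level_T + (8 * weak_const * D ^ (\<kappa> + 3) + 2 * 2 ^ \<kappa> * C\<epsilon>) * (level_avg * D ^ 5)"

lemma level_avg_pos: "0 < level_avg" using D_ge1 by (simp add: level_avg_def)
lemma level_T_pos: "0 < level_T" using D_ge1 weak_const_ge1 by (simp add: level_T_def)
lemma sparse_const_pos: "0 < sparse_const"
  unfolding sparse_const_def using level_T_pos level_avg_pos weak_const_ge1 D_ge1 C\<epsilon>_pos
  by (intro add_pos_nonneg mult_nonneg_nonneg add_nonneg_nonneg) auto

end

context cz_grid begin

text \<open>
  The dilate of a cube such that the kernel is smooth on the cube as long as the other variable stays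
  outside of the dilate.
\<close>

definition big :: "nat \<times> 'a \<Rightarrow> 'a set" where
  "big p = ball (snd p) (2 ^ (\<kappa> + 1) * rad (fst p))"

abbreviation Q :: "nat \<times> 'a \<Rightarrow> 'a set" where "Q p \<equiv> cube (fst p) (snd p)"

definition restr :: "('a \<Rightarrow> real) \<Rightarrow> nat \<times> 'a \<Rightarrow> 'a \<Rightarrow> real" where
  "restr f p x = f x * indicator (big p) x"

definition avg :: "('a \<Rightarrow> real) \<Rightarrow> nat \<times> 'a \<Rightarrow> real" where
  "avg f p = (\<integral>x. \<bar>f x\<bar> * indicator (big p) x \<partial>\<mu>) / measure \<mu> (big p)"

lemma big_measurable [measurable]: "big p \<in> sets borel" unfolding big_def by auto

lemma big_alt: "big p = ball (snd p) (2 ^ \<kappa> * (2 * rad (fst p)))"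
  by (simp add: big_def mult_ac)

lemma restr_BB: "f \<in> BB \<Longrightarrow> restr f p \<in> BB"
  unfolding restr_def[abs_def] by (intro BB_intros big_measurable)

lemma big_pos: "0 < measure \<mu> (big p)"
  unfolding big_def by (rule ball_pos) (simp add: rad_pos)

lemma big_le: "snd p \<in> net (fst p) \<Longrightarrow> measure \<mu> (big p) \<le> D ^ (\<kappa> + 3) * measure \<mu> (Q p)"
  using V_cube[of "snd p" "fst p" "\<kappa> + 1"] by (simp add: big_def numeral_eq_Suc)

lemma avg_nonneg: "0 \<le> avg f p"
  unfolding avg_def by (intro divide_nonneg_nonneg integral_indicator_nonneg) auto

lemma integral_restr: "(\<integral>x. \<bar>restr f p x\<bar> \<partial>\<mu>) = avg f p * measure \<mu> (big p)"
  using big_pos[of p] by (simp add: avg_def restr_def abs_mult)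

lemma two_le_pow: "2 \<le> (2::real) ^ \<kappa>"
  using power_increasing[OF \<kappa>_pos, of "2::real"] by simp

lemma Q_subset_ball: "Q p \<subseteq> ball (snd p) (2 * rad (fst p))" by (rule cube_ball)

text \<open>
  The ratio \<open>16\<close> of consecutive scales leaves room for the dilates of smaller cubes.
\<close>

lemma big_subset:
  assumes "snd p \<in> net (fst p)" "Q p \<subseteq> Q r" "fst p < fst r"
  shows "big p \<subseteq> big r"
  unfolding big_def
proof (rule ball_subI)
  have "snd p \<in> ball (snd r) (2 * rad (fst r))"
    using center_in_cube[OF assms(1)] assms(2) Q_subset_ball[of r] by blast
  then have d: "dist (snd p) (snd r) < 2 * rad (fst r)" by (simp add: dist_commute)
  define k where "k = (2::real) ^ \<kappa>"
  have k: "2 \<le> k" using two_le_pow by (simp add: k_def)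
  have "k * (16 * rad (fst p)) \<le> k * rad (fst r)"
    using rad_less[OF assms(3)] k by (intro mult_left_mono) auto
  moreover have "2 * rad (fst r) \<le> k * rad (fst r)" using k rad_pos[of "fst r"] by (intro mult_right_mono) auto
  moreover have "0 < k * rad (fst p)" using k rad_pos[of "fst p"] by simp
  ultimately have "2 * rad (fst r) + 2 * (k * rad (fst p)) \<le> 2 * (k * rad (fst r))" by linarith
  then show "dist (snd p) (snd r) + 2 ^ (\<kappa> + 1) * rad (fst p) \<le> 2 ^ (\<kappa> + 1) * rad (fst r)"
    using d by (simp add: k_def)
qed

text \<open>
  On \<open>Q p\<close> the part of \<open>F\<close> outside of the dilate contributes to \<open>T F\<close> the constant \<open>k\<close> up to an
  error \<open>osc\<close>. If \<open>|k|\<close> were larger than \<open>t + t2 + osc\<close>, then at almost every point of \<open>Q p\<close> either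
  \<open>|T F| > t\<close> or \<open>|T (restr F p)| > t2\<close>. But each of these sets has at most a quarter of the measure of
  \<open>Q p\<close>, the first by assumption and the second by the weak type (1,1).
\<close>

lemma localization:
  assumes F: "F \<in> BB" and p: "snd p \<in> net (fst p)" and b: "0 < b" and t: "0 < t"
    and few: "measure \<mu> ({x. t < \<bar>T F x\<bar>} \<inter> Q p) \<le> measure \<mu> (Q p) / 4"
    and avgs: "\<And>m. (\<integral>x. \<bar>F x\<bar> * indicator (ball (snd p) (2 ^ m * (2 * rad (fst p)))) x \<partial>\<mu>)
        \<le> b * V (snd p) (2 ^ m * (2 * rad (fst p)))"
  shows "AE x in \<mu>. x \<in> Q p \<longrightarrow>
    \<bar>T F x\<bar> \<le> \<bar>T (restr F p) x\<bar> + (t + (8 * weak_const * D ^ (\<kappa> + 3) + 2 * 2 ^ \<kappa> * C\<epsilon>) * b)"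
proof -
  define \<rho> where "\<rho> = 2 * rad (fst p)"
  have \<rho>: "0 < \<rho>" by (simp add: \<rho>_def rad_pos)
  have F1: "restr F p \<in> BB" by (rule restr_BB[OF F])
  define F2 where "F2 x = F x - restr F p x" for x
  have F2: "F2 \<in> BB" unfolding F2_def[abs_def] by (intro BB_diff F F1)
  have F2le: "\<bar>F2 x\<bar> \<le> \<bar>F x\<bar>" for x by (auto simp: F2_def restr_def indicator_def)
  define k where "k = (\<integral>y. K (snd p) y * F2 y \<partial>\<mu>)"
  define osc where "osc = 2 ^ \<kappa> * C\<epsilon> * b"
  have "AE x in \<mu>. x \<in> ball (snd p) \<rho> \<longrightarrow> \<bar>T F2 x - k\<bar> \<le> osc"
    unfolding k_def osc_def
  proof (rule T_oscillation[OF F2 \<rho> less_imp_le[OF b]])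
    show "F2 y = 0" if "y \<in> ball (snd p) (2 ^ \<kappa> * \<rho>)" for y
      using that by (simp add: F2_def restr_def big_alt \<rho>_def)
    fix m
    have "(\<integral>x. \<bar>F2 x\<bar> * indicator (ball (snd p) (2 ^ m * \<rho>)) x \<partial>\<mu>) \<le> (\<integral>x. \<bar>F x\<bar> * indicator (ball (snd p) (2 ^ m * \<rho>)) x \<partial>\<mu>)"
      by (intro integral_mono BB_integrable BB_intros F F2 mult_right_mono F2le) auto
    also have "\<dots> \<le> b * V (snd p) (2 ^ m * \<rho>)" using avgs by (simp add: \<rho>_def)
    finally show "(\<integral>x. \<bar>F2 x\<bar> * indicator (ball (snd p) (2 ^ m * \<rho>)) x \<partial>\<mu>) \<le> b * V (snd p) (2 ^ m * \<rho>)" .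
  qed
  then have osc: "AE x in \<mu>. x \<in> Q p \<longrightarrow> \<bar>T F2 x - k\<bar> \<le> osc"
    by eventually_elim (use Q_subset_ball[of p] in \<open>auto simp: \<rho>_def\<close>)
  have split: "AE x in \<mu>. T F x = T (restr F p) x + T F2 x"
    using T_add[OF F1 F2] by (simp add: F2_def)
  define t2 where "t2 = 8 * weak_const * D ^ (\<kappa> + 3) * b"
  have t2: "0 < t2" using weak_const_ge1 D_ge1 b by (simp add: t2_def)
  define E1 E2 where "E1 = {x. t < \<bar>T F x\<bar>} \<inter> Q p" and "E2 = {x. t2 < \<bar>T (restr F p) x\<bar>}"
  have E1: "E1 \<in> fmeasurable \<mu>"
    unfolding E1_def by (rule fmeasurable_Int_fmeasurable[OF level_set(1)[OF F t]]) (simp add: sets_M)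
  have E2: "E2 \<in> fmeasurable \<mu>" unfolding E2_def by (rule level_set(1)[OF F1 t2])
  have Qpos: "0 < measure \<mu> (Q p)" by (rule cube_pos[OF p])
  have "t2 * measure \<mu> E2 \<le> 2 * weak_const * (\<integral>x. \<bar>restr F p x\<bar> \<partial>\<mu>)" unfolding E2_def by (rule weak_type[OF F1 t2])
  also have "\<dots> \<le> 2 * weak_const * (b * measure \<mu> (big p))"
    using avgs[of \<kappa>] weak_const_ge1 unfolding big_alt[symmetric] by (intro mult_left_mono) (auto simp: restr_def abs_mult)
  also have "\<dots> \<le> 2 * weak_const * (b * (D ^ (\<kappa> + 3) * measure \<mu> (Q p)))"
    using weak_const_ge1 b by (intro mult_left_mono big_le p) auto
  also have "\<dots> = t2 * (measure \<mu> (Q p) / 4)" by (simp add: t2_def)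
  finally have mE2: "measure \<mu> E2 \<le> measure \<mu> (Q p) / 4" using t2 by simp
  have k: "\<bar>k\<bar> \<le> t + t2 + osc"
  proof (rule ccontr)
    assume nk: "\<not> \<bar>k\<bar> \<le> t + t2 + osc"
    have "AE x in \<mu>. x \<in> Q p \<longrightarrow> x \<in> E1 \<union> E2"
      using osc split
    proof eventually_elim
      case (elim x)
      have "t < \<bar>T F x\<bar> \<or> t2 < \<bar>T (restr F p) x\<bar>" if "x \<in> Q p"
        using elim(1)[rule_format, OF that] nk unfolding elim(2) by linarith
      then show ?case by (auto simp: E1_def E2_def)
    qed
    then have "measure \<mu> (Q p) \<le> measure \<mu> (E1 \<union> E2)"
      by (rule measure_le_AE) (auto intro: fmeasurable.Un E1 E2)
    also have "\<dots> \<le> measure \<mu> E1 + measure \<mu> E2" using E1 E2 by (intro measure_Un_le) auto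
    also have "\<dots> < measure \<mu> (Q p)" using mE2 few Qpos unfolding E1_def by linarith
    finally show False by simp
  qed
  have "t + t2 + osc + osc = t + (8 * weak_const * D ^ (\<kappa> + 3) + 2 * 2 ^ \<kappa> * C\<epsilon>) * b"
    by (simp add: t2_def osc_def algebra_simps)
  with osc split k show ?thesis
    by (elim AE_mp) (intro AE_I2 impI, linarith)
qed

text \<open>
  The stopping conditions, \<open>dense\<close> and \<open>large\<close>, fail for the parent of every stopping cube. By doubling they
  fail for the cube itself with worse constants, which is what \<open>localization\<close> needs. The stopping
  cubes of positive level satisfy one of the two conditions, and the weak type inequalities bound
  their total measure.
\<close>

lemma stopping_step:
  assumes f: "f \<in> BB" and r: "snd r \<in> net (fst r)" and pos: "0 < avg f r" and lev: "0 < fst r"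
  shows "\<exists>P. finite P \<and> disjoint_family_on Q P \<and> (\<Union>p\<in>P. Q p) = Q r \<and>
    (\<forall>p\<in>P. snd p \<in> net (fst p) \<and> fst p < fst r) \<and>
    measure \<mu> (\<Union>p\<in>{p\<in>P. 0 < fst p}. Q p) \<le> measure \<mu> (Q r) / 2 \<and>
    (\<forall>p\<in>P. AE x in \<mu>. x \<in> Q p \<longrightarrow> \<bar>T (restr f r) x\<bar> \<le> \<bar>T (restr f p) x\<bar> + sparse_const * avg f r)"
proof -
  define a where "a = avg f r"
  have a: "0 < a" using pos by (simp add: a_def)
  define F where "F = restr f r"
  have F: "F \<in> BB" unfolding F_def by (rule restr_BB[OF f])
  have intF: "(\<integral>x. \<bar>F x\<bar> \<partial>\<mu>) = a * measure \<mu> (big r)" by (simp add: F_def integral_restr a_def)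
  have intF': "(\<integral>x. \<bar>F x\<bar> \<partial>\<mu>) \<le> a * (D ^ (\<kappa> + 3) * measure \<mu> (Q r))"
    unfolding intF using a by (intro mult_left_mono big_le r) auto
  have t: "0 < level_T * a" using level_T_pos a by simp
  define E where "E = {x. level_T * a < \<bar>T F x\<bar>}"
  have Ef: "E \<in> fmeasurable \<mu>" unfolding E_def by (rule level_set(1)[OF F t])
  have EQf: "E \<inter> cube i y \<in> fmeasurable \<mu>" for i y
    by (rule fmeasurable_Int_fmeasurable[OF Ef]) (simp add: sets_M)
  have [measurable]: "E \<in> sets borel" using Ef by (simp add: fmeasurable_def sets_M)
  have "level_T * a * measure \<mu> E \<le> 2 * weak_const * (\<integral>x. \<bar>F x\<bar> \<partial>\<mu>)" unfolding E_def by (rule weak_type[OF F t])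
  also have "\<dots> \<le> 2 * weak_const * (a * (D ^ (\<kappa> + 3) * measure \<mu> (Q r)))" using weak_const_ge1 by (intro mult_left_mono intF') auto
  finally have mE: "16 * D ^ 8 * measure \<mu> E \<le> measure \<mu> (Q r)"
  proof -
    assume "level_T * a * measure \<mu> E \<le> 2 * weak_const * (a * (D ^ (\<kappa> + 3) * measure \<mu> (Q r)))"
    moreover have D11: "D ^ (\<kappa> + 11) = D ^ (\<kappa> + 3) * D ^ 8" by (simp add: power_add[symmetric] add.commute)
    have "level_T * a * measure \<mu> E = (2 * weak_const * a * D ^ (\<kappa> + 3)) * (16 * D ^ 8 * measure \<mu> E)"
      unfolding level_T_def D11 by simp
    moreover have "2 * weak_const * (a * (D ^ (\<kappa> + 3) * measure \<mu> (Q r))) = (2 * weak_const * a * D ^ (\<kappa> + 3)) * measure \<mu> (Q r)"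
      by simp
    ultimately have "(2 * weak_const * a * D ^ (\<kappa> + 3)) * (16 * D ^ 8 * measure \<mu> E) \<le> (2 * weak_const * a * D ^ (\<kappa> + 3)) * measure \<mu> (Q r)"
      by simp
    moreover have "0 < 2 * weak_const * a * D ^ (\<kappa> + 3)" using weak_const_ge1 a D_ge1 by simp
    ultimately show ?thesis by (simp only: mult_le_cancel_left_pos)
  qed
  define dense where "dense i y \<longleftrightarrow> measure \<mu> (cube i y) < 4 * D ^ 8 * measure \<mu> (E \<inter> cube i y)" for i y
  define large where "large i y m \<longleftrightarrow> level_avg * a * V y (2 ^ m * (2 * rad i)) < (\<integral>x. \<bar>F x\<bar> * indicator (ball y (2 ^ m * (2 * rad i))) x \<partial>\<mu>)" for i y m
  define bad where "bad i y \<longleftrightarrow> dense i y \<or> (\<exists>m::nat. large i y m)" for i y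
  have "\<not> bad (fst r) (snd r)"
  proof -
    have "4 * D ^ 8 * measure \<mu> (E \<inter> Q r) \<le> 4 * D ^ 8 * measure \<mu> E"
      using Ef D_ge1 by (intro mult_left_mono measure_mono_fmeasurable) (auto simp: sets_M)
    also have "\<dots> \<le> 16 * D ^ 8 * measure \<mu> E" using D_ge1 by (intro mult_right_mono) auto
    also have "\<dots> \<le> measure \<mu> (Q r)" by (rule mE)
    finally have "\<not> dense (fst r) (snd r)" by (simp add: dense_def)
    moreover have "\<not> large (fst r) (snd r) m" for m
    proof -
      have "(\<integral>x. \<bar>F x\<bar> * indicator (ball (snd r) (2 ^ m * (2 * rad (fst r)))) x \<partial>\<mu>) \<le> a * measure \<mu> (big r)"
        unfolding intF[symmetric] by (rule integral_indicator_le[OF F]) auto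
      also have "\<dots> \<le> a * (D ^ \<kappa> * V (snd r) (2 * rad (fst r)))"
        unfolding big_alt using a rad_pos[of "fst r"] by (intro mult_left_mono V_pow) auto
      also have "\<dots> \<le> a * (level_avg * V (snd r) (2 ^ m * (2 * rad (fst r))))"
      proof (intro mult_left_mono mult_mono)
        have "D ^ \<kappa> \<le> D ^ (\<kappa> + 5)" using D_ge1 by (intro power_increasing) auto
        also have "\<dots> \<le> level_avg" using D_ge1 by (simp add: level_avg_def)
        finally show "D ^ \<kappa> \<le> level_avg" .
        show "V (snd r) (2 * rad (fst r)) \<le> V (snd r) (2 ^ m * (2 * rad (fst r)))"
          using mult_right_mono[of 1 "2 ^ m" "2 * rad (fst r)"] rad_pos[of "fst r"] by (intro V_mono) auto
      qed (use a level_avg_pos in auto)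
      finally show ?thesis by (simp add: large_def mult_ac)
    qed
    ultimately show ?thesis by (simp add: bad_def)
  qed
  from stopping_cubes[where bad = bad, OF r this] obtain P where P0: "finite P" "disjoint_family_on (\<lambda>(i, y). cube i y) P"
    "(\<Union>(i, y)\<in>P. cube i y) = Q r"
    "\<forall>(i, y)\<in>P. i \<le> fst r \<and> y \<in> net i \<and> (i < fst r \<and> bad i y \<and> \<not> bad (Suc i) (parent i y) \<or> i = 0 \<and> \<not> bad 0 y)"
    by (elim exE conjE) (rule that)
  have dj: "disjoint_family_on Q P" and un: "(\<Union>p\<in>P. Q p) = Q r"
    using P0(2,3) by (auto simp: case_prod_unfold)
  have Pnet: "snd p \<in> net (fst p)" "fst p < fst r" if "p \<in> P" for p
    using P0(4) that lev by (auto simp: case_prod_unfold)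
  have Pcases: "bad (fst p) (snd p) \<and> \<not> bad (Suc (fst p)) (parent (fst p) (snd p)) \<or> fst p = 0 \<and> \<not> bad (fst p) (snd p)"
    if "p \<in> P" for p using P0(4) that by (auto simp: case_prod_unfold)
  define Pd where "Pd = {p \<in> P. dense (fst p) (snd p)}"
  define Pl where "Pl = {p \<in> P. \<exists>m. large (fst p) (snd p) m}"
  have fin: "finite Pd" "finite Pl" "Pd \<subseteq> P" "Pl \<subseteq> P" using P0(1) by (auto simp: Pd_def Pl_def)
  have U_fm: "(\<Union>p\<in>X. Q p) \<in> fmeasurable \<mu>" if "X \<subseteq> P" for X
    using P0(1) that by (intro bounded_fmeasurable sets.countable_UN' bounded_UN ballI)
      (auto intro: cube_bounded finite_subset countable_finite)
  have mPd: "measure \<mu> (\<Union>p\<in>Pd. Q p) \<le> measure \<mu> (Q r) / 4"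
  proof -
    have djd: "disjoint_family_on (\<lambda>p. E \<inter> Q p) Pd"
      using dj fin(3) unfolding disjoint_family_on_def by blast
    have "measure \<mu> (\<Union>p\<in>Pd. Q p) \<le> (\<Sum>p\<in>Pd. measure \<mu> (Q p))"
      by (rule measure_UNION_le[OF fin(1)]) (simp add: sets_M)
    also have "\<dots> \<le> (\<Sum>p\<in>Pd. 4 * D ^ 8 * measure \<mu> (E \<inter> Q p))"
      by (intro sum_mono) (auto simp: Pd_def dense_def)
    also have "\<dots> = 4 * D ^ 8 * measure \<mu> (\<Union>p\<in>Pd. E \<inter> Q p)"
      unfolding sum_distrib_left[symmetric]
      by (subst measure_finite_Union[OF fin(1) _ djd]) (auto simp: fmeasurableD2[OF EQf] sets_M image_subset_iff)
    also have "\<dots> \<le> 4 * D ^ 8 * measure \<mu> E"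
      using Ef D_ge1 by (intro mult_left_mono measure_mono_fmeasurable sets.countable_UN') (auto simp: sets_M fin countable_finite)
    also have "\<dots> \<le> measure \<mu> (Q r) / 4" using mE by simp
    finally show ?thesis .
  qed
  have mPl: "measure \<mu> (\<Union>p\<in>Pl. Q p) \<le> measure \<mu> (Q r) / 4"
  proof -
    have "\<forall>p\<in>Pl. \<exists>m. large (fst p) (snd p) m" by (simp add: Pl_def)
    then obtain m where m: "\<And>p. p \<in> Pl \<Longrightarrow> large (fst p) (snd p) (m p)" by metis
    let ?R = "\<lambda>p. 2 ^ m p * (2 * rad (fst p))"
    have "level_avg * a * measure \<mu> (\<Union>p\<in>Pl. ball (snd p) (?R p)) \<le> D ^ 2 * (\<integral>x. \<bar>F x\<bar> \<partial>\<mu>)"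
    proof (rule maximal_inequality[OF fin(2)])
      show "level_avg * a * V (snd p) (?R p) \<le> (\<integral>x. \<bar>F x\<bar> * indicator (ball (snd p) (?R p)) x \<partial>\<mu>)" if "p \<in> Pl" for p
        using m[OF that] by (simp add: large_def)
    qed (use rad_pos level_avg_pos a in \<open>auto intro!: BB_integrable BB_abs F\<close>)
    also have "\<dots> \<le> D ^ 2 * (a * (D ^ (\<kappa> + 3) * measure \<mu> (Q r)))" using D_ge1 by (intro mult_left_mono intF') auto
    also have "\<dots> = level_avg * a * (measure \<mu> (Q r) / 4)"
      by (simp add: level_avg_def power_add mult_ac numeral_eq_Suc)
    finally have "measure \<mu> (\<Union>p\<in>Pl. ball (snd p) (?R p)) \<le> measure \<mu> (Q r) / 4"
      using level_avg_pos a by (simp only: mult_le_cancel_left_pos mult_pos_pos)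
    moreover have "measure \<mu> (\<Union>p\<in>Pl. Q p) \<le> measure \<mu> (\<Union>p\<in>Pl. ball (snd p) (?R p))"
    proof (rule measure_mono_bounded)
      have "Q p \<subseteq> ball (snd p) (?R p)" for p
      proof (rule order_trans[OF Q_subset_ball subset_ball])
        show "2 * rad (fst p) \<le> 2 ^ m p * (2 * rad (fst p))"
          using mult_right_mono[of 1 "2 ^ m p" "2 * rad (fst p)"] rad_pos[of "fst p"] by simp
      qed
      then show "(\<Union>p\<in>Pl. Q p) \<subseteq> (\<Union>p\<in>Pl. ball (snd p) (?R p))" by blast
      show "(\<Union>p\<in>Pl. Q p) \<in> sets borel" using U_fm[OF fin(4)] by (simp add: fmeasurable_def sets_M)
      show "bounded (\<Union>p\<in>Pl. ball (snd p) (?R p))" by (intro bounded_UN fin ballI bounded_ball)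
    qed (intro borel_open open_UN ballI open_ball)
    ultimately show ?thesis by linarith
  qed
  have "measure \<mu> (\<Union>p\<in>{p\<in>P. 0 < fst p}. Q p) \<le> measure \<mu> ((\<Union>p\<in>Pd. Q p) \<union> (\<Union>p\<in>Pl. Q p))"
  proof (rule measure_mono_fmeasurable)
    have "p \<in> Pd \<union> Pl" if "p \<in> P" "0 < fst p" for p
    proof -
      have "bad (fst p) (snd p)" using Pcases[OF that(1)] that(2) by (elim disjE conjE) simp_all
      then show ?thesis using that(1) unfolding Pd_def Pl_def bad_def by blast
    qed
    then have "{p\<in>P. 0 < fst p} \<subseteq> Pd \<union> Pl" by blast
    then show "(\<Union>p\<in>{p\<in>P. 0 < fst p}. Q p) \<subseteq> (\<Union>p\<in>Pd. Q p) \<union> (\<Union>p\<in>Pl. Q p)" by blast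
    show "(\<Union>p\<in>{p\<in>P. 0 < fst p}. Q p) \<in> sets \<mu>" using U_fm[of "{p\<in>P. 0 < fst p}"] by auto
    show "(\<Union>p\<in>Pd. Q p) \<union> (\<Union>p\<in>Pl. Q p) \<in> fmeasurable \<mu>" by (intro fmeasurable.Un U_fm fin)
  qed
  also have "\<dots> \<le> measure \<mu> (\<Union>p\<in>Pd. Q p) + measure \<mu> (\<Union>p\<in>Pl. Q p)"
    using U_fm[OF fin(3)] U_fm[OF fin(4)] by (intro measure_Un_le) auto
  finally have half: "measure \<mu> (\<Union>p\<in>{p\<in>P. 0 < fst p}. Q p) \<le> measure \<mu> (Q r) / 2" using mPd mPl by simp
  have loc: "AE x in \<mu>. x \<in> Q p \<longrightarrow> \<bar>T (restr f r) x\<bar> \<le> \<bar>T (restr f p) x\<bar> + sparse_const * avg f r" if p: "p \<in> P" for p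
  proof -
    note pn = Pnet(1)[OF p]
    define p' where "p' = parent (fst p) (snd p)"
    define \<rho> where "\<rho> = 2 * rad (fst p)"
    have \<rho>: "0 < \<rho>" by (simp add: \<rho>_def rad_pos)
    have rS: "2 * rad (Suc (fst p)) = 16 * \<rho>" by (simp add: \<rho>_def rad_Suc)
    have dp: "dist (snd p) p' < 8 * \<rho>" using parent_dist[of "snd p" "fst p"] by (simp add: p'_def \<rho>_def rad_Suc)
    have few: "4 * measure \<mu> (E \<inter> Q p) \<le> measure \<mu> (Q p)"
      using Pcases[OF p]
    proof
      assume "bad (fst p) (snd p) \<and> \<not> bad (Suc (fst p)) (parent (fst p) (snd p))"
      then have nd: "\<not> dense (Suc (fst p)) p'" by (simp add: bad_def p'_def)
      have "measure \<mu> (E \<inter> Q p) \<le> measure \<mu> (E \<inter> cube (Suc (fst p)) p')"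
        using child_subset[OF pn] EQf by (intro measure_mono_fmeasurable) (auto simp: p'_def sets_M)
      then have "4 * D ^ 8 * measure \<mu> (E \<inter> Q p) \<le> 4 * D ^ 8 * measure \<mu> (E \<inter> cube (Suc (fst p)) p')"
        using D_ge1 by (intro mult_left_mono) auto
      also have "\<dots> \<le> measure \<mu> (cube (Suc (fst p)) p')" using nd unfolding dense_def not_less .
      also have "\<dots> \<le> D ^ 8 * measure \<mu> (Q p)" unfolding p'_def by (rule measure_parent[OF pn])
      finally have "D ^ 8 * (4 * measure \<mu> (E \<inter> Q p)) \<le> D ^ 8 * measure \<mu> (Q p)" by (simp add: mult_ac)
      moreover have "0 < D ^ 8" using D_ge1 by simp
      ultimately show ?thesis by (simp only: mult_le_cancel_left_pos)
    next
      assume "fst p = 0 \<and> \<not> bad (fst p) (snd p)"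
      then have "\<not> dense (fst p) (snd p)" by (auto simp: bad_def)
      then have 1: "4 * D ^ 8 * measure \<mu> (E \<inter> Q p) \<le> measure \<mu> (Q p)" unfolding dense_def not_less .
      have "1 * (4 * measure \<mu> (E \<inter> Q p)) \<le> D ^ 8 * (4 * measure \<mu> (E \<inter> Q p))"
        by (intro mult_right_mono D_pow_ge1) auto
      with 1 show ?thesis by (simp add: mult_ac)
    qed
    have avgs: "(\<integral>x. \<bar>F x\<bar> * indicator (ball (snd p) (2 ^ m * \<rho>)) x \<partial>\<mu>) \<le> (level_avg * D ^ 5 * a) * V (snd p) (2 ^ m * \<rho>)" for m
      using Pcases[OF p]
    proof
      assume "bad (fst p) (snd p) \<and> \<not> bad (Suc (fst p)) (parent (fst p) (snd p))"
      then have nl: "\<not> large (Suc (fst p)) p' m" by (simp add: bad_def p'_def)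
      have one: "\<rho> \<le> 2 ^ m * \<rho>" using mult_right_mono[of 1 "2 ^ m" \<rho>] \<rho> by simp
      have "(\<integral>x. \<bar>F x\<bar> * indicator (ball (snd p) (2 ^ m * \<rho>)) x \<partial>\<mu>) \<le> (\<integral>x. \<bar>F x\<bar> * indicator (ball p' (2 ^ m * (16 * \<rho>))) x \<partial>\<mu>)"
      proof (rule integral_indicator_mono[OF F ball_subI])
        have "2 ^ m * (16 * \<rho>) = 16 * (2 ^ m * \<rho>)" by simp
        then show "dist (snd p) p' + 2 ^ m * \<rho> \<le> 2 ^ m * (16 * \<rho>)" using dp one \<rho> by linarith
      qed auto
      also have "\<dots> \<le> level_avg * a * V p' (2 ^ m * (16 * \<rho>))" using nl unfolding large_def not_less rS .
      also have "\<dots> \<le> level_avg * a * (D ^ 5 * V (snd p) (2 ^ m * \<rho>))"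
      proof (intro mult_left_mono V_comp)
        have "2 ^ m * (16 * \<rho>) = 16 * (2 ^ m * \<rho>)" "(2::real) ^ 5 * (2 ^ m * \<rho>) = 32 * (2 ^ m * \<rho>)" by simp_all
        then show "dist p' (snd p) + 2 ^ m * (16 * \<rho>) \<le> 2 ^ 5 * (2 ^ m * \<rho>)"
          using dp one \<rho> unfolding dist_commute[of p'] by linarith
      qed (use \<rho> level_avg_pos a in auto)
      finally show ?thesis by (simp add: mult_ac)
    next
      assume "fst p = 0 \<and> \<not> bad (fst p) (snd p)"
      then have "\<not> large (fst p) (snd p) m" by (auto simp: bad_def)
      then have "(\<integral>x. \<bar>F x\<bar> * indicator (ball (snd p) (2 ^ m * \<rho>)) x \<partial>\<mu>) \<le> level_avg * a * V (snd p) (2 ^ m * \<rho>)"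
        unfolding large_def not_less \<rho>_def .
      also have "\<dots> = 1 * (level_avg * a * V (snd p) (2 ^ m * \<rho>))" by simp
      also have "\<dots> \<le> D ^ 5 * (level_avg * a * V (snd p) (2 ^ m * \<rho>))"
        using level_avg_pos a by (intro mult_right_mono D_pow_ge1) auto
      finally show ?thesis by (simp add: mult_ac)
    qed
    \<comment> \<open>the restrictions are consistent because the dilates are nested\<close>
    have cc: "restr F p = restr f p"
    proof
      fix x
      have "big p \<subseteq> big r" using un p Pnet[OF p] by (intro big_subset) auto
      then show "restr F p x = restr f p x" by (auto simp: restr_def F_def indicator_def)
    qed
    have "AE x in \<mu>. x \<in> Q p \<longrightarrow> \<bar>T F x\<bar> \<le> \<bar>T (restr F p) x\<bar>
      + (level_T * a + (8 * weak_const * D ^ (\<kappa> + 3) + 2 * 2 ^ \<kappa> * C\<epsilon>) * (level_avg * D ^ 5 * a))"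
    proof (rule localization[OF F pn _ t])
      show "0 < level_avg * D ^ 5 * a" using level_avg_pos a D_ge1 by simp
      show "measure \<mu> ({x. level_T * a < \<bar>T F x\<bar>} \<inter> Q p) \<le> measure \<mu> (Q p) / 4" using few unfolding E_def by simp
    qed (use avgs in \<open>simp add: \<rho>_def\<close>)
    moreover have "level_T * a + (8 * weak_const * D ^ (\<kappa> + 3) + 2 * 2 ^ \<kappa> * C\<epsilon>) * (level_avg * D ^ 5 * a) = sparse_const * a"
      by (simp add: sparse_const_def algebra_simps)
    ultimately show ?thesis unfolding F_def[symmetric] a_def[symmetric] by (simp add: cc)
  qed
  show ?thesis
    using P0(1) dj un Pnet half loc by (intro exI[of _ P] conjI ballI)
qed

text \<open>
  What remains of \<open>T f\<close> at the point \<open>x\<close> when the recursion has arrived at the cube of level \<open>0\<close>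
  that contains \<open>x\<close>.
\<close>

definition Tleaf :: "('a \<Rightarrow> real) \<Rightarrow> 'a \<Rightarrow> real" where
  "Tleaf f x = T (restr f (0, anc 0 x)) x"

lemma Tleaf_measurable [measurable]:
  assumes "f \<in> BB" shows "Tleaf f \<in> borel_measurable borel"
proof -
  have cn: "countable (net 0)" by (rule separated_countable[OF rad_pos net_separated])
  have "anc 0 -` {z} \<inter> space borel \<in> sets borel" for z
    using cube_measurable[of 0 z] by (simp add: cube_def vimage_def)
  then have anc: "anc 0 \<in> measurable borel (count_space (net 0))"
    using anc_net[of 0] by (subst measurable_count_space_eq_countable[OF cn]) auto
  have Tm: "(\<lambda>x. T (restr f (0, y)) x) \<in> borel_measurable borel" for y
    by (rule T_measurable[OF restr_BB[OF assms]])
  show ?thesis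
    unfolding Tleaf_def[abs_def]
    by (rule measurable_compose_countable'[where f = "\<lambda>y x. T (restr f (0, y)) x" and g = "anc 0", OF Tm anc cn])
qed

text \<open>
  The part of a cube that no smaller cube of the family reaches. The sets \<open>rest S p\<close> are disjoint, and
  in a sparse family they carry at least half of the measure.
\<close>

definition rest :: "(nat \<times> 'a) set \<Rightarrow> nat \<times> 'a \<Rightarrow> 'a set" where
  "rest S p = Q p - (\<Union>q\<in>{q\<in>S. fst q < fst p}. Q q)"

definition sparse :: "(nat \<times> 'a) set \<Rightarrow> bool" where
  "sparse S \<longleftrightarrow> finite S \<and> (\<forall>p\<in>S. snd p \<in> net (fst p) \<and> measure \<mu> (Q p) \<le> 2 * measure \<mu> (rest S p))"

lemma rest_disjoint: "disjoint_family_on (rest S) S"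
  unfolding disjoint_family_on_def
proof (intro ballI impI)
  fix p q assume "p \<in> S" "q \<in> S" "p \<noteq> q"
  then show "rest S p \<inter> rest S q = {}"
    using cube_disjoint[of "snd p" "snd q" "fst p"]
    by (cases "fst p" "fst q" rule: linorder_cases) (auto simp: rest_def prod_eq_iff)
qed

lemma rest_measurable: "finite S \<Longrightarrow> rest S p \<in> sets borel"
  unfolding rest_def by (intro sets.Diff cube_measurable sets.finite_UN) auto

lemma rest_bounded: "bounded (rest S p)"
  by (rule bounded_subset[OF cube_bounded[of "fst p" "snd p"]]) (auto simp: rest_def)

lemma nn_integral_disjoint_cubes:
  assumes "finite P" "disjoint_family_on Q P" "h \<in> borel_measurable borel"
  shows "(\<integral>\<^sup>+x. h x * indicator (\<Union>p\<in>P. Q p) x \<partial>\<mu>) = (\<Sum>p\<in>P. \<integral>\<^sup>+x. h x * indicator (Q p) x \<partial>\<mu>)"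
proof -
  note [measurable] = assms(3)
  have "h x * indicator (\<Union>p\<in>P. Q p) x = (\<Sum>p\<in>P. h x * indicator (Q p) x)" for x
    by (subst indicator_UN_disjoint[OF assms(1,2)]) (simp add: sum_distrib_left)
  then show ?thesis by (simp add: nn_integral_sum)
qed

text \<open>
  Induction on the level of the cube. The families of the stopping cubes of positive level are united and the
  cube itself is added. It keeps half of its measure because the stopping cubes of positive level
  fill at most half of it; stopping cubes of level \<open>0\<close> contribute no cubes but leaf terms. If
  the average of \<open>|f|\<close> vanishes, then \<open>T\<close> vanishes on the restriction and the empty family is enough.
\<close>

theorem sparse_domination:
  assumes f: "f \<in> BB" and g: "g \<in> BB" and r: "snd r \<in> net (fst r)"
  shows "\<exists>S. sparse S \<and> (\<forall>p\<in>S. fst p \<le> fst r \<and> Q p \<subseteq> Q r) \<and>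
    (\<integral>\<^sup>+x. ennreal (\<bar>T (restr f r) x\<bar> * \<bar>g x\<bar>) * indicator (Q r) x \<partial>\<mu>)
    \<le> ennreal (sparse_const * (\<Sum>p\<in>S. avg f p * (\<integral>x. \<bar>g x\<bar> * indicator (Q p) x \<partial>\<mu>)))
      + (\<integral>\<^sup>+x. ennreal (\<bar>Tleaf f x\<bar> * \<bar>g x\<bar>) * indicator (Q r) x \<partial>\<mu>)"
  using r
proof (induction "fst r" arbitrary: r rule: less_induct)
  case (less r)
  note [measurable] = BB_measurable[OF g] T_measurable[OF restr_BB[OF f]] Tleaf_measurable[OF f]
  define G where "G p = (\<integral>x. \<bar>g x\<bar> * indicator (Q p) x \<partial>\<mu>)" for p
  have G0: "0 \<le> G p" for p unfolding G_def by (rule integral_indicator_nonneg)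
  define W where "W S = sparse_const * (\<Sum>p\<in>S. avg f p * G p)" for S
  have W0: "0 \<le> W S" for S unfolding W_def using sparse_const_pos G0 avg_nonneg by (intro mult_nonneg_nonneg sum_nonneg) auto
  define lhs where "lhs p R = (\<integral>\<^sup>+x. ennreal (\<bar>T (restr f p) x\<bar> * \<bar>g x\<bar>) * indicator (Q R) x \<partial>\<mu>)" for p R
  define leaf where "leaf p = (\<integral>\<^sup>+x. ennreal (\<bar>Tleaf f x\<bar> * \<bar>g x\<bar>) * indicator (Q p) x \<partial>\<mu>)" for p
  define good where "good p S \<longleftrightarrow> sparse S \<and> (\<forall>q\<in>S. fst q \<le> fst p \<and> Q q \<subseteq> Q p) \<and> lhs p p \<le> ennreal (W S) + leaf p" for p S
  have zero: "good p {}" if "fst p = 0" for p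
  proof -
    have "lhs p p = leaf p"
    proof -
      have "p = (0, snd p)" using that by (simp add: prod_eq_iff)
      then obtain y where "p = (0, y)" by blast
      then show ?thesis
        unfolding lhs_def leaf_def by (intro nn_integral_cong) (simp add: Tleaf_def cube_def indicator_def)
    qed
    then show ?thesis by (simp add: good_def sparse_def)
  qed
  have "\<exists>S. good r S"
  proof (cases "fst r = 0 \<or> avg f r = 0")
    case True
    show ?thesis
    proof (cases "fst r = 0")
      case True then show ?thesis using zero by blast
    next
      case False
      then have "avg f r = 0" using True by simp
      then have "AE x in \<mu>. T (restr f r) x = 0"
        by (intro T_null restr_BB f) (simp add: integral_restr)
      then have "AE x in \<mu>. ennreal (\<bar>T (restr f r) x\<bar> * \<bar>g x\<bar>) * indicator (Q r) x = 0" by eventually_elim simp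
      then have "lhs r r = 0" unfolding lhs_def by (subst nn_integral_0_iff_AE) auto
      then have "good r {}" by (simp add: good_def sparse_def)
      then show ?thesis ..
    qed
  next
    case False
    then have lev: "0 < fst r" and pos: "0 < avg f r" using avg_nonneg[of f r] by auto
    from stopping_step[OF f less.prems pos lev]
    obtain P where P: "finite P" "disjoint_family_on Q P" "(\<Union>p\<in>P. Q p) = Q r"
      "\<forall>p\<in>P. snd p \<in> net (fst p) \<and> fst p < fst r"
      "measure \<mu> (\<Union>p\<in>{p\<in>P. 0 < fst p}. Q p) \<le> measure \<mu> (Q r) / 2"
      "\<forall>p\<in>P. AE x in \<mu>. x \<in> Q p \<longrightarrow> \<bar>T (restr f r) x\<bar> \<le> \<bar>T (restr f p) x\<bar> + sparse_const * avg f r"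
      by (elim exE conjE) (rule that)
    note Pnet = P(4)[rule_format] and Ploc = P(6)[rule_format]
    have "\<exists>S. good p S \<and> (fst p = 0 \<longrightarrow> S = {})" if p: "p \<in> P" for p
    proof (cases "fst p = 0")
      case True then show ?thesis using zero by blast
    next
      case False
      have "\<exists>S. good p S"
        unfolding good_def lhs_def leaf_def W_def G_def by (rule less.hyps) (use Pnet[OF p] in auto)
      then obtain S where "good p S" ..
      then show ?thesis using False by (intro exI[of _ S]) simp
    qed
    then have "\<forall>p\<in>P. \<exists>S. good p S \<and> (fst p = 0 \<longrightarrow> S = {})" ..
    from bchoice[OF this] obtain \<S> where \<S>0: "\<forall>p\<in>P. good p (\<S> p) \<and> (fst p = 0 \<longrightarrow> \<S> p = {})" ..
    have \<S>: "good p (\<S> p)" "fst p = 0 \<Longrightarrow> \<S> p = {}" if "p \<in> P" for p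
      using \<S>0 that by simp_all
    define S1 where "S1 = (\<Union>p\<in>P. \<S> p)"
    define S where "S = insert r S1"
    have sub: "fst q \<le> fst p" "Q q \<subseteq> Q p" "snd q \<in> net (fst q)" "fst q < fst r" "0 < fst p" if "p \<in> P" "q \<in> \<S> p" for p q
      using \<S>[OF that(1)] that Pnet[OF that(1)] by (auto simp: good_def sparse_def)
    have finS: "finite (\<S> p)" if "p \<in> P" for p using \<S>(1)[OF that] by (simp add: good_def sparse_def)
    have fin1: "finite S1" unfolding S1_def using P(1) finS by auto
    have dj\<S>: "\<S> p \<inter> \<S> p' = {}" if "p \<in> P" "p' \<in> P" "p \<noteq> p'" for p p'
    proof (rule ccontr)
      assume "\<S> p \<inter> \<S> p' \<noteq> {}"
      then obtain q where q: "q \<in> \<S> p" "q \<in> \<S> p'" by blast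
      have "snd q \<in> Q p" "snd q \<in> Q p'"
        using center_in_cube[OF sub(3)[OF that(1) q(1)]] sub(2)[OF that(1) q(1)] sub(2)[OF that(2) q(2)] by auto
      moreover have "Q p \<inter> Q p' = {}" using P(2) that by (auto simp: disjoint_family_on_def)
      ultimately show False by blast
    qed
    have finS': "finite S" using fin1 by (simp add: S_def)
    have rS1: "r \<notin> S1" using sub(4) less_irrefl[of "fst r"] unfolding S1_def by blast
    have sparse: "sparse S"
      unfolding sparse_def
    proof (intro conjI ballI)
      show "finite S" using fin1 by (simp add: S_def)
      fix p assume p: "p \<in> S"
      show "snd p \<in> net (fst p)" using p less.prems sub(3) by (auto simp: S_def S1_def)
      show "measure \<mu> (Q p) \<le> 2 * measure \<mu> (rest S p)"
      proof (cases "p = r")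
        case True
        let ?U = "\<Union>p\<in>{p\<in>P. 0 < fst p}. Q p"
        have Um: "?U \<in> sets borel" using P(1) by (intro sets.finite_UN) auto
        have "Q r - ?U \<subseteq> rest S r"
          using sub by (fastforce simp: rest_def S_def S1_def)
        then have "measure \<mu> (Q r - ?U) \<le> measure \<mu> (rest S r)"
          by (rule measure_mono_bounded[OF _ sets.Diff[OF cube_measurable Um] rest_measurable[OF finS'] rest_bounded])
        moreover have "measure \<mu> (Q r) \<le> measure \<mu> (Q r - ?U) + measure \<mu> ?U"
        proof -
          have "?U \<subseteq> Q r" using P(3) by blast
          then have "Q r = (Q r - ?U) \<union> ?U" by blast
          then have "measure \<mu> (Q r) = measure \<mu> ((Q r - ?U) \<union> ?U)" by simp
          also have "\<dots> \<le> measure \<mu> (Q r - ?U) + measure \<mu> ?U" by (rule measure_Un_le) (use Um in \<open>auto simp: sets_M\<close>)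
          finally show ?thesis .
        qed
        ultimately show ?thesis using P(5) True by simp
      next
        case False
        then obtain p0 where p0: "p0 \<in> P" "p \<in> \<S> p0" using p by (auto simp: S_def S1_def)
        have "rest (\<S> p0) p \<subseteq> rest S p"
        proof
          fix x assume x: "x \<in> rest (\<S> p0) p"
          have "x \<notin> Q q" if q: "q \<in> S" "fst q < fst p" for q
          proof
            assume xq: "x \<in> Q q"
            have "q \<noteq> r" using q(2) sub(4)[OF p0] by auto
            then obtain p1 where p1: "p1 \<in> P" "q \<in> \<S> p1" using q by (auto simp: S_def S1_def)
            have "x \<in> Q p0" "x \<in> Q p1" using x xq sub(2)[OF p0] sub(2)[OF p1] by (auto simp: rest_def)
            then have "p1 = p0" using P(2) p0(1) p1(1) by (auto simp: disjoint_family_on_def)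
            then show False using x xq p1 q by (auto simp: rest_def)
          qed
          then show "x \<in> rest S p" using x by (auto simp: rest_def)
        qed
        then have "measure \<mu> (rest (\<S> p0) p) \<le> measure \<mu> (rest S p)"
          by (rule measure_mono_bounded[OF _ rest_measurable[OF finS[OF p0(1)]] rest_measurable[OF finS'] rest_bounded])
        moreover have "measure \<mu> (Q p) \<le> 2 * measure \<mu> (rest (\<S> p0) p)"
          using \<S>(1)[OF p0(1)] p0(2) by (auto simp: good_def sparse_def)
        ultimately show ?thesis by simp
      qed
    qed
    have inr: "\<forall>q\<in>S. fst q \<le> fst r \<and> Q q \<subseteq> Q r"
    proof
      fix q assume "q \<in> S"
      then consider "q = r" | p where "p \<in> P" "q \<in> \<S> p" by (auto simp: S_def S1_def)
      then show "fst q \<le> fst r \<and> Q q \<subseteq> Q r"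
      proof cases
        case 2
        then have "Q q \<subseteq> Q p" "Q p \<subseteq> Q r" using sub(2) P(3) by blast+
        then show ?thesis using sub(4)[OF 2] by simp
      qed simp
    qed
    have step: "lhs r p \<le> lhs p p + ennreal (sparse_const * avg f r * G p)" if p: "p \<in> P" for p
    proof -
      have "lhs r p \<le> (\<integral>\<^sup>+x. ennreal (\<bar>T (restr f p) x\<bar> * \<bar>g x\<bar>) * indicator (Q p) x + ennreal (sparse_const * avg f r * (\<bar>g x\<bar> * indicator (Q p) x)) \<partial>\<mu>)"
        unfolding lhs_def
      proof (rule nn_integral_mono_AE)
        show "AE x in \<mu>. ennreal (\<bar>T (restr f r) x\<bar> * \<bar>g x\<bar>) * indicator (Q p) x \<le> ennreal (\<bar>T (restr f p) x\<bar> * \<bar>g x\<bar>) * indicator (Q p) x + ennreal (sparse_const * avg f r * (\<bar>g x\<bar> * indicator (Q p) x))"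
          using Ploc[OF p]
        proof eventually_elim
          case (elim x)
          show ?case
          proof (cases "x \<in> Q p")
            case True
            then have "\<bar>T (restr f r) x\<bar> * \<bar>g x\<bar> \<le> (\<bar>T (restr f p) x\<bar> + sparse_const * avg f r) * \<bar>g x\<bar>"
              using elim by (intro mult_right_mono) auto
            then have "ennreal (\<bar>T (restr f r) x\<bar> * \<bar>g x\<bar>) \<le> ennreal (\<bar>T (restr f p) x\<bar> * \<bar>g x\<bar> + sparse_const * avg f r * \<bar>g x\<bar>)"
              by (intro ennreal_leI) (simp add: distrib_right)
            also have "\<dots> = ennreal (\<bar>T (restr f p) x\<bar> * \<bar>g x\<bar>) + ennreal (sparse_const * avg f r * \<bar>g x\<bar>)"
              using sparse_const_pos avg_nonneg[of f r] by (intro ennreal_plus) auto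
            finally show ?thesis using True by simp
          qed simp
        qed
      qed
      also have "\<dots> = lhs p p + (\<integral>\<^sup>+x. ennreal (sparse_const * avg f r * (\<bar>g x\<bar> * indicator (Q p) x)) \<partial>\<mu>)"
        unfolding lhs_def by (rule nn_integral_add) measurable
      also have "(\<integral>\<^sup>+x. ennreal (sparse_const * avg f r * (\<bar>g x\<bar> * indicator (Q p) x)) \<partial>\<mu>) = ennreal (sparse_const * avg f r * G p)"
      proof -
        have "integrable \<mu> (\<lambda>x. sparse_const * avg f r * (\<bar>g x\<bar> * indicator (Q p) x))"
          by (intro BB_integrable BB_intros g cube_measurable)
        then show ?thesis
          using sparse_const_pos avg_nonneg[of f r] unfolding G_def by (subst nn_integral_eq_integral) auto
      qed
      finally show ?thesis .
    qed
    have "lhs r r = (\<Sum>p\<in>P. lhs r p)"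
      unfolding lhs_def P(3)[symmetric] by (intro nn_integral_disjoint_cubes P) measurable
    also have "\<dots> \<le> (\<Sum>p\<in>P. (ennreal (W (\<S> p)) + leaf p) + ennreal (sparse_const * avg f r * G p))"
    proof (rule sum_mono)
      fix p assume p: "p \<in> P"
      have "lhs p p \<le> ennreal (W (\<S> p)) + leaf p" using \<S>(1)[OF p] by (simp add: good_def)
      then show "lhs r p \<le> (ennreal (W (\<S> p)) + leaf p) + ennreal (sparse_const * avg f r * G p)"
        using step[OF p] by (meson add_right_mono order_trans)
    qed
    also have "\<dots> = ennreal (\<Sum>p\<in>P. W (\<S> p)) + (\<Sum>p\<in>P. leaf p) + ennreal (\<Sum>p\<in>P. sparse_const * avg f r * G p)"
      using W0 sparse_const_pos avg_nonneg[of f r] G0 by (simp add: sum.distrib sum_ennreal)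
    also have "(\<Sum>p\<in>P. leaf p) = leaf r"
      unfolding leaf_def P(3)[symmetric] by (intro nn_integral_disjoint_cubes[symmetric] P) measurable
    also have "(\<Sum>p\<in>P. W (\<S> p)) = W S1"
      unfolding W_def S1_def sum_distrib_left[symmetric]
      by (subst sum.UNION_disjoint) (use P(1) finS dj\<S> in auto)
    also have "(\<Sum>p\<in>P. sparse_const * avg f r * G p) = sparse_const * avg f r * G r"
      unfolding G_def sum_distrib_left[symmetric] P(3)[symmetric]
      by (subst sum_integrals_disjoint[OF g P(1,2)]) (auto intro: cube_measurable)
    also have "ennreal (W S1) + leaf r + ennreal (sparse_const * avg f r * G r) = ennreal (W S) + leaf r"
    proof -
      have "W S = W S1 + sparse_const * avg f r * G r" using rS1 fin1 by (simp add: W_def S_def algebra_simps)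
      moreover have "0 \<le> sparse_const * avg f r * G r" using sparse_const_pos avg_nonneg[of f r] G0[of r] by simp
      ultimately show ?thesis using W0[of S1] by (simp add: ennreal_plus add_ac)
    qed
    finally have "good r S" using sparse inr by (simp add: good_def)
    then show ?thesis ..
  qed
  then show ?case unfolding good_def lhs_def leaf_def W_def G_def by blast
qed

end

section \<open>Maximal functions of nested families\<close>

text \<open>
  The maximal sets of the family are disjoint. This makes the constant \<open>1\<close>, for every measure.
\<close>

lemma nested_weak_type:
  fixes G :: "'i \<Rightarrow> 'a set" and h :: "'a \<Rightarrow> real"
  assumes "finite I" "\<And>i. i \<in> I \<Longrightarrow> G i \<in> fmeasurable \<nu>"
    and "\<And>i j. i \<in> I \<Longrightarrow> j \<in> I \<Longrightarrow> G i \<inter> G j = {} \<or> G i \<subseteq> G j \<or> G j \<subseteq> G i"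
    and "integrable \<nu> h"
    and "\<And>i. i \<in> I \<Longrightarrow> c * measure \<nu> (G i) \<le> (\<integral>x. h x * indicator (G i) x \<partial>\<nu>)"
  shows "c * measure \<nu> (\<Union>i\<in>I. G i) \<le> (\<integral>x. h x * indicator (\<Union>i\<in>I. G i) x \<partial>\<nu>)"
  using assms
proof (induction I rule: finite_psubset_induct)
  case (psubset I)
  show ?case
  proof (cases "\<exists>i\<in>I. \<exists>j\<in>I. i \<noteq> j \<and> G i \<subseteq> G j")
    case True
    then obtain i j where ij: "i \<in> I" "j \<in> I" "i \<noteq> j" "G i \<subseteq> G j" by blast
    then have "(\<Union>k\<in>I. G k) = (\<Union>k\<in>I - {i}. G k)" by blast
    moreover have "I - {i} \<subset> I" using ij by blast
    ultimately show ?thesis using psubset.IH[of "I - {i}"] psubset.prems by simp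
  next
    case False
    have dj: "disjoint_family_on G I"
      unfolding disjoint_family_on_def
    proof (intro ballI impI)
      fix i j assume ij: "i \<in> I" "j \<in> I" "i \<noteq> j"
      show "G i \<inter> G j = {}" using psubset.prems(2)[OF ij(1,2)] False ij by metis
    qed
    have "c * measure \<nu> (\<Union>i\<in>I. G i) = (\<Sum>i\<in>I. c * measure \<nu> (G i))"
      using psubset.prems(1)
      by (subst measure_finite_Union[OF psubset.hyps(1) _ dj]) (auto simp: sum_distrib_left fmeasurableD2)
    also have "\<dots> \<le> (\<Sum>i\<in>I. \<integral>x. h x * indicator (G i) x \<partial>\<nu>)" by (intro sum_mono psubset.prems)
    also have "\<dots> = (\<integral>x. (\<Sum>i\<in>I. h x * indicator (G i) x) \<partial>\<nu>)"
      using psubset.prems(1,3) by (intro Bochner_Integration.integral_sum[symmetric] integrable_real_mult_indicator) auto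
    also have "\<dots> = (\<integral>x. h x * indicator (\<Union>i\<in>I. G i) x \<partial>\<nu>)"
      by (subst indicator_UN_disjoint[OF psubset.hyps(1) dj]) (simp add: sum_distrib_left)
    finally show ?thesis .
  qed
qed

text \<open>
  \<open>M\<close> is the maximal function, which assigns to \<open>x\<close> the largest \<open>a i\<close> with \<open>x \<in> G i\<close>. It is constructed by
  adding the sets in the order of decreasing \<open>a i\<close>. The last conjunct is Doob's inequality
  \<open>\<integral> M\<^sup>2 \<le> 2 * \<integral> h * M\<close> in a form that is stable in this induction: \<open>c\<close> is a lower bound of the values
  used so far, and lowering \<open>c\<close> is possible because \<open>nested_weak_type\<close> makes the right hand side decrease in \<open>c\<close>
  up to the least \<open>a i\<close>. The case \<open>c = 0\<close> is Doob's inequality.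
\<close>

lemma nested_maximal_function:
  fixes G :: "'i \<Rightarrow> 'a set" and h :: "'a \<Rightarrow> real" and a :: "'i \<Rightarrow> real"
  assumes "finite I" "\<And>i. i \<in> I \<Longrightarrow> G i \<in> fmeasurable \<nu>"
    and "\<And>i j. i \<in> I \<Longrightarrow> j \<in> I \<Longrightarrow> G i \<inter> G j = {} \<or> G i \<subseteq> G j \<or> G j \<subseteq> G i"
    and "integrable \<nu> h"
    and "\<And>i. i \<in> I \<Longrightarrow> 0 \<le> a i"
    and "\<And>i. i \<in> I \<Longrightarrow> a i * measure \<nu> (G i) \<le> (\<integral>x. h x * indicator (G i) x \<partial>\<nu>)"
  shows "\<exists>M. (\<forall>x. 0 \<le> M x) \<and> (\<forall>x. x \<notin> (\<Union>i\<in>I. G i) \<longrightarrow> M x = 0) \<and> (\<forall>i\<in>I. \<forall>x\<in>G i. a i \<le> M x) \<and>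
    integrable \<nu> (\<lambda>x. (M x)\<^sup>2) \<and> integrable \<nu> (\<lambda>x. h x * M x) \<and>
    (\<forall>c\<ge>0. (\<forall>i\<in>I. c \<le> a i) \<longrightarrow>
      (\<integral>x. (M x)\<^sup>2 \<partial>\<nu>) - 2 * (\<integral>x. h x * M x \<partial>\<nu>)
        \<le> c\<^sup>2 * measure \<nu> (\<Union>i\<in>I. G i) - 2 * c * (\<integral>x. h x * indicator (\<Union>i\<in>I. G i) x \<partial>\<nu>))"
  using assms
proof (induction I rule: finite_ranking_induct[where f = "\<lambda>i. - a i"])
  case empty
  show ?case by (intro exI[of _ "\<lambda>x. 0"]) simp
next
  case (insert k I)
  define \<Omega> where "\<Omega> = (\<Union>i\<in>I. G i)"
  define \<Omega>' where "\<Omega>' = (\<Union>i\<in>insert k I. G i)"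
  define Dk where "Dk = G k - \<Omega>"
  have "\<exists>M. (\<forall>x. 0 \<le> M x) \<and> (\<forall>x. x \<notin> \<Omega> \<longrightarrow> M x = 0) \<and> (\<forall>i\<in>I. \<forall>x\<in>G i. a i \<le> M x) \<and>
    integrable \<nu> (\<lambda>x. (M x)\<^sup>2) \<and> integrable \<nu> (\<lambda>x. h x * M x) \<and>
    (\<forall>c\<ge>0. (\<forall>i\<in>I. c \<le> a i) \<longrightarrow> (\<integral>x. (M x)\<^sup>2 \<partial>\<nu>) - 2 * (\<integral>x. h x * M x \<partial>\<nu>)
        \<le> c\<^sup>2 * measure \<nu> \<Omega> - 2 * c * (\<integral>x. h x * indicator \<Omega> x \<partial>\<nu>))"
    unfolding \<Omega>_def by (rule insert.IH; use insert.prems in simp)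
  then obtain M where M0: "\<forall>x. 0 \<le> M x" "\<forall>x. x \<notin> \<Omega> \<longrightarrow> M x = 0" "\<forall>i\<in>I. \<forall>x\<in>G i. a i \<le> M x"
    and M: "integrable \<nu> (\<lambda>x. (M x)\<^sup>2)" "integrable \<nu> (\<lambda>x. h x * M x)"
    and Mc: "\<forall>c\<ge>0. (\<forall>i\<in>I. c \<le> a i) \<longrightarrow> (\<integral>x. (M x)\<^sup>2 \<partial>\<nu>) - 2 * (\<integral>x. h x * M x \<partial>\<nu>)
        \<le> c\<^sup>2 * measure \<nu> \<Omega> - 2 * c * (\<integral>x. h x * indicator \<Omega> x \<partial>\<nu>)"
    by (elim exE conjE) (rule that)
  note M1 = M0(1)[rule_format] and M2 = M0(2)[rule_format] and M3 = M0(3)[rule_format]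
  have Gk: "G k \<in> fmeasurable \<nu>" and GI: "\<And>i. i \<in> I \<Longrightarrow> G i \<in> fmeasurable \<nu>" using insert.prems by auto
  have \<Omega>f: "\<Omega> \<in> fmeasurable \<nu>" unfolding \<Omega>_def by (intro fmeasurable.finite_UN insert.hyps GI)
  have Df: "Dk \<in> fmeasurable \<nu>" unfolding Dk_def by (intro fmeasurable.Diff Gk \<Omega>f)
  have [measurable]: "Dk \<in> sets \<nu>" "\<Omega> \<in> sets \<nu>" using Df \<Omega>f by auto
  have \<Omega>'eq: "\<Omega>' = \<Omega> \<union> Dk" and dj: "\<Omega> \<inter> Dk = {}" by (auto simp: \<Omega>'_def \<Omega>_def Dk_def)
  have ak: "0 \<le> a k" "\<And>i. i \<in> I \<Longrightarrow> a k \<le> a i" using insert.prems insert.hyps by auto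
  have hD: "integrable \<nu> (\<lambda>x. h x * indicator Dk x)" by (intro integrable_real_mult_indicator insert.prems) auto
  have h\<Omega>: "integrable \<nu> (\<lambda>x. h x * indicator \<Omega> x)" by (intro integrable_real_mult_indicator insert.prems) auto
  have iD: "integrable \<nu> (indicator Dk :: 'a \<Rightarrow> real)" using Df by (simp add: fmeasurable_def)
  define H where "H = (\<integral>x. h x * indicator \<Omega> x \<partial>\<nu>)"
  define HD where "HD = (\<integral>x. h x * indicator Dk x \<partial>\<nu>)"
  define v where "v = measure \<nu> \<Omega>"
  define vD where "vD = measure \<nu> Dk"
  have H': "(\<integral>x. h x * indicator \<Omega>' x \<partial>\<nu>) = H + HD"
  proof -
    have "h x * indicator \<Omega>' x = h x * indicator \<Omega> x + h x * indicator Dk x" for x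
      using dj by (auto simp: \<Omega>'eq indicator_def)
    then show ?thesis using hD h\<Omega> by (simp add: H_def HD_def)
  qed
  have v': "measure \<nu> \<Omega>' = v + vD"
    unfolding \<Omega>'eq v_def vD_def using \<Omega>f Df dj by (intro measure_Union) (auto simp: fmeasurableD2)
  have weak: "a k * (v + vD) \<le> H + HD"
    unfolding v'[symmetric] H'[symmetric] \<Omega>'_def
  proof (rule nested_weak_type)
    show "a k * measure \<nu> (G i) \<le> (\<integral>x. h x * indicator (G i) x \<partial>\<nu>)" if "i \<in> insert k I" for i
    proof -
      have "a k * measure \<nu> (G i) \<le> a i * measure \<nu> (G i)" using that ak by (intro mult_right_mono) auto
      also have "\<dots> \<le> (\<integral>x. h x * indicator (G i) x \<partial>\<nu>)" using insert.prems(5) that by blast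
      finally show ?thesis .
    qed
  qed (use insert.prems insert.hyps in auto)
  define M' where "M' x = M x + a k * indicator Dk x" for x
  have M'sq: "(M' x)\<^sup>2 = (M x)\<^sup>2 + (a k)\<^sup>2 * indicator Dk x" for x
  proof (cases "x \<in> Dk")
    case True
    then have "M x = 0" using M2[of x] dj by blast
    then show ?thesis using True by (simp add: M'_def)
  qed (simp add: M'_def)
  have M'h: "h x * M' x = h x * M x + a k * (h x * indicator Dk x)" for x
    by (simp add: M'_def distrib_left)
  have int1: "(\<integral>x. (M' x)\<^sup>2 \<partial>\<nu>) = (\<integral>x. (M x)\<^sup>2 \<partial>\<nu>) + (a k)\<^sup>2 * vD"
    unfolding M'sq using M(1) iD by (simp add: vD_def)
  have int2: "(\<integral>x. h x * M' x \<partial>\<nu>) = (\<integral>x. h x * M x \<partial>\<nu>) + a k * HD"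
    unfolding M'h using M(2) hD by (simp add: HD_def)
  have r6: "(\<integral>x. (M' x)\<^sup>2 \<partial>\<nu>) - 2 * (\<integral>x. h x * M' x \<partial>\<nu>) \<le> c\<^sup>2 * (v + vD) - 2 * c * (H + HD)"
    if c: "0 \<le> c" "\<forall>i\<in>insert k I. c \<le> a i" for c
  proof -
    have "(\<integral>x. (M x)\<^sup>2 \<partial>\<nu>) - 2 * (\<integral>x. h x * M x \<partial>\<nu>) \<le> (a k)\<^sup>2 * v - 2 * a k * H"
      unfolding v_def H_def by (rule Mc[rule_format]) (use ak in auto)
    then have "(\<integral>x. (M' x)\<^sup>2 \<partial>\<nu>) - 2 * (\<integral>x. h x * M' x \<partial>\<nu>) \<le> (a k)\<^sup>2 * (v + vD) - 2 * a k * (H + HD)"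
      unfolding int1 int2 by (simp add: algebra_simps)
    also have "\<dots> \<le> c\<^sup>2 * (v + vD) - 2 * c * (H + HD)"
    proof -
      have "0 \<le> (a k - c) * (2 * ((H + HD) - a k * (v + vD)) + (a k - c) * (v + vD))"
        using c weak by (intro mult_nonneg_nonneg add_nonneg_nonneg) (auto simp: v_def vD_def)
      then show ?thesis by (simp add: power2_eq_square algebra_simps)
    qed
    finally show ?thesis .
  qed
  have r3: "a i \<le> M' x" if "i \<in> insert k I" "x \<in> G i" for i x
  proof (cases "i \<in> I")
    case True
    then have "a i \<le> M x" using M3 that by blast
    also have "\<dots> \<le> M' x" using ak(1) by (simp add: M'_def)
    finally show ?thesis .
  next
    case False
    then have ik: "i = k" using that by simp
    show ?thesis
    proof (cases "x \<in> \<Omega>")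
      case True
      then obtain j where j: "j \<in> I" "x \<in> G j" by (auto simp: \<Omega>_def)
      have "a k \<le> a j" by (rule ak(2)[OF j(1)])
      also have "\<dots> \<le> M x" by (rule M3[OF j])
      also have "\<dots> \<le> M' x" using ak(1) by (simp add: M'_def)
      finally show ?thesis by (simp add: ik)
    next
      case False
      then have "x \<in> Dk" using that ik by (simp add: Dk_def)
      then show ?thesis using M1[of x] by (simp add: M'_def ik)
    qed
  qed
  have r4: "integrable \<nu> (\<lambda>x. (M' x)\<^sup>2)" unfolding M'sq using M(1) iD by simp
  have r5: "integrable \<nu> (\<lambda>x. h x * M' x)" unfolding M'h using M(2) hD by simp
  have r1: "0 \<le> M' x" for x using M1[of x] ak(1) by (simp add: M'_def)
  have r2: "M' x = 0" if "x \<notin> \<Omega>'" for x using that M2[of x] by (simp add: M'_def \<Omega>'eq)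
  show ?case
    unfolding \<Omega>'_def[symmetric]
  proof (intro exI[of _ M'] conjI allI ballI impI)
    fix c :: real assume "0 \<le> c" "\<forall>i\<in>insert k I. c \<le> a i"
    then show "(\<integral>x. (M' x)\<^sup>2 \<partial>\<nu>) - 2 * (\<integral>x. h x * M' x \<partial>\<nu>)
        \<le> c\<^sup>2 * measure \<nu> \<Omega>' - 2 * c * (\<integral>x. h x * indicator \<Omega>' x \<partial>\<nu>)"
      unfolding v' H' by (rule r6)
  qed (simp_all add: r1 r2 r3 r4 r5)
qed

text \<open>
  On \<open>E i\<close> the maximal function is at least \<open>a i\<close>, and by Doob's inequality its \<open>L\<^sup>2\<close> norm is at most twice the
  norm of \<open>h\<close>. The constant is the same for every measure, so \<open>\<nu>\<close> may be weighted.
\<close>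

lemma carleson_embedding:
  fixes G E :: "'i \<Rightarrow> 'a set" and h :: "'a \<Rightarrow> real" and a :: "'i \<Rightarrow> real"
  assumes I: "finite I" "\<And>i. i \<in> I \<Longrightarrow> G i \<in> fmeasurable \<nu>"
    and nested: "\<And>i j. i \<in> I \<Longrightarrow> j \<in> I \<Longrightarrow> G i \<inter> G j = {} \<or> G i \<subseteq> G j \<or> G j \<subseteq> G i"
    and h: "integrable \<nu> h" "integrable \<nu> (\<lambda>x. (h x)\<^sup>2)"
    and a: "\<And>i. i \<in> I \<Longrightarrow> 0 \<le> a i"
      "\<And>i. i \<in> I \<Longrightarrow> a i * measure \<nu> (G i) \<le> (\<integral>x. h x * indicator (G i) x \<partial>\<nu>)"
    and E: "disjoint_family_on E I" "\<And>i. i \<in> I \<Longrightarrow> E i \<in> sets \<nu>" "\<And>i. i \<in> I \<Longrightarrow> E i \<subseteq> G i"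
  shows "(\<Sum>i\<in>I. (a i)\<^sup>2 * measure \<nu> (E i)) \<le> 4 * (\<integral>x. (h x)\<^sup>2 \<partial>\<nu>)"
proof -
  have "\<exists>M. (\<forall>x. 0 \<le> M x) \<and> (\<forall>x. x \<notin> (\<Union>i\<in>I. G i) \<longrightarrow> M x = 0) \<and> (\<forall>i\<in>I. \<forall>x\<in>G i. a i \<le> M x) \<and>
    integrable \<nu> (\<lambda>x. (M x)\<^sup>2) \<and> integrable \<nu> (\<lambda>x. h x * M x) \<and>
    (\<forall>c\<ge>0. (\<forall>i\<in>I. c \<le> a i) \<longrightarrow>
      (\<integral>x. (M x)\<^sup>2 \<partial>\<nu>) - 2 * (\<integral>x. h x * M x \<partial>\<nu>)
        \<le> c\<^sup>2 * measure \<nu> (\<Union>i\<in>I. G i) - 2 * c * (\<integral>x. h x * indicator (\<Union>i\<in>I. G i) x \<partial>\<nu>))"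
    by (rule nested_maximal_function; fact I nested h a)
  then obtain M where M: "\<forall>x. 0 \<le> M x" "\<forall>i\<in>I. \<forall>x\<in>G i. a i \<le> M x"
    "integrable \<nu> (\<lambda>x. (M x)\<^sup>2)" "integrable \<nu> (\<lambda>x. h x * M x)"
    "\<forall>c\<ge>0. (\<forall>i\<in>I. c \<le> a i) \<longrightarrow>
      (\<integral>x. (M x)\<^sup>2 \<partial>\<nu>) - 2 * (\<integral>x. h x * M x \<partial>\<nu>)
        \<le> c\<^sup>2 * measure \<nu> (\<Union>i\<in>I. G i) - 2 * c * (\<integral>x. h x * indicator (\<Union>i\<in>I. G i) x \<partial>\<nu>)"
    by (elim exE conjE) (rule that)
  have Ef: "E i \<in> fmeasurable \<nu>" if "i \<in> I" for i
    by (rule fmeasurableI2[OF I(2)[OF that] E(3)[OF that] E(2)[OF that]])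
  have iE: "integrable \<nu> (indicator (E i) :: 'a \<Rightarrow> real)" if "i \<in> I" for i
    using Ef[OF that] by (simp add: fmeasurable_def)
  have "(\<Sum>i\<in>I. (a i)\<^sup>2 * measure \<nu> (E i)) = (\<Sum>i\<in>I. \<integral>x. (a i)\<^sup>2 * indicator (E i) x \<partial>\<nu>)"
    using E(2) sets.sets_into_space by (intro sum.cong refl) (simp add: Int_absorb2)
  also have "\<dots> = (\<integral>x. (\<Sum>i\<in>I. (a i)\<^sup>2 * indicator (E i) x) \<partial>\<nu>)"
    using iE by (intro Bochner_Integration.integral_sum[symmetric] integrable_mult_right) auto
  also have "\<dots> \<le> (\<integral>x. (M x)\<^sup>2 \<partial>\<nu>)"
  proof (rule integral_mono)
    show "integrable \<nu> (\<lambda>x. \<Sum>i\<in>I. (a i)\<^sup>2 * indicator (E i) x)"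
      using iE by (intro Bochner_Integration.integrable_sum integrable_mult_right) auto
    show "(\<Sum>i\<in>I. (a i)\<^sup>2 * indicator (E i) x) \<le> (M x)\<^sup>2" for x
    proof (cases "\<exists>i\<in>I. x \<in> E i")
      case True
      then obtain i where i: "i \<in> I" "x \<in> E i" by blast
      have "(\<Sum>i\<in>I. (a i)\<^sup>2 * indicator (E i) x) = (a i)\<^sup>2"
        by (rule sum_indicator_disjoint[where F = "\<lambda>i. (a i)\<^sup>2", OF I(1) E(1) i])
      also have "\<dots> \<le> (M x)\<^sup>2" using M(2) i E(3)[OF i(1)] a(1)[OF i(1)] by (intro power_mono) auto
      finally show ?thesis .
    next
      case False
      then have "(\<Sum>i\<in>I. (a i)\<^sup>2 * indicator (E i) x) = 0" by (intro sum.neutral) auto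
      then show ?thesis by simp
    qed
  qed fact
  also have "(\<integral>x. (M x)\<^sup>2 \<partial>\<nu>) \<le> 4 * (\<integral>x. (h x)\<^sup>2 \<partial>\<nu>)"
  proof -
    have "(\<integral>x. (M x)\<^sup>2 \<partial>\<nu>) \<le> 2 * (\<integral>x. h x * M x \<partial>\<nu>)" using M(5)[rule_format, of 0] a(1) by simp
    also have "\<dots> = (\<integral>x. 2 * (h x * M x) \<partial>\<nu>)" by simp
    also have "\<dots> \<le> (\<integral>x. 2 * (h x)\<^sup>2 + (M x)\<^sup>2 / 2 \<partial>\<nu>)"
    proof (rule integral_mono)
      show "2 * (h x * M x) \<le> 2 * (h x)\<^sup>2 + (M x)\<^sup>2 / 2" for x
        using zero_le_power2[of "2 * h x - M x"] by (simp add: power2_eq_square algebra_simps)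
    qed (use M(3,4) h in auto)
    also have "\<dots> = 2 * (\<integral>x. (h x)\<^sup>2 \<partial>\<nu>) + (\<integral>x. (M x)\<^sup>2 \<partial>\<nu>) / 2" using M(3) h by simp
    finally show ?thesis by simp
  qed
  finally show ?thesis .
qed

text \<open>
  Greedy colouring of a graph with degrees less than \<open>n\<close>.
\<close>

lemma finite_coloring:
  assumes "finite V" "\<And>u v. R u v \<Longrightarrow> R v u" "\<And>v. v \<in> V \<Longrightarrow> card {u \<in> V. u \<noteq> v \<and> R u v} < (n::nat)"
  shows "\<exists>c. (\<forall>v\<in>V. c v < n) \<and> (\<forall>u\<in>V. \<forall>v\<in>V. u \<noteq> v \<and> R u v \<longrightarrow> c u \<noteq> c v)"
  using assms(1,3)
proof (induction V rule: finite_induct)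
  case (insert v V)
  have "card {u \<in> V. u \<noteq> w \<and> R u w} < n" if "w \<in> V" for w
  proof -
    have "card {u \<in> V. u \<noteq> w \<and> R u w} \<le> card {u \<in> insert v V. u \<noteq> w \<and> R u w}"
      using insert.hyps by (intro card_mono) auto
    also have "\<dots> < n" using insert.prems[of w] that by simp
    finally show ?thesis .
  qed
  then have "\<exists>c. (\<forall>v\<in>V. c v < n) \<and> (\<forall>u\<in>V. \<forall>v\<in>V. u \<noteq> v \<and> R u v \<longrightarrow> c u \<noteq> c v)" by (rule insert.IH)
  then obtain c where c: "\<forall>v\<in>V. c v < n" "\<forall>u\<in>V. \<forall>v\<in>V. u \<noteq> v \<and> R u v \<longrightarrow> c u \<noteq> c v"
    by (elim exE conjE) (rule that)
  define N where "N = {u \<in> insert v V. u \<noteq> v \<and> R u v}"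
  have "finite N" using insert.hyps by (simp add: N_def)
  then have "card (c ` N) < n" using card_image_le[of N c] insert.prems[of v] by (simp add: N_def)
  have "\<not> {..<n} \<subseteq> c ` N"
  proof
    assume "{..<n} \<subseteq> c ` N"
    then have "card {..<n} \<le> card (c ` N)" using \<open>finite N\<close> by (intro card_mono) auto
    then show False using \<open>card (c ` N) < n\<close> by simp
  qed
  then obtain k where k: "k < n" "k \<notin> c ` N" by auto
  have kn: "c u \<noteq> k" if "u \<in> V" "u \<noteq> v" "R u v" for u using k(2) that by (auto simp: N_def)
  show ?case
  proof (intro exI[of _ "c(v := k)"] conjI ballI impI)
    fix u assume "u \<in> insert v V" then show "(c(v := k)) u < n" using c(1) k(1) by auto
  next
    fix u u' assume *: "u \<in> insert v V" "u' \<in> insert v V" "u \<noteq> u' \<and> R u u'"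
    then show "(c(v := k)) u \<noteq> (c(v := k)) u'"
      using c(2) kn[of u] kn[of u'] assms(2)[of u u'] insert.hyps by auto
  qed
qed simp

section \<open>Nested neighbourhoods of the dilated cubes\<close>

context cz_operator begin

definition ncol :: nat where "ncol = nat \<lfloor>D ^ (\<kappa> + 6)\<rfloor> + 1"

end

context cz_grid begin

text \<open>
  The separation is twice the radius in \<open>adj_subset\<close>, so that neighbourhoods of cubes of equal level are
  disjoint.
\<close>

definition spread :: "(nat \<times> 'a) set \<Rightarrow> bool" where
  "spread S \<longleftrightarrow> (\<forall>p\<in>S. \<forall>q\<in>S. p \<noteq> q \<longrightarrow> fst p = fst q \<longrightarrow> 2 ^ (\<kappa> + 3) * rad (fst p) \<le> dist (snd p) (snd q))"

lemma split_into_spread: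
  assumes S: "finite S" "\<And>p. p \<in> S \<Longrightarrow> snd p \<in> net (fst p)"
  shows "\<exists>c. (\<forall>p\<in>S. c p < ncol) \<and> (\<forall>k. spread {p \<in> S. c p = k})"
proof -
  define R where "R p q \<longleftrightarrow> fst p = fst q \<and> dist (snd p) (snd q) < 2 ^ (\<kappa> + 3) * rad (fst p)" for p q :: "nat \<times> 'a"
  have "\<exists>c. (\<forall>p\<in>S. c p < ncol) \<and> (\<forall>p\<in>S. \<forall>q\<in>S. p \<noteq> q \<and> R p q \<longrightarrow> c p \<noteq> c q)"
  proof (rule finite_coloring[OF S(1)])
    show "R q p" if "R p q" for p q using that by (auto simp: R_def dist_commute)
    fix p assume p: "p \<in> S"
    define N where "N = net (fst p) \<inter> ball (snd p) (2 ^ (\<kappa> + 3) * rad (fst p))"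
    have sep: "separated (rad (fst p)) N" using net_separated[of "fst p"] by (auto simp: separated_def N_def)
    have N: "finite N \<and> card N \<le> nat \<lfloor>D ^ (\<kappa> + 3 + 3)\<rfloor>"
      by (rule packing[OF rad_pos sep]) (auto simp: N_def)
    have "{q \<in> S. q \<noteq> p \<and> R q p} \<subseteq> Pair (fst p) ` N"
    proof
      fix q assume "q \<in> {q \<in> S. q \<noteq> p \<and> R q p}"
      then have "q \<in> S" "fst q = fst p" "dist (snd p) (snd q) < 2 ^ (\<kappa> + 3) * rad (fst p)"
        by (auto simp: R_def dist_commute)
      then have "snd q \<in> N" "q = (fst p, snd q)" using S(2)[of q] by (auto simp: N_def prod_eq_iff)
      then show "q \<in> Pair (fst p) ` N" by blast
    qed
    then have "card {q \<in> S. q \<noteq> p \<and> R q p} \<le> card (Pair (fst p) ` N)" using N by (intro card_mono) auto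
    also have "\<dots> \<le> card N" using N by (intro card_image_le) auto
    also have "\<dots> < ncol" using N by (simp add: ncol_def add.commute)
    finally show "card {q \<in> S. q \<noteq> p \<and> R q p} < ncol" .
  qed
  then obtain c where c: "\<forall>p\<in>S. c p < ncol" "\<forall>p\<in>S. \<forall>q\<in>S. p \<noteq> q \<and> R p q \<longrightarrow> c p \<noteq> c q"
    by (elim exE conjE) (rule that)
  then have "spread {p \<in> S. c p = k}" for k unfolding spread_def R_def by force
  then show ?thesis using c(1) by blast
qed

text \<open>
  A point is chained to \<open>p\<close> if it is in the dilate of \<open>p\<close> or in the neighbourhood of a smaller cube of the
  family that meets this dilate. By absorbing all of these neighbourhoods, the neighbourhoods
  become nested, and as the scales decrease geometrically they remain comparable with the dilates.
\<close>

inductive chained :: "(nat \<times> 'a) set \<Rightarrow> nat \<times> 'a \<Rightarrow> 'a \<Rightarrow> bool" for S where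
  base: "x \<in> big p \<Longrightarrow> chained S p x"
| step: "q \<in> S \<Longrightarrow> fst q < fst p \<Longrightarrow> chained S q u \<Longrightarrow> u \<in> big p \<Longrightarrow> chained S q x \<Longrightarrow> chained S p x"

definition adj :: "(nat \<times> 'a) set \<Rightarrow> nat \<times> 'a \<Rightarrow> 'a set" where "adj S p = {x. chained S p x}"

lemma adj_eq: "adj S p = big p \<union> (\<Union>q\<in>{q\<in>S. fst q < fst p \<and> adj S q \<inter> big p \<noteq> {}}. adj S q)"
proof
  show "adj S p \<subseteq> big p \<union> (\<Union>q\<in>{q\<in>S. fst q < fst p \<and> adj S q \<inter> big p \<noteq> {}}. adj S q)"
  proof
    fix x assume "x \<in> adj S p"
    then have "chained S p x" by (simp add: adj_def)
    then show "x \<in> big p \<union> (\<Union>q\<in>{q\<in>S. fst q < fst p \<and> adj S q \<inter> big p \<noteq> {}}. adj S q)"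
    proof cases
      case (step q u)
      then have "q \<in> {q\<in>S. fst q < fst p \<and> adj S q \<inter> big p \<noteq> {}}" "x \<in> adj S q"
        by (auto simp: adj_def)
      then show ?thesis by blast
    qed simp
  qed
  show "big p \<union> (\<Union>q\<in>{q\<in>S. fst q < fst p \<and> adj S q \<inter> big p \<noteq> {}}. adj S q) \<subseteq> adj S p"
    by (auto simp: adj_def intro: chained.intros)
qed

lemma big_adj: "big p \<subseteq> adj S p" using adj_eq by blast

lemma adj_absorb: "q \<in> S \<Longrightarrow> fst q < fst p \<Longrightarrow> adj S q \<inter> big p \<noteq> {} \<Longrightarrow> adj S q \<subseteq> adj S p"
  by (subst (2) adj_eq) blast

lemma adj_open: "open (adj S p)"
proof (induction "fst p" arbitrary: p rule: less_induct)
  case less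
  show ?case by (subst adj_eq) (use less in \<open>auto simp: big_def intro!: open_Un open_UN\<close>)
qed

lemma adj_subset: "adj S p \<subseteq> ball (snd p) (2 ^ (\<kappa> + 2) * rad (fst p))"
proof (induction "fst p" arbitrary: p rule: less_induct)
  case (less p)
  define k where "k = (2::real) ^ \<kappa>"
  have kr: "0 < k * rad i" for i using rad_pos[of i] by (simp add: k_def)
  show ?case
  proof
    fix x assume "x \<in> adj S p"
    then consider "x \<in> big p" | q where "q \<in> S" "fst q < fst p" "adj S q \<inter> big p \<noteq> {}" "x \<in> adj S q"
      using adj_eq[of S p] by blast
    then show "x \<in> ball (snd p) (2 ^ (\<kappa> + 2) * rad (fst p))"
    proof cases
      case 1
      then show ?thesis using kr[of "fst p"] by (simp add: big_def k_def)
    next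
      case 2
      then obtain u where u: "u \<in> adj S q" "u \<in> big p" by blast
      have "dist (snd q) x < 4 * (k * rad (fst q))" "dist (snd q) u < 4 * (k * rad (fst q))"
        using less[OF 2(2)] 2(4) u(1) by (auto simp: k_def power_add mult_ac)
      moreover have "dist (snd p) u < 2 * (k * rad (fst p))" using u(2) by (simp add: big_def k_def)
      moreover have "k * (16 * rad (fst q)) \<le> k * rad (fst p)"
        using rad_less[OF 2(2)] by (intro mult_left_mono) (auto simp: k_def)
      moreover have "dist (snd p) x \<le> dist (snd p) u + (dist (snd q) u + dist (snd q) x)"
        using dist_triangle[of "snd p" x u] dist_triangle3[of u x "snd q"] by linarith
      ultimately have "dist (snd p) x < 4 * (k * rad (fst p))" using kr[of "fst p"] by linarith
      then show ?thesis by (simp add: k_def power_add mult_ac)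
    qed
  qed
qed

text \<open>
  Let the neighbourhoods of a cube \<open>p\<close> and of a smaller cube \<open>q\<close> meet. If they meet in the dilate of \<open>p\<close>,
  then \<open>q\<close> has been absorbed. Otherwise they meet in the neighbourhood of an absorbed cube \<open>q'\<close>, and by
  induction this contains the neighbourhood of \<open>q\<close> or is contained in it; in the latter case the
  neighbourhood of \<open>q\<close> meets the dilate of \<open>p\<close>, too, and has been absorbed.
\<close>

lemma adj_nested:
  assumes S: "spread S"
  shows "p \<in> S \<Longrightarrow> q \<in> S \<Longrightarrow> fst q \<le> fst p \<Longrightarrow> adj S p \<inter> adj S q \<noteq> {} \<Longrightarrow> adj S q \<subseteq> adj S p"
proof (induction "fst p" arbitrary: p q rule: less_induct)
  case (less p q)
  obtain u where u: "u \<in> adj S p" "u \<in> adj S q" using less.prems by blast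
  show ?case
  proof (cases "fst q = fst p")
    case True
    have "dist (snd p) u < 2 ^ (\<kappa> + 2) * rad (fst p)" "dist (snd q) u < 2 ^ (\<kappa> + 2) * rad (fst p)"
      using adj_subset[of S p] adj_subset[of S q] u True by auto
    then have "dist (snd p) (snd q) < 2 ^ (\<kappa> + 3) * rad (fst p)"
      using dist_triangle2[of "snd p" "snd q" u] by (simp add: power_add)
    then have "p = q" using S less.prems(1,2) True unfolding spread_def by (metis not_le)
    then show ?thesis by simp
  next
    case False
    then have lt: "fst q < fst p" using less.prems(3) by simp
    from u(1) consider "u \<in> big p" | q' where "q' \<in> S" "fst q' < fst p" "adj S q' \<inter> big p \<noteq> {}" "u \<in> adj S q'"
      using adj_eq[of S p] by blast
    then show ?thesis
    proof cases
      case 1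
      then show ?thesis using u(2) by (intro adj_absorb less.prems lt) auto
    next
      case 2
      have sub: "adj S q' \<subseteq> adj S p" by (rule adj_absorb[OF 2(1-3)])
      show ?thesis
      proof (cases "fst q \<le> fst q'")
        case True
        have "adj S q \<subseteq> adj S q'" using less.hyps[OF 2(2,1) less.prems(2) True] u(2) 2(4) by blast
        with sub show ?thesis by blast
      next
        case False
        have "adj S q' \<subseteq> adj S q" using less.hyps[OF lt less.prems(2) 2(1)] False u(2) 2(4) by auto
        then have "adj S q \<inter> big p \<noteq> {}" using 2(3) by blast
        then show ?thesis by (intro adj_absorb less.prems lt)
      qed
    qed
  qed
qed

end

section \<open>Weighted bound for sparse forms\<close>

text \<open>
  The inequality of Cauchy and Schwarz from its version with a parameter, including that neither of
  the factors vanishes.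
\<close>

lemma am_gm_positive:
  fixes p q v :: real
  assumes "0 \<le> p" "0 \<le> q" "0 < v" and le: "\<And>\<theta>. 0 < \<theta> \<Longrightarrow> 2 * v \<le> \<theta> * p + q / \<theta>"
  shows "0 < p" "0 < q" "v * v \<le> q * p"
proof -
  have "p \<noteq> 0"
  proof
    assume "p = 0"
    then have "2 * v \<le> q / ((q + 1) / v)" using le[of "(q + 1) / v"] assms by simp
    also have "\<dots> \<le> v" using assms by (simp add: field_simps)
    finally show False using assms by simp
  qed
  then show p: "0 < p" using assms(1) by simp
  have "q \<noteq> 0"
  proof
    assume "q = 0"
    then have "2 * v \<le> v / (p + 1) * p" using le[of "v / (p + 1)"] assms by simp
    also have "\<dots> \<le> v" using assms by (simp add: field_simps)
    finally show False using assms by simp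
  qed
  then show "0 < q" using assms(2) by simp
  have "2 * v \<le> (v / p) * p + q / (v / p)" using le[of "v / p"] assms(3) p by simp
  then show "v * v \<le> q * p" using assms(3) p by (simp add: field_simps)
qed

text \<open>
  The weight is positive everywhere and not only almost everywhere, so that the division by \<open>w\<close>
  needs no exceptional set. \<open>W\<close> stands for the constant \<open>[w]\<close>.
\<close>

locale a2_weight = doubling_space \<mu> D for \<mu> :: "'a::metric_space measure" and D +
  fixes w :: "'a \<Rightarrow> real" and W :: real
  assumes w_measurable [measurable]: "w \<in> borel_measurable borel"
    and w_pos: "0 < w x"
    and w_finite: "emeasure (density \<mu> (\<lambda>x. ennreal (w x))) (ball x r) < \<infinity>"
    and i_finite: "emeasure (density \<mu> (\<lambda>x. ennreal (inverse (w x)))) (ball x r) < \<infinity>"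
    and a2: "0 < r \<Longrightarrow> measure (density \<mu> (\<lambda>x. ennreal (w x))) (ball x r) *
      measure (density \<mu> (\<lambda>x. ennreal (inverse (w x)))) (ball x r) \<le> W * (measure \<mu> (ball x r))\<^sup>2"
begin

abbreviation \<mu>w :: "'a measure" where "\<mu>w \<equiv> density \<mu> (\<lambda>x. ennreal (w x))"
abbreviation \<mu>i :: "'a measure" where "\<mu>i \<equiv> density \<mu> (\<lambda>x. ennreal (inverse (w x)))"

sublocale mw: borel_ball_finite \<mu>w by unfold_locales (use w_finite in \<open>simp_all add: sets_M\<close>)
sublocale mi: borel_ball_finite \<mu>i by unfold_locales (use i_finite in \<open>simp_all add: sets_M\<close>)

lemma am_gm:
  assumes "0 < \<theta>" shows "2 * (a * b) \<le> \<theta> * a\<^sup>2 * inverse (w x) + b\<^sup>2 / \<theta> * w x"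
proof -
  define s where "s = \<theta> * inverse (w x)"
  have s: "0 < s" using assms w_pos by (simp add: s_def)
  have "0 \<le> (s * a - b)\<^sup>2 / s" using s by simp
  also have "\<dots> = s * a\<^sup>2 - 2 * (a * b) + b\<^sup>2 / s"
    using s by (simp add: power2_eq_square field_simps)
  finally show ?thesis using w_pos[of x] assms by (simp add: s_def field_simps)
qed

lemma integral_mw:
  fixes f :: "'a \<Rightarrow> real"
  assumes "f \<in> borel_measurable borel"
  shows "integral\<^sup>L \<mu>w f = (\<integral>x. w x * f x \<partial>\<mu>)" "integrable \<mu>w f \<longleftrightarrow> integrable \<mu> (\<lambda>x. w x * f x)"
  using assms w_pos by (auto simp: integral_density integrable_density less_imp_le)

lemma integral_mi:
  fixes f :: "'a \<Rightarrow> real"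
  assumes "f \<in> borel_measurable borel"
  shows "integral\<^sup>L \<mu>i f = (\<integral>x. inverse (w x) * f x \<partial>\<mu>)" "integrable \<mu>i f \<longleftrightarrow> integrable \<mu> (\<lambda>x. inverse (w x) * f x)"
  using assms w_pos by (auto simp: integral_density integrable_density less_imp_le)

lemma am_gm_measure:
  assumes "0 < \<theta>" "E \<in> sets borel" "bounded E"
  shows "2 * (a * b) * measure \<mu> E \<le> \<theta> * a\<^sup>2 * measure \<mu>i E + b\<^sup>2 / \<theta> * measure \<mu>w E"
proof -
  have ind: "(indicator E :: 'a \<Rightarrow> real) \<in> BB" by (rule BB_of_indicator[OF assms(2,3)])
  note [measurable] = assms(2)
  have i1: "integrable \<mu> (\<lambda>x. inverse (w x) * indicator E x)" "measure \<mu>i E = (\<integral>x. inverse (w x) * indicator E x \<partial>\<mu>)"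
    using mi.BB_integrable[OF ind] integral_mi[of "indicator E"] by auto
  have i2: "integrable \<mu> (\<lambda>x. w x * indicator E x)" "measure \<mu>w E = (\<integral>x. w x * indicator E x \<partial>\<mu>)"
    using mw.BB_integrable[OF ind] integral_mw[of "indicator E"] by auto
  have "2 * (a * b) * measure \<mu> E = (\<integral>x. 2 * (a * b) * indicator E x \<partial>\<mu>)" by simp
  also have "\<dots> \<le> (\<integral>x. \<theta> * a\<^sup>2 * (inverse (w x) * indicator E x) + b\<^sup>2 / \<theta> * (w x * indicator E x) \<partial>\<mu>)"
  proof (rule integral_mono)
    show "integrable \<mu> (\<lambda>x. 2 * (a * b) * indicator E x)" using BB_integrable[OF ind] by simp
    show "2 * (a * b) * indicator E x \<le> \<theta> * a\<^sup>2 * (inverse (w x) * indicator E x) + b\<^sup>2 / \<theta> * (w x * indicator E x)" for x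
      using am_gm[OF assms(1), of a b x] by (cases "x \<in> E") auto
  qed (use i1 i2 in auto)
  also have "\<dots> = \<theta> * a\<^sup>2 * measure \<mu>i E + b\<^sup>2 / \<theta> * measure \<mu>w E" using i1 i2 by simp
  finally show ?thesis .
qed

lemma W_ge1: "1 \<le> W"
proof -
  obtain x :: 'a where True by blast
  let ?B = "ball x 1"
  define v where "v = measure \<mu> ?B"
  have v: "0 < v" by (simp add: v_def ball_pos)
  define p q where "p = measure \<mu>i ?B" and "q = measure \<mu>w ?B"
  have "v * v \<le> q * p"
  proof (rule am_gm_positive(3))
    show "2 * v \<le> \<theta> * p + q / \<theta>" if "0 < \<theta>" for \<theta>
      using am_gm_measure[OF that, of ?B 1 1] by (simp add: p_def q_def v_def)
  qed (use v in \<open>auto simp: p_def q_def\<close>)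
  also have "\<dots> \<le> W * v\<^sup>2" using a2[of 1 x] by (simp add: p_def q_def v_def)
  finally show ?thesis using v by (simp add: power2_eq_square)
qed

end

locale cz_grid_weight = cz_grid \<mu> D K T \<kappa> \<epsilon> B s x0 + a2_weight \<mu> D w W
  for \<mu> :: "'a::metric_space measure" and D K T \<kappa> \<epsilon> B s x0 w W
begin

text \<open>
  Averages of \<open>|f|\<close> and \<open>|g|\<close> over the nested neighbourhoods \<open>G p\<close> are the averages \<open>a p\<close> of \<open>|f| * w\<close>
  with respect to \<open>\<mu>i\<close> and \<open>b p\<close> of \<open>|g| / w\<close> with respect to \<open>\<mu>w\<close>, up to the factor
  \<open>\<mu>i (G p) * \<mu>w (G p)\<close>, which the \<open>A\<^sub>2\<close> condition bounds by \<open>W\<close> times the square of \<open>\<mu> (G p)\<close>. The remaining factor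
  \<open>\<mu> (Q p)\<close> is at most twice \<open>\<mu> (E p)\<close>, which Cauchy-Schwarz splits between \<open>\<mu>i (E p)\<close> and \<open>\<mu>w (E p)\<close>. Then
  the embedding theorem is used for \<open>\<mu>i\<close> and for \<open>\<mu>w\<close>.
\<close>

lemma carleson_term:
  assumes S: "finite S" "spread S" "\<And>p. p \<in> S \<Longrightarrow> snd p \<in> net (fst p)"
    and half: "\<And>p. p \<in> S \<Longrightarrow> measure \<mu> (Q p) \<le> 2 * measure \<mu> (E p)"
    and E: "disjoint_family_on E S" "\<And>p. p \<in> S \<Longrightarrow> E p \<in> sets borel" "\<And>p. p \<in> S \<Longrightarrow> E p \<subseteq> Q p"
    and f: "f \<in> BB" and g: "g \<in> BB" and \<theta>: "0 < \<theta>"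
  shows "(\<Sum>p\<in>S. avg f p * (\<integral>x. \<bar>g x\<bar> * indicator (Q p) x \<partial>\<mu>))
    \<le> 4 * D ^ (\<kappa> + 5) * W * (\<theta> * (\<integral>x. (f x)\<^sup>2 \<partial>\<mu>w) + (\<integral>x. (g x)\<^sup>2 \<partial>\<mu>i) / \<theta>)"
proof -
  note [measurable] = BB_measurable[OF f] BB_measurable[OF g]
  define G where "G = adj S"
  have Gs [measurable]: "G p \<in> sets borel" for p unfolding G_def using adj_open by (rule borel_open)
  have Gsub: "G p \<subseteq> ball (snd p) (2 ^ (\<kappa> + 2) * rad (fst p))" for p unfolding G_def by (rule adj_subset)
  have Gb: "bounded (G p)" for p by (rule bounded_subset[OF bounded_ball Gsub])
  have bigG: "big p \<subseteq> G p" for p unfolding G_def by (rule big_adj)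
  have QG: "Q p \<subseteq> G p" for p
  proof -
    have "2 * rad (fst p) \<le> 2 ^ (\<kappa> + 1) * rad (fst p)"
      using mult_right_mono[OF two_le_pow less_imp_le[OF rad_pos[of "fst p"]]] rad_pos[of "fst p"] by simp
    then have "ball (snd p) (2 * rad (fst p)) \<subseteq> big p" unfolding big_def by (rule subset_ball)
    then show ?thesis using Q_subset_ball[of p] bigG[of p] by blast
  qed
  have nested: "G p \<inter> G q = {} \<or> G p \<subseteq> G q \<or> G q \<subseteq> G p" if "p \<in> S" "q \<in> S" for p q
    using adj_nested[OF S(2) that] adj_nested[OF S(2) that(2,1)] unfolding G_def by (metis Int_commute linear)
  define \<Phi> \<Psi> where "\<Phi> p = (\<integral>x. \<bar>f x\<bar> * indicator (G p) x \<partial>\<mu>)" and "\<Psi> p = (\<integral>x. \<bar>g x\<bar> * indicator (G p) x \<partial>\<mu>)" for p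
  have \<Phi>0: "0 \<le> \<Phi> p" "0 \<le> \<Psi> p" for p unfolding \<Phi>_def \<Psi>_def by (rule integral_indicator_nonneg)+
  define a b where "a p = \<Phi> p / measure \<mu>i (G p)" and "b p = \<Psi> p / measure \<mu>w (G p)" for p
  have ball_Gpos: "0 < measure \<mu>i (G p) \<and> 0 < measure \<mu>w (G p)" for p
  proof -
    have v: "0 < measure \<mu> (G p)"
      using measure_mono_bounded[OF bigG _ _ Gb] big_pos[of p] by (meson Gs big_measurable less_le_trans)
    have am: "2 * measure \<mu> (G p) \<le> t * measure \<mu>i (G p) + measure \<mu>w (G p) / t" if "0 < t" for t
      using am_gm_measure[OF that Gs Gb, of 1 1 p] by simp
    show ?thesis
      using am_gm_positive(1,2)[OF measure_nonneg measure_nonneg v am] by blast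
  qed
  have a0: "0 \<le> a p" "0 \<le> b p" for p unfolding a_def b_def using \<Phi>0 by auto
  have Esub: "E p \<subseteq> G p" if "p \<in> S" for p using E(3)[OF that] QG by blast
  have carA: "(\<Sum>p\<in>S. (a p)\<^sup>2 * measure \<mu>i (E p)) \<le> 4 * (\<integral>x. (\<bar>f x\<bar> * w x)\<^sup>2 \<partial>\<mu>i)"
  proof (rule carleson_embedding[OF S(1) _ nested])
    show "G p \<in> fmeasurable \<mu>i" for p by (rule mi.bounded_fmeasurable[OF Gs Gb])
    show "integrable \<mu>i (\<lambda>x. \<bar>f x\<bar> * w x)"
      using BB_integrable[OF BB_abs[OF f]] w_pos by (subst integral_mi) (auto simp: less_imp_neq[THEN not_sym] field_simps)
    show "integrable \<mu>i (\<lambda>x. (\<bar>f x\<bar> * w x)\<^sup>2)"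
    proof -
      have "integrable \<mu>w (\<lambda>x. (f x)\<^sup>2)" using mw.BB_L2[OF f] by (simp add: L2_def)
      then have "integrable \<mu> (\<lambda>x. w x * (f x)\<^sup>2)" by (subst (asm) integral_mw) auto
      moreover have "inverse (w x) * (\<bar>f x\<bar> * w x)\<^sup>2 = w x * (f x)\<^sup>2" for x
        using w_pos[of x] by (simp add: power2_eq_square field_simps)
      ultimately show ?thesis by (subst integral_mi) auto
    qed
    show "a p * measure \<mu>i (G p) \<le> (\<integral>x. \<bar>f x\<bar> * w x * indicator (G p) x \<partial>\<mu>i)" for p
    proof -
      have eq: "inverse (w x) * (\<bar>f x\<bar> * w x * indicator (G p) x) = \<bar>f x\<bar> * indicator (G p) x" for x
        using w_pos[of x] by (simp add: field_simps)
      have m: "(\<lambda>x. \<bar>f x\<bar> * w x * indicator (G p) x) \<in> borel_measurable borel" by measurable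
      show ?thesis unfolding integral_mi(1)[OF m] eq using ball_Gpos[of p] by (simp add: a_def \<Phi>_def)
    qed
    show "E p \<in> sets \<mu>i" if "p \<in> S" for p using E(2)[OF that] by (simp add: sets_M)
  qed (use a0 E(1) Esub in auto)
  have carB: "(\<Sum>p\<in>S. (b p)\<^sup>2 * measure \<mu>w (E p)) \<le> 4 * (\<integral>x. (\<bar>g x\<bar> * inverse (w x))\<^sup>2 \<partial>\<mu>w)"
  proof (rule carleson_embedding[OF S(1) _ nested])
    show "G p \<in> fmeasurable \<mu>w" for p by (rule mw.bounded_fmeasurable[OF Gs Gb])
    show "integrable \<mu>w (\<lambda>x. \<bar>g x\<bar> * inverse (w x))"
      using BB_integrable[OF BB_abs[OF g]] w_pos by (subst integral_mw) (auto simp: less_imp_neq[THEN not_sym] field_simps)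
    show "integrable \<mu>w (\<lambda>x. (\<bar>g x\<bar> * inverse (w x))\<^sup>2)"
    proof -
      have "integrable \<mu>i (\<lambda>x. (g x)\<^sup>2)" using mi.BB_L2[OF g] by (simp add: L2_def)
      then have "integrable \<mu> (\<lambda>x. inverse (w x) * (g x)\<^sup>2)" by (subst (asm) integral_mi) auto
      moreover have "w x * (\<bar>g x\<bar> * inverse (w x))\<^sup>2 = inverse (w x) * (g x)\<^sup>2" for x
        using w_pos[of x] by (simp add: power2_eq_square field_simps)
      ultimately show ?thesis by (subst integral_mw) auto
    qed
    show "b p * measure \<mu>w (G p) \<le> (\<integral>x. \<bar>g x\<bar> * inverse (w x) * indicator (G p) x \<partial>\<mu>w)" for p
    proof -
      have eq: "w x * (\<bar>g x\<bar> * inverse (w x) * indicator (G p) x) = \<bar>g x\<bar> * indicator (G p) x" for x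
        using w_pos[of x] by (simp add: field_simps)
      have m: "(\<lambda>x. \<bar>g x\<bar> * inverse (w x) * indicator (G p) x) \<in> borel_measurable borel" by measurable
      show ?thesis unfolding integral_mw(1)[OF m] eq using ball_Gpos[of p] by (simp add: b_def \<Psi>_def)
    qed
    show "E p \<in> sets \<mu>w" if "p \<in> S" for p using E(2)[OF that] by (simp add: sets_M)
  qed (use a0 E(1) Esub in auto)
  have normA: "(\<integral>x. (\<bar>f x\<bar> * w x)\<^sup>2 \<partial>\<mu>i) = (\<integral>x. (f x)\<^sup>2 \<partial>\<mu>w)"
  proof -
    have eq: "inverse (w x) * (\<bar>f x\<bar> * w x)\<^sup>2 = w x * (f x)\<^sup>2" for x
      using w_pos[of x] by (simp add: power2_eq_square field_simps)
    have m: "(\<lambda>x. (\<bar>f x\<bar> * w x)\<^sup>2) \<in> borel_measurable borel" "(\<lambda>x. (f x)\<^sup>2) \<in> borel_measurable borel" by measurable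
    show ?thesis unfolding integral_mi(1)[OF m(1)] integral_mw(1)[OF m(2)] eq ..
  qed
  have normB: "(\<integral>x. (\<bar>g x\<bar> * inverse (w x))\<^sup>2 \<partial>\<mu>w) = (\<integral>x. (g x)\<^sup>2 \<partial>\<mu>i)"
  proof -
    have eq: "w x * (\<bar>g x\<bar> * inverse (w x))\<^sup>2 = inverse (w x) * (g x)\<^sup>2" for x
      using w_pos[of x] by (simp add: power2_eq_square field_simps)
    have m: "(\<lambda>x. (\<bar>g x\<bar> * inverse (w x))\<^sup>2) \<in> borel_measurable borel" "(\<lambda>x. (g x)\<^sup>2) \<in> borel_measurable borel" by measurable
    show ?thesis unfolding integral_mw(1)[OF m(1)] integral_mi(1)[OF m(2)] eq ..
  qed
  define k where "k = D ^ (\<kappa> + 5) * W"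
  have k: "0 \<le> k" using W_ge1 D_ge1 by (simp add: k_def)
  have bterm: "avg f p * (\<integral>x. \<bar>g x\<bar> * indicator (Q p) x \<partial>\<mu>)
      \<le> k * (\<theta> * ((a p)\<^sup>2 * measure \<mu>i (E p)) + (b p)\<^sup>2 * measure \<mu>w (E p) / \<theta>)" if p: "p \<in> S" for p
  proof -
    define v where "v = measure \<mu> (big p)"
    have v: "0 < v" unfolding v_def by (rule big_pos)
    define R where "R = 2 ^ (\<kappa> + 2) * rad (fst p)"
    have R: "0 < R" by (simp add: R_def rad_pos)
    have "V (snd p) R \<le> D * v"
      using doubling[of "2 ^ (\<kappa> + 1) * rad (fst p)" "snd p"] rad_pos[of "fst p"] by (simp add: v_def big_def R_def mult.assoc)
    then have VR: "(V (snd p) R)\<^sup>2 \<le> (D * v)\<^sup>2" by (intro power_mono) auto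
    have "measure \<mu>w (G p) * measure \<mu>i (G p) \<le> measure \<mu>w (ball (snd p) R) * measure \<mu>i (ball (snd p) R)"
    proof (intro mult_mono)
      show "measure \<mu>w (G p) \<le> measure \<mu>w (ball (snd p) R)"
        by (rule measure_mono_fmeasurable) (use Gsub R_def in \<open>auto simp: sets_M intro: mw.bounded_fmeasurable\<close>)
      show "measure \<mu>i (G p) \<le> measure \<mu>i (ball (snd p) R)"
        by (rule measure_mono_fmeasurable) (use Gsub R_def in \<open>auto simp: sets_M intro: mi.bounded_fmeasurable\<close>)
    qed auto
    also have "\<dots> \<le> W * (V (snd p) R)\<^sup>2" by (rule a2[OF R])
    also have "\<dots> \<le> W * (D * v)\<^sup>2" using W_ge1 by (intro mult_left_mono VR) auto
    finally have wi: "measure \<mu>w (G p) * measure \<mu>i (G p) \<le> W * (D * v)\<^sup>2" .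
    have "avg f p * (\<integral>x. \<bar>g x\<bar> * indicator (Q p) x \<partial>\<mu>) \<le> (\<Phi> p / v) * \<Psi> p"
      unfolding avg_def v_def \<Phi>_def \<Psi>_def
      by (intro mult_mono divide_right_mono integral_indicator_mono f g bigG QG big_measurable Gs cube_measurable
          integral_indicator_nonneg divide_nonneg_nonneg) auto
    also have "\<dots> = a p * b p * (measure \<mu>w (G p) * measure \<mu>i (G p)) / v"
      using ball_Gpos[of p] by (simp add: a_def b_def)
    also have "\<dots> \<le> a p * b p * (W * (D * v)\<^sup>2) / v"
      using v a0 by (intro divide_right_mono mult_left_mono wi mult_nonneg_nonneg) auto
    also have "\<dots> = (a p * b p * W * D\<^sup>2) * v" using v by (simp add: power2_eq_square)
    also have "\<dots> \<le> (a p * b p * W * D\<^sup>2) * (D ^ (\<kappa> + 3) * (2 * measure \<mu> (E p)))"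
    proof (intro mult_left_mono)
      have "v \<le> D ^ (\<kappa> + 3) * measure \<mu> (Q p)" unfolding v_def by (rule big_le[OF S(3)[OF p]])
      also have "\<dots> \<le> D ^ (\<kappa> + 3) * (2 * measure \<mu> (E p))" using half[OF p] D_ge1 by (intro mult_left_mono) auto
      finally show "v \<le> D ^ (\<kappa> + 3) * (2 * measure \<mu> (E p))" .
    qed (use a0 W_ge1 D_ge1 in auto)
    also have "\<dots> = k * (2 * (a p * b p) * measure \<mu> (E p))"
      by (simp add: k_def power_add numeral_eq_Suc)
    also have "\<dots> \<le> k * (\<theta> * (a p)\<^sup>2 * measure \<mu>i (E p) + (b p)\<^sup>2 / \<theta> * measure \<mu>w (E p))"
      using k by (intro mult_left_mono am_gm_measure \<theta> E(2) p bounded_subset[OF cube_bounded E(3)[OF p]]) auto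
    finally show ?thesis by (simp add: mult_ac)
  qed
  have "(\<Sum>p\<in>S. avg f p * (\<integral>x. \<bar>g x\<bar> * indicator (Q p) x \<partial>\<mu>))
    \<le> (\<Sum>p\<in>S. k * (\<theta> * ((a p)\<^sup>2 * measure \<mu>i (E p)) + (b p)\<^sup>2 * measure \<mu>w (E p) / \<theta>))"
    by (intro sum_mono bterm)
  also have "\<dots> = k * (\<theta> * (\<Sum>p\<in>S. (a p)\<^sup>2 * measure \<mu>i (E p)) + (\<Sum>p\<in>S. (b p)\<^sup>2 * measure \<mu>w (E p)) / \<theta>)"
    by (simp add: sum.distrib sum_distrib_left sum_divide_distrib distrib_left)
  also have "\<dots> \<le> k * (\<theta> * (4 * (\<integral>x. (f x)\<^sup>2 \<partial>\<mu>w)) + (4 * (\<integral>x. (g x)\<^sup>2 \<partial>\<mu>i)) / \<theta>)"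
    using carA carB unfolding normA normB
    by (intro mult_left_mono add_mono divide_right_mono) (use k \<theta> in auto)
  also have "\<dots> = 4 * D ^ (\<kappa> + 5) * W * (\<theta> * (\<integral>x. (f x)\<^sup>2 \<partial>\<mu>w) + (\<integral>x. (g x)\<^sup>2 \<partial>\<mu>i) / \<theta>)"
    by (simp add: k_def algebra_simps)
  finally show ?thesis .
qed

lemma sparse_weighted:
  assumes S: "sparse S" and f: "f \<in> BB" and g: "g \<in> BB" and \<theta>: "0 < \<theta>"
  shows "(\<Sum>p\<in>S. avg f p * (\<integral>x. \<bar>g x\<bar> * indicator (Q p) x \<partial>\<mu>))
    \<le> real ncol * (4 * D ^ (\<kappa> + 5)) * W * (\<theta> * (\<integral>x. (f x)\<^sup>2 \<partial>\<mu>w) + (\<integral>x. (g x)\<^sup>2 \<partial>\<mu>i) / \<theta>)"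
proof -
  have fin: "finite S" and net: "\<And>p. p \<in> S \<Longrightarrow> snd p \<in> net (fst p)"
    and half: "\<And>p. p \<in> S \<Longrightarrow> measure \<mu> (Q p) \<le> 2 * measure \<mu> (rest S p)"
    using S by (auto simp: sparse_def)
  obtain c where c: "\<forall>p\<in>S. c p < ncol" "\<forall>k. spread {p \<in> S. c p = k}"
  proof -
    have "\<exists>c. (\<forall>p\<in>S. c p < ncol) \<and> (\<forall>k. spread {p \<in> S. c p = k})"
      by (rule split_into_spread[OF fin]) (rule net)
    then show thesis by (elim exE conjE) (rule that)
  qed
  let ?t = "\<lambda>p. avg f p * (\<integral>x. \<bar>g x\<bar> * indicator (Q p) x \<partial>\<mu>)"
  let ?X = "4 * D ^ (\<kappa> + 5) * W * (\<theta> * (\<integral>x. (f x)\<^sup>2 \<partial>\<mu>w) + (\<integral>x. (g x)\<^sup>2 \<partial>\<mu>i) / \<theta>)"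
  have "(\<Sum>p\<in>S. ?t p) = (\<Sum>k<ncol. \<Sum>p\<in>{p \<in> S. c p = k}. ?t p)"
    by (rule sum.group[symmetric]) (use fin c(1) in auto)
  also have "\<dots> \<le> (\<Sum>k<ncol. ?X)"
  proof (rule sum_mono)
    fix k
    show "(\<Sum>p\<in>{p \<in> S. c p = k}. ?t p) \<le> ?X"
    proof (rule carleson_term[where E = "rest S", OF _ _ _ _ _ _ _ f g \<theta>])
      show "disjoint_family_on (rest S) {p \<in> S. c p = k}"
        by (rule disjoint_family_on_mono[OF _ rest_disjoint]) auto
      show "spread {p \<in> S. c p = k}" using c(2) by blast
      show "rest S p \<in> sets borel" for p by (rule rest_measurable[OF fin])
      show "rest S p \<subseteq> Q p" for p by (auto simp: rest_def)
    qed (use fin net half in auto)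
  qed
  also have "\<dots> = real ncol * (4 * D ^ (\<kappa> + 5)) * W * (\<theta> * (\<integral>x. (f x)\<^sup>2 \<partial>\<mu>w) + (\<integral>x. (g x)\<^sup>2 \<partial>\<mu>i) / \<theta>)"
    by simp
  finally show ?thesis .
qed

end

section \<open>The cubes of finest scale\<close>

context cz_operator begin

definition leaf_const :: real where "leaf_const = B * D ^ (\<kappa> + 3) + 1"

definition form_const :: real where "form_const = sparse_const * (real ncol * (4 * D ^ (\<kappa> + 5))) + leaf_const"

lemma leaf_const_pos: "0 < leaf_const" using B_nonneg D_ge1 by (simp add: leaf_const_def add_nonneg_pos)

lemma form_const_pos: "0 < form_const" unfolding form_const_def using sparse_const_pos leaf_const_pos D_ge1 by (intro add_nonneg_pos) auto

end

context cz_grid begin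

text \<open>
  On a cube of level \<open>0\<close> and its dilate, \<open>|f|\<close> and \<open>|g|\<close> are constant up to \<open>\<delta>\<close>. The \<open>L\<^sup>2\<close> bound of \<open>T\<close>
  then bounds the leaf term by a multiple of the product of these constants times the measure of
  the cube. They are increased by \<open>\<delta>\<close> to be positive, as the arithmetic-geometric mean inequality
  is used with their quotient.
\<close>

lemma leaf_cell:
  assumes f: "f \<in> BB" and g: "g \<in> BB" and L: "0 < L"
    and fL: "\<And>x y. \<bar>f x - f y\<bar> \<le> L * dist x y" and gL: "\<And>x y. \<bar>g x - g y\<bar> \<le> L * dist x y"
    and y: "y \<in> net 0" and \<delta>: "\<delta> = L * (2 ^ (\<kappa> + 1) * s)"
  shows "(\<integral>\<^sup>+x. ennreal (\<bar>T (restr f (0, y)) x\<bar> * \<bar>g x\<bar>) * indicator (cube 0 y) x \<partial>\<mu>)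
    \<le> ennreal (leaf_const * (\<integral>x. (\<bar>f x\<bar> + 2 * \<delta>) * (\<bar>g x\<bar> + 2 * \<delta>) * indicator (cube 0 y) x \<partial>\<mu>))"
proof -
  note [measurable] = BB_measurable[OF f] BB_measurable[OF g] T_measurable[OF restr_BB[OF f]]
  define p where "p = (0::nat, y)"
  have p: "snd p \<in> net (fst p)" using y by (simp add: p_def)
  have \<delta>0: "0 < \<delta>" using L s_pos by (simp add: \<delta>)
  define a b where "a = \<bar>f y\<bar> + \<delta>" and "b = \<bar>g y\<bar> + \<delta>"
  have ab: "0 < a" "0 < b" using \<delta>0 by (auto simp: a_def b_def)
  define F where "F = restr f p"
  have F: "F \<in> BB" unfolding F_def by (rule restr_BB[OF f])
  have lipd: "L * dist y x \<le> \<delta>" if "x \<in> big p" for x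
    using that L unfolding \<delta> by (intro mult_left_mono) (auto simp: big_def p_def rad_def)
  have two: "2 * s \<le> 2 ^ (\<kappa> + 1) * s" using two_le_pow s_pos by simp
  have Qbig: "cube 0 y \<subseteq> big p"
  proof -
    have "ball y (2 * s) \<subseteq> ball y (2 ^ (\<kappa> + 1) * s)" by (rule subset_ball[OF two])
    then show ?thesis using cube_ball[of 0 y] by (auto simp: big_def p_def rad_def)
  qed
  have Fa: "(F x)\<^sup>2 \<le> a\<^sup>2 * indicator (big p) x" for x
  proof (cases "x \<in> big p")
    case True
    have "\<bar>f x\<bar> \<le> a" using fL[of y x] lipd[OF True] by (simp add: a_def)
    then have "(f x)\<^sup>2 \<le> a\<^sup>2" using ab by (simp add: abs_le_square_iff[symmetric])
    then show ?thesis using True by (simp add: F_def restr_def)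
  qed (simp add: F_def restr_def)
  have gb: "\<bar>g x\<bar> \<le> b" if "x \<in> cube 0 y" for x
    using gL[of y x] lipd[of x] Qbig that by (auto simp: b_def)
  define v where "v = measure \<mu> (cube 0 y)"
  have v: "0 \<le> v" by (simp add: v_def)
  have "(\<integral>x. (T F x)\<^sup>2 \<partial>\<mu>) \<le> B * (\<integral>x. (F x)\<^sup>2 \<partial>\<mu>)" by (rule T_bound[OF BB_L2[OF F]])
  also have "\<dots> \<le> B * (\<integral>x. a\<^sup>2 * indicator (big p) x \<partial>\<mu>)"
  proof (intro mult_left_mono integral_mono Fa)
    show "integrable \<mu> (\<lambda>x. (F x)\<^sup>2)" using BB_L2[OF F] by (simp add: L2_def)
    show "integrable \<mu> (\<lambda>x. a\<^sup>2 * indicator (big p) x)" by (intro BB_integrable BB_intros big_measurable) (simp add: big_def)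
  qed (rule B_nonneg)
  also have "\<dots> = B * (a\<^sup>2 * measure \<mu> (big p))" by simp
  also have "\<dots> \<le> B * (a\<^sup>2 * (D ^ (\<kappa> + 3) * v))"
    using big_le[OF p] B_nonneg by (intro mult_left_mono) (auto simp: v_def p_def)
  finally have TF: "(\<integral>x. (T F x)\<^sup>2 \<partial>\<mu>) \<le> B * (a\<^sup>2 * (D ^ (\<kappa> + 3) * v))" .
  let ?h = "\<lambda>x. b / a / 2 * (T F x)\<^sup>2 + a * b / 2 * indicator (cube 0 y) x"
  have ind: "(\<lambda>x. a * b / 2 * indicator (cube 0 y) x) \<in> BB" by (intro BB_intros cube_measurable cube_bounded)
  have ih: "integrable \<mu> ?h" using T_integrable[OF F] BB_integrable[OF ind] by simp
  have "(\<integral>\<^sup>+x. ennreal (\<bar>T F x\<bar> * \<bar>g x\<bar>) * indicator (cube 0 y) x \<partial>\<mu>) \<le> (\<integral>\<^sup>+x. ennreal (?h x) \<partial>\<mu>)"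
  proof (rule nn_integral_mono)
    fix x
    show "ennreal (\<bar>T F x\<bar> * \<bar>g x\<bar>) * indicator (cube 0 y) x \<le> ennreal (?h x)"
    proof (cases "x \<in> cube 0 y")
      case True
      have "\<bar>T F x\<bar> * \<bar>g x\<bar> \<le> \<bar>T F x\<bar> * b" by (intro mult_left_mono gb True) auto
      also have "\<dots> \<le> b / a / 2 * (T F x)\<^sup>2 + a * b / 2"
      proof -
        have "0 \<le> b / a / 2 * (\<bar>T F x\<bar> - a)\<^sup>2" using ab by simp
        also have "\<dots> = b / a / 2 * (T F x)\<^sup>2 + a * b / 2 - \<bar>T F x\<bar> * b"
          using ab by (simp add: power2_eq_square field_simps)
        finally show ?thesis by simp
      qed
      finally show ?thesis using True by (simp add: ennreal_leI)
    qed (use ab in simp)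
  qed
  also have "\<dots> = ennreal (\<integral>x. ?h x \<partial>\<mu>)" using ih ab by (intro nn_integral_eq_integral) (auto simp: indicator_def)
  also have "(\<integral>x. ?h x \<partial>\<mu>) = b / a / 2 * (\<integral>x. (T F x)\<^sup>2 \<partial>\<mu>) + a * b / 2 * v"
    using T_integrable[OF F] BB_integrable[OF ind] by (simp add: v_def)
  also have "ennreal \<dots> \<le> ennreal (leaf_const * (a * b * v))"
  proof (rule ennreal_leI)
    have "b / a / 2 * (\<integral>x. (T F x)\<^sup>2 \<partial>\<mu>) \<le> b / a / 2 * (B * (a\<^sup>2 * (D ^ (\<kappa> + 3) * v)))"
      using ab by (intro mult_left_mono TF) auto
    also have "\<dots> = (B * D ^ (\<kappa> + 3)) * (a * b * v) / 2" using ab by (simp add: power2_eq_square)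
    finally have "b / a / 2 * (\<integral>x. (T F x)\<^sup>2 \<partial>\<mu>) + a * b / 2 * v \<le> leaf_const * (a * b * v) / 2" by (simp add: leaf_const_def algebra_simps)
    also have "\<dots> \<le> leaf_const * (a * b * v)" using leaf_const_pos ab v by simp
    finally show "b / a / 2 * (\<integral>x. (T F x)\<^sup>2 \<partial>\<mu>) + a * b / 2 * v \<le> leaf_const * (a * b * v)" .
  qed
  also have "\<dots> \<le> ennreal (leaf_const * (\<integral>x. (\<bar>f x\<bar> + 2 * \<delta>) * (\<bar>g x\<bar> + 2 * \<delta>) * indicator (cube 0 y) x \<partial>\<mu>))"
  proof (intro ennreal_leI mult_left_mono)
    have "a * b * v = (\<integral>x. a * b * indicator (cube 0 y) x \<partial>\<mu>)" by (simp add: v_def)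
    also have "\<dots> \<le> (\<integral>x. (\<bar>f x\<bar> + 2 * \<delta>) * (\<bar>g x\<bar> + 2 * \<delta>) * indicator (cube 0 y) x \<partial>\<mu>)"
    proof (rule integral_mono)
      show "integrable \<mu> (\<lambda>x. a * b * indicator (cube 0 y) x)"
        by (intro BB_integrable BB_intros cube_measurable cube_bounded)
      have "(\<lambda>x. (\<bar>f x\<bar> * \<bar>g x\<bar>) * indicator (cube 0 y) x + (2 * \<delta> * (\<bar>f x\<bar> * indicator (cube 0 y) x)
        + (2 * \<delta> * (\<bar>g x\<bar> * indicator (cube 0 y) x) + 4 * \<delta>\<^sup>2 * indicator (cube 0 y) x))) \<in> BB"
        by (intro BB_intros BB_mult f g cube_measurable cube_bounded)
      moreover have "(\<bar>f x\<bar> * \<bar>g x\<bar>) * indicator (cube 0 y) x + (2 * \<delta> * (\<bar>f x\<bar> * indicator (cube 0 y) x)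
        + (2 * \<delta> * (\<bar>g x\<bar> * indicator (cube 0 y) x) + 4 * \<delta>\<^sup>2 * indicator (cube 0 y) x))
        = (\<bar>f x\<bar> + 2 * \<delta>) * (\<bar>g x\<bar> + 2 * \<delta>) * indicator (cube 0 y) x" for x
        by (simp add: power2_eq_square algebra_simps)
      ultimately show "integrable \<mu> (\<lambda>x. (\<bar>f x\<bar> + 2 * \<delta>) * (\<bar>g x\<bar> + 2 * \<delta>) * indicator (cube 0 y) x)"
        using BB_integrable by simp
      show "a * b * indicator (cube 0 y) x \<le> (\<bar>f x\<bar> + 2 * \<delta>) * (\<bar>g x\<bar> + 2 * \<delta>) * indicator (cube 0 y) x" for x
      proof (cases "x \<in> cube 0 y")
        case True
        then have x: "x \<in> big p" using Qbig by blast
        have "a \<le> \<bar>f x\<bar> + 2 * \<delta>" using fL[of y x] lipd[OF x] by (simp add: a_def)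
        moreover have "b \<le> \<bar>g x\<bar> + 2 * \<delta>" using gL[of y x] lipd[OF x] by (simp add: b_def)
        ultimately have "a * b \<le> (\<bar>f x\<bar> + 2 * \<delta>) * (\<bar>g x\<bar> + 2 * \<delta>)" using ab \<delta>0 by (intro mult_mono) auto
        then show ?thesis using True by simp
      qed simp
    qed
    finally show "a * b * v \<le> (\<integral>x. (\<bar>f x\<bar> + 2 * \<delta>) * (\<bar>g x\<bar> + 2 * \<delta>) * indicator (cube 0 y) x \<partial>\<mu>)" .
  qed (use leaf_const_pos in simp)
  finally show ?thesis by (simp add: F_def p_def)
qed

text \<open>
  \<open>J\<close> is arbitrary, while \<open>\<delta>\<close> is proportional to \<open>s\<close>: the sum over all cubes of level \<open>0\<close> in a cube of
  fixed size is \<open>leaf_const * \<integral> |f * g|\<close> up to terms that vanish with \<open>s\<close>.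
\<close>

lemma leaf_bound:
  assumes f: "f \<in> BB" and g: "g \<in> BB" and L: "0 < L"
    and fL: "\<And>x y. \<bar>f x - f y\<bar> \<le> L * dist x y" and gL: "\<And>x y. \<bar>g x - g y\<bar> \<le> L * dist x y"
    and z: "z \<in> net J" and \<delta>: "\<delta> = L * (2 ^ (\<kappa> + 1) * s)"
  shows "(\<integral>\<^sup>+x. ennreal (\<bar>Tleaf f x\<bar> * \<bar>g x\<bar>) * indicator (cube J z) x \<partial>\<mu>)
    \<le> ennreal (leaf_const * ((\<integral>x. \<bar>f x * g x\<bar> \<partial>\<mu>) + 2 * \<delta> * ((\<integral>x. \<bar>f x\<bar> \<partial>\<mu>) + (\<integral>x. \<bar>g x\<bar> \<partial>\<mu>)) + 4 * \<delta>\<^sup>2 * measure \<mu> (cube J z)))"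
proof -
  note [measurable] = BB_measurable[OF f] BB_measurable[OF g] Tleaf_measurable[OF f]
  have \<delta>0: "0 < \<delta>" using L s_pos by (simp add: \<delta>)
  have "\<not> (\<lambda>i y. False) J z" by simp
  from stopping_cubes[where bad = "\<lambda>i y. False", OF z this] obtain P where P0: "finite P"
    "disjoint_family_on (\<lambda>(i, y). cube i y) P" "(\<Union>(i, y)\<in>P. cube i y) = cube J z"
    "\<forall>(i, y)\<in>P. i \<le> J \<and> y \<in> net i \<and> (i < J \<and> False \<and> \<not> False \<or> i = 0 \<and> \<not> False)"
    by (elim exE conjE) (rule that)
  have dj: "disjoint_family_on Q P" and un: "(\<Union>p\<in>P. Q p) = cube J z"
    using P0(2,3) by (auto simp: case_prod_unfold)
  have P: "p = (0, snd p)" "snd p \<in> net 0" if "p \<in> P" for p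
    using P0(4) that by (auto simp: case_prod_unfold prod_eq_iff)
  define H where "H x = \<bar>f x\<bar> * \<bar>g x\<bar> + 2 * \<delta> * (\<bar>f x\<bar> + \<bar>g x\<bar>) + 4 * \<delta>\<^sup>2 * indicator (cube J z) x" for x
  have HBB: "H \<in> BB" unfolding H_def[abs_def] by (intro BB_intros BB_mult f g cube_measurable cube_bounded)
  have H0: "0 \<le> H x" for x using \<delta>0 by (simp add: H_def indicator_def)
  define I where "I p = (\<integral>x. (\<bar>f x\<bar> + 2 * \<delta>) * (\<bar>g x\<bar> + 2 * \<delta>) * indicator (Q p) x \<partial>\<mu>)" for p
  have I_eq: "I p = (\<integral>x. \<bar>H x\<bar> * indicator (Q p) x \<partial>\<mu>)" if "p \<in> P" for p
    unfolding I_def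
  proof (rule Bochner_Integration.integral_cong[OF refl])
    fix x
    have "Q p \<subseteq> cube J z" using un that by blast
    then show "(\<bar>f x\<bar> + 2 * \<delta>) * (\<bar>g x\<bar> + 2 * \<delta>) * indicator (Q p) x = \<bar>H x\<bar> * indicator (Q p) x"
      using H0[of x] by (cases "x \<in> Q p") (auto simp: H_def power2_eq_square algebra_simps)
  qed
  have I0: "0 \<le> I p" if "p \<in> P" for p unfolding I_eq[OF that] by (rule integral_indicator_nonneg)
  have "(\<integral>\<^sup>+x. ennreal (\<bar>Tleaf f x\<bar> * \<bar>g x\<bar>) * indicator (cube J z) x \<partial>\<mu>)
    = (\<Sum>p\<in>P. \<integral>\<^sup>+x. ennreal (\<bar>Tleaf f x\<bar> * \<bar>g x\<bar>) * indicator (Q p) x \<partial>\<mu>)"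
    unfolding un[symmetric] by (intro nn_integral_disjoint_cubes P0 dj) measurable
  also have "\<dots> \<le> (\<Sum>p\<in>P. ennreal (leaf_const * I p))"
  proof (rule sum_mono)
    fix p assume p: "p \<in> P"
    obtain y where y: "p = (0, y)" "y \<in> net 0" using P[OF p] by metis
    have "(\<integral>\<^sup>+x. ennreal (\<bar>Tleaf f x\<bar> * \<bar>g x\<bar>) * indicator (Q p) x \<partial>\<mu>)
      = (\<integral>\<^sup>+x. ennreal (\<bar>T (restr f (0, y)) x\<bar> * \<bar>g x\<bar>) * indicator (cube 0 y) x \<partial>\<mu>)"
      by (intro nn_integral_cong) (simp add: Tleaf_def cube_def indicator_def y)
    also have "\<dots> \<le> ennreal (leaf_const * I p)"
      unfolding I_def y fst_conv snd_conv by (rule leaf_cell[OF f g L fL gL y(2) \<delta>])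
    finally show "(\<integral>\<^sup>+x. ennreal (\<bar>Tleaf f x\<bar> * \<bar>g x\<bar>) * indicator (Q p) x \<partial>\<mu>) \<le> ennreal (leaf_const * I p)" .
  qed
  also have "\<dots> = ennreal (leaf_const * (\<Sum>p\<in>P. I p))"
    using leaf_const_pos I0 by (simp add: sum_ennreal sum_distrib_left)
  also have "\<dots> \<le> ennreal (leaf_const * (\<integral>x. \<bar>H x\<bar> \<partial>\<mu>))"
  proof (intro ennreal_leI mult_left_mono)
    have "(\<Sum>p\<in>P. I p) = (\<Sum>p\<in>P. \<integral>x. \<bar>H x\<bar> * indicator (Q p) x \<partial>\<mu>)" by (intro sum.cong I_eq refl)
    also have "\<dots> = (\<integral>x. \<bar>H x\<bar> * indicator (\<Union>p\<in>P. Q p) x \<partial>\<mu>)"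
      by (rule sum_integrals_disjoint[OF HBB P0(1) dj]) (rule cube_measurable)
    also have "\<dots> \<le> (\<integral>x. \<bar>H x\<bar> \<partial>\<mu>)" unfolding un by (rule integral_indicator_le[OF HBB cube_measurable])
    finally show "(\<Sum>p\<in>P. I p) \<le> (\<integral>x. \<bar>H x\<bar> \<partial>\<mu>)" .
  qed (use leaf_const_pos in simp)
  also have "(\<integral>x. \<bar>H x\<bar> \<partial>\<mu>) = (\<integral>x. \<bar>f x * g x\<bar> \<partial>\<mu>) + 2 * \<delta> * ((\<integral>x. \<bar>f x\<bar> \<partial>\<mu>) + (\<integral>x. \<bar>g x\<bar> \<partial>\<mu>)) + 4 * \<delta>\<^sup>2 * measure \<mu> (cube J z)"
  proof -
    have i: "integrable \<mu> (\<lambda>x. \<bar>f x\<bar> * \<bar>g x\<bar>)" "integrable \<mu> (\<lambda>x. \<bar>f x\<bar>)" "integrable \<mu> (\<lambda>x. \<bar>g x\<bar>)"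
      "integrable \<mu> (indicator (cube J z) :: 'a \<Rightarrow> real)"
      by (intro BB_integrable BB_mult BB_intros f g cube_measurable cube_bounded)+
    have "(\<integral>x. \<bar>H x\<bar> \<partial>\<mu>) = (\<integral>x. H x \<partial>\<mu>)" using H0 by simp
    also have "\<dots> = (\<integral>x. \<bar>f x\<bar> * \<bar>g x\<bar> \<partial>\<mu>) + 2 * \<delta> * ((\<integral>x. \<bar>f x\<bar> \<partial>\<mu>) + (\<integral>x. \<bar>g x\<bar> \<partial>\<mu>)) + 4 * \<delta>\<^sup>2 * measure \<mu> (cube J z)"
      unfolding H_def[abs_def] using i by simp
    finally show ?thesis by (simp add: abs_mult)
  qed
  finally show ?thesis .
qed

end

section \<open>The weighted form on Lipschitz functions\<close>

locale cz_weight = cz_operator \<mu> D K T \<kappa> \<epsilon> B + a2_weight \<mu> D w W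
  for \<mu> :: "'a::metric_space measure" and D K T \<kappa> \<epsilon> B w W
begin

text \<open>
  Sparse domination on a cube of size \<open>R\<close> that contains the supports, with finest scale \<open>R / 16 ^ n\<close>. The
  sparse family depends on \<open>n\<close>, but its bound does not, and the leaf term tends to a multiple of \<open>\<integral> |f * g|\<close>.
\<close>

lemma bilinear_Lipschitz:
  assumes f: "f \<in> BB" "lip f" and g: "g \<in> BB" "lip g" and \<theta>: "0 < \<theta>"
  shows "(\<integral>\<^sup>+x. ennreal (\<bar>T f x\<bar> * \<bar>g x\<bar>) \<partial>\<mu>)
    \<le> ennreal (form_const * W * (\<theta> * (\<integral>x. (f x)\<^sup>2 \<partial>\<mu>w) + (\<integral>x. (g x)\<^sup>2 \<partial>\<mu>i) / \<theta>))"
proof -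
  note [measurable] = BB_measurable[OF f(1)] BB_measurable[OF g(1)]
  obtain x0 :: 'a where True by blast
  obtain L1 where L1: "0 \<le> L1" "\<And>x y. \<bar>f x - f y\<bar> \<le> L1 * dist x y" using lipE[OF f(2)] by metis
  obtain L2 where L2: "0 \<le> L2" "\<And>x y. \<bar>g x - g y\<bar> \<le> L2 * dist x y" using lipE[OF g(2)] by metis
  define L where "L = L1 + L2 + 1"
  have L: "0 < L" using L1 L2 by (simp add: L_def)
  have fL: "\<bar>f x - f y\<bar> \<le> L * dist x y" for x y
  proof -
    have "L1 * dist x y \<le> L * dist x y" using L2 by (intro mult_right_mono) (auto simp: L_def)
    with L1(2)[of x y] show ?thesis by linarith
  qed
  have gL: "\<bar>g x - g y\<bar> \<le> L * dist x y" for x y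
  proof -
    have "L2 * dist x y \<le> L * dist x y" using L1 by (intro mult_right_mono) (auto simp: L_def)
    with L2(2)[of x y] show ?thesis by linarith
  qed
  obtain c1 r1 where r1: "0 < r1" "\<And>x. f x \<noteq> 0 \<Longrightarrow> x \<in> ball x0 r1" using BB_E[OF f(1), of x0] by metis
  obtain c2 r2 where r2: "0 < r2" "\<And>x. g x \<noteq> 0 \<Longrightarrow> x \<in> ball x0 r2" using BB_E[OF g(1), of x0] by metis
  define R where "R = 4 * (r1 + r2)"
  have R: "0 < R" using r1 r2 by (simp add: R_def)
  have fR: "x \<in> ball x0 (R / 4)" if "f x \<noteq> 0" for x using r1(2)[OF that] r2(1) by (simp add: R_def)
  have gR: "x \<in> ball x0 (R / 4)" if "g x \<noteq> 0" for x using r2(2)[OF that] r1(1) by (simp add: R_def)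
  define N where "N = \<theta> * (\<integral>x. (f x)\<^sup>2 \<partial>\<mu>w) + (\<integral>x. (g x)\<^sup>2 \<partial>\<mu>i) / \<theta>"
  have N0: "0 \<le> N" using \<theta> by (simp add: N_def)
  define J where "J = (\<integral>x. \<bar>f x * g x\<bar> \<partial>\<mu>)"
  define S where "S = (\<integral>x. \<bar>f x\<bar> \<partial>\<mu>) + (\<integral>x. \<bar>g x\<bar> \<partial>\<mu>)"
  have JS: "0 \<le> J" "0 \<le> S" by (simp_all add: J_def S_def)
  define M where "M = sparse_const * (real ncol * (4 * D ^ (\<kappa> + 5)) * W * N)"
  have M0: "0 \<le> M" using sparse_const_pos D_ge1 W_ge1 N0 by (simp add: M_def)
  define \<delta> where "\<delta> n = L * (2 ^ (\<kappa> + 1) * (R / 16 ^ n))" for n :: nat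
  have \<delta>0: "0 < \<delta> n" for n using L R by (simp add: \<delta>_def)
  define lhs where "lhs = (\<integral>\<^sup>+x. ennreal (\<bar>T f x\<bar> * \<bar>g x\<bar>) \<partial>\<mu>)"
  define rhs where "rhs n = M + leaf_const * (J + 2 * \<delta> n * S + 4 * (\<delta> n)\<^sup>2 * V x0 (2 * R))" for n
  have le: "lhs \<le> ennreal (rhs n)" for n
  proof -
    interpret cz_grid_weight \<mu> D K T \<kappa> \<epsilon> B "R / 16 ^ n" x0 w W
      by unfold_locales (use R in simp)
    have rad: "rad n = R" by (simp add: rad_def)
    define r where "r = (n, x0)"
    have r: "snd r \<in> net (fst r)" by (simp add: r_def net)
    have Qr: "Q r = cube n x0" by (simp add: r_def)
    have sub: "ball x0 (R / 4) \<subseteq> cube n x0" "cube n x0 \<subseteq> ball x0 (2 * R)"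
      using ball_cube[OF net(1), of n] cube_ball[of n x0] by (simp_all add: rad)
    have "R / 4 \<le> 2 ^ (\<kappa> + 1) * R" using R two_le_pow mult_right_mono[OF two_le_pow less_imp_le[OF R]] by simp
    then have "ball x0 (R / 4) \<subseteq> big r" unfolding big_def r_def fst_conv snd_conv rad by (rule subset_ball)
    then have big: "x \<in> big r" if "x \<in> ball x0 (R / 4)" for x using that by (rule subsetD)
    have rf: "restr f r = f"
    proof
      fix x show "restr f r x = f x"
        using fR[of x] big[of x] unfolding restr_def by (cases "f x = 0") simp_all
    qed
    have gind: "ennreal (\<bar>T f x\<bar> * \<bar>g x\<bar>) * indicator (Q r) x = ennreal (\<bar>T f x\<bar> * \<bar>g x\<bar>)" for x
      using gR[of x] sub(1) unfolding Qr by (cases "g x = 0") auto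
    from sparse_domination[OF f(1) g(1) r] obtain \<S> where \<S>: "sparse \<S>"
      "lhs \<le> ennreal (sparse_const * (\<Sum>p\<in>\<S>. avg f p * (\<integral>x. \<bar>g x\<bar> * indicator (Q p) x \<partial>\<mu>)))
      + (\<integral>\<^sup>+x. ennreal (\<bar>Tleaf f x\<bar> * \<bar>g x\<bar>) * indicator (Q r) x \<partial>\<mu>)"
      unfolding rf gind lhs_def[symmetric] by (elim exE conjE) (rule that)
    note \<S>(2)
    also have "\<dots> \<le> ennreal M + ennreal (leaf_const * (J + 2 * \<delta> n * S + 4 * (\<delta> n)\<^sup>2 * V x0 (2 * R)))"
    proof (rule add_mono)
      show "ennreal (sparse_const * (\<Sum>p\<in>\<S>. avg f p * (\<integral>x. \<bar>g x\<bar> * indicator (Q p) x \<partial>\<mu>))) \<le> ennreal M"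
        unfolding M_def N_def using sparse_const_pos by (intro ennreal_leI mult_left_mono sparse_weighted[OF \<S>(1) f(1) g(1) \<theta>]) auto
      have "(\<integral>\<^sup>+x. ennreal (\<bar>Tleaf f x\<bar> * \<bar>g x\<bar>) * indicator (Q r) x \<partial>\<mu>) \<le>
        ennreal (leaf_const * (J + 2 * \<delta> n * S + 4 * (\<delta> n)\<^sup>2 * measure \<mu> (cube n x0)))"
        unfolding Qr J_def S_def by (rule leaf_bound[OF f(1) g(1) L fL gL net(1)]) (simp add: \<delta>_def)
      also have "\<dots> \<le> ennreal (leaf_const * (J + 2 * \<delta> n * S + 4 * (\<delta> n)\<^sup>2 * V x0 (2 * R)))"
        using leaf_const_pos by (intro ennreal_leI mult_left_mono add_left_mono measure_mono_bounded[OF sub(2)]) auto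
      finally show "(\<integral>\<^sup>+x. ennreal (\<bar>Tleaf f x\<bar> * \<bar>g x\<bar>) * indicator (Q r) x \<partial>\<mu>) \<le>
        ennreal (leaf_const * (J + 2 * \<delta> n * S + 4 * (\<delta> n)\<^sup>2 * V x0 (2 * R)))" .
    qed
    also have "\<dots> = ennreal (rhs n)"
      unfolding rhs_def using M0 leaf_const_pos JS \<delta>0[of n] by (intro ennreal_plus[symmetric]) auto
    finally show ?thesis .
  qed
  have "(\<lambda>n. inverse ((16::real) ^ n)) \<longlonglongrightarrow> 0" by (rule LIMSEQ_inverse_realpow_zero) simp
  then have "(\<lambda>n. L * (2 ^ (\<kappa> + 1) * (R * inverse (16 ^ n)))) \<longlonglongrightarrow> L * (2 ^ (\<kappa> + 1) * (R * 0))"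
    by (intro tendsto_intros)
  then have \<delta>lim: "\<delta> \<longlonglongrightarrow> 0" by (simp add: \<delta>_def[abs_def] divide_inverse)
  have "rhs \<longlonglongrightarrow> M + leaf_const * (J + 2 * 0 * S + 4 * 0\<^sup>2 * V x0 (2 * R))"
    unfolding rhs_def[abs_def] by (intro tendsto_intros \<delta>lim)
  then have "(\<lambda>n. ennreal (rhs n)) \<longlonglongrightarrow> ennreal (M + leaf_const * J)" by (intro tendsto_ennrealI) simp
  then have "lhs \<le> ennreal (M + leaf_const * J)" using le by (intro LIMSEQ_le_const) auto
  also have "\<dots> \<le> ennreal (form_const * W * N)"
  proof (rule ennreal_leI)
    have "2 * J \<le> N"
    proof -
      have fg: "(\<lambda>x. f x * g x) \<in> BB" by (rule BB_mult[OF f(1) g(1)])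
      have i1: "integrable \<mu> (\<lambda>x. w x * (f x)\<^sup>2)" using mw.BB_L2[OF f(1)] by (subst integral_mw[symmetric]) (auto simp: L2_def)
      have i2: "integrable \<mu> (\<lambda>x. inverse (w x) * (g x)\<^sup>2)" using mi.BB_L2[OF g(1)] by (subst integral_mi[symmetric]) (auto simp: L2_def)
      have "2 * J = (\<integral>x. 2 * \<bar>f x * g x\<bar> \<partial>\<mu>)" by (simp add: J_def)
      also have "\<dots> \<le> (\<integral>x. \<theta> * (w x * (f x)\<^sup>2) + inverse (w x) * (g x)\<^sup>2 / \<theta> \<partial>\<mu>)"
      proof (rule integral_mono)
        show "integrable \<mu> (\<lambda>x. 2 * \<bar>f x * g x\<bar>)" by (intro BB_integrable BB_intros fg)
        show "2 * \<bar>f x * g x\<bar> \<le> \<theta> * (w x * (f x)\<^sup>2) + inverse (w x) * (g x)\<^sup>2 / \<theta>" for x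
          using am_gm[of "1 / \<theta>" "\<bar>g x\<bar>" "\<bar>f x\<bar>" x] \<theta> by (simp add: abs_mult mult_ac add_ac)
      qed (use i1 i2 in auto)
      also have "\<dots> = \<theta> * (\<integral>x. w x * (f x)\<^sup>2 \<partial>\<mu>) + (\<integral>x. inverse (w x) * (g x)\<^sup>2 \<partial>\<mu>) / \<theta>" using i1 i2 by simp
      also have "\<dots> = N" unfolding N_def by (subst integral_mw, measurable, subst integral_mi, measurable)
      finally show ?thesis .
    qed
    then have "leaf_const * J \<le> leaf_const * (W * N)"
      using leaf_const_pos JS mult_right_mono[OF W_ge1 N0] by (intro mult_left_mono) auto
    then show "M + leaf_const * J \<le> form_const * W * N" by (simp add: M_def form_const_def algebra_simps)
  qed
  finally show ?thesis by (simp add: lhs_def N_def)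
qed

end

section \<open>Completeness and density in \<open>L\<^sup>2\<close>\<close>

lemma square_add_le: "((a::real) + b)\<^sup>2 \<le> 2 * a\<^sup>2 + 2 * b\<^sup>2"
  using zero_le_power2[of "a - b"] by (simp add: power2_eq_square algebra_simps)

lemma L2_measurable: "f \<in> L2 M \<Longrightarrow> f \<in> borel_measurable M" by (simp add: L2_def)

lemma L2_integrable: "f \<in> L2 M \<Longrightarrow> integrable M (\<lambda>x. (f x)\<^sup>2)" by (simp add: L2_def)

lemma L2_add: assumes "f \<in> L2 M" "g \<in> L2 M" shows "(\<lambda>x. f x + g x) \<in> L2 M"
proof -
  have [measurable]: "f \<in> borel_measurable M" "g \<in> borel_measurable M" using assms by (auto simp: L2_def)
  have "integrable M (\<lambda>x. 2 * (f x)\<^sup>2 + 2 * (g x)\<^sup>2)" using assms by (auto simp: L2_def)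
  then have "integrable M (\<lambda>x. (f x + g x)\<^sup>2)"
    by (rule Bochner_Integration.integrable_bound) (auto intro!: AE_I2 square_add_le)
  then show ?thesis by (simp add: L2_def)
qed

lemma L2_cmult: "f \<in> L2 M \<Longrightarrow> (\<lambda>x. c * f x) \<in> L2 M"
  by (auto simp: L2_def power_mult_distrib)

lemma L2_diff: "f \<in> L2 M \<Longrightarrow> g \<in> L2 M \<Longrightarrow> (\<lambda>x. f x - g x) \<in> L2 M"
  using L2_add[of f M "\<lambda>x. (-1) * g x"] L2_cmult[of g M "-1"] by simp

lemma L2_integral_add_le:
  assumes "f \<in> L2 M" "g \<in> L2 M"
  shows "(\<integral>x. (f x + g x)\<^sup>2 \<partial>M) \<le> 2 * (\<integral>x. (f x)\<^sup>2 \<partial>M) + 2 * (\<integral>x. (g x)\<^sup>2 \<partial>M)"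
proof -
  have "(\<integral>x. (f x + g x)\<^sup>2 \<partial>M) \<le> (\<integral>x. 2 * (f x)\<^sup>2 + 2 * (g x)\<^sup>2 \<partial>M)"
    by (intro integral_mono square_add_le) (use L2_integrable[OF L2_add[OF assms]] assms in \<open>auto simp: L2_def\<close>)
  also have "\<dots> = 2 * (\<integral>x. (f x)\<^sup>2 \<partial>M) + 2 * (\<integral>x. (g x)\<^sup>2 \<partial>M)"
    using assms by (auto simp: L2_def)
  finally show ?thesis .
qed

lemma L2_triangle:
  assumes "f \<in> L2 M" "g \<in> L2 M" "h \<in> L2 M"
  shows "(\<integral>x. (f x - h x)\<^sup>2 \<partial>M) \<le> 2 * (\<integral>x. (f x - g x)\<^sup>2 \<partial>M) + 2 * (\<integral>x. (g x - h x)\<^sup>2 \<partial>M)"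
  using L2_integral_add_le[OF L2_diff[OF assms(1,2)] L2_diff[OF assms(2,3)]] by simp

lemma L2_square_le:
  assumes "f \<in> L2 M" "h \<in> L2 M"
  shows "(\<integral>x. (h x)\<^sup>2 \<partial>M) \<le> 2 * (\<integral>x. (f x)\<^sup>2 \<partial>M) + 2 * (\<integral>x. (f x - h x)\<^sup>2 \<partial>M)"
  using L2_integral_add_le[OF assms(1) L2_diff[OF assms(2,1)]] by (simp add: power2_commute)

lemma L2_AE_zero:
  assumes "f \<in> L2 M" "\<And>e. 0 < e \<Longrightarrow> (\<integral>x. (f x)\<^sup>2 \<partial>M) \<le> e"
  shows "AE x in M. f x = 0"
proof -
  have "(\<integral>x. (f x)\<^sup>2 \<partial>M) \<le> 0" using assms(2) by (rule field_le_epsilon[where y = 0, simplified])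
  then have "(\<integral>x. (f x)\<^sup>2 \<partial>M) = 0" by (simp add: antisym)
  then show ?thesis using L2_integrable[OF assms(1)] by (subst (asm) integral_nonneg_eq_0_iff_AE) auto
qed

lemma L2_nn_integral: "f \<in> L2 M \<Longrightarrow> (\<integral>\<^sup>+x. ennreal ((f x)\<^sup>2) \<partial>M) = ennreal (\<integral>x. (f x)\<^sup>2 \<partial>M)"
  by (rule nn_integral_eq_integral) (auto simp: L2_def)

lemma L2_of_nn_integral:
  assumes "f \<in> borel_measurable M" "(\<integral>\<^sup>+x. ennreal ((f x)\<^sup>2) \<partial>M) \<le> ennreal c" "0 \<le> c"
  shows "f \<in> L2 M" "(\<integral>x. (f x)\<^sup>2 \<partial>M) \<le> c"
proof -
  have "(\<integral>\<^sup>+x. ennreal ((f x)\<^sup>2) \<partial>M) < \<infinity>" using assms(2) by (auto intro: le_less_trans)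
  then have "integrable M (\<lambda>x. (f x)\<^sup>2)" using assms(1) by (intro integrableI_bounded) auto
  then show "f \<in> L2 M" using assms(1) by (simp add: L2_def)
  from L2_nn_integral[OF this] assms(2,3) show "(\<integral>x. (f x)\<^sup>2 \<partial>M) \<le> c" by simp
qed

lemma fatou_square:
  fixes u :: "nat \<Rightarrow> 'a \<Rightarrow> real"
  assumes [measurable]: "\<And>n. u n \<in> borel_measurable M" "g \<in> borel_measurable M"
    and lim: "AE x in M. (\<lambda>n. u n x) \<longlonglongrightarrow> g x" and le: "\<And>n. (\<integral>\<^sup>+x. ennreal ((u n x)\<^sup>2) \<partial>M) \<le> c"
  shows "(\<integral>\<^sup>+x. ennreal ((g x)\<^sup>2) \<partial>M) \<le> c"
proof -
  have "(\<integral>\<^sup>+x. ennreal ((g x)\<^sup>2) \<partial>M) = (\<integral>\<^sup>+x. liminf (\<lambda>n. ennreal ((u n x)\<^sup>2)) \<partial>M)"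
  proof (rule nn_integral_cong_AE)
    show "AE x in M. ennreal ((g x)\<^sup>2) = liminf (\<lambda>n. ennreal ((u n x)\<^sup>2))"
      using lim
    proof eventually_elim
      case (elim x)
      then have "(\<lambda>n. ennreal ((u n x)\<^sup>2)) \<longlonglongrightarrow> ennreal ((g x)\<^sup>2)" by (intro tendsto_ennrealI tendsto_power)
      from lim_imp_Liminf[OF trivial_limit_sequentially this] show ?case by simp
    qed
  qed
  also have "\<dots> \<le> liminf (\<lambda>n. \<integral>\<^sup>+x. ennreal ((u n x)\<^sup>2) \<partial>M)" by (rule nn_integral_liminf) measurable
  also have "\<dots> \<le> liminf (\<lambda>n. c)" by (intro Liminf_mono always_eventually allI le)
  also have "\<dots> = c" by (simp add: Liminf_const)
  finally show ?thesis .
qed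

text \<open>
  The factors \<open>2 ^ (k + 1)\<close> replace the triangle inequality of the \<open>L\<^sup>2\<close> norm for sums of any length.
\<close>

lemma square_sum_weighted:
  fixes d :: "nat \<Rightarrow> real"
  shows "(\<Sum>k<m. d k)\<^sup>2 \<le> (\<Sum>k<m. 2 ^ (k + 1) * (d k)\<^sup>2)"
proof (induction m arbitrary: d)
  case (Suc m)
  have "(\<Sum>k<Suc m. d k)\<^sup>2 = (d 0 + (\<Sum>k<m. d (Suc k)))\<^sup>2" by (simp only: sum.lessThan_Suc_shift)
  also have "\<dots> \<le> 2 * (d 0)\<^sup>2 + 2 * (\<Sum>k<m. d (Suc k))\<^sup>2" by (rule square_add_le)
  also have "\<dots> \<le> 2 * (d 0)\<^sup>2 + 2 * (\<Sum>k<m. 2 ^ (k + 1) * (d (Suc k))\<^sup>2)" using Suc[of "\<lambda>k. d (Suc k)"] by simp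
  also have "\<dots> = (\<Sum>k<Suc m. 2 ^ (k + 1) * (d k)\<^sup>2)"
    by (simp only: sum.lessThan_Suc_shift) (simp add: sum_distrib_left mult_ac)
  finally show ?case .
qed simp

text \<open>
  Completeness of \<open>L\<^sup>2\<close> for sequences that converge fast enough to converge almost everywhere, with
  the rate of convergence. Squares of norms are used throughout, so the decay \<open>1 / 8\<close> has to beat
  the factors \<open>2 ^ n\<close> in \<open>square_sum_weighted\<close>.
\<close>

lemma L2_complete_fast:
  fixes u :: "nat \<Rightarrow> 'a \<Rightarrow> real"
  assumes u: "\<And>n. u n \<in> L2 M" and "0 \<le> c"
    and fast: "\<And>n. (\<integral>x. (u (Suc n) x - u n x)\<^sup>2 \<partial>M) \<le> c * (1 / 8) ^ n"
  shows "\<exists>g\<in>L2 M. \<forall>n. (\<integral>x. (g x - u n x)\<^sup>2 \<partial>M) \<le> 4 * c * (1 / 8) ^ n"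
proof -
  have um [measurable]: "u n \<in> borel_measurable M" for n by (rule L2_measurable[OF u])
  define d where "d n x = u (Suc n) x - u n x" for n x
  have dL2: "d n \<in> L2 M" for n unfolding d_def[abs_def] by (intro L2_diff u)
  have [measurable]: "d n \<in> borel_measurable M" for n by (rule L2_measurable[OF dL2])
  have dint: "(\<integral>\<^sup>+x. ennreal ((d n x)\<^sup>2) \<partial>M) \<le> ennreal (c * (1 / 8) ^ n)" for n
    using fast[of n] unfolding L2_nn_integral[OF dL2] by (intro ennreal_leI) (simp add: d_def)
  have "(\<integral>\<^sup>+x. (\<Sum>n. ennreal (2 ^ n * (d n x)\<^sup>2)) \<partial>M) = (\<Sum>n. \<integral>\<^sup>+x. ennreal (2 ^ n * (d n x)\<^sup>2) \<partial>M)"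
    by (rule nn_integral_suminf) measurable
  also have "\<dots> \<le> (\<Sum>n. ennreal (c * (1 / 4) ^ n))"
  proof (intro suminf_le summableI)
    fix n
    have "(\<integral>\<^sup>+x. ennreal (2 ^ n * (d n x)\<^sup>2) \<partial>M) = ennreal (2 ^ n) * (\<integral>\<^sup>+x. ennreal ((d n x)\<^sup>2) \<partial>M)"
      by (subst nn_integral_cmult[symmetric]) (auto simp: ennreal_mult)
    also have "\<dots> \<le> ennreal (2 ^ n) * ennreal (c * (1 / 8) ^ n)" by (intro mult_left_mono dint) auto
    also have "\<dots> = ennreal (2 ^ n * (c * (1 / 8) ^ n))" using \<open>0 \<le> c\<close> by (intro ennreal_mult[symmetric]) auto
    also have "2 ^ n * (c * (1 / 8) ^ n) = c * (2 * (1 / 8)) ^ n" by (simp only: power_mult_distrib mult_ac)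
    also have "\<dots> = c * (1 / 4) ^ n" by simp
    finally show "(\<integral>\<^sup>+x. ennreal (2 ^ n * (d n x)\<^sup>2) \<partial>M) \<le> ennreal (c * (1 / 4) ^ n)" .
  qed
  also have "\<dots> = ennreal (\<Sum>n. c * (1 / 4) ^ n)"
    by (rule suminf_ennreal2) (use \<open>0 \<le> c\<close> in \<open>auto intro!: summable_mult summable_geometric\<close>)
  finally have "(\<integral>\<^sup>+x. (\<Sum>n. ennreal (2 ^ n * (d n x)\<^sup>2)) \<partial>M) \<noteq> \<infinity>" by (auto simp: top_unique)
  then have fin: "AE x in M. (\<Sum>n. ennreal (2 ^ n * (d n x)\<^sup>2)) \<noteq> \<infinity>"
    by (intro nn_integral_PInf_AE) measurable
  define g where "g x = lim (\<lambda>n. u n x)" for x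
  have gm [measurable]: "g \<in> borel_measurable M" unfolding g_def by measurable
  have conv: "AE x in M. (\<lambda>n. u n x) \<longlonglongrightarrow> g x"
    using fin
  proof eventually_elim
    case (elim x)
    have s1: "summable (\<lambda>n. 2 ^ n * (d n x)\<^sup>2)"
      by (rule summable_suminf_not_top) (use elim in auto)
    have "summable (\<lambda>n. d n x)"
    proof (rule summable_comparison_test')
      show "summable (\<lambda>n. 1 / 2 * (1 / 2) ^ n + 1 / 2 * (2 ^ n * (d n x)\<^sup>2))"
        using s1 by (intro summable_add summable_mult summable_geometric) auto
      fix n :: nat
      have p: "0 < (2::real) ^ n" by simp
      have "0 \<le> (2 ^ n * \<bar>d n x\<bar> - 1)\<^sup>2 / 2 ^ n" using p by simp
      also have "\<dots> = 2 ^ n * (d n x)\<^sup>2 - 2 * \<bar>d n x\<bar> + 1 / 2 ^ n"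
        using p by (simp add: power2_eq_square field_simps)
      finally show "norm (d n x) \<le> 1 / 2 * (1 / 2) ^ n + 1 / 2 * (2 ^ n * (d n x)\<^sup>2)"
        by (simp add: power_divide)
    qed
    then have "convergent (\<lambda>n. \<Sum>i<n. d i x)" by (simp add: summable_iff_convergent)
    then have "convergent (\<lambda>n. (\<Sum>i<n. d i x) + u 0 x)" by (intro convergent_add convergent_const)
    moreover have "(\<Sum>i<n. d i x) + u 0 x = u n x" for n
      using sum_lessThan_telescope[of "\<lambda>i. u i x" n] by (simp add: d_def)
    ultimately have "convergent (\<lambda>n. u n x)" by simp
    then show ?case by (simp add: g_def convergent_LIMSEQ_iff)
  qed
  have gu: "(\<integral>\<^sup>+x. ennreal ((g x - u n x)\<^sup>2) \<partial>M) \<le> ennreal (4 * c * (1 / 8) ^ n)" for n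
  proof (rule fatou_square[where u = "\<lambda>m x. u (m + n) x - u n x"])
    show "AE x in M. (\<lambda>m. u (m + n) x - u n x) \<longlonglongrightarrow> g x - u n x"
      using conv by eventually_elim (intro tendsto_intros LIMSEQ_ignore_initial_segment)
    fix m
    have "(u (m + n) x - u n x)\<^sup>2 \<le> (\<Sum>k<m. 2 ^ (k + 1) * (d (k + n) x)\<^sup>2)" for x
    proof -
      have "u (m + n) x - u n x = (\<Sum>k<m. d (k + n) x)"
        using sum_lessThan_telescope[of "\<lambda>k. u (k + n) x" m] by (simp add: d_def)
      then show ?thesis using square_sum_weighted[of "\<lambda>k. d (k + n) x" m] by simp
    qed
    then have "(\<integral>\<^sup>+x. ennreal ((u (m + n) x - u n x)\<^sup>2) \<partial>M) \<le> (\<integral>\<^sup>+x. (\<Sum>k<m. ennreal (2 ^ (k + 1)) * ennreal ((d (k + n) x)\<^sup>2)) \<partial>M)"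
      by (intro nn_integral_mono) (simp add: ennreal_mult[symmetric] sum_ennreal ennreal_leI)
    also have "\<dots> = (\<Sum>k<m. ennreal (2 ^ (k + 1)) * (\<integral>\<^sup>+x. ennreal ((d (k + n) x)\<^sup>2) \<partial>M))"
      by (subst nn_integral_sum, measurable, subst nn_integral_cmult) auto
    also have "\<dots> \<le> (\<Sum>k<m. ennreal (2 ^ (k + 1)) * ennreal (c * (1 / 8) ^ (k + n)))"
      by (intro sum_mono mult_left_mono dint) auto
    also have "\<dots> = ennreal (\<Sum>k<m. 2 ^ (k + 1) * (c * (1 / 8) ^ (k + n)))"
      using \<open>0 \<le> c\<close> by (simp add: ennreal_mult[symmetric] sum_ennreal)
    also have "\<dots> \<le> ennreal (4 * c * (1 / 8) ^ n)"
    proof (rule ennreal_leI)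
      have "(\<Sum>k<m. 2 ^ (k + 1) * (c * (1 / 8) ^ (k + n))) = 2 * c * (1 / 8) ^ n * (\<Sum>k<m. (1 / 4) ^ k)"
      proof -
        have "2 ^ (k + 1) * (c * (1 / 8) ^ (k + n)) = 2 * c * (1 / 8) ^ n * (1 / 4) ^ k" for k
        proof -
          have "(1 / 4 :: real) ^ k = 2 ^ k * (1 / 8) ^ k" by (simp only: power_mult_distrib[symmetric]) simp
          then show ?thesis by (simp add: power_add)
        qed
        then show ?thesis unfolding sum_distrib_left by (intro sum.cong refl)
      qed
      also have "\<dots> \<le> 2 * c * (1 / 8) ^ n * 2"
      proof (intro mult_left_mono)
        have "(\<Sum>k<m. (1 / 4 :: real) ^ k) = (1 - (1 / 4) ^ m) / (1 - 1 / 4)" by (subst sum_gp_strict) auto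
        also have "\<dots> \<le> 1 / (1 - 1 / 4)" by (intro divide_right_mono) auto
        also have "\<dots> \<le> (2::real)" by simp
        finally show "(\<Sum>k<m. (1 / 4 :: real) ^ k) \<le> 2" .
      qed (use \<open>0 \<le> c\<close> in auto)
      finally show "(\<Sum>k<m. 2 ^ (k + 1) * (c * (1 / 8) ^ (k + n))) \<le> 4 * c * (1 / 8) ^ n" by simp
    qed
    finally show "(\<integral>\<^sup>+x. ennreal ((u (m + n) x - u n x)\<^sup>2) \<partial>M) \<le> ennreal (4 * c * (1 / 8) ^ n)" .
  qed measurable
  have gdiff: "(\<lambda>x. g x - u n x) \<in> L2 M" "(\<integral>x. (g x - u n x)\<^sup>2 \<partial>M) \<le> 4 * c * (1 / 8) ^ n" for n
    by (rule L2_of_nn_integral[OF _ gu[of n]], measurable, use \<open>0 \<le> c\<close> in simp)+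
  have "g \<in> L2 M" using L2_add[OF gdiff(1)[of 0] u[of 0]] by simp
  then show ?thesis using gdiff(2) by blast
qed

context borel_ball_finite begin

lemma L2_Lipschitz_dense:
  assumes f: "f \<in> L2 M" and e: "0 < e"
  shows "\<exists>\<phi>. lip \<phi> \<and> \<phi> \<in> BB \<and> (\<integral>x. (f x - \<phi> x)\<^sup>2 \<partial>M) < e"
proof -
  obtain x0 :: 'a where True by blast
  have fm: "f \<in> borel_measurable borel" using L2_measurable[OF f] measurable_cong_sets[OF sets_M refl, of "borel :: real measure"] by simp
  note [measurable] = fm
  define A where "A n = {x. \<bar>f x\<bar> \<le> real n} \<inter> ball x0 (real n)" for n
  have A: "A n \<in> sets borel" for n
  proof -
    have "{x. \<bar>f x\<bar> \<le> real n} \<in> sets borel" by measurable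
    then show ?thesis unfolding A_def by auto
  qed
  note [measurable] = A
  define t where "t n x = f x * indicator (A n) x" for n x
  have tBB: "t n \<in> BB" for n
  proof (rule BB_I[of _ "real n" x0 "real n"])
    show "t n \<in> borel_measurable borel" unfolding t_def[abs_def] by measurable
  qed (auto simp: t_def A_def indicator_def)
  have "(\<lambda>n. \<integral>x. (f x - t n x)\<^sup>2 \<partial>M) \<longlonglongrightarrow> (\<integral>x. 0 \<partial>M)"
  proof (rule integral_dominated_convergence[where w = "\<lambda>x. (f x)\<^sup>2"])
    show "(\<lambda>x. (f x - t n x)\<^sup>2) \<in> borel_measurable M" for n unfolding t_def by measurable
    show "integrable M (\<lambda>x. (f x)\<^sup>2)" by (rule L2_integrable[OF f])
    show "AE x in M. norm ((f x - t n x)\<^sup>2) \<le> (f x)\<^sup>2" for n by (intro AE_I2) (auto simp: t_def indicator_def)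
    show "AE x in M. (\<lambda>n. (f x - t n x)\<^sup>2) \<longlonglongrightarrow> 0"
    proof (rule AE_I2)
      fix x
      obtain N where N: "max \<bar>f x\<bar> (dist x0 x) < real N" using reals_Archimedean2 by blast
      have "eventually (\<lambda>n. (f x - t n x)\<^sup>2 = 0) sequentially"
        using eventually_ge_at_top[of N]
      proof eventually_elim
        case (elim n)
        then have "x \<in> A n" using N by (auto simp: A_def)
        then show ?case by (simp add: t_def)
      qed
      then show "(\<lambda>n. (f x - t n x)\<^sup>2) \<longlonglongrightarrow> 0" by (rule tendsto_eventually)
    qed
  qed simp
  then have "eventually (\<lambda>n. (\<integral>x. (f x - t n x)\<^sup>2 \<partial>M) < e / 4) sequentially"
    using e by (intro order_tendstoD(2)) auto
  then obtain n where n: "(\<integral>x. (f x - t n x)\<^sup>2 \<partial>M) < e / 4" by (auto simp: eventually_sequentially)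
  obtain c r where "0 < r" "\<And>x. \<bar>t n x\<bar> \<le> c" "\<And>x. t n x \<noteq> 0 \<Longrightarrow> x \<in> ball x0 r" using BB_E[OF tBB[of n], of x0] by metis
  then obtain \<phi> where \<phi>: "lip \<phi>" "\<phi> \<in> BB" "(\<integral>x. (t n x - \<phi> x)\<^sup>2 \<partial>M) < e / 4"
    using BB_Lipschitz_approx[OF tBB[of n], of c x0 r "e / 4"] e by auto
  have "(\<integral>x. (f x - \<phi> x)\<^sup>2 \<partial>M) \<le> 2 * (\<integral>x. (f x - t n x)\<^sup>2 \<partial>M) + 2 * (\<integral>x. (t n x - \<phi> x)\<^sup>2 \<partial>M)"
    by (intro L2_triangle f BB_L2 tBB \<phi>)
  then show ?thesis using n \<phi> by (intro exI[of _ \<phi>]) auto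
qed

end

context cz_operator begin

lemma T_L2_add: "f \<in> L2 \<mu> \<Longrightarrow> g \<in> L2 \<mu> \<Longrightarrow> AE x in \<mu>. T (\<lambda>y. f y + g y) x = T f x + T g x"
  using T_CZ by (auto simp: CZ_operator_def bounded_L2_operator_def)

lemma T_L2_cmult: "f \<in> L2 \<mu> \<Longrightarrow> AE x in \<mu>. T (\<lambda>y. c * f y) x = c * T f x"
  using T_CZ by (auto simp: CZ_operator_def bounded_L2_operator_def)

lemma T_L2_diff: assumes "f \<in> L2 \<mu>" "g \<in> L2 \<mu>" shows "AE x in \<mu>. T (\<lambda>y. f y - g y) x = T f x - T g x"
  using T_L2_add[OF assms(1) L2_cmult[OF assms(2), of "-1"]] T_L2_cmult[OF assms(2), of "-1"] by eventually_elim auto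

end

section \<open>Extension to the weighted space\<close>

context cz_weight begin

lemma mixed_ball_finite:
  assumes "\<And>x. 0 < v x" "v \<in> borel_measurable borel" "borel_ball_finite (density \<mu> (\<lambda>x. ennreal (v x)))"
  shows "borel_ball_finite (density \<mu> (\<lambda>x. ennreal (1 + v x)))"
proof
  show "sets (density \<mu> (\<lambda>x. ennreal (1 + v x))) = sets borel" by (simp add: sets_M)
  note [measurable] = assms(2)
  interpret v: borel_ball_finite "density \<mu> (\<lambda>x. ennreal (v x))" by fact
  fix x r
  have "emeasure (density \<mu> (\<lambda>x. ennreal (1 + v x))) (ball x r) = (\<integral>\<^sup>+y. ennreal (1 + v y) * indicator (ball x r) y \<partial>\<mu>)"
    by (subst emeasure_density) (auto simp: sets_M)
  also have "\<dots> = (\<integral>\<^sup>+y. indicator (ball x r) y + ennreal (v y) * indicator (ball x r) y \<partial>\<mu>)"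
  proof (rule nn_integral_cong)
    fix y
    have "ennreal (1 + v y) = 1 + ennreal (v y)" using assms(1)[of y] by (simp add: ennreal_plus)
    then show "ennreal (1 + v y) * indicator (ball x r) y = indicator (ball x r) y + ennreal (v y) * indicator (ball x r) y"
      by (simp add: distrib_right)
  qed
  also have "\<dots> = emeasure \<mu> (ball x r) + emeasure (density \<mu> (\<lambda>x. ennreal (v x))) (ball x r)"
    by (subst nn_integral_add) (auto simp: sets_M emeasure_density)
  also have "\<dots> < \<infinity>" using ball_finite[of x r] v.ball_finite[of x r] by (simp add: less_top)
  finally show "emeasure (density \<mu> (\<lambda>x. ennreal (1 + v x))) (ball x r) < \<infinity>" .
qed

text \<open>
  Simultaneous approximation in \<open>L\<^sup>2(\<mu>)\<close> and \<open>L\<^sup>2(v d\<mu>)\<close> is approximation in \<open>L\<^sup>2((1 + v) d\<mu>)\<close>.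
\<close>

lemma mixed_approx:
  assumes v: "\<And>x. 0 < v x" "v \<in> borel_measurable borel" "borel_ball_finite (density \<mu> (\<lambda>x. ennreal (v x)))"
    and f: "f \<in> L2 \<mu>" "f \<in> L2 (density \<mu> (\<lambda>x. ennreal (v x)))" and e: "0 < e"
  shows "\<exists>\<phi>. lip \<phi> \<and> \<phi> \<in> BB \<and> (\<integral>x. (f x - \<phi> x)\<^sup>2 \<partial>\<mu>) < e \<and> (\<integral>x. (f x - \<phi> x)\<^sup>2 \<partial>density \<mu> (\<lambda>x. ennreal (v x))) < e"
proof -
  note [measurable] = v(2)
  let ?N = "density \<mu> (\<lambda>x. ennreal (1 + v x))"
  let ?v = "density \<mu> (\<lambda>x. ennreal (v x))"
  interpret N: borel_ball_finite ?N by (rule mixed_ball_finite[OF v])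
  interpret v: borel_ball_finite ?v by fact
  have fm [measurable]: "f \<in> borel_measurable borel"
    using L2_measurable[OF f(1)] measurable_cong_sets[OF sets_M refl, of "borel :: real measure"] by simp
  have v0: "0 \<le> v x" "0 \<le> 1 + v x" for x using v(1)[of x] by linarith+
  have split: "h \<in> L2 \<mu> \<Longrightarrow> h \<in> L2 ?v \<Longrightarrow> h \<in> borel_measurable borel \<Longrightarrow>
    h \<in> L2 ?N \<and> (\<integral>x. (h x)\<^sup>2 \<partial>?N) = (\<integral>x. (h x)\<^sup>2 \<partial>\<mu>) + (\<integral>x. (h x)\<^sup>2 \<partial>?v)" for h
  proof -
    assume h: "h \<in> L2 \<mu>" "h \<in> L2 ?v" and [measurable]: "h \<in> borel_measurable borel"
    have i1: "integrable \<mu> (\<lambda>x. (h x)\<^sup>2)" by (rule L2_integrable[OF h(1)])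
    have i2: "integrable \<mu> (\<lambda>x. v x * (h x)\<^sup>2)"
      using L2_integrable[OF h(2)] v0 by (subst (asm) integrable_density) auto
    have eq: "(1 + v x) * (h x)\<^sup>2 = (h x)\<^sup>2 + v x * (h x)\<^sup>2" for x by (simp add: distrib_right)
    have "integrable \<mu> (\<lambda>x. (1 + v x) *\<^sub>R (h x)\<^sup>2)" using i1 i2 by (simp add: eq)
    then have "integrable ?N (\<lambda>x. (h x)\<^sup>2)" using v0 by (subst integrable_density) auto
    moreover have "(\<integral>x. (h x)\<^sup>2 \<partial>?N) = (\<integral>x. (1 + v x) *\<^sub>R (h x)\<^sup>2 \<partial>\<mu>)"
      using v0 by (subst integral_density) auto
    moreover have "\<dots> = (\<integral>x. (h x)\<^sup>2 \<partial>\<mu>) + (\<integral>x. v x * (h x)\<^sup>2 \<partial>\<mu>)" using i1 i2 by (simp add: eq)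
    moreover have "(\<integral>x. v x * (h x)\<^sup>2 \<partial>\<mu>) = (\<integral>x. (h x)\<^sup>2 \<partial>?v)" using v0 by (subst integral_density) auto
    ultimately show ?thesis by (simp add: L2_def)
  qed
  from split[OF f fm] have "f \<in> L2 ?N" by simp
  from N.L2_Lipschitz_dense[OF this e] obtain \<phi> where \<phi>: "lip \<phi>" "\<phi> \<in> BB" "(\<integral>x. (f x - \<phi> x)\<^sup>2 \<partial>?N) < e" by blast
  have "(\<lambda>x. f x - \<phi> x) \<in> L2 \<mu>" "(\<lambda>x. f x - \<phi> x) \<in> L2 ?v" by (intro L2_diff f BB_L2 v.BB_L2 \<phi>)+
  moreover have "(\<lambda>x. f x - \<phi> x) \<in> borel_measurable borel" using BB_measurable[OF \<phi>(2)] by simp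
  ultimately have "(\<integral>x. (f x - \<phi> x)\<^sup>2 \<partial>?N) = (\<integral>x. (f x - \<phi> x)\<^sup>2 \<partial>\<mu>) + (\<integral>x. (f x - \<phi> x)\<^sup>2 \<partial>?v)"
    using split by blast
  moreover have "0 \<le> (\<integral>x. (f x - \<phi> x)\<^sup>2 \<partial>\<mu>)" "0 \<le> (\<integral>x. (f x - \<phi> x)\<^sup>2 \<partial>?v)" by simp_all
  ultimately have "(\<integral>x. (f x - \<phi> x)\<^sup>2 \<partial>\<mu>) < e" "(\<integral>x. (f x - \<phi> x)\<^sup>2 \<partial>?v) < e" using \<phi>(3) by linarith+
  with \<phi>(1,2) show ?thesis by (intro exI[of _ \<phi>] conjI)
qed

text \<open>
  \<open>g\<close> is approximated by Lipschitz functions in \<open>L\<^sup>2(\<mu>)\<close>, to control the error by the \<open>L\<^sup>2(\<mu>)\<close> norm of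
  \<open>T f\<close>, and in \<open>L\<^sup>2(w\<^sup>-\<^sup>1 d\<mu>)\<close>, to control the norm of the approximation.
\<close>

lemma bilinear_BB:
  assumes f: "f \<in> BB" "lip f" and g: "g \<in> BB" and \<theta>: "0 < \<theta>"
  shows "(\<integral>\<^sup>+x. ennreal (\<bar>T f x\<bar> * \<bar>g x\<bar>) \<partial>\<mu>)
    \<le> ennreal (2 * form_const * W * (\<theta> * (\<integral>x. (f x)\<^sup>2 \<partial>\<mu>w) + (\<integral>x. (g x)\<^sup>2 \<partial>\<mu>i) / \<theta>))"
proof -
  define F where "F = (\<integral>x. (f x)\<^sup>2 \<partial>\<mu>w)"
  define G where "G = (\<integral>x. (g x)\<^sup>2 \<partial>\<mu>i)"
  define Y where "Y = (\<integral>x. (T f x)\<^sup>2 \<partial>\<mu>)"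
  have nn: "0 \<le> F" "0 \<le> G" "0 \<le> Y" by (simp_all add: F_def G_def Y_def)
  have square_const: "0 < form_const * W" using form_const_pos W_ge1 by simp
  have [measurable]: "T f \<in> borel_measurable borel" "g \<in> borel_measurable borel"
    using T_measurable[OF f(1)] BB_measurable[OF g] by auto
  define lhs where "lhs = (\<integral>\<^sup>+x. ennreal (\<bar>T f x\<bar> * \<bar>g x\<bar>) \<partial>\<mu>)"
  define rhs where "rhs e = form_const * W * (\<theta> * F + (2 * G + 2 * e\<^sup>2) / \<theta>) + e / 2 * (Y + 1)" for e
  have le: "lhs \<le> ennreal (rhs e)" if e: "0 < e" for e
  proof -
    have "0 < e\<^sup>2" using e by simp
    then obtain \<phi> where \<phi>: "lip \<phi>" "\<phi> \<in> BB" "(\<integral>x. (g x - \<phi> x)\<^sup>2 \<partial>\<mu>) < e\<^sup>2" "(\<integral>x. (g x - \<phi> x)\<^sup>2 \<partial>\<mu>i) < e\<^sup>2"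
      using mixed_approx[of "\<lambda>x. inverse (w x)" g "e\<^sup>2"] w_pos mi.borel_ball_finite_axioms BB_L2[OF g] mi.BB_L2[OF g] by auto
    have [measurable]: "\<phi> \<in> borel_measurable borel" by (rule BB_measurable[OF \<phi>(2)])
    have d: "(\<lambda>x. g x - \<phi> x) \<in> BB" by (intro BB_diff g \<phi>)
    have "lhs \<le> (\<integral>\<^sup>+x. ennreal (\<bar>T f x\<bar> * \<bar>\<phi> x\<bar>) + ennreal (e / 2 * (T f x)\<^sup>2 + (g x - \<phi> x)\<^sup>2 / (2 * e)) \<partial>\<mu>)"
      unfolding lhs_def
    proof (rule nn_integral_mono)
      fix x
      have "\<bar>T f x\<bar> * \<bar>g x\<bar> \<le> \<bar>T f x\<bar> * (\<bar>\<phi> x\<bar> + \<bar>g x - \<phi> x\<bar>)" by (intro mult_left_mono) auto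
      also have "\<dots> = \<bar>T f x\<bar> * \<bar>\<phi> x\<bar> + \<bar>T f x\<bar> * \<bar>g x - \<phi> x\<bar>" by (simp add: distrib_left)
      also have "\<bar>T f x\<bar> * \<bar>g x - \<phi> x\<bar> \<le> e / 2 * (T f x)\<^sup>2 + (g x - \<phi> x)\<^sup>2 / (2 * e)"
      proof -
        have "0 \<le> (e * \<bar>T f x\<bar> - \<bar>g x - \<phi> x\<bar>)\<^sup>2 / (2 * e)" using e by simp
        also have "\<dots> = e / 2 * (T f x)\<^sup>2 + (g x - \<phi> x)\<^sup>2 / (2 * e) - \<bar>T f x\<bar> * \<bar>g x - \<phi> x\<bar>"
        proof -
          have "(e * \<bar>T f x\<bar> - \<bar>g x - \<phi> x\<bar>)\<^sup>2 = e\<^sup>2 * (T f x)\<^sup>2 - 2 * e * (\<bar>T f x\<bar> * \<bar>g x - \<phi> x\<bar>) + (g x - \<phi> x)\<^sup>2"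
            by (simp add: power2_diff power_mult_distrib)
          then show ?thesis using e by (simp add: field_simps power2_eq_square)
        qed
        finally show ?thesis by simp
      qed
      finally have "ennreal (\<bar>T f x\<bar> * \<bar>g x\<bar>) \<le> ennreal (\<bar>T f x\<bar> * \<bar>\<phi> x\<bar> + (e / 2 * (T f x)\<^sup>2 + (g x - \<phi> x)\<^sup>2 / (2 * e)))"
        by (rule ennreal_leI) simp
      also have "\<dots> = ennreal (\<bar>T f x\<bar> * \<bar>\<phi> x\<bar>) + ennreal (e / 2 * (T f x)\<^sup>2 + (g x - \<phi> x)\<^sup>2 / (2 * e))"
        using e by (intro ennreal_plus) auto
      finally show "ennreal (\<bar>T f x\<bar> * \<bar>g x\<bar>) \<le> ennreal (\<bar>T f x\<bar> * \<bar>\<phi> x\<bar>) + ennreal (e / 2 * (T f x)\<^sup>2 + (g x - \<phi> x)\<^sup>2 / (2 * e))" .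
    qed
    also have "\<dots> = (\<integral>\<^sup>+x. ennreal (\<bar>T f x\<bar> * \<bar>\<phi> x\<bar>) \<partial>\<mu>) + (\<integral>\<^sup>+x. ennreal (e / 2 * (T f x)\<^sup>2 + (g x - \<phi> x)\<^sup>2 / (2 * e)) \<partial>\<mu>)"
      by (rule nn_integral_add) measurable
    also have "\<dots> \<le> ennreal (form_const * W * (\<theta> * F + (2 * G + 2 * e\<^sup>2) / \<theta>)) + ennreal (e / 2 * (Y + 1))"
    proof (rule add_mono)
      have "(\<integral>x. (\<phi> x)\<^sup>2 \<partial>\<mu>i) \<le> 2 * G + 2 * e\<^sup>2"
        using L2_square_le[OF mi.BB_L2[OF g] mi.BB_L2[OF \<phi>(2)]] \<phi>(4) by (simp add: G_def)
      then have "(\<integral>x. (\<phi> x)\<^sup>2 \<partial>\<mu>i) / \<theta> \<le> (2 * G + 2 * e\<^sup>2) / \<theta>" using \<theta> by (intro divide_right_mono) auto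
      then have "ennreal (form_const * W * (\<theta> * F + (\<integral>x. (\<phi> x)\<^sup>2 \<partial>\<mu>i) / \<theta>)) \<le> ennreal (form_const * W * (\<theta> * F + (2 * G + 2 * e\<^sup>2) / \<theta>))"
        using square_const by (intro ennreal_leI mult_left_mono add_left_mono) auto
      with bilinear_Lipschitz[OF f \<phi>(2,1) \<theta>]
      show "(\<integral>\<^sup>+x. ennreal (\<bar>T f x\<bar> * \<bar>\<phi> x\<bar>) \<partial>\<mu>) \<le> ennreal (form_const * W * (\<theta> * F + (2 * G + 2 * e\<^sup>2) / \<theta>))"
        unfolding F_def by (rule order_trans)
      have i1: "integrable \<mu> (\<lambda>x. (T f x)\<^sup>2)" by (rule T_integrable[OF f(1)])
      have i2: "integrable \<mu> (\<lambda>x. (g x - \<phi> x)\<^sup>2)" by (rule L2_integrable[OF BB_L2[OF d]])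
      have "(\<integral>\<^sup>+x. ennreal (e / 2 * (T f x)\<^sup>2 + (g x - \<phi> x)\<^sup>2 / (2 * e)) \<partial>\<mu>) = ennreal (\<integral>x. e / 2 * (T f x)\<^sup>2 + (g x - \<phi> x)\<^sup>2 / (2 * e) \<partial>\<mu>)"
        using i1 i2 e by (intro nn_integral_eq_integral) auto
      also have "(\<integral>x. e / 2 * (T f x)\<^sup>2 + (g x - \<phi> x)\<^sup>2 / (2 * e) \<partial>\<mu>) = e / 2 * Y + (\<integral>x. (g x - \<phi> x)\<^sup>2 \<partial>\<mu>) / (2 * e)"
        using i1 i2 by (simp add: Y_def)
      also have "ennreal \<dots> \<le> ennreal (e / 2 * (Y + 1))"
      proof (rule ennreal_leI)
        have "(\<integral>x. (g x - \<phi> x)\<^sup>2 \<partial>\<mu>) / (2 * e) \<le> e\<^sup>2 / (2 * e)" using \<phi>(3) e by (intro divide_right_mono) auto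
        also have "\<dots> = e / 2" using e by (simp add: power2_eq_square)
        finally show "e / 2 * Y + (\<integral>x. (g x - \<phi> x)\<^sup>2 \<partial>\<mu>) / (2 * e) \<le> e / 2 * (Y + 1)" by (simp add: distrib_left)
      qed
      finally show "(\<integral>\<^sup>+x. ennreal (e / 2 * (T f x)\<^sup>2 + (g x - \<phi> x)\<^sup>2 / (2 * e)) \<partial>\<mu>) \<le> ennreal (e / 2 * (Y + 1))" .
    qed
    also have "\<dots> = ennreal (rhs e)"
      unfolding rhs_def using square_const nn e \<theta> by (intro ennreal_plus[symmetric]) auto
    finally show ?thesis .
  qed
  have "(\<lambda>n. rhs (inverse (real (Suc n)))) \<longlonglongrightarrow> form_const * W * (\<theta> * F + (2 * G + 2 * 0\<^sup>2) / \<theta>) + 0 / 2 * (Y + 1)"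
    unfolding rhs_def using \<theta> by (intro tendsto_intros LIMSEQ_inverse_real_of_nat) auto
  then have "(\<lambda>n. ennreal (rhs (inverse (real (Suc n))))) \<longlonglongrightarrow> ennreal (form_const * W * (\<theta> * F + 2 * G / \<theta>))"
    by (intro tendsto_ennrealI) simp
  then have "lhs \<le> ennreal (form_const * W * (\<theta> * F + 2 * G / \<theta>))"
    by (rule LIMSEQ_le_const) (intro exI[of _ 0] allI impI le, simp)
  also have "\<dots> \<le> ennreal (2 * form_const * W * (\<theta> * F + G / \<theta>))"
  proof (rule ennreal_leI)
    have "\<theta> * F + 2 * G / \<theta> \<le> 2 * (\<theta> * F + G / \<theta>)" using nn \<theta> by simp
    from mult_left_mono[OF this less_imp_le[OF square_const]]
    have "form_const * W * (\<theta> * F + 2 * G / \<theta>) \<le> form_const * W * (2 * (\<theta> * F + G / \<theta>))" .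
    also have "\<dots> = 2 * form_const * W * (\<theta> * F + G / \<theta>)" by (simp only: mult_ac)
    finally show "form_const * W * (\<theta> * F + 2 * G / \<theta>) \<le> 2 * form_const * W * (\<theta> * F + G / \<theta>)" .
  qed
  finally show ?thesis by (simp add: lhs_def F_def G_def)
qed

text \<open>
  The form is tested with \<open>g = |T f| w\<close>, restricted to a set \<open>A n\<close> on which \<open>g\<close> is admissible. The form is then
  the square \<open>I\<close> of the norm of \<open>g\<close>, which is also the square of the norm of \<open>T f\<close> on \<open>A n\<close> for \<open>w d\<mu>\<close>.
  With \<open>\<theta> = 4 * form_const * W\<close> half of \<open>I\<close> is absorbed on the left.
\<close>

lemma weighted_bound_Lipschitz:
  assumes f: "f \<in> BB" "lip f"
  shows "(\<integral>\<^sup>+x. ennreal ((T f x)\<^sup>2) \<partial>\<mu>w) \<le> ennreal (16 * (form_const * W)\<^sup>2 * (\<integral>x. (f x)\<^sup>2 \<partial>\<mu>w))"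
proof -
  obtain x0 :: 'a where True by blast
  have square_const: "0 < form_const * W" using form_const_pos W_ge1 by simp
  note Tm [measurable] = T_measurable[OF f(1)]
  define F where "F = (\<integral>x. (f x)\<^sup>2 \<partial>\<mu>w)"
  define A where "A n = {x. \<bar>T f x\<bar> \<le> real n} \<inter> {x. w x \<le> real n} \<inter> ball x0 (real n)" for n
  have A: "A n \<in> sets borel" for n
  proof -
    have "{x. \<bar>T f x\<bar> \<le> real n} \<in> sets borel" "{x. w x \<le> real n} \<in> sets borel" by measurable
    then show ?thesis unfolding A_def by auto
  qed
  note [measurable] = A
  have w0: "0 \<le> w x" for x using w_pos[of x] by simp
  have le: "(\<integral>\<^sup>+x. ennreal ((T f x)\<^sup>2 * w x) * indicator (A n) x \<partial>\<mu>) \<le> ennreal (16 * (form_const * W)\<^sup>2 * F)" for n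
  proof -
    define g where "g x = \<bar>T f x\<bar> * w x * indicator (A n) x" for x
    have [measurable]: "g \<in> borel_measurable borel" unfolding g_def[abs_def] by measurable
    have g: "g \<in> BB"
    proof (rule BB_I[of _ "real n * real n" x0 "real n"])
      show "\<bar>g x\<bar> \<le> real n * real n" for x
      proof (cases "x \<in> A n")
        case True
        then have "\<bar>T f x\<bar> * w x \<le> real n * real n" using w0 by (intro mult_mono) (auto simp: A_def)
        then show ?thesis using True w0[of x] by (simp add: g_def abs_mult)
      qed (simp add: g_def)
      show "x \<in> ball x0 (real n)" if "g x \<noteq> 0" for x using that by (auto simp: g_def A_def indicator_def split: if_splits)
    qed measurable
    define I where "I = (\<integral>x. (g x)\<^sup>2 \<partial>\<mu>i)"
    have Ieq: "(\<integral>\<^sup>+x. ennreal (\<bar>T f x\<bar> * \<bar>g x\<bar>) \<partial>\<mu>) = ennreal I"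
    proof -
      have "ennreal I = (\<integral>\<^sup>+x. ennreal ((g x)\<^sup>2) \<partial>\<mu>i)"
        unfolding I_def by (rule L2_nn_integral[OF mi.BB_L2[OF g], symmetric])
      also have "\<dots> = (\<integral>\<^sup>+x. ennreal (inverse (w x)) * ennreal ((g x)\<^sup>2) \<partial>\<mu>)" by (rule nn_integral_density) measurable
      also have "\<dots> = (\<integral>\<^sup>+x. ennreal (\<bar>T f x\<bar> * \<bar>g x\<bar>) \<partial>\<mu>)"
      proof (rule nn_integral_cong)
        fix x
        have "inverse (w x) * (g x)\<^sup>2 = \<bar>T f x\<bar> * \<bar>g x\<bar>"
          using w_pos[of x] by (cases "x \<in> A n") (auto simp: g_def power2_eq_square abs_mult field_simps)
        then show "ennreal (inverse (w x)) * ennreal ((g x)\<^sup>2) = ennreal (\<bar>T f x\<bar> * \<bar>g x\<bar>)"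
          using w0[of x] by (simp add: ennreal_mult[symmetric])
      qed
      finally show ?thesis ..
    qed
    have I0: "0 \<le> I" by (simp add: I_def)
    have "I \<le> 2 * form_const * W * ((4 * (form_const * W)) * F + I / (4 * (form_const * W)))"
    proof (rule iffD1[OF ennreal_le_iff])
      have "0 \<le> F" by (simp add: F_def)
      with form_const_pos W_ge1 I0 show "0 \<le> 2 * form_const * W * ((4 * (form_const * W)) * F + I / (4 * (form_const * W)))"
        by (intro mult_nonneg_nonneg add_nonneg_nonneg divide_nonneg_nonneg) auto
      have th: "0 < 4 * (form_const * W)" using square_const by simp
      show "ennreal I \<le> ennreal (2 * form_const * W * ((4 * (form_const * W)) * F + I / (4 * (form_const * W))))"
        using bilinear_BB[OF f g th] unfolding Ieq F_def[symmetric] I_def[symmetric] .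
    qed
    also have "\<dots> = 8 * (form_const * W)\<^sup>2 * F + I / 2"
      using form_const_pos W_ge1 by (simp add: power2_eq_square field_simps)
    finally have I: "I \<le> 16 * (form_const * W)\<^sup>2 * F" by simp
    have "(\<integral>\<^sup>+x. ennreal ((T f x)\<^sup>2 * w x) * indicator (A n) x \<partial>\<mu>) = (\<integral>\<^sup>+x. ennreal (\<bar>T f x\<bar> * \<bar>g x\<bar>) \<partial>\<mu>)"
    proof (rule nn_integral_cong)
      fix x show "ennreal ((T f x)\<^sup>2 * w x) * indicator (A n) x = ennreal (\<bar>T f x\<bar> * \<bar>g x\<bar>)"
        using w0[of x] by (cases "x \<in> A n") (auto simp: g_def abs_mult power2_eq_square mult_ac)
    qed
    also have "\<dots> \<le> ennreal (16 * (form_const * W)\<^sup>2 * F)" unfolding Ieq using I by (rule ennreal_leI)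
    finally show ?thesis .
  qed
  have "(\<integral>\<^sup>+x. ennreal ((T f x)\<^sup>2) \<partial>\<mu>w) = (\<integral>\<^sup>+x. ennreal (w x) * ennreal ((T f x)\<^sup>2) \<partial>\<mu>)"
    by (rule nn_integral_density) measurable
  also have "\<dots> = (\<integral>\<^sup>+x. (SUP n. ennreal ((T f x)\<^sup>2 * w x) * indicator (A n) x) \<partial>\<mu>)"
  proof (rule nn_integral_cong)
    fix x
    obtain N where N: "max (max \<bar>T f x\<bar> (w x)) (dist x0 x) < real N" using reals_Archimedean2 by blast
    then have "x \<in> A N" by (auto simp: A_def)
    then have "ennreal ((T f x)\<^sup>2 * w x) * indicator (A N) x = ennreal ((T f x)\<^sup>2 * w x)" by simp
    then have "(SUP n. ennreal ((T f x)\<^sup>2 * w x) * indicator (A n) x) = ennreal ((T f x)\<^sup>2 * w x)"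
      by (intro antisym SUP_least SUP_upper2[of N]) (auto simp: indicator_def)
    then show "ennreal (w x) * ennreal ((T f x)\<^sup>2) = (SUP n. ennreal ((T f x)\<^sup>2 * w x) * indicator (A n) x)"
      using w0[of x] by (simp add: ennreal_mult[symmetric] mult.commute)
  qed
  also have "\<dots> = (SUP n. \<integral>\<^sup>+x. ennreal ((T f x)\<^sup>2 * w x) * indicator (A n) x \<partial>\<mu>)"
  proof (rule nn_integral_monotone_convergence_SUP)
    show "incseq (\<lambda>n x. ennreal ((T f x)\<^sup>2 * w x) * indicator (A n) x)"
    proof (intro incseq_SucI le_funI mult_left_mono)
      fix n x
      have "A n \<subseteq> A (Suc n)" by (auto simp: A_def)
      then show "indicator (A n) x \<le> (indicator (A (Suc n)) x :: ennreal)" by (auto simp: indicator_def)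
    qed simp
  qed measurable
  also have "\<dots> \<le> ennreal (16 * (form_const * W)\<^sup>2 * F)" by (intro SUP_least le)
  finally show ?thesis by (simp add: F_def)
qed

definition square_const :: real where "square_const = 32 * (form_const * W)\<^sup>2"

lemma square_const_pos: "0 < square_const" using form_const_pos W_ge1 by (simp add: square_const_def)

text \<open>
  \<open>f\<close> is approximated by Lipschitz functions in \<open>L\<^sup>2(\<mu>)\<close>, where \<open>T\<close> is continuous, and at the same time in
  \<open>L\<^sup>2(w d\<mu>)\<close>; Fatou's lemma passes the bound to the limit along a subsequence.
\<close>

lemma weighted_bound:
  assumes f: "f \<in> L2 \<mu>" "f \<in> L2 \<mu>w"
  shows "T f \<in> L2 \<mu>w" "(\<integral>x. (T f x)\<^sup>2 \<partial>\<mu>w) \<le> square_const * (\<integral>x. (f x)\<^sup>2 \<partial>\<mu>w)"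
proof -
  define F where "F = (\<integral>x. (f x)\<^sup>2 \<partial>\<mu>w)"
  have F0: "0 \<le> F" by (simp add: F_def)
  have bm: "h \<in> borel_measurable borel" if "h \<in> L2 \<mu>" for h
    using L2_measurable[OF that] measurable_cong_sets[OF sets_M refl, of "borel :: real measure"] by simp
  have Tm [measurable]: "T f \<in> borel_measurable borel" by (rule bm[OF T_L2[OF f(1)]])
  have k0: "0 \<le> 16 * (form_const * W)\<^sup>2" by simp
  have main: "(\<integral>\<^sup>+x. ennreal ((T f x)\<^sup>2) \<partial>\<mu>w) \<le> ennreal (16 * (form_const * W)\<^sup>2 * (2 * F + 2 * e))" if e: "0 < e" for e
  proof -
    have "\<exists>\<phi>. lip \<phi> \<and> \<phi> \<in> BB \<and> (\<integral>x. (f x - \<phi> x)\<^sup>2 \<partial>\<mu>) < e * inverse (real (Suc n)) \<and> (\<integral>x. (f x - \<phi> x)\<^sup>2 \<partial>\<mu>w) < e * inverse (real (Suc n))" for n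
      by (rule mixed_approx) (use w_pos mw.borel_ball_finite_axioms f e in auto)
    then have "\<forall>n. \<exists>\<phi>. lip \<phi> \<and> \<phi> \<in> BB \<and> (\<integral>x. (f x - \<phi> x)\<^sup>2 \<partial>\<mu>) < e * inverse (real (Suc n)) \<and> (\<integral>x. (f x - \<phi> x)\<^sup>2 \<partial>\<mu>w) < e * inverse (real (Suc n))"
      by (rule allI)
    from choice[OF this] obtain \<phi> where \<phi>all: "\<forall>n. lip (\<phi> n) \<and> \<phi> n \<in> BB \<and> (\<integral>x. (f x - \<phi> n x)\<^sup>2 \<partial>\<mu>) < e * inverse (real (Suc n)) \<and> (\<integral>x. (f x - \<phi> n x)\<^sup>2 \<partial>\<mu>w) < e * inverse (real (Suc n))"
      by (elim exE) (rule that)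
    have \<phi>: "lip (\<phi> n)" "\<phi> n \<in> BB"
      "(\<integral>x. (f x - \<phi> n x)\<^sup>2 \<partial>\<mu>) < e * inverse (real (Suc n))" "(\<integral>x. (f x - \<phi> n x)\<^sup>2 \<partial>\<mu>w) < e * inverse (real (Suc n))" for n
      using spec[OF \<phi>all, of n] by blast+
    have d: "(\<lambda>y. f y - \<phi> n y) \<in> L2 \<mu>" for n by (intro L2_diff f BB_L2 \<phi>)
    have iu: "integrable \<mu> (\<lambda>x. (T (\<lambda>y. f y - \<phi> n y) x)\<^sup>2)" for n by (rule L2_integrable[OF T_L2[OF d]])
    have ule: "norm (\<integral>x. norm ((T (\<lambda>y. f y - \<phi> n y) x)\<^sup>2) \<partial>\<mu>) \<le> B * (e * inverse (real (Suc n)))" for n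
    proof -
      have "(\<integral>x. (T (\<lambda>y. f y - \<phi> n y) x)\<^sup>2 \<partial>\<mu>) \<le> B * (\<integral>x. (f x - \<phi> n x)\<^sup>2 \<partial>\<mu>)" by (rule T_bound[OF d])
      also have "\<dots> \<le> B * (e * inverse (real (Suc n)))" using \<phi>(3)[of n] B_nonneg by (intro mult_left_mono) auto
      finally show ?thesis by simp
    qed
    have "(\<lambda>n. B * (e * inverse (real (Suc n)))) \<longlonglongrightarrow> 0"
      by (intro tendsto_mult_right_zero LIMSEQ_inverse_real_of_nat)
    then have "(\<lambda>n. \<integral>x. norm ((T (\<lambda>y. f y - \<phi> n y) x)\<^sup>2) \<partial>\<mu>) \<longlonglongrightarrow> 0"
      by (rule Lim_null_comparison[rotated]) (rule always_eventually, rule allI, rule ule)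
    from tendsto_L1_AE_subseq[OF iu this] obtain q where q: "strict_mono q"
      "AE x in \<mu>. (\<lambda>n. (T (\<lambda>y. f y - \<phi> (q n) y) x)\<^sup>2) \<longlonglongrightarrow> 0" by (elim exE conjE) (rule that)
    have "AE x in \<mu>. \<forall>n. T (\<lambda>y. f y - \<phi> n y) x = T f x - T (\<phi> n) x"
      by (simp add: AE_all_countable) (intro allI T_L2_diff f BB_L2 \<phi>)
    then have "AE x in \<mu>. (\<lambda>n. T (\<phi> (q n)) x) \<longlonglongrightarrow> T f x"
      using q(2)
    proof eventually_elim
      case (elim x)
      then have "(\<lambda>n. (T f x - T (\<phi> (q n)) x)\<^sup>2) \<longlonglongrightarrow> 0" by simp
      then show ?case by (rule tendsto_of_square_zero)
    qed
    then have lim: "AE x in \<mu>w. (\<lambda>n. T (\<phi> (q n)) x) \<longlonglongrightarrow> T f x"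
      by (subst AE_density) (auto simp: measurable_cong_sets[OF sets_M refl])
    show ?thesis
    proof (rule fatou_square[OF _ _ lim])
      show "T (\<phi> (q n)) \<in> borel_measurable \<mu>w" for n using T_measurable[OF \<phi>(2)] by simp
      show "T f \<in> borel_measurable \<mu>w" by measurable
      fix n
      define m where "m = q n"
      have "(\<integral>x. (\<phi> m x)\<^sup>2 \<partial>\<mu>w) \<le> 2 * F + 2 * (\<integral>x. (f x - \<phi> m x)\<^sup>2 \<partial>\<mu>w)"
        unfolding F_def by (rule L2_square_le[OF f(2) mw.BB_L2[OF \<phi>(2)]])
      moreover have "e * inverse (real (Suc m)) \<le> e * 1" using e by (intro mult_left_mono) (auto simp: inverse_le_1_iff)
      ultimately have "(\<integral>x. (\<phi> m x)\<^sup>2 \<partial>\<mu>w) \<le> 2 * F + 2 * e" using \<phi>(4)[of m] by simp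
      then have "ennreal (16 * (form_const * W)\<^sup>2 * (\<integral>x. (\<phi> m x)\<^sup>2 \<partial>\<mu>w)) \<le> ennreal (16 * (form_const * W)\<^sup>2 * (2 * F + 2 * e))"
        by (intro ennreal_leI mult_left_mono k0)
      with weighted_bound_Lipschitz[OF \<phi>(2,1), of m]
      show "(\<integral>\<^sup>+x. ennreal ((T (\<phi> (q n)) x)\<^sup>2) \<partial>\<mu>w) \<le> ennreal (16 * (form_const * W)\<^sup>2 * (2 * F + 2 * e))"
        unfolding m_def by (rule order_trans)
    qed
  qed
  have "(\<lambda>n. 16 * (form_const * W)\<^sup>2 * (2 * F + 2 * inverse (real (Suc n)))) \<longlonglongrightarrow> 16 * (form_const * W)\<^sup>2 * (2 * F + 2 * 0)"
    by (intro tendsto_intros LIMSEQ_inverse_real_of_nat)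
  then have "(\<lambda>n. ennreal (16 * (form_const * W)\<^sup>2 * (2 * F + 2 * inverse (real (Suc n))))) \<longlonglongrightarrow> ennreal (square_const * F)"
    by (intro tendsto_ennrealI) (simp add: square_const_def mult.assoc)
  then have le: "(\<integral>\<^sup>+x. ennreal ((T f x)\<^sup>2) \<partial>\<mu>w) \<le> ennreal (square_const * F)"
    by (rule LIMSEQ_le_const) (intro exI[of _ 0] allI impI main, simp)
  have Tm': "T f \<in> borel_measurable \<mu>w" by measurable
  have "0 \<le> square_const * F" using square_const_pos F0 by simp
  from L2_of_nn_integral[OF Tm' le this]
  show "T f \<in> L2 \<mu>w" "(\<integral>x. (T f x)\<^sup>2 \<partial>\<mu>w) \<le> square_const * (\<integral>x. (f x)\<^sup>2 \<partial>\<mu>w)" by (simp_all add: F_def)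
qed

lemma AE_mw: "(AE x in \<mu>w. P x) \<longleftrightarrow> (AE x in \<mu>. P x)"
  by (subst AE_density) (auto simp: w_pos measurable_cong_sets[OF sets_M refl])

lemma T_diff_mw:
  assumes "\<phi> \<in> L2 \<mu>" "\<phi> \<in> L2 \<mu>w" "\<psi> \<in> L2 \<mu>" "\<psi> \<in> L2 \<mu>w"
  shows "(\<integral>x. (T \<phi> x - T \<psi> x)\<^sup>2 \<partial>\<mu>w) \<le> square_const * (\<integral>x. (\<phi> x - \<psi> x)\<^sup>2 \<partial>\<mu>w)"
proof -
  have "AE x in \<mu>w. T (\<lambda>y. \<phi> y - \<psi> y) x = T \<phi> x - T \<psi> x"
    unfolding AE_mw by (rule T_L2_diff[OF assms(1,3)])
  then have "(\<integral>x. (T \<phi> x - T \<psi> x)\<^sup>2 \<partial>\<mu>w) = (\<integral>x. (T (\<lambda>y. \<phi> y - \<psi> y) x)\<^sup>2 \<partial>\<mu>w)"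
  proof (intro integral_cong_AE)
    have "T \<phi> \<in> borel_measurable \<mu>w" "T \<psi> \<in> borel_measurable \<mu>w" "T (\<lambda>y. \<phi> y - \<psi> y) \<in> borel_measurable \<mu>w"
      by (intro L2_measurable weighted_bound assms L2_diff)+
    then show "(\<lambda>x. (T \<phi> x - T \<psi> x)\<^sup>2) \<in> borel_measurable \<mu>w" "(\<lambda>x. (T (\<lambda>y. \<phi> y - \<psi> y) x)\<^sup>2) \<in> borel_measurable \<mu>w"
      by measurable
  qed (auto elim!: eventually_mono)
  also have "\<dots> \<le> square_const * (\<integral>x. (\<phi> x - \<psi> x)\<^sup>2 \<partial>\<mu>w)" by (intro weighted_bound(2) L2_diff assms)
  finally show ?thesis .
qed

text \<open>
  The value \<open>g\<close> of the extension at \<open>f\<close> is characterised by its distance to the values of \<open>T\<close> on the common domain. This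
  determines \<open>g\<close> almost everywhere and yields linearity without reference to a particular
  approximating sequence. The factor \<open>4\<close> comes from using \<open>(a + b)\<^sup>2 \<le> 2 * a\<^sup>2 + 2 * b\<^sup>2\<close> twice.
\<close>

definition limit_of :: "('a \<Rightarrow> real) \<Rightarrow> ('a \<Rightarrow> real) \<Rightarrow> bool" where
  "limit_of f g \<longleftrightarrow> g \<in> L2 \<mu>w \<and>
    (\<forall>\<phi>\<in>L2 \<mu> \<inter> L2 \<mu>w. (\<integral>x. (g x - T \<phi> x)\<^sup>2 \<partial>\<mu>w) \<le> 4 * square_const * (\<integral>x. (f x - \<phi> x)\<^sup>2 \<partial>\<mu>w))"

lemma dense_both:
  assumes "f \<in> L2 \<mu>w" "0 < e"
  shows "\<exists>\<phi>. \<phi> \<in> L2 \<mu> \<and> \<phi> \<in> L2 \<mu>w \<and> (\<integral>x. (f x - \<phi> x)\<^sup>2 \<partial>\<mu>w) \<le> e"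
proof -
  from mw.L2_Lipschitz_dense[OF assms] obtain \<phi> where "\<phi> \<in> BB" "(\<integral>x. (f x - \<phi> x)\<^sup>2 \<partial>\<mu>w) < e"
    by (elim exE conjE) (rule that)
  then show ?thesis by (intro exI[of _ \<phi>] conjI BB_L2 mw.BB_L2) auto
qed

lemma limit_exists:
  assumes f: "f \<in> L2 \<mu>w" shows "\<exists>g. limit_of f g"
proof -
  have "\<forall>n. \<exists>\<phi>. \<phi> \<in> L2 \<mu> \<and> \<phi> \<in> L2 \<mu>w \<and> (\<integral>x. (f x - \<phi> x)\<^sup>2 \<partial>\<mu>w) \<le> (1 / 8) ^ n"
    by (intro allI dense_both f) simp
  from choice[OF this] obtain \<phi>
    where \<phi>all: "\<forall>n. \<phi> n \<in> L2 \<mu> \<and> \<phi> n \<in> L2 \<mu>w \<and> (\<integral>x. (f x - \<phi> n x)\<^sup>2 \<partial>\<mu>w) \<le> (1 / 8) ^ n" by (elim exE) (rule that)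
  have \<phi>: "\<phi> n \<in> L2 \<mu>" "\<phi> n \<in> L2 \<mu>w" "(\<integral>x. (f x - \<phi> n x)\<^sup>2 \<partial>\<mu>w) \<le> (1 / 8) ^ n" for n
    using spec[OF \<phi>all, of n] by blast+
  have comm: "(\<integral>x. (\<phi> n x - h x)\<^sup>2 \<partial>\<mu>w) = (\<integral>x. (h x - \<phi> n x)\<^sup>2 \<partial>\<mu>w)" for n h by (simp add: power2_commute)
  have "\<exists>g\<in>L2 \<mu>w. \<forall>n. (\<integral>x. (g x - T (\<phi> n) x)\<^sup>2 \<partial>\<mu>w) \<le> 4 * (4 * square_const) * (1 / 8) ^ n"
  proof (rule L2_complete_fast)
    show "T (\<phi> n) \<in> L2 \<mu>w" for n by (rule weighted_bound(1)[OF \<phi>(1,2)])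
    fix n
    have "(\<integral>x. (T (\<phi> (Suc n)) x - T (\<phi> n) x)\<^sup>2 \<partial>\<mu>w) \<le> square_const * (\<integral>x. (\<phi> (Suc n) x - \<phi> n x)\<^sup>2 \<partial>\<mu>w)"
      by (intro T_diff_mw \<phi>)
    also have "\<dots> \<le> square_const * (4 * (1 / 8) ^ n)"
    proof (rule mult_left_mono)
      have "(\<integral>x. (\<phi> (Suc n) x - \<phi> n x)\<^sup>2 \<partial>\<mu>w) \<le> 2 * (\<integral>x. (\<phi> (Suc n) x - f x)\<^sup>2 \<partial>\<mu>w) + 2 * (\<integral>x. (f x - \<phi> n x)\<^sup>2 \<partial>\<mu>w)"
        by (intro L2_triangle f \<phi>)
      also have "\<dots> \<le> 2 * (1 / 8) ^ Suc n + 2 * (1 / 8) ^ n" unfolding comm by (intro add_mono mult_left_mono \<phi>) auto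
      also have "\<dots> \<le> 4 * (1 / 8) ^ n" by simp
      finally show "(\<integral>x. (\<phi> (Suc n) x - \<phi> n x)\<^sup>2 \<partial>\<mu>w) \<le> 4 * (1 / 8) ^ n" .
    qed (use square_const_pos in simp)
    finally show "(\<integral>x. (T (\<phi> (Suc n)) x - T (\<phi> n) x)\<^sup>2 \<partial>\<mu>w) \<le> 4 * square_const * (1 / 8) ^ n" by (simp add: mult_ac)
  qed (use square_const_pos in simp)
  then obtain g where g: "g \<in> L2 \<mu>w" "\<And>n. (\<integral>x. (g x - T (\<phi> n) x)\<^sup>2 \<partial>\<mu>w) \<le> 4 * (4 * square_const) * (1 / 8) ^ n" by (elim bexE) (rule that, assumption, erule spec)
  have "limit_of f g"
    unfolding limit_of_def
  proof (intro conjI ballI g)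
    fix \<psi> assume "\<psi> \<in> L2 \<mu> \<inter> L2 \<mu>w"
    then have \<psi>: "\<psi> \<in> L2 \<mu>" "\<psi> \<in> L2 \<mu>w" by auto
    define X where "X = (\<integral>x. (f x - \<psi> x)\<^sup>2 \<partial>\<mu>w)"
    have "(\<integral>x. (g x - T \<psi> x)\<^sup>2 \<partial>\<mu>w) \<le> 36 * square_const * (1 / 8) ^ n + 4 * square_const * X" for n
    proof -
      have "(\<integral>x. (g x - T \<psi> x)\<^sup>2 \<partial>\<mu>w) \<le> 2 * (\<integral>x. (g x - T (\<phi> n) x)\<^sup>2 \<partial>\<mu>w) + 2 * (\<integral>x. (T (\<phi> n) x - T \<psi> x)\<^sup>2 \<partial>\<mu>w)"
        by (intro L2_triangle g weighted_bound \<phi> \<psi>)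
      also have "\<dots> \<le> 2 * (16 * square_const * (1 / 8) ^ n) + 2 * (square_const * (2 * (1 / 8) ^ n + 2 * X))"
      proof (intro add_mono mult_left_mono)
        show "(\<integral>x. (g x - T (\<phi> n) x)\<^sup>2 \<partial>\<mu>w) \<le> 16 * square_const * (1 / 8) ^ n" using g(2)[of n] by simp
        have "(\<integral>x. (T (\<phi> n) x - T \<psi> x)\<^sup>2 \<partial>\<mu>w) \<le> square_const * (\<integral>x. (\<phi> n x - \<psi> x)\<^sup>2 \<partial>\<mu>w)" by (intro T_diff_mw \<phi> \<psi>)
        also have "\<dots> \<le> square_const * (2 * (\<integral>x. (\<phi> n x - f x)\<^sup>2 \<partial>\<mu>w) + 2 * X)"
          unfolding X_def using square_const_pos by (intro mult_left_mono L2_triangle f \<phi> \<psi>) auto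
        also have "\<dots> \<le> square_const * (2 * (1 / 8) ^ n + 2 * X)"
          unfolding comm using square_const_pos \<phi>(3)[of n] by (intro mult_left_mono add_mono) auto
        finally show "(\<integral>x. (T (\<phi> n) x - T \<psi> x)\<^sup>2 \<partial>\<mu>w) \<le> square_const * (2 * (1 / 8) ^ n + 2 * X)" .
      qed auto
      also have "\<dots> = 36 * square_const * (1 / 8) ^ n + 4 * square_const * X" by (simp add: algebra_simps)
      finally show ?thesis .
    qed
    moreover have "(\<lambda>n. 36 * square_const * (1 / 8) ^ n + 4 * square_const * X) \<longlonglongrightarrow> 36 * square_const * 0 + 4 * square_const * X"
      by (intro tendsto_intros LIMSEQ_power_zero) simp
    ultimately have "(\<integral>x. (g x - T \<psi> x)\<^sup>2 \<partial>\<mu>w) \<le> 36 * square_const * 0 + 4 * square_const * X" by (intro LIMSEQ_le_const) auto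
    then show "(\<integral>x. (g x - T \<psi> x)\<^sup>2 \<partial>\<mu>w) \<le> 4 * square_const * (\<integral>x. (f x - \<psi> x)\<^sup>2 \<partial>\<mu>w)" by (simp add: X_def)
  qed
  then show ?thesis by (rule exI[of _ g])
qed

definition extension :: "('a \<Rightarrow> real) \<Rightarrow> ('a \<Rightarrow> real)" where "extension f = (SOME g. limit_of f g)"

lemma extension:
  assumes "f \<in> L2 \<mu>w"
  shows "extension f \<in> L2 \<mu>w"
    "\<phi> \<in> L2 \<mu> \<Longrightarrow> \<phi> \<in> L2 \<mu>w \<Longrightarrow> (\<integral>x. (extension f x - T \<phi> x)\<^sup>2 \<partial>\<mu>w) \<le> 4 * square_const * (\<integral>x. (f x - \<phi> x)\<^sup>2 \<partial>\<mu>w)"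
proof -
  have "limit_of f (extension f)" unfolding extension_def by (rule someI_ex[OF limit_exists[OF assms]])
  then show "extension f \<in> L2 \<mu>w"
    "\<phi> \<in> L2 \<mu> \<Longrightarrow> \<phi> \<in> L2 \<mu>w \<Longrightarrow> (\<integral>x. (extension f x - T \<phi> x)\<^sup>2 \<partial>\<mu>w) \<le> 4 * square_const * (\<integral>x. (f x - \<phi> x)\<^sup>2 \<partial>\<mu>w)"
    unfolding limit_of_def by simp_all
qed

lemma extension_eq_T:
  assumes "f \<in> L2 \<mu>" "f \<in> L2 \<mu>w" shows "AE x in \<mu>. extension f x = T f x"
proof -
  have "(\<integral>x. (extension f x - T f x)\<^sup>2 \<partial>\<mu>w) \<le> 0" using extension(2)[OF assms(2) assms] by simp
  then have "AE x in \<mu>w. extension f x - T f x = 0"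
    by (intro L2_AE_zero L2_diff extension weighted_bound assms) auto
  then show ?thesis unfolding AE_mw by simp
qed

lemma extension_add:
  assumes f: "f \<in> L2 \<mu>w" and g: "g \<in> L2 \<mu>w"
  shows "AE x in \<mu>w. extension (\<lambda>y. f y + g y) x = extension f x + extension g x"
proof -
  let ?s = "\<lambda>y. f y + g y"
  have s: "?s \<in> L2 \<mu>w" by (rule L2_add[OF f g])
  have "AE x in \<mu>w. extension ?s x - (extension f x + extension g x) = 0"
  proof (rule L2_AE_zero)
    show "(\<lambda>x. extension ?s x - (extension f x + extension g x)) \<in> L2 \<mu>w" by (intro L2_diff L2_add extension f g s)
    fix e :: real assume "0 < e"
    define \<eta> where "\<eta> = e / (64 * square_const)"
    have \<eta>: "0 < \<eta>" using \<open>0 < e\<close> square_const_pos by (simp add: \<eta>_def)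
    obtain \<phi> where \<phi>: "\<phi> \<in> L2 \<mu>" "\<phi> \<in> L2 \<mu>w" "(\<integral>x. (f x - \<phi> x)\<^sup>2 \<partial>\<mu>w) \<le> \<eta>"
      using dense_both[OF f \<eta>] by (elim exE conjE) (rule that)
    obtain \<psi> where \<psi>: "\<psi> \<in> L2 \<mu>" "\<psi> \<in> L2 \<mu>w" "(\<integral>x. (g x - \<psi> x)\<^sup>2 \<partial>\<mu>w) \<le> \<eta>"
      using dense_both[OF g \<eta>] by (elim exE conjE) (rule that)
    let ?t = "\<lambda>y. \<phi> y + \<psi> y"
    have t: "?t \<in> L2 \<mu>" "?t \<in> L2 \<mu>w" by (intro L2_add \<phi> \<psi>)+
    have Teq: "AE x in \<mu>w. T ?t x = T \<phi> x + T \<psi> x" unfolding AE_mw by (rule T_L2_add[OF \<phi>(1) \<psi>(1)])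
    have TL: "T ?t \<in> L2 \<mu>w" "T \<phi> \<in> L2 \<mu>w" "T \<psi> \<in> L2 \<mu>w" by (intro weighted_bound t \<phi> \<psi>)+
    have EL: "extension f \<in> L2 \<mu>w" "extension g \<in> L2 \<mu>w" "extension ?s \<in> L2 \<mu>w" by (intro extension f g s)+
    have 1: "(\<integral>x. (extension ?s x - T ?t x)\<^sup>2 \<partial>\<mu>w) \<le> 4 * square_const * (4 * \<eta>)"
    proof (rule order_trans[OF extension(2)[OF s t]], rule mult_left_mono)
      have "(\<integral>x. (f x + g x - (\<phi> x + \<psi> x))\<^sup>2 \<partial>\<mu>w) = (\<integral>x. ((f x - \<phi> x) + (g x - \<psi> x))\<^sup>2 \<partial>\<mu>w)" by (simp add: algebra_simps)
      also have "\<dots> \<le> 2 * (\<integral>x. (f x - \<phi> x)\<^sup>2 \<partial>\<mu>w) + 2 * (\<integral>x. (g x - \<psi> x)\<^sup>2 \<partial>\<mu>w)"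
        by (intro L2_integral_add_le L2_diff f g \<phi> \<psi>)
      finally show "(\<integral>x. (f x + g x - (\<phi> x + \<psi> x))\<^sup>2 \<partial>\<mu>w) \<le> 4 * \<eta>" using \<phi>(3) \<psi>(3) by simp
    qed (use square_const_pos in simp)
    have 2: "(\<integral>x. (T ?t x - (extension f x + extension g x))\<^sup>2 \<partial>\<mu>w) \<le> 4 * square_const * (4 * \<eta>)"
    proof -
      have m: "T ?t \<in> borel_measurable \<mu>w" "T \<phi> \<in> borel_measurable \<mu>w" "T \<psi> \<in> borel_measurable \<mu>w"
        "extension f \<in> borel_measurable \<mu>w" "extension g \<in> borel_measurable \<mu>w" using TL EL by (auto dest: L2_measurable)
      have "(\<integral>x. (T ?t x - (extension f x + extension g x))\<^sup>2 \<partial>\<mu>w) = (\<integral>x. ((extension f x - T \<phi> x) + (extension g x - T \<psi> x))\<^sup>2 \<partial>\<mu>w)"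
      proof (rule integral_cong_AE)
        show "AE x in \<mu>w. (T ?t x - (extension f x + extension g x))\<^sup>2 = ((extension f x - T \<phi> x) + (extension g x - T \<psi> x))\<^sup>2"
          using Teq by eventually_elim (simp add: power2_eq_square algebra_simps)
      qed (use m in measurable)
      also have "\<dots> \<le> 2 * (\<integral>x. (extension f x - T \<phi> x)\<^sup>2 \<partial>\<mu>w) + 2 * (\<integral>x. (extension g x - T \<psi> x)\<^sup>2 \<partial>\<mu>w)"
        by (intro L2_integral_add_le L2_diff TL EL)
      also have "\<dots> \<le> 2 * (4 * square_const * \<eta>) + 2 * (4 * square_const * \<eta>)"
        using square_const_pos by (intro add_mono mult_left_mono order_trans[OF extension(2)[OF f \<phi>(1,2)]] order_trans[OF extension(2)[OF g \<psi>(1,2)]] \<phi>(3) \<psi>(3)) auto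
      finally show ?thesis by (simp add: mult_ac)
    qed
    have "(\<integral>x. (extension ?s x - (extension f x + extension g x))\<^sup>2 \<partial>\<mu>w) \<le> 2 * (\<integral>x. (extension ?s x - T ?t x)\<^sup>2 \<partial>\<mu>w) + 2 * (\<integral>x. (T ?t x - (extension f x + extension g x))\<^sup>2 \<partial>\<mu>w)"
      by (intro L2_triangle L2_add EL TL)
    also have "\<dots> \<le> 64 * square_const * \<eta>" using 1 2 by simp
    also have "\<dots> = e" using square_const_pos by (simp add: \<eta>_def)
    finally show "(\<integral>x. (extension ?s x - (extension f x + extension g x))\<^sup>2 \<partial>\<mu>w) \<le> e" .
  qed
  then show ?thesis by simp
qed

lemma extension_cmult:
  assumes f: "f \<in> L2 \<mu>w"
  shows "AE x in \<mu>w. extension (\<lambda>y. c * f y) x = c * extension f x"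
proof -
  let ?s = "\<lambda>y. c * f y"
  have s: "?s \<in> L2 \<mu>w" by (rule L2_cmult[OF f])
  have "AE x in \<mu>w. extension ?s x - c * extension f x = 0"
  proof (rule L2_AE_zero)
    show "(\<lambda>x. extension ?s x - c * extension f x) \<in> L2 \<mu>w" by (intro L2_diff L2_cmult extension f s)
    fix e :: real assume "0 < e"
    define \<eta> where "\<eta> = e / (16 * square_const * (c\<^sup>2 + 1))"
    have c1: "0 < c\<^sup>2 + 1" by (simp add: add_nonneg_pos)
    have \<eta>: "0 < \<eta>" using \<open>0 < e\<close> square_const_pos c1 by (simp add: \<eta>_def)
    obtain \<phi> where \<phi>: "\<phi> \<in> L2 \<mu>" "\<phi> \<in> L2 \<mu>w" "(\<integral>x. (f x - \<phi> x)\<^sup>2 \<partial>\<mu>w) \<le> \<eta>"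
      using dense_both[OF f \<eta>] by (elim exE conjE) (rule that)
    let ?t = "\<lambda>y. c * \<phi> y"
    have t: "?t \<in> L2 \<mu>" "?t \<in> L2 \<mu>w" by (intro L2_cmult \<phi>)+
    have Teq: "AE x in \<mu>w. T ?t x = c * T \<phi> x" unfolding AE_mw by (rule T_L2_cmult[OF \<phi>(1)])
    have TL: "T ?t \<in> L2 \<mu>w" "T \<phi> \<in> L2 \<mu>w" by (intro weighted_bound t \<phi>)+
    have EL: "extension f \<in> L2 \<mu>w" "extension ?s \<in> L2 \<mu>w" by (intro extension f s)+
    have 1: "(\<integral>x. (extension ?s x - T ?t x)\<^sup>2 \<partial>\<mu>w) \<le> 4 * square_const * (c\<^sup>2 * \<eta>)"
    proof (rule order_trans[OF extension(2)[OF s t]], rule mult_left_mono)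
      have "(\<integral>x. (c * f x - c * \<phi> x)\<^sup>2 \<partial>\<mu>w) = (\<integral>x. c\<^sup>2 * (f x - \<phi> x)\<^sup>2 \<partial>\<mu>w)"
        by (simp add: right_diff_distrib[symmetric] power_mult_distrib)
      also have "\<dots> = c\<^sup>2 * (\<integral>x. (f x - \<phi> x)\<^sup>2 \<partial>\<mu>w)" by simp
      also have "\<dots> \<le> c\<^sup>2 * \<eta>" by (intro mult_left_mono \<phi>) auto
      finally show "(\<integral>x. (c * f x - c * \<phi> x)\<^sup>2 \<partial>\<mu>w) \<le> c\<^sup>2 * \<eta>" .
    qed (use square_const_pos in simp)
    have 2: "(\<integral>x. (T ?t x - c * extension f x)\<^sup>2 \<partial>\<mu>w) \<le> c\<^sup>2 * (4 * square_const * \<eta>)"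
    proof -
      have m: "T ?t \<in> borel_measurable \<mu>w" "T \<phi> \<in> borel_measurable \<mu>w" "extension f \<in> borel_measurable \<mu>w"
        using TL EL by (auto dest: L2_measurable)
      have "(\<integral>x. (T ?t x - c * extension f x)\<^sup>2 \<partial>\<mu>w) = (\<integral>x. c\<^sup>2 * (extension f x - T \<phi> x)\<^sup>2 \<partial>\<mu>w)"
      proof (rule integral_cong_AE)
        show "AE x in \<mu>w. (T ?t x - c * extension f x)\<^sup>2 = c\<^sup>2 * (extension f x - T \<phi> x)\<^sup>2"
          using Teq by eventually_elim (simp add: power2_eq_square algebra_simps)
      qed (use m in measurable)
      also have "\<dots> = c\<^sup>2 * (\<integral>x. (extension f x - T \<phi> x)\<^sup>2 \<partial>\<mu>w)" by simp
      also have "\<dots> \<le> c\<^sup>2 * (4 * square_const * \<eta>)"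
        using square_const_pos by (intro mult_left_mono order_trans[OF extension(2)[OF f \<phi>(1,2)]] \<phi>(3)) auto
      finally show ?thesis .
    qed
    have "(\<integral>x. (extension ?s x - c * extension f x)\<^sup>2 \<partial>\<mu>w) \<le> 2 * (\<integral>x. (extension ?s x - T ?t x)\<^sup>2 \<partial>\<mu>w) + 2 * (\<integral>x. (T ?t x - c * extension f x)\<^sup>2 \<partial>\<mu>w)"
      by (intro L2_triangle L2_cmult EL TL)
    also have "\<dots> \<le> 2 * (4 * square_const * (c\<^sup>2 * \<eta>)) + 2 * (c\<^sup>2 * (4 * square_const * \<eta>))" using 1 2 by (intro add_mono mult_left_mono) auto
    also have "\<dots> = 16 * square_const * c\<^sup>2 * \<eta>" by (simp add: algebra_simps)
    also have "\<dots> \<le> 16 * square_const * (c\<^sup>2 + 1) * \<eta>" using square_const_pos \<eta> by (intro mult_right_mono mult_left_mono) auto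
    also have "\<dots> = e" using square_const_pos c1 by (simp add: \<eta>_def)
    finally show "(\<integral>x. (extension ?s x - c * extension f x)\<^sup>2 \<partial>\<mu>w) \<le> e" .
  qed
  then show ?thesis by simp
qed

lemma extension_bound:
  assumes f: "f \<in> L2 \<mu>w" shows "(\<integral>x. (extension f x)\<^sup>2 \<partial>\<mu>w) \<le> 4 * square_const * (\<integral>x. (f x)\<^sup>2 \<partial>\<mu>w)"
proof -
  have z: "(\<lambda>x. 0) \<in> L2 \<mu>" "(\<lambda>x. 0) \<in> L2 \<mu>w" by (auto intro: BB_L2 mw.BB_L2 BB_zero)
  have T0: "AE x in \<mu>w. T (\<lambda>x. 0) x = 0" unfolding AE_mw by (rule T_zero)
  have m: "T (\<lambda>x. 0) \<in> borel_measurable \<mu>w" "extension f \<in> borel_measurable \<mu>w"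
    by (intro L2_measurable weighted_bound z extension f)+
  have "(\<integral>x. (extension f x)\<^sup>2 \<partial>\<mu>w) = (\<integral>x. (extension f x - T (\<lambda>x. 0) x)\<^sup>2 \<partial>\<mu>w)"
    by (rule integral_cong_AE) (use m T0 in \<open>measurable, auto elim!: eventually_mono\<close>)
  also have "\<dots> \<le> 4 * square_const * (\<integral>x. (f x)\<^sup>2 \<partial>\<mu>w)" using extension(2)[OF f z] by simp
  finally show ?thesis .
qed

lemma L2_norm_le_iff_square:
  assumes "0 \<le> c" "(\<integral>x. (g x)\<^sup>2 \<partial>M) \<le> c\<^sup>2 * (\<integral>x. (f x)\<^sup>2 \<partial>M)"
  shows "L2_norm M g \<le> c * L2_norm M f"
proof -
  have "sqrt (\<integral>x. (g x)\<^sup>2 \<partial>M) \<le> sqrt (c\<^sup>2 * (\<integral>x. (f x)\<^sup>2 \<partial>M))" using assms(2) by simp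
  then show ?thesis using assms(1) by (simp add: L2_norm_def real_sqrt_mult)
qed

lemma square_const_sqrt: "4 * square_const \<le> (12 * (form_const * W))\<^sup>2"
  by (simp add: square_const_def power_mult_distrib)

lemma extension_bounded_operator: "bounded_L2_operator \<mu>w extension"
  unfolding bounded_L2_operator_def
proof (intro conjI ballI allI)
  show "\<exists>C. \<forall>f\<in>L2 \<mu>w. L2_norm \<mu>w (extension f) \<le> C * L2_norm \<mu>w f"
  proof (intro exI[of _ "12 * (form_const * W)"] ballI L2_norm_le_iff_square)
    show "0 \<le> 12 * (form_const * W)" using form_const_pos W_ge1 by simp
    fix f assume "f \<in> L2 \<mu>w"
    from extension_bound[OF this] show "(\<integral>x. (extension f x)\<^sup>2 \<partial>\<mu>w) \<le> (12 * (form_const * W))\<^sup>2 * (\<integral>x. (f x)\<^sup>2 \<partial>\<mu>w)"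
      by (rule order_trans) (intro mult_right_mono square_const_sqrt, simp)
  qed
qed (fact extension extension_add extension_cmult)+

text \<open>
  Every extension \<open>S\<close> is continuous with some constant \<open>C\<close>, so the bound of \<open>T\<close> on the dense subspace
  passes to \<open>S\<close>, and \<open>C\<close> disappears in the limit. The factor \<open>12\<close> is a round upper bound of
  the square root of \<open>4 * square_const\<close> divided by \<open>form_const * W\<close>.
\<close>

lemma extension_norm:
  assumes S: "bounded_L2_operator \<mu>w S" and ST: "\<And>f. f \<in> L2 \<mu> \<Longrightarrow> f \<in> L2 \<mu>w \<Longrightarrow> AE x in \<mu>. S f x = T f x"
    and f: "f \<in> L2 \<mu>w"
  shows "L2_norm \<mu>w (S f) \<le> 12 * (form_const * W) * L2_norm \<mu>w f"
proof (rule L2_norm_le_iff_square)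
  show "0 \<le> 12 * (form_const * W)" using form_const_pos W_ge1 by simp
  obtain C where C: "\<And>f. f \<in> L2 \<mu>w \<Longrightarrow> L2_norm \<mu>w (S f) \<le> C * L2_norm \<mu>w f"
    using S unfolding bounded_L2_operator_def by (elim conjE exE) (rule that, drule (1) bspec)
  have SL: "S f \<in> L2 \<mu>w" if "f \<in> L2 \<mu>w" for f using S that by (auto simp: bounded_L2_operator_def)
  have Cb: "(\<integral>x. (S h x)\<^sup>2 \<partial>\<mu>w) \<le> C\<^sup>2 * (\<integral>x. (h x)\<^sup>2 \<partial>\<mu>w)" if "h \<in> L2 \<mu>w" for h
  proof -
    have "(L2_norm \<mu>w (S h))\<^sup>2 \<le> (C * L2_norm \<mu>w h)\<^sup>2" using C[OF that] by (intro power_mono) (auto simp: L2_norm_def)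
    then show ?thesis by (simp add: L2_norm_def power_mult_distrib)
  qed
  define F where "F = (\<integral>x. (f x)\<^sup>2 \<partial>\<mu>w)"
  have main: "(\<integral>x. (S f x)\<^sup>2 \<partial>\<mu>w) \<le> 2 * (C\<^sup>2 * e) + 2 * (square_const * (2 * F + 2 * e))" if e: "0 < e" for e
  proof -
    obtain \<phi> where \<phi>: "\<phi> \<in> L2 \<mu>" "\<phi> \<in> L2 \<mu>w" "(\<integral>x. (f x - \<phi> x)\<^sup>2 \<partial>\<mu>w) \<le> e"
      using dense_both[OF f e] by (elim exE conjE) (rule that)
    let ?d = "\<lambda>y. f y - \<phi> y"
    have d: "?d \<in> L2 \<mu>w" by (rule L2_diff[OF f \<phi>(2)])
    have "AE x in \<mu>w. S (\<lambda>y. ?d y + \<phi> y) x = S ?d x + S \<phi> x"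
    proof -
      have "\<forall>f\<in>L2 \<mu>w. \<forall>g\<in>L2 \<mu>w. AE x in \<mu>w. S (\<lambda>y. f y + g y) x = S f x + S g x"
        using S unfolding bounded_L2_operator_def by (elim conjE)
      from bspec[OF bspec[OF this d] \<phi>(2)] show ?thesis .
    qed
    moreover have "AE x in \<mu>w. S \<phi> x = T \<phi> x" unfolding AE_mw by (rule ST[OF \<phi>(1,2)])
    ultimately have ae: "AE x in \<mu>w. S f x = S ?d x + T \<phi> x" by eventually_elim simp
    have L: "S f \<in> L2 \<mu>w" "S ?d \<in> L2 \<mu>w" "T \<phi> \<in> L2 \<mu>w" by (intro SL f d weighted_bound \<phi>)+
    have m: "S f \<in> borel_measurable \<mu>w" "S ?d \<in> borel_measurable \<mu>w" "T \<phi> \<in> borel_measurable \<mu>w" by (intro L2_measurable L)+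
    have "(\<integral>x. (S f x)\<^sup>2 \<partial>\<mu>w) = (\<integral>x. (S ?d x + T \<phi> x)\<^sup>2 \<partial>\<mu>w)"
      by (rule integral_cong_AE) (use m ae in \<open>measurable, auto elim!: eventually_mono\<close>)
    also have "\<dots> \<le> 2 * (\<integral>x. (S ?d x)\<^sup>2 \<partial>\<mu>w) + 2 * (\<integral>x. (T \<phi> x)\<^sup>2 \<partial>\<mu>w)" by (rule L2_integral_add_le[OF L(2,3)])
    also have "\<dots> \<le> 2 * (C\<^sup>2 * e) + 2 * (square_const * (2 * F + 2 * e))"
    proof (intro add_mono mult_left_mono)
      show "(\<integral>x. (S ?d x)\<^sup>2 \<partial>\<mu>w) \<le> C\<^sup>2 * e" by (rule order_trans[OF Cb[OF d]]) (intro mult_left_mono \<phi>, simp)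
      have "(\<integral>x. (T \<phi> x)\<^sup>2 \<partial>\<mu>w) \<le> square_const * (\<integral>x. (\<phi> x)\<^sup>2 \<partial>\<mu>w)" by (rule weighted_bound(2)[OF \<phi>(1,2)])
      also have "\<dots> \<le> square_const * (2 * F + 2 * e)"
        using L2_square_le[OF f \<phi>(2)] \<phi>(3) square_const_pos by (intro mult_left_mono) (auto simp: F_def)
      finally show "(\<integral>x. (T \<phi> x)\<^sup>2 \<partial>\<mu>w) \<le> square_const * (2 * F + 2 * e)" .
    qed auto
    finally show ?thesis .
  qed
  have "(\<lambda>n. 2 * (C\<^sup>2 * inverse (real (Suc n))) + 2 * (square_const * (2 * F + 2 * inverse (real (Suc n)))))
    \<longlonglongrightarrow> 2 * (C\<^sup>2 * 0) + 2 * (square_const * (2 * F + 2 * 0))"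
    by (intro tendsto_intros LIMSEQ_inverse_real_of_nat)
  then have "(\<integral>x. (S f x)\<^sup>2 \<partial>\<mu>w) \<le> 2 * (C\<^sup>2 * 0) + 2 * (square_const * (2 * F + 2 * 0))"
    by (rule LIMSEQ_le_const) (intro exI[of _ 0] allI impI main, simp)
  also have "\<dots> = 4 * square_const * F" by simp
  also have "\<dots> \<le> (12 * (form_const * W))\<^sup>2 * F" by (intro mult_right_mono square_const_sqrt) (simp add: F_def)
  finally show "(\<integral>x. (S f x)\<^sup>2 \<partial>\<mu>w) \<le> (12 * (form_const * W))\<^sup>2 * (\<integral>x. (f x)\<^sup>2 \<partial>\<mu>w)" by (simp add: F_def)
qed

end

section \<open>The theorem\<close>

text \<open>
  The bound \<open>\<mu>(B(x,r)) \<le> M \<Lambda>(x,r)\<close> turns each \<open>1 / \<Lambda>\<close> into \<open>M\<close> divided by the measure of the ball.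
\<close>

lemma cz_operator_exists:
  fixes \<mu> :: "'a::metric_space measure"
  assumes "dominating_function \<Lambda>" "doubling_measure \<mu>"
    and "\<exists>C. \<forall>x r. 0 < r \<longrightarrow> measure \<mu> (ball x r) \<le> C * \<Lambda> x r"
    and "CZ_kernel \<Lambda> K" "CZ_operator \<mu> K T"
  shows "\<exists>D \<kappa> \<epsilon> B. cz_operator \<mu> D K T \<kappa> \<epsilon> B"
proof -
  let ?V = "\<lambda>x r. measure \<mu> (ball x r)"
  have sets: "sets \<mu> = sets borel" and em: "0 < r \<Longrightarrow> 0 < emeasure \<mu> (ball x r) \<and> emeasure \<mu> (ball x r) < \<infinity>" for x r
    using assms(2) by (auto simp: doubling_measure_def)
  obtain D where D: "\<And>x r. 0 < r \<Longrightarrow> ?V x (2 * r) \<le> D * ?V x r" using assms(2) unfolding doubling_measure_def by blast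
  have Vpos: "0 < ?V x r" if "0 < r" for x r using em[OF that, of x] by (simp add: measure_def enn2real_positive_iff)
  have fin: "emeasure \<mu> (ball x r) < \<infinity>" for x r by (cases "0 < r") (use em in \<open>auto simp: ball_empty\<close>)
  have \<Lambda>: "0 < r \<Longrightarrow> 0 < \<Lambda> x r" for x r using assms(1) by (auto simp: dominating_function_def)
  obtain M where M: "\<And>x r. 0 < r \<Longrightarrow> ?V x r \<le> M * \<Lambda> x r" using assms(3) by blast
  have M0: "0 < M"
  proof -
    have "0 < M * \<Lambda> undefined 1" using M[of 1 undefined] Vpos[of 1 undefined] by simp
    then show ?thesis using \<Lambda>[of 1 undefined] by (simp add: zero_less_mult_iff)
  qed
  from assms(4) obtain C \<epsilon> where \<epsilon>: "0 < \<epsilon>"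
    and size: "\<forall>x y. x \<noteq> y \<longrightarrow> \<bar>K x y\<bar> \<le> C * min (1 / \<Lambda> x (dist x y)) (1 / \<Lambda> y (dist x y))"
    and reg1: "\<forall>x x' y. x \<noteq> y \<longrightarrow> C * dist x x' \<le> dist x y \<longrightarrow>
      \<bar>K x y - K x' y\<bar> \<le> C * (dist x x' powr \<epsilon> / (dist x y powr \<epsilon> * \<Lambda> x (dist x y)))"
    and reg2: "\<forall>x y y'. x \<noteq> y \<longrightarrow> C * dist y y' \<le> dist x y \<longrightarrow>
      \<bar>K x y - K x y'\<bar> \<le> C * (dist y y' powr \<epsilon> / (dist x y powr \<epsilon> * \<Lambda> y (dist x y)))"
    unfolding CZ_kernel_def by (elim exE conjE) (rule that)
  from real_arch_pow[of 2 "max 2 (max \<bar>C\<bar> (\<bar>C\<bar> * M))"]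
  obtain \<kappa> where \<kappa>: "max 2 (max \<bar>C\<bar> (\<bar>C\<bar> * M)) < (2::real) ^ \<kappa>" by auto
  have \<kappa>1: "1 \<le> \<kappa>" using \<kappa> by (cases \<kappa>) auto
  have le: "C * (a / \<Lambda> x d) \<le> 2 ^ \<kappa> * (a / ?V x d)" if "0 < d" "0 \<le> a" for a d x
  proof -
    have "1 / \<Lambda> x d \<le> M / ?V x d" using M[OF that(1), of x] \<Lambda>[OF that(1), of x] Vpos[OF that(1), of x] by (simp add: field_simps)
    then have "a * (1 / \<Lambda> x d) \<le> a * (M / ?V x d)" by (rule mult_left_mono) fact
    then have 1: "\<bar>C\<bar> * (a / \<Lambda> x d) \<le> \<bar>C\<bar> * (a * (M / ?V x d))" by (intro mult_left_mono) auto
    have "C * (a / \<Lambda> x d) \<le> \<bar>C\<bar> * (a / \<Lambda> x d)" using that \<Lambda>[OF that(1), of x] by (intro mult_right_mono) auto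
    also note 1
    also have "\<bar>C\<bar> * (a * (M / ?V x d)) = \<bar>C\<bar> * M * (a / ?V x d)" by simp
    also have "\<dots> \<le> 2 ^ \<kappa> * (a / ?V x d)" using \<kappa> that by (intro mult_right_mono) auto
    finally show ?thesis .
  qed
  have far: "C * d' \<le> d" if "2 ^ \<kappa> * d' \<le> d" "0 \<le> d'" for d' d
  proof -
    have "C \<le> 2 ^ \<kappa>" using \<kappa> by auto
    from mult_right_mono[OF this that(2)] that(1) show ?thesis by linarith
  qed
  have quot: "p powr \<epsilon> / (q powr \<epsilon> * l) = (p / q) powr \<epsilon> / l" if "0 \<le> p" "0 \<le> q" for p q l :: real
    using that by (simp add: powr_divide)
  have bdd: "bounded_L2_operator \<mu> T" using assms(5) by (simp add: CZ_operator_def)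
  then have "\<exists>C. \<forall>f\<in>L2 \<mu>. L2_norm \<mu> (T f) \<le> C * L2_norm \<mu> f" unfolding bounded_L2_operator_def by (elim conjE)
  then obtain N where N: "\<forall>f\<in>L2 \<mu>. L2_norm \<mu> (T f) \<le> N * L2_norm \<mu> f" by (elim exE) (rule that)
  have "cz_operator \<mu> D K T \<kappa> \<epsilon> (N\<^sup>2)"
  proof
    show "sets \<mu> = sets borel" "emeasure \<mu> (ball x r) < \<infinity>" "0 < r \<Longrightarrow> 0 < ?V x r"
      "0 < r \<Longrightarrow> ?V x (2 * r) \<le> D * ?V x r" "0 < \<epsilon>" "1 \<le> \<kappa>" "0 \<le> N\<^sup>2" "CZ_operator \<mu> K T" for x r
      using sets fin Vpos D \<epsilon> \<kappa>1 assms(5) by simp_all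
    show "\<bar>K x y\<bar> \<le> 2 ^ \<kappa> / ?V x (dist x y)" if "x \<noteq> y" for x y
    proof -
      have d: "0 < dist x y" using that by simp
      let ?m = "min (1 / \<Lambda> x (dist x y)) (1 / \<Lambda> y (dist x y))"
      have m: "0 \<le> ?m" "?m \<le> 1 / \<Lambda> x (dist x y)" using \<Lambda>[OF d] by (auto simp: less_imp_le)
      have "\<bar>K x y\<bar> \<le> C * ?m" by (rule size[rule_format, OF that])
      also have "\<dots> = C * ((?m * \<Lambda> x (dist x y)) / \<Lambda> x (dist x y))" using \<Lambda>[OF d, of x] by simp
      also have "\<dots> \<le> 2 ^ \<kappa> * ((?m * \<Lambda> x (dist x y)) / ?V x (dist x y))"
        using \<Lambda>[OF d, of x] m(1) by (intro le d mult_nonneg_nonneg) auto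
      also have "\<dots> \<le> 2 ^ \<kappa> * (1 / ?V x (dist x y))"
      proof (intro mult_left_mono divide_right_mono)
        show "?m * \<Lambda> x (dist x y) \<le> 1" using mult_right_mono[OF m(2), of "\<Lambda> x (dist x y)"] \<Lambda>[OF d, of x] by simp
      qed auto
      finally show ?thesis by simp
    qed
    show "\<bar>K x y - K x' y\<bar> \<le> 2 ^ \<kappa> * ((dist x x' / dist x y) powr \<epsilon> / ?V x (dist x y))"
      if "x \<noteq> y" "2 ^ \<kappa> * dist x x' \<le> dist x y" for x x' y
    proof -
      have "\<bar>K x y - K x' y\<bar> \<le> C * ((dist x x' / dist x y) powr \<epsilon> / \<Lambda> x (dist x y))"
        using reg1[rule_format, OF that(1) far[OF that(2) zero_le_dist]] unfolding quot[OF zero_le_dist zero_le_dist] .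
      also have "\<dots> \<le> 2 ^ \<kappa> * ((dist x x' / dist x y) powr \<epsilon> / ?V x (dist x y))"
        using that(1) by (intro le) auto
      finally show ?thesis .
    qed
    show "\<bar>K x y - K x y'\<bar> \<le> 2 ^ \<kappa> * ((dist y y' / dist x y) powr \<epsilon> / ?V y (dist x y))"
      if "x \<noteq> y" "2 ^ \<kappa> * dist y y' \<le> dist x y" for x y y'
    proof -
      have "\<bar>K x y - K x y'\<bar> \<le> C * ((dist y y' / dist x y) powr \<epsilon> / \<Lambda> y (dist x y))"
        using reg2[rule_format, OF that(1) far[OF that(2) zero_le_dist]] unfolding quot[OF zero_le_dist zero_le_dist] .
      also have "\<dots> \<le> 2 ^ \<kappa> * ((dist y y' / dist x y) powr \<epsilon> / ?V y (dist x y))"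
        using that(1) by (intro le) auto
      finally show ?thesis .
    qed
    show "(\<integral>x. (T f x)\<^sup>2 \<partial>\<mu>) \<le> N\<^sup>2 * (\<integral>x. (f x)\<^sup>2 \<partial>\<mu>)" if "f \<in> L2 \<mu>" for f
    proof -
      have "(L2_norm \<mu> (T f))\<^sup>2 \<le> (N * L2_norm \<mu> f)\<^sup>2" using bspec[OF N that] by (intro power_mono) (auto simp: L2_norm_def)
      then show ?thesis by (simp add: L2_norm_def power_mult_distrib)
    qed
  qed
  then show ?thesis by (intro exI)
qed

text \<open>
  Since \<open>w\<close> and its inverse have positive integrals over every ball, finiteness of the product in the \<open>A\<^sub>2\<close> condition
  implies that both integrals are finite.
\<close>

lemma (in doubling_space) a2_weight_of_A2_const:
  assumes [measurable]: "w \<in> borel_measurable borel" and pos: "\<And>x. 0 < w x" and fin: "A2_const \<mu> w < \<infinity>"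
  shows "a2_weight \<mu> D w (enn2real (A2_const \<mu> w))"
proof -
  let ?d = "\<lambda>h. density \<mu> (\<lambda>x. ennreal (h x))"
  let ?i = "\<lambda>x. inverse (w x)"
  have em: "emeasure (?d h) (ball x r) = (\<integral>\<^sup>+y\<in>ball x r. ennreal (h y) \<partial>\<mu>)" if [measurable]: "h \<in> borel_measurable borel" for h x r
    by (rule emeasure_density) (auto simp: sets_M)
  have im [measurable]: "?i \<in> borel_measurable borel" by measurable
  have Vem: "emeasure \<mu> (ball x r) = ennreal (V x r)" for x r
    using ball_finite[of x r] by (simp add: emeasure_eq_ennreal_measure)
  have bound: "(emeasure (?d w) (ball x r) / ennreal (V x r)) * (emeasure (?d ?i) (ball x r) / ennreal (V x r)) \<le> A2_const \<mu> w"
    if "0 < r" for x r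
    unfolding em[OF assms(1)] em[OF im] A2_const_def Vem[symmetric]
    by (rule SUP_upper2[where i = x], simp, rule SUP_upper2[where i = r]) (use that in auto)
  have nz: "emeasure (?d h) (ball x r) \<noteq> 0" if [measurable]: "h \<in> borel_measurable borel" and h: "\<And>x. 0 < h x" and r: "0 < r" for h x r
  proof
    assume "emeasure (?d h) (ball x r) = 0"
    then have "AE y in \<mu>. ennreal (h y) * indicator (ball x r) y = 0"
      unfolding em[OF that(1)] by (subst (asm) nn_integral_0_iff_AE) auto
    moreover have "ennreal (h y) \<noteq> 0" for y using h[of y] by simp
    ultimately have "AE y in \<mu>. y \<notin> ball x r" by (auto simp: indicator_def elim!: eventually_mono split: if_splits)
    moreover have "{y \<in> space \<mu>. \<not> y \<notin> ball x r} = ball x r" "ball x r \<in> sets \<mu>" by (auto simp: sets_M)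
    ultimately have "emeasure \<mu> (ball x r) = 0" using AE_iff_measurable[of "ball x r" \<mu> "\<lambda>y. y \<notin> ball x r"] by simp
    with ball_pos[OF r, of x] show False by (simp add: measure_def)
  qed
  have Vpos: "0 < V x r" if "0 < r" for x r by (rule ball_pos[OF that])
  have fin2: "emeasure (?d w) (ball x r) < \<infinity> \<and> emeasure (?d ?i) (ball x r) < \<infinity>" for x r
  proof (cases "0 < r")
    case True
    let ?a = "emeasure (?d w) (ball x r)" and ?b = "emeasure (?d ?i) (ball x r)"
    have a: "?a \<noteq> 0" and b: "?b \<noteq> 0" using nz[OF assms(1) pos True] nz[OF im _ True] pos by auto
    have lt: "(?a / ennreal (V x r)) * (?b / ennreal (V x r)) < \<infinity>" using bound[OF True] fin by (rule le_less_trans)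
    have top: "t / ennreal (V x r) = \<infinity>" if "t = \<infinity>" for t using that by (simp add: ennreal_top_divide)
    have zero: "t / ennreal (V x r) \<noteq> 0" if "t \<noteq> 0" for t using that by (simp add: ennreal_divide_eq_0_iff)
    have "?a \<noteq> \<infinity>" using lt zero[OF b] top[of ?a] by (auto simp: ennreal_top_mult)
    moreover have "?b \<noteq> \<infinity>" using lt zero[OF a] top[of ?b] by (auto simp: ennreal_mult_top)
    ultimately show ?thesis by (simp add: less_top)
  qed (simp add: ball_empty)
  show ?thesis
  proof
    show "w \<in> borel_measurable borel" "0 < w x" for x by fact+
    show "emeasure (?d w) (ball x r) < \<infinity>" "emeasure (?d ?i) (ball x r) < \<infinity>" for x r using fin2[of x r] by auto
    fix r x assume r: "(0::real) < r"
    let ?a = "measure (?d w) (ball x r)" and ?b = "measure (?d ?i) (ball x r)"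
    have e: "emeasure (?d w) (ball x r) = ennreal ?a" "emeasure (?d ?i) (ball x r) = ennreal ?b"
      using fin2[of x r] by (auto intro!: emeasure_eq_ennreal_measure)
    have "ennreal ((?a / V x r) * (?b / V x r)) = (ennreal ?a / ennreal (V x r)) * (ennreal ?b / ennreal (V x r))"
      using Vpos[OF r, of x] by (simp add: divide_ennreal ennreal_mult[symmetric])
    also have "\<dots> \<le> A2_const \<mu> w" using bound[OF r, of x] unfolding e .
    finally have "enn2real (ennreal ((?a / V x r) * (?b / V x r))) \<le> enn2real (A2_const \<mu> w)"
      by (rule enn2real_mono) (use fin in \<open>simp add: less_top\<close>)
    then have "(?a / V x r) * (?b / V x r) \<le> enn2real (A2_const \<mu> w)"
      using Vpos[OF r, of x] by (simp add: measure_nonneg)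
    then show "?a * ?b \<le> enn2real (A2_const \<mu> w) * (V x r)\<^sup>2"
      using Vpos[OF r, of x] by (simp add: field_simps power2_eq_square)
  qed
qed

lemma (in cz_weight) L2_onorm_extension:
  assumes "bounded_L2_operator \<mu>w S" "\<And>f. f \<in> L2 \<mu> \<Longrightarrow> f \<in> L2 \<mu>w \<Longrightarrow> AE x in \<mu>. S f x = T f x"
  shows "L2_onorm \<mu>w S \<le> 12 * form_const * W"
  unfolding L2_onorm_def
proof (rule cSUP_least)
  show "L2 \<mu>w \<noteq> {}" using mw.BB_L2[OF BB_zero] by blast
  fix f assume f: "f \<in> L2 \<mu>w"
  have "L2_norm \<mu>w (S f) \<le> 12 * (form_const * W) * L2_norm \<mu>w f" using assms f by (rule extension_norm)
  moreover have "0 \<le> L2_norm \<mu>w f" by (simp add: L2_norm_def)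
  moreover have "0 \<le> 12 * (form_const * W)" using form_const_pos W_ge1 by simp
  ultimately show "L2_norm \<mu>w (S f) / L2_norm \<mu>w f \<le> 12 * form_const * W"
    by (cases "L2_norm \<mu>w f = 0") (auto simp: divide_le_eq mult.assoc)
qed

theorem theorem1p3:
  fixes \<Lambda> :: "'a::metric_space \<Rightarrow> real \<Rightarrow> real"
    and \<mu> :: "'a measure"
    and K :: "'a \<Rightarrow> 'a \<Rightarrow> real"
    and T :: "('a \<Rightarrow> real) \<Rightarrow> ('a \<Rightarrow> real)"
  assumes "geometrically_doubling TYPE('a)"
    and "dominating_function \<Lambda>"
    and "doubling_measure \<mu>"
    and "\<exists>C. \<forall>x r. 0 < r \<longrightarrow> measure \<mu> (ball x r) \<le> C * \<Lambda> x r"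
    and "CZ_kernel \<Lambda> K"
    and "CZ_operator \<mu> K T"
  shows "\<exists>C. \<forall>w. A2_weight \<mu> w \<longrightarrow>
    (\<exists>S. weighted_extension \<mu> w T S) \<and>
    (\<forall>S. weighted_extension \<mu> w T S \<longrightarrow>
      L2_onorm (weighted \<mu> w) S \<le> C * enn2real (A2_const \<mu> w))"
proof -
  from cz_operator_exists[OF assms(2-6)] obtain D \<kappa> \<epsilon> B where cz: "cz_operator \<mu> D K T \<kappa> \<epsilon> B"
    by (elim exE) (rule that)
  interpret cz_operator \<mu> D K T \<kappa> \<epsilon> B by (rule cz)
  show ?thesis
  proof (intro exI[of _ "12 * form_const"] allI impI)
    fix w assume w: "A2_weight \<mu> w"
    \<comment> \<open>a version of the weight that is positive everywhere; the measure and the constant \<open>[w]\<close> do not change\<close>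
    define v where "v x = (if 0 < w x then w x else 1)" for x
    have wm: "w \<in> borel_measurable borel"
      using w measurable_cong_sets[OF sets_M refl, of "borel :: real measure"] by (simp add: A2_weight_def)
    have vm: "v \<in> borel_measurable borel" unfolding v_def[abs_def] using wm by measurable
    have vpos: "0 < v x" for x by (simp add: v_def)
    have ae: "AE x in \<mu>. w x = v x" using w unfolding A2_weight_def by (auto simp: v_def elim!: eventually_mono)
    have "(\<integral>\<^sup>+y\<in>ball x r. ennreal (w y) \<partial>\<mu>) = (\<integral>\<^sup>+y\<in>ball x r. ennreal (v y) \<partial>\<mu>)"
      "(\<integral>\<^sup>+y\<in>ball x r. ennreal (inverse (w y)) \<partial>\<mu>) = (\<integral>\<^sup>+y\<in>ball x r. ennreal (inverse (v y)) \<partial>\<mu>)" for x r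
      using ae by (intro nn_integral_cong_AE; elim eventually_mono; simp)+
    then have A2: "A2_const \<mu> w = A2_const \<mu> v" unfolding A2_const_def by simp
    have dens: "weighted \<mu> w = density \<mu> (\<lambda>x. ennreal (v x))"
      unfolding weighted_def using wm vm ae by (intro density_cong) (auto elim!: eventually_mono)
    have "A2_const \<mu> v < \<infinity>" using w A2 by (simp add: A2_weight_def)
    then have "a2_weight \<mu> D v (enn2real (A2_const \<mu> v))" by (rule a2_weight_of_A2_const[OF vm vpos])
    with cz have "cz_weight \<mu> D K T \<kappa> \<epsilon> B v (enn2real (A2_const \<mu> v))" by (rule cz_weight.intro)
    then interpret weight: cz_weight \<mu> D K T \<kappa> \<epsilon> B v "enn2real (A2_const \<mu> v)" .
    show "(\<exists>S. weighted_extension \<mu> w T S) \<and>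
      (\<forall>S. weighted_extension \<mu> w T S \<longrightarrow> L2_onorm (weighted \<mu> w) S \<le> 12 * form_const * enn2real (A2_const \<mu> w))"
      unfolding weighted_extension_def dens A2
    proof (intro conjI allI impI)
      show "\<exists>S. bounded_L2_operator weight.\<mu>w S \<and> (\<forall>f\<in>L2 \<mu> \<inter> L2 weight.\<mu>w. AE x in \<mu>. S f x = T f x)"
        by (intro exI[of _ weight.extension] conjI weight.extension_bounded_operator ballI weight.extension_eq_T) auto
      fix S assume "bounded_L2_operator weight.\<mu>w S \<and> (\<forall>f\<in>L2 \<mu> \<inter> L2 weight.\<mu>w. AE x in \<mu>. S f x = T f x)"
      then show "L2_onorm weight.\<mu>w S \<le> 12 * form_const * enn2real (A2_const \<mu> v)"
        by (intro weight.L2_onorm_extension) auto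
    qed
  qed
qed

end
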